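(* Let $d\ge2$ and let $F_0$ and $H$ be distributions on $\mathbb{R}^d$ with continuous positive densities $f_0$ and $h$, such that $E_{F_0}\{h(\mathbf{x})/f_0(\mathbf{x})-1\}^2<\infty$. Fix $\gamma>0$ and consider $H_0:F=F_0$ and the alternatives $H_n: F=(1-\gamma/\sqrt n)F_0+(\gamma/\sqrt n)H$, $n=1,2,\dots$, with $\mathbf{x}_1,\dots,\mathbf{x}_n$ i.i.d. from $F$. Then: (i) the distributions of $(\mathbf{x}_1,\dots,\mathbf{x}_n)$ under $H_n$ are contiguous to those under $H_0$; (ii) under $H_n$, $\lim_n P(V_n>c_1(\alpha))=P_\gamma[\mathcal{V}'>c_1(\alpha)]$, where $V_n=n\int_{\bar B_r}\|Q_{\mathcal{X}}(\mathbf{u})-Q_{F_0}(\mathbf{u})\|^2d\mathbf{u}$ for a fixed $r\in(0,1)$, $\mathcal{V}'=\int_{\bar B_r}\|Z_1'(\mathbf{u})\|^2d\mathbf{u}$ with $Z_1'$ a $d$-variate Gaussian process with mean function $$m_1(\mathbf{u})=\gamma[D_1\{Q_{F_0}(\mathbf{u})\}]^{-1}E_H\Big\{\frac{\mathbf{x}-Q_{F_0}(\mathbf{u})}{\|\mathbf{x}-Q_{F_0}(\mathbf{u})\|}+\mathbf{u}\Big\}$$ and covariance kernel $k_1$, and $c_1(\alpha)$ satisfies $P_{\gamma=0}[\mathcal{V}'>c_1(\alpha)]=\alpha$; (iii) under $H_n$, the asymptotic powers of the Kolmogorov–Smirnov test based on $T_n^{(1)}=\sup_{\mathbf{x}\in\mathbb{R}^d}\sqrt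 n|F_n(\mathbf{x})-F_0(\mathbf{x})|$ and the Cramér–von Mises test based on $T_n^{(2)}=n\int_{\mathbb{R}^d}[F_n(\mathbf{x})-F_0(\mathbf{x})]^2dF_0(\mathbf{x})$ are $P_\gamma[\sup_{\mathbf{t}\in\mathbb{R}^d}|Z_1''(\mathbf{t})|>c_1^*(\alpha)]$ and $P_\gamma[\int_{\mathbb{R}^d}\{Z_1''(\mathbf{t})\}^2dF_0(\mathbf{t})>c_1^{**}(\alpha)]$ respectively, where $Z_1''$ is a Gaussian process on $\mathbb{R}^d$ with mean $m_1'(\mathbf{t})=\gamma\{H(\mathbf{t})-F_0(\mathbf{t})\}$ and covariance kernel $k_3(\mathbf{t}_1,\mathbf{t}_2)=F_0(\min(\mathbf{t}_1,\mathbf{t}_2))-F_0(\mathbf{t}_1)F_0(\mathbf{t}_2)$, and $c_1^*(\alpha),c_1^{**}(\alpha)$ satisfy $P_{\gamma=0}[\sup_{\mathbf t}|Z_1''(\mathbf{t})|>c_1^*(\alpha)]=\alpha$ and $P_{\gamma=0}[\int\{Z_1''(\mathbf{t})\}^2dF_0(\mathbf t)>c_1^{**}(\alpha)]=\alpha$. (Each test rejects when its statistic exceeds the corresponding critical value.)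
   Context: $\bar B_r=\{\mathbf{u}\in\mathbb{R}^d:\|\mathbf{u}\|\le r\}$. $\Phi(\mathbf{u},\mathbf{s})=\|\mathbf{s}\|+\langle\mathbf{u},\mathbf{s}\rangle$; spatial quantile $Q_F(\mathbf{u})=\arg\min_Q E_F\{\Phi(\mathbf{u},\mathbf{x}-Q)-\Phi(\mathbf{u},\mathbf{x})\}$ for $\|\mathbf{u}\|<1$; $Q_{\mathcal{X}}$ is the spatial quantile of the empirical distribution of $\mathcal{X}=\{\mathbf{x}_1,\dots,\mathbf{x}_n\}$. $F_n(\mathbf{x})$ is the empirical distribution function (fraction of $\mathbf{x}_i$ coordinatewise $\le\mathbf{x}$), distribution functions $F(\mathbf{t})$ are multivariate c.d.f.'s, and $\min(\mathbf{t}_1,\mathbf{t}_2)$ is the coordinatewise minimum. $D_1\{Q_{F_0}(\mathbf{u})\}=E_{F_0}\big[\|\mathbf{x}-Q_{F_0}(\mathbf{u})\|^{-1}\{I_d-\|\mathbf{x}-Q_{F_0}(\mathbf{u})\|^{-2}(\mathbf{x}-Q_{F_0}(\mathbf{u}))(\mathbf{x}-Q_{F_0}(\mathbf{u}))^T\}\big]$, $D_2\{Q_{F_0}(\mathbf{u}),Q_{F_0}(\mathbf{v}),\mathbf{u},\mathbf{v}\}=E_{F_0}\big[\{\tfrac{\mathbf{x}-Q_{F_0}(\mathbf{u})}{\|\mathbf{x}-Q_{F_0}(\mathbf{u})\|}+\mathbf{u}\}\{\tfrac{\mathbf{x}-Q_{F_0}(\mathbf{v})}{\|\mathbf{x}-Q_{F_0}(\mathbf{v})\|}+\mathbf{v}\}^T\big]$,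 and $k_1(\mathbf{u}_1,\mathbf{u}_2)=[D_1\{Q_{F_0}(\mathbf{u}_1)\}]^{-1}D_2\{Q_{F_0}(\mathbf{u}_1),Q_{F_0}(\mathbf{u}_2),\mathbf{u}_1,\mathbf{u}_2\}[D_1\{Q_{F_0}(\mathbf{u}_2)\}]^{-1}$. *)

theory Defs
  imports "HOL-Probability.Probability"
begin

definition Phi :: "'a::real_inner \<Rightarrow> 'a \<Rightarrow> real" where
  "Phi u s = norm s + inner u s"

definition spatial_quantile :: "'a::euclidean_space measure \<Rightarrow> 'a \<Rightarrow> 'a" where
  "spatial_quantile M u =
     (SOME q. \<forall>q'. (\<integral>x. Phi u (x - q) - Phi u x \<partial>M) \<le> (\<integral>x. Phi u (x - q') - Phi u x \<partial>M))"

definition empirical_measure :: "(nat \<Rightarrow> 'a) \<Rightarrow> nat \<Rightarrow> 'a measure" where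
  "empirical_measure X n = measure_pmf (pmf_of_multiset (image_mset X (mset_set {..<n})))"

definition dens :: "('a::euclidean_space \<Rightarrow> real) \<Rightarrow> 'a measure" where
  "dens f = density lborel (\<lambda>x. ennreal (f x))"

definition cdf_vec :: "(real^'n) measure \<Rightarrow> real^'n \<Rightarrow> real" where
  "cdf_vec M t = measure M {x. \<forall>i. x $ i \<le> t $ i}"

definition emp_cdf :: "(nat \<Rightarrow> real^'n) \<Rightarrow> nat \<Rightarrow> real^'n \<Rightarrow> real" where
  "emp_cdf X n t = real (card {k\<in>{..<n}. \<forall>i. X k $ i \<le> t $ i}) / real n"

definition vmin :: "real^'n \<Rightarrow> real^'n \<Rightarrow> real^'n" where
  "vmin s t = (\<chi> i. min (s $ i) (t $ i))"

text \<open>Mixing weight gamma/sqrt n, capped at 1 so that F_n is a distribution for every n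
  (it equals gamma/sqrt n for all n \<ge> gamma^2).\<close>
definition mix_weight :: "real \<Rightarrow> nat \<Rightarrow> real" where
  "mix_weight \<gamma> n = min 1 (\<gamma> / sqrt (real n))"

definition alt_law :: "(real^'n \<Rightarrow> real) \<Rightarrow> (real^'n \<Rightarrow> real) \<Rightarrow> real \<Rightarrow> nat \<Rightarrow> (real^'n) measure" where
  "alt_law f0 h \<gamma> n = dens (\<lambda>x. (1 - mix_weight \<gamma> n) * f0 x + mix_weight \<gamma> n * h x)"

definition sample_law :: "'a measure \<Rightarrow> nat \<Rightarrow> (nat \<Rightarrow> 'a) measure" where
  "sample_law F n = PiM {..<n} (\<lambda>_. F)"

definition contiguous :: "(nat \<Rightarrow> 'a measure) \<Rightarrow> (nat \<Rightarrow> 'a measure) \<Rightarrow> bool" where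
  "contiguous Q P \<longleftrightarrow>
     (\<forall>A. (\<forall>n. A n \<in> sets (P n) \<and> A n \<in> sets (Q n)) \<longrightarrow>
          (\<lambda>n. measure (P n) (A n)) \<longlonglongrightarrow> 0 \<longrightarrow> (\<lambda>n. measure (Q n) (A n)) \<longlonglongrightarrow> 0)"

definition outer :: "real^'n \<Rightarrow> real^'n \<Rightarrow> real^'n^'n" where
  "outer v w = (\<chi> i j. v $ i * w $ j)"

definition unitv :: "real^'n \<Rightarrow> real^'n" where
  "unitv y = (1 / norm y) *\<^sub>R y"

definition D1 :: "(real^'n) measure \<Rightarrow> real^'n \<Rightarrow> real^'n^'n" where
  "D1 F q = (\<integral>x. (1 / norm (x - q)) *\<^sub>R
               (mat 1 - (1 / norm (x - q)^2) *\<^sub>R outer (x - q) (x - q)) \<partial>F)"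

definition D2 :: "(real^'n) measure \<Rightarrow> real^'n \<Rightarrow> real^'n \<Rightarrow> real^'n \<Rightarrow> real^'n \<Rightarrow> real^'n^'n" where
  "D2 F q1 q2 u v = (\<integral>x. outer (unitv (x - q1) + u) (unitv (x - q2) + v) \<partial>F)"

definition k1 :: "(real^'n) measure \<Rightarrow> real^'n \<Rightarrow> real^'n \<Rightarrow> real^'n^'n" where
  "k1 F u1 u2 =
     matrix_inv (D1 F (spatial_quantile F u1))
     ** D2 F (spatial_quantile F u1) (spatial_quantile F u2) u1 u2
     ** matrix_inv (D1 F (spatial_quantile F u2))"

definition m1 :: "real \<Rightarrow> (real^'n) measure \<Rightarrow> (real^'n) measure \<Rightarrow> real^'n \<Rightarrow> real^'n" where
  "m1 \<gamma> F H u = \<gamma> *\<^sub>R (matrix_inv (D1 F (spatial_quantile F u))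
                 *v (\<integral>x. unitv (x - spatial_quantile F u) + u \<partial>H))"

definition k3 :: "(real^'n) measure \<Rightarrow> real^'n \<Rightarrow> real^'n \<Rightarrow> real" where
  "k3 F t1 t2 = cdf_vec F (vmin t1 t2) - cdf_vec F t1 * cdf_vec F t2"

text \<open>A real random variable is Gaussian (possibly degenerate) iff its characteristic
  function is that of N(mu, sigma2) for some mu and sigma2 \<ge> 0.\<close>
definition gaussian_rv :: "'a measure \<Rightarrow> ('a \<Rightarrow> real) \<Rightarrow> bool" where
  "gaussian_rv M Y \<longleftrightarrow> Y \<in> borel_measurable M \<and>
     (\<exists>\<mu> \<sigma>2. 0 \<le> \<sigma>2 \<and>
        (\<forall>t. char (distr M borel Y) t = exp (\<i> * complex_of_real (t * \<mu>) - complex_of_real (\<sigma>2 * t^2 / 2))))"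

definition gaussian_process_vec ::
  "'a measure \<Rightarrow> 'i set \<Rightarrow> ('i \<Rightarrow> 'a \<Rightarrow> real^'n) \<Rightarrow> ('i \<Rightarrow> real^'n) \<Rightarrow> ('i \<Rightarrow> 'i \<Rightarrow> real^'n^'n) \<Rightarrow> bool" where
  "gaussian_process_vec M I Z m K \<longleftrightarrow> prob_space M \<and>
     (\<forall>s\<in>I. Z s \<in> borel_measurable M) \<and>
     (\<forall>(S::nat set) u a. finite S \<longrightarrow> u ` S \<subseteq> I \<longrightarrow>
         gaussian_rv M (\<lambda>\<omega>. \<Sum>k\<in>S. inner (a k) (Z (u k) \<omega>))) \<and>
     (\<forall>s\<in>I. \<forall>i. (\<integral>\<omega>. Z s \<omega> $ i \<partial>M) = m s $ i) \<and>
     (\<forall>s\<in>I. \<forall>t\<in>I. \<forall>i j.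
         (\<integral>\<omega>. (Z s \<omega> $ i - m s $ i) * (Z t \<omega> $ j - m t $ j) \<partial>M) = K s t $ i $ j)"

definition gaussian_process_real ::
  "'a measure \<Rightarrow> 'i set \<Rightarrow> ('i \<Rightarrow> 'a \<Rightarrow> real) \<Rightarrow> ('i \<Rightarrow> real) \<Rightarrow> ('i \<Rightarrow> 'i \<Rightarrow> real) \<Rightarrow> bool" where
  "gaussian_process_real M I Z m K \<longleftrightarrow> prob_space M \<and>
     (\<forall>s\<in>I. Z s \<in> borel_measurable M) \<and>
     (\<forall>(S::nat set) u a. finite S \<longrightarrow> u ` S \<subseteq> I \<longrightarrow>
         gaussian_rv M (\<lambda>\<omega>. \<Sum>k\<in>S. a k * Z (u k) \<omega>)) \<and>
     (\<forall>s\<in>I. (\<integral>\<omega>. Z s \<omega> \<partial>M) = m s) \<and>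
     (\<forall>s\<in>I. \<forall>t\<in>I. (\<integral>\<omega>. (Z s \<omega> - m s) * (Z t \<omega> - m t) \<partial>M) = K s t)"

definition V_stat :: "(real^'n) measure \<Rightarrow> real \<Rightarrow> nat \<Rightarrow> (nat \<Rightarrow> real^'n) \<Rightarrow> real" where
  "V_stat F0 r n X = real n *
     (LINT u:cball 0 r|lborel. (norm (spatial_quantile (empirical_measure X n) u - spatial_quantile F0 u))^2)"

definition KS_stat :: "(real^'n) measure \<Rightarrow> nat \<Rightarrow> (nat \<Rightarrow> real^'n) \<Rightarrow> real" where
  "KS_stat F0 n X = (SUP x. sqrt (real n) * \<bar>emp_cdf X n x - cdf_vec F0 x\<bar>)"

definition CvM_stat :: "(real^'n) measure \<Rightarrow> nat \<Rightarrow> (nat \<Rightarrow> real^'n) \<Rightarrow> real" where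
  "CvM_stat F0 n X = real n * (\<integral>x. (emp_cdf X n x - cdf_vec F0 x)^2 \<partial>F0)"

end

theory Submission
  imports Defs
begin

text \<open>The likelihood ratio of the local alternatives has bounded second moments under the null law
  (this is the chi-square hypothesis), so probabilities under the alternatives are at most a constant times
  the square root of those under the null law: this gives contiguity and transfers all tightness bounds.
  Characteristic functions of standardised sums of bounded functions converge under the alternatives to
  Gaussian ones with the shift $\gamma E_H f$. Finite-dimensional convergence is lifted to $L^2$ functionals
  through Laplace transforms and discretised processes, and to the supremum by chaining over grids in the scale
  of the marginal distribution functions. The limits have no atoms because re-sampling one standard
  Gaussian direction leaves their law unchanged. The empirical spatial quantile is linearised by comparing
  a convex objective with its quadratic approximation; the error is controlled by fourth moments of
  the score and by the integrability of $1/\|x - \theta\|$ in dimension at least two.\<close>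

text \<open>The limit processes live on arbitrary probability spaces and are known only through
  Gaussian finite-dimensional laws and continuous paths, so there is no weak convergence in a
  function space to quote. Every functional is replaced by one of finitely many coordinates, with an
  error uniform in n that also holds for the limit; index spaces therefore come with projections
  \<open>pj k\<close> of finite range. Both integral statistics are reduced to squared L2 norms of
  one kind of process: the index measure is F itself for the distribution function, and Lebesgue
  measure on the ball times the coordinates for the quantiles. The critical value must not be an
  atom of the limit; for the supremum this needs a positive critical value, which follows from its
  level being below 1. The supremum runs over a non-compact set, and a clause on points of small
  variance in the chaining bound takes care of infinity. \<open>spatial_quantile\<close> is an
  arbitrary choice among minimisers, so measurability in u and in the sample is itself a result: for
  a given sample and norm u < 1, ties occur only for finitely many u.\<close>

abbreviation lim_seq :: "(nat \<Rightarrow> 'a::topological_space) \<Rightarrow> 'a \<Rightarrow> bool" (infix "---->" 60) where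
  "X ----> L \<equiv> X \<longlonglongrightarrow> L"

lemmas Lint_add = Bochner_Integration.integrable_add
  and Lint_bound = Bochner_Integration.integrable_bound
  and Lint_diff = Bochner_Integration.integrable_diff
  and Lint_sum = Bochner_Integration.integrable_sum
  and LINT_add = Bochner_Integration.integral_add
  and LINT_cong = Bochner_Integration.integral_cong
  and LINT_diff = Bochner_Integration.integral_diff
  and LINT_nonneg = Bochner_Integration.integral_nonneg
  and LINT_sum = Bochner_Integration.integral_sum

abbreviation std_normal :: "real measure" where "std_normal \<equiv> std_normal_distribution"

abbreviation nn_int :: "'a measure \<Rightarrow> ('a \<Rightarrow> real) \<Rightarrow> ennreal" where
  "nn_int M f \<equiv> nn_integral M (%x. ennreal (f x))"

abbreviation eventually_seq :: "(nat \<Rightarrow> bool) \<Rightarrow> bool" (binder "EV " 10) where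
  "eventually_seq P \<equiv> eventually P sequentially"

abbreviation bmeas :: "'a measure \<Rightarrow> ('a \<Rightarrow> 'b::topological_space) set" where
  "bmeas M \<equiv> borel_measurable M"

notation pair_measure (infixr "><" 80) and scaleR (infixr "*R" 75)

section \<open>Standardised sums of bounded functions\<close>

definition Gsum :: "nat => ('a => real) => (nat => 'a) => real" where
 "Gsum n f X = (SUM i<n. f (X i)) / sqrt (real n)"

lemma exp_le_quadratic:
 fixes x :: real assumes "abs x <= 1" shows "exp x <= 1 + x + x^2"
proof (cases "x >= 0")
 case True thus ?thesis using exp_bound[of x] assms by auto
next
 case False
 \<comment> \<open>For negative x the claim is multiplied by 1 - x > 0: the left side becomes at
   most 1 and the right side becomes 1 - x^3.\<close>
 have "0 < 1 - x" using False by simp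
 have "exp x * (1 - x) <= 1"
  using exp_ge_add_one_self[of "-x"] mult_left_mono[of "1 - x" "exp (-x)" "exp x"]
  by (simp add: exp_minus)
 also have "1 <= (1 + x + x^2) * (1 - x)"
 proof -
  have "(1 + x + x^2) * (1 - x) = 1 - x^3" by (simp add: algebra_simps power2_eq_square power3_eq_cube)
  thus ?thesis using False by simp
 qed
 finally show ?thesis using \<open>0 < 1 - x\<close> by simp
qed

text \<open>The constant is 4^4, from raising y/4 <= exp (y/4) to the fourth power; the two
  exponentials cover the two signs.\<close>

lemma power4_le_exp: fixes x :: real shows "x^4 <= 256 * (exp x + exp (-x))"
proof -
 have *: "y^4 <= 256 * exp y" if "y >= 0" for y :: real
 proof -
  have "y/4 <= exp (y/4)" using exp_ge_add_one_self[of "y/4"] by linarith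
  hence "(y/4)^4 <= exp (y/4)^4" using that by (intro power_mono) auto
  also have "exp (y/4)^4 = exp y" by (simp flip: exp_of_nat_mult)
  finally show ?thesis by (simp add: power_divide)
 qed
 show ?thesis
 proof (cases "x >= 0")
  case True thus ?thesis using *[of x] by (simp add: add_increasing2)
 next
  case False thus ?thesis using *[of "-x"] by (simp add: add_increasing)
 qed
qed

context prob_space begin

lemma iid_product_sigma_finite: "product_sigma_finite (%_::nat. M)"
 by (simp add: product_sigma_finite_def sigma_finite_measure_axioms)

lemma prob_space_iid: "prob_space (PiM {..<n::nat} (%_. M))"
 by (intro prob_space_PiM prob_space_axioms)

lemma iid_integral_prod:
 fixes f :: "nat => 'a => 'c::{real_normed_field,banach,second_countable_topology}"
 assumes "!!i. i < n ==> integrable M (f i)"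
 shows "(LINT X|(PiM {..<n} (%_. M)). (PROD i<n. f i (X i))) = (PROD i<n. (LINT x|M. f i x))"
 using product_sigma_finite.product_integral_prod[OF iid_product_sigma_finite, of "{..<n}" f] assms by auto

lemma iid_integrable_bounded:
 fixes g :: "(nat => 'a) => 'c::{banach,second_countable_topology}"
 assumes "g : bmeas (PiM {..<n} (%_. M))" "!!X. norm (g X) <= B"
 shows "integrable (PiM {..<n} (%_. M)) g"
proof -
 interpret P: prob_space "PiM {..<n} (%_. M)" by (rule prob_space_iid)
 show ?thesis by (rule P.integrable_const_bound[where B=B]) (use assms in auto)
qed

lemma integrable_bounded:
 fixes g :: "'a => 'c::{banach,second_countable_topology}"
 assumes "g : bmeas M" "!!X. norm (g X) <= B"
 shows "integrable M g"
 by (rule integrable_const_bound[where B=B]) (use assms in auto)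

lemma Gsum_measurable [measurable]:
 assumes [measurable]: "f : bmeas M"
 shows "Gsum n f : bmeas (PiM {..<n} (%_. M))"
 unfolding Gsum_def by measurable

lemma Gsum_bound:
 assumes "!!x. abs (f x) <= B" shows "abs (Gsum n f X) <= sqrt n * B"
proof (cases "n = 0")
 case False
 have "abs (Gsum n f X) <= real n * B / sqrt n"
  using order_trans[OF sum_abs sum_bounded_above[of "{..<n}" "%i. abs (f (X i))" B]] assms by (simp add: divide_right_mono Gsum_def)
 also have "... = sqrt n * B" using False by (simp add: field_simps)
 finally show ?thesis .
qed (simp add: Gsum_def)

text \<open>The restriction on s keeps each exponent \<open>y x\<close> in [-1,1], where exp is
  below its quadratic bound. The linear term integrates to zero, and 1 + a <= exp a lets the n
  factors multiply to a bound free of n.\<close>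

lemma Gsum_exp_moment:
 assumes [measurable]: "f : bmeas M" and B: "!!x. abs (f x) <= B"
  and zero: "expectation f = 0" and p: "(LINT x|M. (f x)^2) <= p"
  and s: "abs s * B <= sqrt n" and n: "n > 0"
 shows "(LINT X|(PiM {..<n} (%_. M)). exp (s * Gsum n f X)) <= exp (s^2 * p)"
proof -
 define y where "y = (%x. s * f x / sqrt n)"
 have [measurable]: "y : bmeas M" unfolding y_def by measurable
 have y1: "abs (y x) <= 1" for x
 proof -
  have "abs s * abs (f x) <= abs s * B" using B by (intro mult_left_mono) auto
  thus ?thesis using s n unfolding y_def by (simp add: abs_mult)
 qed
 let ?a = "LINT x|M. exp (y x)"
 let ?b = "exp (s^2 / n * p)"
 have "?a <= (LINT x|M. 1 + y x + (y x)^2)"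
 proof (intro integral_mono integrable_bounded)
  show "norm (exp (y x)) <= exp 1" for x using y1[of x] by auto
  show "norm (1 + y x + (y x)^2) <= 3" for x
   using y1[of x] abs_square_le_1[of "y x"] by auto
  show "exp (y x) <= 1 + y x + (y x)^2" for x by (rule exp_le_quadratic[OF y1])
 qed measurable
 also have "... = 1 + (s^2 / n) * (LINT x|M. (f x)^2)"
 proof -
  have i1: "integrable M y" by (rule integrable_bounded[of _ 1]) (use y1 in auto)
  have i2: "integrable M (%x. (y x)^2)" by (rule integrable_bounded[of _ 1]) (use y1 in \<open>auto simp: abs_square_le_1\<close>)
  have "expectation y = 0" unfolding y_def using zero by simp
  moreover have "(LINT x|M. (y x)^2) = (s^2 / n) * (LINT x|M. (f x)^2)"
   unfolding y_def by (simp add: power_divide power_mult_distrib)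
  ultimately show ?thesis using i1 i2 by (simp add: prob_space)
 qed
 also have "... <= 1 + s^2 / n * p" using p by (intro add_left_mono mult_left_mono) auto
 also have "... <= ?b" by auto
 finally have le: "?a <= ?b" .
 have "(LINT X|(PiM {..<n} (%_. M)). exp (s * Gsum n f X)) = (LINT X|(PiM {..<n} (%_. M)). (PROD i<n. exp (y (X i))))"
  by (simp add: Gsum_def y_def sum_distrib_left sum_divide_distrib exp_sum)
 also have "... = (PROD i<n. ?a)"
 proof (rule iid_integral_prod, rule integrable_bounded)
  show "norm (exp (y x)) <= exp 1" for x using y1[of x] by auto
 qed measurable
 also have "... <= (PROD i<n. ?b)"
  by (intro prod_mono) (use le in auto)
 also have "... = exp (s^2 * p)" using n by (simp flip: exp_of_nat_mult)
 finally show ?thesis .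
qed

lemma Gsum_exp_integrable:
 assumes [measurable]: "f : bmeas M" and B: "!!x. abs (f x) <= B"
 shows "integrable (PiM {..<n} (%_. M)) (%X. exp (s * Gsum n f X))"
proof (rule iid_integrable_bounded)
 fix X
 have "s * Gsum n f X <= abs s * (sqrt n * B)"
 proof -
  have "s * Gsum n f X <= abs s * abs (Gsum n f X)" by (metis abs_ge_self abs_mult)
  also have "... <= abs s * (sqrt n * B)" by (rule mult_left_mono[OF Gsum_bound[OF B]]) auto
  finally show ?thesis .
 qed
 thus "norm (exp (s * Gsum n f X)) <= exp (abs s * (sqrt n * B))" by simp
qed measurable

text \<open>Chernoff's bound for both signs. The parameter s stays free because its admissible range
  depends on B and n; \<open>W_tail\<close> takes s = 1/sqrt p.\<close>

lemma Gsum_tail: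
 assumes [measurable]: "f : bmeas M" and B: "!!x. abs (f x) <= B"
  and zero: "expectation f = 0" and p: "(LINT x|M. (f x)^2) <= p"
  and s: "0 <= s" "s * B <= sqrt n" and n: "n > 0"
 shows "measure (PiM {..<n} (%_. M)) {X:space (PiM {..<n} (%_. M)). abs (Gsum n f X) >= l}
     <= 2 * exp (s^2 * p - s * l)"
proof -
 let ?P = "PiM {..<n} (%_. M)"
 interpret P: prob_space ?P by (rule prob_space_iid)
 let ?d = "exp (s * l)"
 let ?e = "exp (s^2 * p - s * l)"
 let ?f = "Gsum n f"
 have one: "measure ?P {X:space ?P. exp (t * ?f X) >= ?d} <= ?e"
  if t: "abs t = s" for t
 proof -
  have "measure ?P {X:space ?P. exp (t * ?f X) >= ?d}
   <= (LINT X|?P. exp (t * ?f X)) / ?d"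
   using Gsum_exp_integrable[OF assms(1) B, of n t]
   by (intro integral_Markov_inequality_measure[where A="{}"]) auto
  also have "... <= exp (s^2 * p) / ?d"
   using Gsum_exp_moment[OF assms(1) B zero p, of t n] s n t by (intro divide_right_mono) auto
  also have "... = ?e" by (simp add: exp_diff)
  finally show ?thesis .
 qed
 let ?a = "{X:space ?P. exp ((-s) * ?f X) >= ?d}"
 let ?b = "{X:space ?P. exp (s * ?f X) >= ?d}"
 let ?c = "{X:space ?P. abs (?f X) >= l}"
 have "measure ?P ?c
  <= measure ?P (?b Un ?a)"
 proof (rule P.finite_measure_mono)
  show "?c <=
   ?b Un ?a"
  proof (rule subsetI)
   fix X assume X: "X : ?c"
   hence "s * l <= s * abs (?f X)" using s by (intro mult_left_mono) auto
   thus "X : ?b Un ?a"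
    using X by auto
  qed
 qed measurable
 also have "... <= measure ?P ?b + measure ?P ?a"
  by (rule measure_Un_le) measurable
 also have "... <= 2 * ?e"
  using one[of s] one[of "-s"] s by simp
 finally show ?thesis .
qed

text \<open>Exponential moments at s = 1 and s = -1 dominate the fourth power, so the fourfold sum
  is never expanded; 512 is twice the constant of \<open>power4_le_exp\<close>.\<close>

lemma Gsum_fourth_moment:
 assumes [measurable]: "f : bmeas M" and B: "!!x. abs (f x) <= B"
  and zero: "expectation f = 0" and n: "B <= sqrt n" "n > 0"
 shows "(LINT X|(PiM {..<n} (%_. M)). (Gsum n f X)^4) <= 512 * exp (B^2)"
proof -
 let ?P = "PiM {..<n} (%_. M)"
 have p: "(LINT x|M. (f x)^2) <= B^2"
 proof -
  have fB: "(f x)^2 <= B^2" for x using B[of x] by (intro power2_le_iff_abs_le[THEN iffD2]) auto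
  have "(LINT x|M. (f x)^2) <= (LINT x|M. B^2)"
  proof (rule integral_mono)
   show "integrable M (%x. (f x)^2)" by (rule integrable_bounded[of _ "B^2"]) (use fB in auto)
  qed (use fB in auto)
  thus ?thesis by (simp add: prob_space)
 qed
 note e = Gsum_exp_integrable[OF assms(1) B, of n 1] Gsum_exp_integrable[OF assms(1) B, of n "-1"]
 let ?a = "Gsum n f"
 let ?b = "LINT X|?P. 256 * (exp (1 * ?a X) + exp ((-1) * ?a X))"
 have "(LINT X|?P. (?a X)^4) <= ?b"
 proof (rule integral_mono)
  have "norm (?a X ^ 4) <= (sqrt n * B)^4" for X
   using power_mono[where n=4, OF Gsum_bound[OF B]] by (simp add: power_abs)
  thus "integrable ?P (%X. ?a X ^ 4)"
   by (intro iid_integrable_bounded[of _ _ "(sqrt n * B)^4"]) auto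
  show "integrable ?P (%X. 256 * (exp (1 * ?a X) + exp ((-1) * ?a X)))"
   by (intro integrable_mult_right Lint_add e)
  show "?a X ^ 4 <= 256 * (exp (1 * ?a X) + exp ((-1) * ?a X))" for X
   using power4_le_exp[of "?a X"] by simp
 qed
 also have "... <= 256 * (exp (B^2) + exp (B^2))"
 proof -
  have "?b
   = 256 * ((LINT X|?P. exp (1 * ?a X)) + (LINT X|?P. exp ((-1) * ?a X)))"
   unfolding integral_mult_right_zero by (subst LINT_add) (use e in auto)
  thus ?thesis
   using Gsum_exp_moment[OF assms(1) B zero p, of 1 n] Gsum_exp_moment[OF assms(1) B zero p, of "-1" n] n by simp
 qed
 finally show ?thesis by simp
qed

lemma Gsum_second_moment:
 assumes [measurable]: "f : bmeas M" and B: "!!x. abs (f x) <= B"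
  and zero: "expectation f = 0" and n: "n > 0"
 shows "(LINT X|(PiM {..<n} (%_. M)). (Gsum n f X)^2) = (LINT x|M. (f x)^2)"
proof -
 let ?P = "PiM {..<n} (%_. M)"
 have B0: "0 <= B" using B[of undefined] by auto
 have fB: "abs (f x) * abs (f y) <= B * B" for x y using B[of x] B[of y] B0 by (intro mult_mono) auto
 let ?a = "LINT x|M. (f x)^2"
 have ij: "(LINT X|?P. f (X i) * f (X j)) = (if i = j then ?a else 0)" if ij: "i < n" "j < n" for i j
 proof -
  \<comment> \<open>Writing f (X i) * f (X j) as a product over all coordinates lets one product
    formula serve both the diagonal and the off-diagonal terms.\<close>
  define g where "g = (%k x. (if k = i then f x else 1) * (if k = j then f x else 1))"
  have "(PROD k<n. g k (X k)) = f (X i) * f (X j)" for X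
   unfolding g_def prod.distrib using ij by simp
  hence "(LINT X|?P. f (X i) * f (X j)) = (LINT X|?P. (PROD k<n. g k (X k)))" by simp
  also have "... = (PROD k<n. (LINT x|M. g k x))"
  proof (rule iid_integral_prod, rule integrable_bounded)
   show "norm (g k x) <= max 1 (max B (B * B))" for k x
    unfolding g_def using B[of x] fB[of x x] by auto
  qed (simp add: g_def)
  also have "... = (if i = j then ?a else 0)"
  proof (cases "i = j")
   case True
   hence "(LINT x|M. g k x) = (if k = i then ?a else 1)" for k
    unfolding g_def by (auto simp: power2_eq_square prob_space)
   thus ?thesis using True ij by (simp add: prod.delta)
  next
   case False
   hence "(LINT x|M. g i x) = 0" unfolding g_def using zero by simp
   thus ?thesis using False ij by (auto intro!: prod_zero)
  qed
  finally show ?thesis .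
 qed
 have int: "integrable ?P (%X. f (X i) * f (X j))" if "i < n" "j < n" for i j
  by (rule iid_integrable_bounded[of _ _ "B * B"]) (use fB that in \<open>auto simp: abs_mult\<close>)
 let ?b = "SUM i<n. SUM j<n. (LINT X|?P. f (X i) * f (X j))"
 have "(LINT X|?P. (Gsum n f X)^2) = (LINT X|?P. (SUM i<n. SUM j<n. f (X i) * f (X j)) / n)"
  by (simp add: Gsum_def power2_eq_square sum_product)
 also have "... = ?b / n"
 proof -
  have "(LINT X|?P. (SUM i<n. SUM j<n. f (X i) * f (X j))) = ?b"
   by (subst LINT_sum, use int in force)
    (intro sum.cong refl LINT_sum, use int in auto)
  thus ?thesis by simp
 qed
 also have "... = ?a"
  using n by (simp add: ij)
 finally show ?thesis .
qed

end

section \<open>Contiguity and limits under the alternatives\<close>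

lemma space_dens [simp]: "space (dens f) = UNIV"
 and sets_dens [simp, measurable_cong]: "sets (dens f) = sets borel"
 by (simp_all add: dens_def)

lemma null_le:
 fixes f :: "nat => 'a::real_normed_vector"
 assumes "!!n. norm (f n) <= g n" "g ----> 0" shows "f ----> 0"
 using assms by (intro Lim_null_comparison[of f g] always_eventually allI)

lemma tendsto_scaled_exp:
 fixes z :: complex
 shows "(%n. of_nat n * (exp (z / of_nat n) - 1)) ----> z"
proof -
 have "((%h. exp (z * h)) has_field_derivative z) (at 0)"
  by (auto intro!: derivative_eq_intros)
 hence *: "((%h. (exp (z * h) - 1) / h) \<longlongrightarrow> z) (at 0)"
  by (simp add: has_field_derivative_def field_has_derivative_at)
 have inv: "filterlim (%n. inverse (of_nat n :: complex)) (at 0) sequentially"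
  unfolding filterlim_at by (auto intro!: lim_inverse_n)
 show ?thesis
  using filterlim_compose[OF * inv] by (simp add: divide_inverse mult.commute)
qed

text \<open>Both \<open>ph n\<close> and exp (z/n) lie in the closed unit disc, the latter because
  Re z <= 0. Their n-th powers then differ by at most n times the difference of the bases, and no
  complex logarithm occurs.\<close>

lemma tendsto_power_exp:
 fixes ph :: "nat => complex"
 assumes lim: "(%n. of_nat n * (ph n - 1)) ----> z" and le: "!!n. norm (ph n) <= 1" and re: "Re z <= 0"
 shows "(%n. ph n ^ n) ----> exp z"
proof -
 have "norm (exp (z / of_nat n)) <= 1" for n
  by (simp add: re Re_divide_of_nat divide_nonpos_nonneg)
 hence "norm (ph n ^ n - exp (z / of_nat n) ^ n) <= real n * norm (ph n - exp (z / of_nat n))" for n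
  using norm_power_diff[of "ph n" "exp (z / of_nat n)" n] le by simp
 hence le2: "norm (ph n ^ n - exp (z / of_nat n) ^ n) <= norm (of_nat n * (ph n - 1) - of_nat n * (exp (z / of_nat n) - 1))" for n
 proof -
  have eq: "of_nat n * (ph n - 1) - of_nat n * (exp (z / of_nat n) - 1) = of_nat n * (ph n - exp (z / of_nat n))"
   by (simp add: right_diff_distrib)
  show "norm (ph n ^ n - exp (z / of_nat n) ^ n) <= norm (of_nat n * (ph n - 1) - of_nat n * (exp (z / of_nat n) - 1))"
   if "!!n. norm (ph n ^ n - exp (z / of_nat n) ^ n) <= real n * norm (ph n - exp (z / of_nat n))"
   unfolding eq norm_mult using that[of n] by simp
 qed
 have "(%n. norm (of_nat n * (ph n - 1) - of_nat n * (exp (z / of_nat n) - 1))) ----> 0"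
  using tendsto_norm[OF tendsto_diff[OF lim tendsto_scaled_exp[of z]]] by simp
 from null_le[OF le2 this] have l0: "(%n. ph n ^ n - exp (z / of_nat n) ^ n) ----> 0" .
 have "exp (z / of_nat n) ^ n = exp z" if "n > 0" for n
  using that by (simp flip: exp_of_nat_mult)
 hence "(%n. exp (z / of_nat n) ^ n) ----> exp z"
  by (intro tendsto_eventually eventually_sequentiallyI[of 1]) auto
 from tendsto_add[OF l0 this] show ?thesis by simp
qed

lemma (in prob_space) integral_taylor:
 fixes a b :: "'a => real" and d :: "'a => complex"
 assumes "integrable M a" "integrable M b" "integrable M d"
  and g: "!!x. g x = 1 + \<i> * of_real (a x) - of_real (b x) / 2 + d x"
 shows "(LINT x|M. g x) = 1 + \<i> * of_real (LINT x|M. a x) - of_real (LINT x|M. b x) / 2 + (LINT x|M. d x)"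
 unfolding g using assms(1-3) by (simp add: prob_space)

lemma add_diff_one: fixes a b c :: complex shows "(1 + a + b) - (1 + c) = a + (b - c)" by simp
lemma half_le: fixes a :: real shows "0 <= a ==> a / 2 <= a" by simp
lemma sixth_le: fixes a :: real shows "0 <= a ==> a / 6 <= a" by simp

lemma iexp_cubic: "cmod (iexp y - 1 - \<i> * of_real y + of_real (y^2) / 2) <= abs y^3 / 6"
proof -
 have three: "(SUM k<=(2::nat). g k) = g 0 + g 1 + g 2" for g :: "nat => complex"
  by (simp add: numeral_2_eq_2)
 have "iexp y - (SUM k<=2. (\<i> * of_real y)^k / fact k) = iexp y - 1 - \<i> * of_real y + of_real (y^2) / 2" by (simp add: power_mult_distrib three)
 from this[symmetric] show ?thesis using iexp_approx1[of y 2] by (simp only:) (simp add: fact_numeral)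
qed

section \<open>Likelihood ratio of the local alternatives\<close>

locale local_alternatives =
 fixes f0 h :: "real^'n => real" and ga :: real
 assumes f0_cont: "continuous_on UNIV f0" and f0_pos: "!!x. 0 < f0 x" and F0_prob: "prob_space (dens f0)"
  and h_cont: "continuous_on UNIV h" and h_pos: "!!x. 0 < h x" and H_prob: "prob_space (dens h)"
  and chi2: "integrable (dens f0) (%x. (h x / f0 x - 1)^2)"
  and gamma_pos: "0 < ga"
begin

abbreviation "F == dens f0"
abbreviation "H == dens h"
abbreviation "P n == sample_law F n"
abbreviation "Q n == sample_law (alt_law f0 h ga n) n"
abbreviation "w n == mix_weight ga n"

sublocale F: prob_space F by (rule F0_prob)
sublocale H: prob_space H by (rule H_prob)

lemma f0_measurable [measurable]: "f0 : bmeas borel"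
 using f0_cont by (rule borel_measurable_continuous_onI)

lemma h_measurable [measurable]: "h : bmeas borel"
 using h_cont by (rule borel_measurable_continuous_onI)

lemma w_bounds: "0 <= w n" "w n <= 1"
 using gamma_pos by (auto simp: mix_weight_def)

lemma w_square: "real n * (w n)^2 <= ga^2"
proof (cases "n = 0")
 case False
 have "(w n)^2 <= (ga / sqrt n)^2" using w_bounds[of n] by (intro power_mono) (auto simp: mix_weight_def)
 thus ?thesis using False by (simp add: field_simps)
qed simp

lemma w_eventually: "EV n. w n = ga / sqrt n"
proof (rule eventually_sequentiallyI[of "nat \<lceil>ga\<^sup>2\<rceil>"])
 fix n assume "nat \<lceil>ga\<^sup>2\<rceil> <= n"
 hence "ga <= sqrt n" by (simp add: real_le_rsqrt)
 hence "ga / sqrt n <= 1" by (cases "n = 0") (auto simp: divide_le_eq_1)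
 thus "w n = ga / sqrt n" by (simp add: mix_weight_def)
qed

lemma sets_alt [simp, measurable_cong]: "sets (alt_law f0 h ga n) = sets borel"
 and space_alt [simp]: "space (alt_law f0 h ga n) = UNIV"
 by (simp_all add: alt_law_def)

lemma integrable_dens_h:
 fixes g :: "real^'n => 'c::{banach,second_countable_topology}"
 assumes "integrable H g" shows "integrable lborel (%x. h x *R g x)"
proof -
 have [measurable]: "g : bmeas borel" using borel_measurable_integrable[OF assms] by simp
 show ?thesis using assms less_imp_le[OF h_pos] unfolding dens_def by (subst (asm) integrable_density) auto
qed

lemma integrable_dens_f0:
 fixes g :: "real^'n => 'c::{banach,second_countable_topology}"
 assumes "integrable F g" shows "integrable lborel (%x. f0 x *R g x)"
proof -
 have [measurable]: "g : bmeas borel" using borel_measurable_integrable[OF assms] by simp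
 show ?thesis using assms less_imp_le[OF f0_pos] unfolding dens_def by (subst (asm) integrable_density) auto
qed

lemma mix_nonneg: "0 <= (1 - w n) * f0 x + w n * h x"
 using w_bounds[of n] f0_pos[of x] h_pos[of x] by (intro add_nonneg_nonneg mult_nonneg_nonneg) auto

lemma integral_alt:
 fixes g :: "real^'n => 'c::{banach,second_countable_topology}"
 assumes [measurable]: "g : bmeas borel" and "integrable F g" "integrable H g"
 shows "(LINT x|(alt_law f0 h ga n). g x) = (1 - w n) *R (LINT x|F. g x) + w n *R (LINT x|H. g x)"
proof -
 let ?a = "LINT x|lborel. f0 x *R g x"
 let ?b = "LINT x|lborel. h x *R g x"
 have "(LINT x|(alt_law f0 h ga n). g x) = (LINT x|lborel. ((1 - w n) * f0 x + w n * h x) *R g x)"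
  unfolding alt_law_def dens_def by (rule integral_density) (auto intro!: mix_nonneg)
 also have "... = (LINT x|lborel. (1 - w n) *R (f0 x *R g x) + w n *R (h x *R g x))"
  by (simp add: scaleR_add_left)
 also have "... = (1 - w n) *R ?a + w n *R ?b"
  using integrable_dens_f0[OF assms(2)] integrable_dens_h[OF assms(3)]
  by (subst LINT_add) (auto simp del: scaleR_scaleR)
 also have "?a = (LINT x|F. g x)"
  unfolding dens_def by (rule integral_density[symmetric]) (auto intro: less_imp_le[OF f0_pos])
 also have "?b = (LINT x|H. g x)"
  unfolding dens_def by (rule integral_density[symmetric]) (auto intro: less_imp_le[OF h_pos])
 finally show ?thesis .
qed

definition ratio :: "nat => real^'n => real" where
 "ratio n x = 1 + w n * (h x / f0 x - 1)"

lemma ratio_measurable [measurable]: "ratio n : bmeas borel"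
 unfolding ratio_def by measurable

lemma ratio_nonneg: "0 <= ratio n x"
proof -
 have "ratio n x = ((1 - w n) * f0 x + w n * h x) / f0 x"
  using f0_pos[of x] by (simp add: ratio_def field_simps)
 thus ?thesis using mix_nonneg[of n x] f0_pos[of x] by simp
qed

lemma alt_law_density: "alt_law f0 h ga n = density F (%x. ennreal (ratio n x))"
proof -
 have "ennreal (f0 x) * ennreal (ratio n x) = ennreal ((1 - w n) * f0 x + w n * h x)" for x
  using f0_pos[of x] ratio_nonneg[of n x] by (simp add: ennreal_mult[symmetric] less_imp_le ratio_def distrib_left algebra_simps)
 thus ?thesis
  unfolding alt_law_def dens_def by (subst density_density_eq) auto
qed

lemma integrable_h_ratio: "integrable F (%x. h x / f0 x)"
proof -
 have "integrable lborel h"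
  using integrable_dens_h[of "%_. 1::real"] by simp
 thus ?thesis unfolding dens_def
  using f0_pos less_imp_le[OF f0_pos] by (subst integrable_density) (auto simp: less_imp_neq[OF f0_pos, symmetric])
qed

lemma integral_h_ratio: "(LINT x|F. h x / f0 x) = 1"
proof -
 have "(LINT x|F. h x / f0 x) = (LINT x|lborel. h x *R 1)"
  unfolding dens_def using less_imp_le[OF f0_pos]
  by (subst integral_density) (auto simp: less_imp_neq[OF f0_pos, symmetric])
 also have "... = (LINT x|H. 1)"
  unfolding dens_def by (rule integral_density[symmetric]) (auto intro: less_imp_le[OF h_pos])
 also have "... = 1" using H.prob_space by simp
 finally show ?thesis .
qed

text \<open>The cross term vanishes because h/f0 has F-mean 1. What remains exceeds 1 by (w n)^2
  times the chi-square distance, which is of order 1/n.\<close>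

lemma ratio_second_moment: "nn_integral F (%x. ennreal (ratio n x) ^ 2) = ennreal (1 + (w n)^2 * (LINT x|F. (h x / f0 x - 1)^2))"
proof -
 have eq: "(ratio n x)^2 = 1 + 2 * w n * (h x / f0 x - 1) + (w n)^2 * (h x / f0 x - 1)^2" for x
  unfolding ratio_def by (simp add: power2_eq_square algebra_simps)
 have int: "integrable F (%x. (ratio n x)^2)"
  unfolding eq using chi2 integrable_h_ratio by auto
 have "nn_integral F (%x. ennreal (ratio n x) ^ 2) = ennreal (LINT x|F. (ratio n x)^2)"
  using int by (subst nn_integral_eq_integral[symmetric]) (auto simp: ennreal_power ratio_nonneg)
 also have "(LINT x|F. (ratio n x)^2) = 1 + (w n)^2 * (LINT x|F. (h x / f0 x - 1)^2)"
  unfolding eq using chi2 integrable_h_ratio integral_h_ratio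
  using F.prob_space by simp
 finally show ?thesis .
qed

sublocale alt: prob_space "alt_law f0 h ga n" for n
proof
 let ?a = "emeasure (alt_law f0 h ga n) (space (alt_law f0 h ga n))"
 have "?a = nn_int F (%x. ratio n x)"
  unfolding alt_law_density by (simp add: emeasure_density cong: nn_integral_cong)
 also have "... = ennreal (LINT x|F. ratio n x)"
  unfolding ratio_def using integrable_h_ratio ratio_nonneg[of n]
  by (intro nn_integral_eq_integral) (auto simp: ratio_def)
 also have "(LINT x|F. ratio n x) = 1"
  unfolding ratio_def using integrable_h_ratio integral_h_ratio F.prob_space by simp
 finally show "?a = 1" by simp
qed

sublocale P: prob_space "P n" for n
 unfolding sample_law_def by (rule F.prob_space_iid)

sublocale Q: prob_space "Q n" for n
 unfolding sample_law_def by (rule alt.prob_space_iid)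

lemma prob_UNIV [simp]: "measure F UNIV = 1" "measure H UNIV = 1" "measure (alt_law f0 h ga n) UNIV = 1"
 using F.prob_space H.prob_space alt.prob_space[of n] by auto

lemma sets_Q: "sets (Q n) = sets (P n)"
 unfolding sample_law_def by (rule sets_PiM_cong) auto

lemma space_Q: "space (Q n) = space (P n)"
 by (rule sets_eq_imp_space_eq[OF sets_Q])

definition LR :: "nat => (nat => real^'n) => ennreal" where
 "LR n X = (PROD i<n. ennreal (ratio n (X i)))"

lemma LR_measurable [measurable]: "LR n : bmeas (P n)"
 unfolding LR_def sample_law_def by measurable

lemma Q_density: "Q n = density (P n) (LR n)"
proof -
 let ?a = "alt_law f0 h ga n"
 let ?b = "density (P n) (LR n)"
 have "?b = PiM {..<n} (%_. ?a)"
 proof (rule product_sigma_finite.PiM_eqI[OF alt.iid_product_sigma_finite])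
  show "sets (?b) = sets (PiM {..<n} (%_. ?a))"
   using sets_Q[of n] by (simp add: sample_law_def)
  fix A :: "nat => (real^'n) set"
  assume A: "!!i. i : {..<n} ==> A i : sets (?a)"
  hence [measurable]: "i < n ==> A i : sets borel" for i by simp
  have AS: "Pi\<^sub>E {..<n} A : sets (P n)"
   unfolding sample_law_def by (rule sets_PiM_I_finite) auto
  let ?c = "Pi\<^sub>E {..<n} A"
  let ?d = "PROD i<n. emeasure (?a) (A i)"
  have "emeasure (?b) ?c = nn_integral (P n) (%X. LR n X * indicator ?c X)"
   using AS by (simp add: emeasure_density)
  also have "... = nn_integral (PiM {..<n} (%_. F)) (%X. (PROD i<n. ennreal (ratio n (X i)) * indicator (A i) (X i)))"
   unfolding sample_law_def
  proof (rule nn_integral_cong)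
   fix X assume "X : space (PiM {..<n} (%_. F))"
   hence "indicator ?c X = (PROD i<n. indicator (A i) (X i) :: ennreal)" by (auto simp: space_PiM PiE_def indicator_def Pi_def)
   thus "LR n X * indicator ?c X = (PROD i<n. ennreal (ratio n (X i)) * indicator (A i) (X i))"
    by (simp add: LR_def prod.distrib)
  qed
  also have "... = ?d" by (auto simp: alt_law_density emeasure_density intro!: product_sigma_finite.product_nn_integral_prod[OF F.iid_product_sigma_finite])
  finally show "emeasure (?b) ?c = ?d" .
 qed simp
 thus ?thesis by (simp add: sample_law_def)
qed

definition CQ :: real where "CQ = exp (ga^2 * (LINT x|F. (h x / f0 x - 1)^2))"

lemma CQ_ge_1: "CQ >= 1" unfolding CQ_def by simp

text \<open>The n-th power of 1 + (w n)^2 c is at most exp (n (w n)^2 c), and n (w n)^2 <= ga^2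
  holds for every n, including those where the weight is capped at 1; hence one constant serves all
  n.\<close>

lemma LR_second_moment: "nn_integral (P n) (%X. LR n X ^ 2) <= ennreal CQ"
proof -
 let ?c = "(LINT x|F. (h x / f0 x - 1)^2)"
 have c0: "0 <= ?c" by simp
 let ?a = "1 + (w n)^2 * ?c"
 have "nn_integral (P n) (%X. LR n X ^ 2) = nn_integral (PiM {..<n} (%_. F)) (%X. (PROD i<n. ennreal (ratio n (X i)) ^ 2))"
  by (simp add: LR_def sample_law_def prod_power_distrib)
 also have "... = (PROD i<n. nn_integral F (%x. ennreal (ratio n x) ^ 2))"
  by (rule product_sigma_finite.product_nn_integral_prod[OF F.iid_product_sigma_finite]) auto
 also have "... = ennreal (?a ^ n)"
  by (simp add: ratio_second_moment ennreal_power del: ennreal_plus)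
 also have "... <= ennreal CQ"
 proof (rule ennreal_leI)
  have "?a ^ n <= exp ((w n)^2 * ?c) ^ n"
   using c0 by (intro power_mono exp_ge_add_one_self) auto
  also have "... = exp (real n * (w n)^2 * ?c)" by (simp flip: exp_of_nat_mult)
  also have "... <= CQ" unfolding CQ_def using w_square[of n] by (simp add: mult_right_mono)
  finally show "?a ^ n <= CQ" .
 qed
 finally show ?thesis .
qed

lemma nn_integral_Q_le:
 assumes [measurable]: "Y : bmeas (P n)"
 shows "(nn_integral (Q n) (%X. Y X))^2 <= ennreal CQ * nn_integral (P n) (%X. Y X ^ 2)"
proof -
 let ?a = "nn_integral (P n)"
 have "nn_integral (Q n) (%X. Y X) = ?a (%X. LR n X * Y X)"
  by (subst Q_density, rule nn_integral_density) auto
 hence "(nn_integral (Q n) (%X. Y X))^2 <= ?a (%X. LR n X ^ 2) * ?a (%X. Y X ^ 2)"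
  using Cauchy_Schwarz_nn_integral[of "LR n" "P n" Y] by simp
 also have "... <= ennreal CQ * ?a (%X. Y X ^ 2)"
  by (intro mult_right_mono LR_second_moment) auto
 finally show ?thesis .
qed

lemma integral_Q_le:
 fixes Y :: "(nat => real^'n) => real"
 assumes [measurable]: "Y : bmeas (P n)" and "!!X. 0 <= Y X"
  and "integrable (P n) (%X. (Y X)^2)"
 shows "integrable (Q n) Y" "(LINT X|(Q n). Y X) <= sqrt CQ * sqrt (LINT X|(P n). (Y X)^2)"
proof -
 have [measurable]: "Y : bmeas (Q n)" using assms(1) by (simp add: measurable_cong_sets[OF sets_Q])
 let ?a = "nn_integral (Q n) (%X. Y X)"
 let ?b = "LINT X|(P n). (Y X)^2"
 have "(?a)^2 <= ennreal CQ * nn_integral (P n) (%X. ennreal (Y X) ^ 2)"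
  by (rule nn_integral_Q_le) auto
 also have "... = ennreal (CQ * ?b)"
  using assms(2,3) CQ_ge_1 by (simp add: ennreal_power nn_integral_eq_integral ennreal_mult)
 finally have le: "(?a)^2 <= ennreal (CQ * ?b)" .
 hence "(?a)^2 < top" by (simp add: le_less_trans)
 hence "?a < top" by (simp add: power_less_top_ennreal)
 thus int: "integrable (Q n) Y" using assms(2) by (intro integrableI_bounded) auto
 have "(LINT X|(Q n). Y X)^2 <= CQ * ?b"
  using le int assms(2) CQ_ge_1 by (simp add: nn_integral_eq_integral ennreal_power)
 thus "(LINT X|(Q n). Y X) <= sqrt CQ * sqrt ?b"
  by (simp add: real_le_rsqrt flip: real_sqrt_mult)
qed

lemma measure_Q_le:
 assumes A: "A : sets (P n)"
 shows "measure (Q n) A <= sqrt CQ * sqrt (measure (P n) A)"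
proof -
 have [measurable]: "A : sets (P n)" by fact
 have "A : sets (Q n)" by (simp add: sets_Q)
 have sq: "(indicator A X :: real)^2 = indicator A X" for X by (simp add: indicator_def)
 have "(LINT X|(Q n). indicator A X) <= sqrt CQ * sqrt (LINT X|(P n). (indicator A X :: real)^2)"
 proof (rule integral_Q_le(2))
  show "integrable (P n) (%X. (indicator A X :: real)^2)"
   unfolding sq by (rule integrable_real_indicator) (auto simp: P.emeasure_eq_measure)
 qed auto
 thus ?thesis unfolding sq
  using sets.Int_space_eq2[OF \<open>A : sets (Q n)\<close>] by simp
qed

lemma contiguous_Q_P: "contiguous Q P"
 unfolding contiguous_def
proof (intro allI impI)
 fix A assume A: "ALL n. A n : sets (P n) & A n : sets (Q n)" and lim: "(%n. measure (P n) (A n)) ----> 0"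
 have "(%n. sqrt CQ * sqrt (measure (P n) (A n))) ----> 0"
  using tendsto_mult[OF tendsto_const tendsto_real_sqrt[OF lim], of "sqrt CQ"] by simp
 moreover have "norm (measure (Q n) (A n)) <= sqrt CQ * sqrt (measure (P n) (A n))" for n
  using measure_Q_le[of "A n" n] A by simp
 ultimately show "(%n. measure (Q n) (A n)) ----> 0" by (rule null_le[rotated])
qed

end

section \<open>Characteristic functions of standardised sums under the alternatives\<close>

context local_alternatives begin

text \<open>The integrand is expanded to second order under F, giving the variance, but only to
  first order under H: the weight of H is about ga/sqrt n, so its first-order term mu/sqrt n
  contributes ga mu/n, which is the shift. All other terms are o(1/n) and vanish after
  multiplication by n.\<close>

lemma char_Gsum_limit:
 assumes [measurable]: "f : bmeas borel" and B: "!!x. abs (f x) <= B"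
  and zero: "(LINT x|F. f x) = 0"
 shows "(%n. (LINT X|(Q n). iexp (Gsum n f X))) ---->
  exp (\<i> * of_real (ga * (LINT x|H. f x)) - of_real ((LINT x|F. (f x)^2) / 2))"
proof -
 let ?c = "alt_law f0 h ga"
 define ph where "ph = (%n. (LINT x|(?c n). iexp (f x / sqrt n)))"
 define v where "v = (LINT x|F. (f x)^2)"
 define mu where "mu = (LINT x|H. f x)"
 have char: "(LINT X|(Q n). iexp (Gsum n f X)) = ph n ^ n" for n
 proof -
  have "(LINT X|(Q n). iexp (Gsum n f X)) = (LINT X|(PiM {..<n} (%_. ?c n)). (PROD i<n. iexp (f (X i) / sqrt n)))"
   by (simp add: sample_law_def Gsum_def sum_divide_distrib sum_distrib_left exp_sum)
  also have "... = (PROD i<n. ph n)"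
   unfolding ph_def by (rule alt.iid_integral_prod, rule alt.integrable_bounded[of _ _ 1]) auto
  finally show ?thesis by simp
 qed
 have le: "norm (ph n) <= 1" for n
  unfolding ph_def
  using integral_norm_bound[of "?c n" "%x. iexp (f x / sqrt n)"] by simp
 have B0: "0 <= B" using B[of undefined] by auto
 have fB: "(f x)^2 <= B^2" for x using B[of x] power2_le_iff_abs_le[of B "f x"] by simp
 have iF: "integrable F f" "integrable F (%x. (f x)^2)" "integrable H f"
 proof -
  have "norm ((f x)^2) <= B^2" for x using B[of x] power2_le_iff_abs_le[of B "f x"] by simp
  thus "integrable F (%x. (f x)^2)" by (rule F.integrable_bounded[rotated]) auto
  show "integrable F f" by (rule F.integrable_bounded[of _ B]) (use B in auto)
  show "integrable H f" by (rule H.integrable_bounded[of _ B]) (use B in auto)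
 qed
 \<comment> \<open>Taylor remainders of iexp after the first and after the second order. They are
   uniformly O(1/n) and O(1/(n sqrt n)), by boundedness of f.\<close>
 define d1 where "d1 = (%(n::nat) x. iexp (f x / sqrt n) - 1 - \<i> * of_real (f x / sqrt n))"
 define d2 where "d2 = (%(n::nat) x. iexp (f x / sqrt n) - 1 - \<i> * of_real (f x / sqrt n) + of_real ((f x)^2 / n) / 2)"
 have [measurable]: "d1 n : bmeas borel" "d2 n : bmeas borel" for n
  unfolding d1_def d2_def by measurable
 have d1: "norm (d1 n x) <= B^2 / n" for n x
 proof -
  have "norm (d1 n x) <= (f x)^2 / n / 2"
   using iexp_approx1[of "f x / sqrt n" 1] by (simp add: power2_eq_square algebra_simps power_divide d1_def)
  also have "... <= B^2 / n / 2"
   using fB[of x] by (intro divide_right_mono) auto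
  also have "... <= B^2 / n" by (rule half_le) simp
  finally show ?thesis .
 qed
 have d2: "norm (d2 n x) <= B^3 / (n * sqrt n)" for n x
 proof -
  have y2: "(f x)^2 / n = (f x / sqrt n)^2" by (simp add: power_divide)
  have "norm (d2 n x) <= abs (f x / sqrt n)^3 / 6"
   unfolding d2_def y2 by (rule iexp_cubic)
  also have "... = abs (f x)^3 / (n * sqrt n) / 6"
   by (simp add: power3_eq_cube)
  also have "... <= B^3 / (n * sqrt n) / 6"
   using B[of x] B0 by (intro divide_right_mono power_mono) auto
  also have "... <= B^3 / (n * sqrt n)" by (rule sixth_le) (use B0 in simp)
  finally show ?thesis .
 qed
 have id: "integrable F (d1 n)" "integrable F (d2 n)" "integrable H (d1 n)" for n
  by (rule F.integrable_bounded[OF _ d1] F.integrable_bounded[OF _ d2] H.integrable_bounded[OF _ d1], simp)+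
 have iexpF: "(LINT x|F. iexp (f x / sqrt n)) = 1 - of_real (v / n) / 2 + (LINT x|F. d2 n x)" for n :: nat
  using F.integral_taylor[of "%x. f x / sqrt n" "%x. (f x)^2 / n" "d2 n" "%x. iexp (f x / sqrt n)"] iF id(2)[of n] zero
  by (simp add: d2_def v_def)
 have iexpF': "(LINT x|F. iexp (f x / sqrt n)) = 1 + (LINT x|F. d1 n x)" for n :: nat
  using F.integral_taylor[of "%x. f x / sqrt n" "%x. 0" "d1 n" "%x. iexp (f x / sqrt n)"] iF id(1)[of n] zero
  by (simp add: d1_def)
 have iexpH: "(LINT x|H. iexp (f x / sqrt n)) = 1 + \<i> * of_real (mu / sqrt n) + (LINT x|H. d1 n x)" for n :: nat
  using H.integral_taylor[of "%x. f x / sqrt n" "%x. 0" "d1 n" "%x. iexp (f x / sqrt n)"] iF id(3)[of n]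
  by (simp add: d1_def mu_def)
 have phi: "ph n = (LINT x|F. iexp (f x / sqrt n)) + of_real (w n) * ((LINT x|H. iexp (f x / sqrt n)) - (LINT x|F. iexp (f x / sqrt n)))" for n
  unfolding ph_def
  by (subst integral_alt)
   (auto intro!: F.integrable_bounded[of _ 1] H.integrable_bounded[of _ 1] simp: scaleR_conv_of_real algebra_simps)
 \<comment> \<open>n times everything in \<open>ph n - 1\<close> that is not part of the limit
   exponent.\<close>
 define R where "R = (%n. of_nat n * (LINT x|F. d2 n x) + of_nat n * of_real (w n) * ((LINT x|H. d1 n x) - (LINT x|F. d1 n x)))"
 let ?a = "of_real (v / 2)"
 let ?b = "of_real (ga * mu)"
 have ev: "EV n. of_nat n * (ph n - 1) = \<i> * ?b - ?a + R n"
  using w_eventually eventually_gt_at_top[of 0]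
 proof eventually_elim
  case (elim n)
  let ?e = "of_real (mu / sqrt n)"
  let ?f = "of_real (w n)"
  have a: "of_nat n * ?f * (\<i> * ?e) = \<i> * complex_of_real (ga * mu)"
  proof -
   define s where "s = sqrt (real n)"
   have "real n = s * s" "s > 0" using elim by (auto simp: s_def)
   hence "\<i> * complex_of_real (real n * w n * (mu / sqrt n)) = \<i> * complex_of_real (ga * mu)"
    using elim by (simp add: s_def[symmetric])
   thus ?thesis by (simp add: mult.left_commute)
  qed
  have b: "of_nat n * (complex_of_real (v / n) / 2) = ?a" using elim(2) by simp
  let ?d = "(LINT x|H. d1 n x) - (LINT x|F. d1 n x)"
  have "ph n - 1 = - of_real (v / n) / 2 + (LINT x|F. d2 n x)
    + ?f * (\<i> * ?e) + ?f * ?d"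
  proof -
   have *: "(LINT x|H. iexp (f x / sqrt n)) - (LINT x|F. iexp (f x / sqrt n)) = \<i> * ?e + ?d"
    unfolding iexpH[of n] iexpF'[of n] by auto
   show ?thesis by (subst phi, subst *, subst iexpF) (simp only: distrib_left, simp)
  qed
  hence "of_nat n * (ph n - 1) = - (of_nat n * (of_real (v / n) / 2)) + of_nat n * (LINT x|F. d2 n x)
    + of_nat n * ?f * (\<i> * ?e) + of_nat n * ?f * ?d"
   by (simp only: distrib_left mult.assoc) simp
  thus ?case unfolding a b R_def by simp
 qed
 have nb: "norm (LINT x|M. g x) <= b" if "prob_space M" "integrable M g" "!!x. norm (g x) <= b" for M and g :: "real^'n => complex" and b
 proof -
  interpret M: prob_space M by fact
  have "norm (LINT x|M. g x) <= (LINT x|M. norm (g x))" by auto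
  also have "... <= (LINT x|M. b)" by (rule integral_mono) (use that in auto)
  finally show ?thesis by (simp add: M.prob_space)
 qed
 have "norm (R n) <= B^3 / sqrt n + 2 * B^2 * w n" for n
 proof -
  note i = nb[OF F0_prob id(2)[of n] d2] nb[OF F0_prob id(1)[of n] d1] nb[OF H_prob id(3)[of n] d1]
  have "norm (R n) <= real n * norm (LINT x|F. d2 n x) + real n * w n * (norm (LINT x|H. d1 n x) + norm (LINT x|F. d1 n x))"
   unfolding R_def using w_bounds[of n]
   by (intro order_trans[OF norm_triangle_ineq] add_mono) (auto simp: norm_mult intro!: mult_left_mono norm_triangle_ineq4)
  also have "... <= real n * (B^3 / (n * sqrt n)) + real n * w n * (B^2 / n + B^2 / n)"
   using i w_bounds[of n] by (intro add_mono mult_left_mono) auto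
  also have "... <= B^3 / sqrt n + 2 * B^2 * w n"
   by (cases "n = 0") (auto simp: w_bounds field_simps)
  finally show ?thesis .
 qed
 moreover have "(%n. B^3 / sqrt n + 2 * B^2 * w n) ----> 0"
 proof -
  have s: "(%n. c / sqrt (real n)) ----> 0" for c
   by (intro real_tendsto_divide_at_top[OF tendsto_const] filterlim_compose[OF sqrt_at_top filterlim_real_sequentially])
  have "w ----> 0"
   by (rule Lim_transform_eventually[OF s[of ga]]) (use w_eventually in eventually_elim, simp)
  from tendsto_add[OF s[of "B^3"] tendsto_mult[OF tendsto_const[of "2 * B^2"] this]] show ?thesis by simp
 qed
 ultimately have "R ----> 0" by (rule null_le)
 from tendsto_add[OF tendsto_const this]
 have "(%n. \<i> * ?b - ?a + R n) ----> \<i> * ?b - ?a"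
  by simp
 hence "(%n. of_nat n * (ph n - 1)) ----> \<i> * ?b - ?a"
  by (rule Lim_transform_eventually) (use ev in eventually_elim, simp)
 hence "(%n. ph n ^ n) ----> exp (\<i> * ?b - ?a)"
  by (rule tendsto_power_exp[OF _ le]) (simp add: v_def)
 thus ?thesis unfolding char v_def mu_def .
qed

end

section \<open>Convergence determined by characteristic functions\<close>

text \<open>Functions bounded by 1 that are uniform limits of Fourier transforms of finite complex
  measures \<open>g\<close> d\<open>nu\<close>. For such functions convergence of expectations
  follows from convergence of characteristic functions by Fubini and dominated convergence, with no
  appeal to tightness.\<close>

definition fourier_approx :: "(real => real) => bool" where
 "fourier_approx f \<longleftrightarrow> f : bmeas borel & (ALL x. abs (f x) <= 1) &
  (ALL ep>0. EX nu (g :: real => complex). finite_measure nu & sets nu = sets borel & integrable nu g &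
    (ALL x. norm (of_real (f x) - (LINT xi|nu. g xi * iexp (xi * x))) <= ep))"

lemma (in prob_space) norm_expectation_le:
 fixes g :: "'a => 'c::{banach,second_countable_topology}"
 assumes [measurable]: "g : bmeas M" and "!!x. norm (g x) <= b"
 shows "norm (expectation g) <= b"
proof -
 have "norm (expectation g) <= expectation (%x. norm (g x))" by auto
 also have "... <= expectation (%x. b)"
  by (rule integral_mono[OF integrable_bounded[of _ b]]) (use assms in auto)
 finally show ?thesis by (simp add: prob_space)
qed

text \<open>The factor Y carries the remaining coordinates in the induction of
  \<open>fdd_prod_tendsto\<close>.\<close>

lemma (in prob_space) Fubini_mixture:
 fixes g :: "real => complex" and X :: "'a => real" and Y :: "'a => complex"
 assumes nu: "finite_measure nu" "sets nu = sets borel" and g: "integrable nu g"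
  and [measurable]: "X : bmeas M" "Y : bmeas M" and Y: "!!om. norm (Y om) <= 1"
 shows "(LINT om|M. (LINT xi|nu. g xi * iexp (xi * X om)) * Y om) = (LINT xi|nu. g xi * (LINT om|M. iexp (xi * X om) * Y om))"
  and "!!om. integrable nu (%xi. g xi * iexp (xi * X om))"
proof -
 interpret nu: finite_measure nu by fact
 interpret pair_sigma_finite nu M by unfold_locales
 note [measurable_cong] = nu(2)
 have [measurable]: "g : bmeas borel" using borel_measurable_integrable[OF g] by (simp add: measurable_cong_sets[OF nu(2)])
 define F where "F = (%(xi, om). g xi * (iexp (xi * X om) * Y om))"
 have [measurable]: "F : bmeas (nu >< M)" unfolding F_def by measurable
 have nF: "norm (F (xi, om)) <= norm (g xi)" for xi om
  unfolding F_def using Y[of om] by (simp add: norm_mult mult_left_le)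
 have int: "integrable (nu >< M) F"
 proof (rule Fubini_integrable)
  show "integrable nu (%x. (LINT y|M. norm (F (x, y))))"
  proof (rule Lint_bound[OF g])
   show "AE x in nu. norm (LINT y|M. norm (F (x, y))) <= norm (g x)"
   proof (rule AE_I2)
    fix x
    have i: "integrable M (%y. norm (F (x, y)))"
     by (rule integrable_bounded[of _ "norm (g x)"]) (use nF in \<open>auto simp: F_def\<close>)
    have "(LINT y|M. norm (F (x, y))) <= (LINT y|M. norm (g x))"
     by (rule integral_mono[OF i]) (use nF in auto)
    thus "norm (LINT y|M. norm (F (x, y))) <= norm (g x)" by (simp add: prob_space)
   qed
  qed measurable
  show "AE x in nu. integrable M (%y. F (x, y))"
   by (intro AE_I2 integrable_bounded[of _ "norm (g _)"]) (use nF in \<open>auto simp: F_def\<close>)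
 qed measurable
 have "(LINT om|M. (LINT xi|nu. g xi * (iexp (xi * X om) * Y om))) = (LINT xi|nu. (LINT om|M. g xi * (iexp (xi * X om) * Y om)))"
  using Fubini_integral[of "%xi om. g xi * (iexp (xi * X om) * Y om)"] int unfolding F_def by simp
 thus "(LINT om|M. (LINT xi|nu. g xi * iexp (xi * X om)) * Y om) = (LINT xi|nu. g xi * (LINT om|M. iexp (xi * X om) * Y om))"
  by (simp only: mult.assoc[symmetric] integral_mult_left_zero integral_mult_right_zero) (simp only: mult.assoc integral_mult_right_zero)
 fix om show "integrable nu (%xi. g xi * iexp (xi * X om))"
  by (rule Lint_bound[OF g]) (auto simp: norm_mult)
qed

text \<open>Induction on the set K of coordinates at which a factor f j has been introduced. The
  claim is strengthened by an arbitrary exponential factor with coefficients a: replacing f k by its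
  Fourier mixture only shifts a k, so the induction hypothesis applies under the integral over
  xi.\<close>

lemma fdd_prod_tendsto:
 fixes X :: "nat => 'j => 'a => real" and Z :: "'j => 'b => real" and f :: "'j => real => real"
 assumes N: "!!n. prob_space (N n)" and M: "prob_space M"
  and X: "!!n j. j : J ==> X n j : bmeas (N n)" and Z: "!!j. j : J ==> Z j : bmeas M"
  and J: "finite J"
  and char: "!!a. (%n. (LINT om|(N n). iexp (SUM j:J. a j * X n j om))) ----> (LINT om|M. iexp (SUM j:J. a j * Z j om))"
  and f: "!!j. j : J ==> fourier_approx (f j)"
 shows "(%n. (LINT om|(N n). (PROD j:J. f j (X n j om)))) ----> (LINT om|M. (PROD j:J. f j (Z j om)))"
proof -
 interpret M: prob_space M by fact
 interpret N: prob_space "N n" for n by (rule N)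
 have fm[measurable]: "j : J ==> f j : bmeas borel" and fb: "j : J ==> abs (f j x) <= 1" for j x
  using f by (auto simp: fourier_approx_def)
 define E where "E = (%K a n. (LINT om|(N n). of_real (PROD j:K. f j (X n j om)) * iexp (SUM j:J. a j * X n j om)))"
 define L where "L = (%K a. (LINT om|M. of_real (PROD j:K. f j (Z j om)) * iexp (SUM j:J. a j * Z j om)))"
 have prod1: "abs (PROD j:K. f j (y j)) <= 1" if "K <= J" for K y
  unfolding abs_prod by (rule prod_le_1) (use that fb in auto)
 have main: "(%n. E K a n) ----> L K a" if "K <= J" for K a
  using finite_subset[OF that J] that
 proof (induction K arbitrary: a)
  case empty
  show ?case unfolding E_def L_def using char[of a] by simp
 next
  case (insert k K)
  hence kJ: "k : J" and KJ: "K <= J" and kK: "k ~: K" "finite K" by auto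
  note [measurable] = X[OF kJ] Z[OF kJ] fm[OF kJ]
  have [measurable]: "(%om. SUM j:J. b j * X n j om) : bmeas (N n)" for n b
   by (intro borel_measurable_sum borel_measurable_times X measurable_const) auto
  have [measurable]: "(%om. SUM j:J. b j * Z j om) : bmeas M" for b
   by (intro borel_measurable_sum borel_measurable_times Z measurable_const) auto
  have [measurable]: "(%om. PROD j:K. f j (X n j om)) : bmeas (N n)" for n
   by (intro borel_measurable_prod measurable_compose[OF X fm]) (use KJ in auto)
  have [measurable]: "(%om. PROD j:K. f j (Z j om)) : bmeas M"
   by (intro borel_measurable_prod measurable_compose[OF Z fm]) (use KJ in auto)
  define Y where "Y = (%n om. complex_of_real (PROD j:K. f j (X n j om)) * iexp (SUM j:J. a j * X n j om))"
  define W where "W = (%om. complex_of_real (PROD j:K. f j (Z j om)) * iexp (SUM j:J. a j * Z j om))"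
  have [measurable]: "Y n : bmeas (N n)" "W : bmeas M" for n
   unfolding Y_def W_def by measurable
  have Y1: "norm (Y n om) <= 1" and W1: "norm (W om') <= 1" for n om om'
   unfolding Y_def W_def norm_mult using prod1[OF KJ] by (auto simp del: of_real_prod)
  let ?b = "insert k K"
  have EX: "E ?b a n = (LINT om|(N n). of_real (f k (X n k om)) * Y n om)" for n
   unfolding E_def Y_def using kK by (simp add: mult.assoc)
  have LZ: "L ?b a = (LINT om|M. of_real (f k (Z k om)) * W om)"
   unfolding L_def W_def using kK by (simp add: mult.assoc)
  \<comment> \<open>Absorbs the frequency xi of the new coordinate into the coefficients.\<close>
  define a' where "a' = (%xi. a(k := a k + xi))"
  have shift: "(SUM j:J. a' xi j * y j) = xi * y k + (SUM j:J. a j * y j)" for xi y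
   using J kJ unfolding a'_def
   by (subst (1 2) sum.remove[of J k]) (auto simp: algebra_simps intro!: sum.cong)
  have EY: "(LINT om|(N n). iexp (xi * X n k om) * Y n om) = E K (a' xi) n" for n xi
   unfolding E_def Y_def shift by (intro LINT_cong refl) (simp add: exp_add distrib_left)
  have LW: "(LINT om|M. iexp (xi * Z k om) * W om) = L K (a' xi)" for xi
   unfolding L_def W_def shift by (intro LINT_cong refl) (simp add: exp_add distrib_left)
  have E1: "norm (E K b n) <= 1" for b n
   unfolding E_def
   by (rule N.norm_expectation_le) (use prod1[OF KJ] in \<open>auto simp: norm_mult simp del: of_real_prod of_real_sum\<close>)
  show ?case
  proof (rule LIMSEQ_I)
   fix r :: real assume "0 < r"
   hence "r / 4 > 0" by simp
   with f[OF kJ] obtain nu and g :: "real => complex" where nu: "finite_measure nu" "sets nu = sets borel" and g: "integrable nu g"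
    and app: "!!x. norm (of_real (f k x) - (LINT xi|nu. g xi * iexp (xi * x))) <= r / 4"
    unfolding fourier_approx_def by blast
   interpret nu: finite_measure nu by fact
   note [measurable_cong] = nu(2)
   have [measurable]: "g : bmeas borel" using borel_measurable_integrable[OF g] by (simp add: measurable_cong_sets[OF nu(2)])
   define G where "G = (%x. (LINT xi|nu. g xi * iexp (xi * x)))"
   have [measurable]: "G : bmeas borel" unfolding G_def by measurable
   have Gb: "norm (G x) <= 1 + r / 4" for x
   proof -
    have "norm (G x) <= norm (complex_of_real (f k x)) + norm (G x - of_real (f k x))"
     using norm_triangle_ineq[of "complex_of_real (f k x)" "G x - of_real (f k x)"] by simp
    thus ?thesis using app[of x] fb[OF kJ, of x] by (simp add: G_def norm_minus_commute)
   qed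
   have dX: "norm (E ?b a n - (LINT xi|nu. g xi * E K (a' xi) n)) <= r / 4" for n
   proof -
    let ?d = "LINT xi|nu. g xi * E K (a' xi) n"
    have "?d = (LINT om|(N n). G (X n k om) * Y n om)"
     unfolding G_def EY[symmetric] by (rule N.Fubini_mixture(1)[symmetric, OF nu g]) (auto simp: Y1)
    moreover have "integrable (N n) (%om. of_real (f k (X n k om)) * Y n om)"
     by (rule N.integrable_bounded[of _ _ 1]) (use fb[OF kJ] Y1 in \<open>auto simp: norm_mult intro!: mult_le_one\<close>)
    moreover have "integrable (N n) (%om. G (X n k om) * Y n om)"
    proof (rule N.integrable_bounded[of _ _ "(1 + r / 4) * 1"])
     show "norm (G (X n k om) * Y n om) <= (1 + r / 4) * 1" for om
      unfolding norm_mult by (rule mult_mono[OF Gb Y1]) (use \<open>0 < r\<close> in auto)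
    qed measurable
    ultimately have "E ?b a n - ?d = (LINT om|(N n). (of_real (f k (X n k om)) - G (X n k om)) * Y n om)"
     unfolding EX by (simp add: left_diff_distrib)
    also have "norm ... <= r / 4 * 1"
    proof (rule N.norm_expectation_le)
     show "norm ((of_real (f k (X n k om)) - G (X n k om)) * Y n om) <= r / 4 * 1" for om
      unfolding norm_mult by (rule mult_mono) (use app Y1 \<open>0 < r\<close> in \<open>auto simp: G_def\<close>)
    qed measurable
    finally show ?thesis by simp
   qed
   let ?c = "LINT xi|nu. g xi * L K (a' xi)"
   have dZ: "norm (L ?b a - ?c) <= r / 4"
   proof -
    have "?c = (LINT om|M. G (Z k om) * W om)"
     unfolding G_def LW[symmetric] by (rule M.Fubini_mixture(1)[symmetric, OF nu g]) (auto simp: W1)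
    moreover have "integrable M (%om. of_real (f k (Z k om)) * W om)"
     by (rule M.integrable_bounded[of _ 1]) (use fb[OF kJ] W1 in \<open>auto simp: norm_mult intro!: mult_le_one\<close>)
    moreover have "integrable M (%om. G (Z k om) * W om)"
    proof (rule M.integrable_bounded[of _ "(1 + r / 4) * 1"])
     show "norm (G (Z k om) * W om) <= (1 + r / 4) * 1" for om
      unfolding norm_mult by (rule mult_mono[OF Gb W1]) (use \<open>0 < r\<close> in auto)
    qed measurable
    ultimately have "L ?b a - ?c = (LINT om|M. (of_real (f k (Z k om)) - G (Z k om)) * W om)"
     unfolding LZ by (simp add: left_diff_distrib)
    also have "norm ... <= r / 4 * 1"
    proof (rule M.norm_expectation_le)
     show "norm ((of_real (f k (Z k om)) - G (Z k om)) * W om) <= r / 4 * 1" for om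
      unfolding norm_mult by (rule mult_mono) (use app W1 \<open>0 < r\<close> in \<open>auto simp: G_def\<close>)
    qed measurable
    finally show ?thesis by simp
   qed
   have meas_E: "(%xi. E K (a' xi) n) : bmeas nu" for n
    unfolding EY[symmetric] by measurable
   have meas_L: "(%xi. L K (a' xi)) : bmeas nu"
    unfolding LW[symmetric] by measurable
   \<comment> \<open>For each frequency the induction hypothesis gives the limit; the expectations
     are bounded by 1, so the modulus of g dominates.\<close>
   have "(%n. (LINT xi|nu. g xi * E K (a' xi) n)) ----> ?c"
   proof (rule integral_dominated_convergence[where w="%xi. norm (g xi)"])
    show "AE xi in nu. (%n. g xi * E K (a' xi) n) ----> g xi * L K (a' xi)"
     by (intro AE_I2 tendsto_mult tendsto_const insert.IH KJ)
    show "AE xi in nu. norm (g xi * E K (a' xi) n) <= norm (g xi)" for n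
     using E1 by (auto simp: norm_mult mult_left_le)
   qed (use g meas_E meas_L in auto)
   then obtain n0 where n0: "!!n. n >= n0 ==> norm ((LINT xi|nu. g xi * E K (a' xi) n) - ?c) < r / 4"
    using LIMSEQ_D[OF _ \<open>r / 4 > 0\<close>] by blast
   show "EX no. ALL n>=no. norm (E ?b a n - L ?b a) < r"
   proof (intro exI allI impI)
    fix n assume "n >= n0"
    have "norm (A - D) < r" if "norm (A - B) <= r / 4" "norm (D - C) <= r / 4" "norm (B - C) < r / 4" for A B C D :: complex
    proof -
     have "norm (A - D) <= norm ((A - B) + (B - C)) + norm (D - C)"
      using norm_triangle_ineq4[of "(A - B) + (B - C)" "D - C"] by simp
     with norm_triangle_ineq[of "A - B" "B - C"] that \<open>0 < r\<close> show ?thesis by auto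
    qed
    from this[OF dX dZ n0[OF \<open>n >= n0\<close>]] show "norm (E ?b a n - L ?b a) < r" .
   qed
  qed
 qed
 let ?a = "of_real (LINT om|M. (PROD j:J. f j (Z j om)))"
 have "E J (%_. 0) n = of_real (LINT om|(N n). (PROD j:J. f j (X n j om)))" for n
  unfolding E_def by (simp del: of_real_prod)
 moreover have "L J (%_. 0) = ?a"
  unfolding L_def by (simp del: of_real_prod)
 ultimately have "(%n. complex_of_real (LINT om|(N n). (PROD j:J. f j (X n j om)))) ----> ?a"
  using main[OF subset_refl, of "%_. 0"] by simp
 thus ?thesis by (simp add: tendsto_of_real_iff)
qed

lemma prob_space_std_normal: "prob_space std_normal"
 using real_dist_normal_dist by (simp add: real_distribution_def)

lemma char_distr:
 assumes [measurable]: "f : bmeas M"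
 shows "char (distr M borel f) t = (LINT x|M. iexp (t * f x))"
 unfolding char_def by (subst integral_distr) auto

lemma std_normal_iexp: "(LINT et|std_normal. iexp (t * et)) = of_real (exp (- (t^2) / 2))"
 using fun_cong[OF char_std_normal_distribution, of t] unfolding char_def .

text \<open>Here the approximation is exact: the function is the characteristic function of a
  centred normal variable with variance 2w.\<close>

lemma fourier_approx_gauss:
 assumes "0 <= w" shows "fourier_approx (%x. exp (- w * x^2))"
 unfolding fourier_approx_def
proof (intro conjI allI impI)
 interpret N: prob_space std_normal by (rule prob_space_std_normal)
 fix ep :: real assume "0 < ep"
 let ?nu = "distr std_normal borel (%et. sqrt (2 * w) * et)"
 interpret nu: prob_space ?nu by (rule N.prob_space_distr) simp
 show "EX nu (g :: real => complex). finite_measure nu & sets nu = sets borel & integrable nu g &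
    (ALL x. norm (of_real (exp (- w * x^2)) - (LINT xi|nu. g xi * iexp (xi * x))) <= ep)"
 proof (intro exI conjI allI)
  show "finite_measure ?nu" by auto
  show "integrable ?nu (%_. 1 :: complex)" by simp
  fix x :: real
  let ?a = "LINT xi|?nu. 1 * iexp (xi * x)"
  have "?a = (LINT et|std_normal. iexp ((sqrt (2 * w) * x) * et))"
   by (subst integral_distr) (auto simp: mult_ac)
  also have "... = of_real (exp (- w * x^2))"
   unfolding std_normal_iexp using assms by (simp add: power_mult_distrib)
  finally show "norm (complex_of_real (exp (- w * x^2)) - ?a) <= ep"
   using \<open>0 < ep\<close> by simp
 qed simp
next
 fix x show "abs (exp (- w * x^2)) <= 1" using assms by simp
qed measurable

text \<open>Convolution of f with a normal density of standard deviation dl changes f by at most L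
  dl E|eta|, eta standard normal. Since the normal kernel is itself a Fourier transform, the
  convolution is a mixture of characters, with \<open>nu\<close> the normal law of standard
  deviation 1/dl and \<open>g\<close> a multiple of the Fourier transform of f.\<close>

lemma fourier_approx_lipschitz:
 fixes f :: "real => real"
 assumes b: "!!x. abs (f x) <= 1" and lip: "!!x y. abs (f x - f y) <= L * abs (x - y)" and supp: "!!x. R < abs x ==> f x = 0"
 shows "fourier_approx f"
 unfolding fourier_approx_def
proof (intro conjI allI impI)
 interpret N: prob_space std_normal by (rule prob_space_std_normal)
 have L0: "0 <= L" using lip[of 1 0] by simp
 show fm[measurable]: "f : bmeas borel"
 proof (rule borel_measurable_continuous_onI)
  have "L-lipschitz_on UNIV f" by (rule lipschitz_onI) (use lip L0 in \<open>auto simp: dist_real_def\<close>)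
  thus "continuous_on UNIV f" by (rule lipschitz_on_continuous_on)
 qed
 show "abs (f x) <= 1" for x by (rule b)
 fix ep :: real assume ep: "0 < ep"
 define C where "C = (LINT et|std_normal. abs et)"
 have C0: "0 <= C" unfolding C_def by simp
 have intabs: "integrable std_normal (%et. abs et)"
  using integrable_abs[OF integrable_std_normal_distribution_moment[of 1]] by simp
 \<comment> \<open>Makes L * dl * C at most ep; the summand 1 covers L * C = 0.\<close>
 define dl where "dl = ep / (L * C + 1)"
 have dl: "dl > 0" unfolding dl_def using ep L0 C0 by (intro divide_pos_pos add_nonneg_pos mult_nonneg_nonneg) auto
 define c where "c = 1 / (dl * sqrt (2 * pi))"
 let ?nu = "distr std_normal borel (%et. et / dl)"
 interpret nu: prob_space ?nu by (rule N.prob_space_distr) simp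
 have intf: "integrable lborel f"
 proof -
  have "set_integrable lborel {-R..R} f"
   unfolding set_integrable_def
   by (rule integrableI_bounded_set_indicator[where B=1]) (use b in \<open>auto simp: emeasure_lborel_Icc_eq\<close>)
  moreover have "(%x. indicator {-R..R} x *R f x) = f"
  proof
   fix x show "indicator {-R..R} x *R f x = f x"
    using supp[of x] by (cases "R < abs x") (auto simp: indicator_def abs_le_iff not_less)
  qed
  ultimately show ?thesis unfolding set_integrable_def by simp
 qed
 define g where "g = (%ze. of_real c * (LINT y|lborel. of_real (f y) * iexp (- (y * ze))))"
 have gm[measurable]: "g : bmeas borel" unfolding g_def by measurable
 have gb: "norm (g ze) <= abs c * (LINT y|lborel. abs (f y))" for ze
 proof -
  have "norm (LINT y|lborel. of_real (f y) * iexp (- (y * ze))) <= (LINT y|lborel. norm (of_real (f y) * iexp (- (y * ze))))"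
   by auto
  also have "... = (LINT y|lborel. abs (f y))" by (simp add: norm_mult)
  finally show ?thesis unfolding g_def norm_mult by (simp add: mult_left_mono)
 qed
 show "EX nu (g :: real => complex). finite_measure nu & sets nu = sets borel & integrable nu g &
    (ALL x. norm (of_real (f x) - (LINT xi|nu. g xi * iexp (xi * x))) <= ep)"
 proof (intro exI conjI allI)
  show "finite_measure ?nu" by auto
  show "integrable ?nu g" by (rule nu.integrable_bounded[OF _ gb]) measurable
  fix x :: real
  interpret pair_sigma_finite lborel ?nu by unfold_locales
  have int: "integrable (lborel >< ?nu) (%(y, ze). of_real (f y) * iexp ((x - y) * ze))"
  proof (rule Fubini_integrable)
   show "integrable lborel (%y. (LINT ze|?nu. norm (case (y, ze) of (y, ze) => of_real (f y) * iexp ((x - y) * ze))))"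
    using integrable_abs[OF intf] by (simp add: norm_mult)
   show "AE y in lborel. integrable ?nu (%ze. case (y, ze) of (y, ze) => of_real (f y) * iexp ((x - y) * ze))"
    by (intro AE_I2 nu.integrable_bounded[of _ 1]) (use b in \<open>auto simp: norm_mult simp del: of_real_mult of_real_diff\<close>)
  qed measurable
  have kern: "(LINT ze|?nu. iexp ((x - y) * ze)) = of_real (exp (- (((x - y) / dl)^2) / 2))" for y
  proof -
   have "(LINT ze|?nu. iexp ((x - y) * ze)) = (LINT et|std_normal. iexp (((x - y) / dl) * et))"
    by (subst integral_distr) (auto simp: mult_ac)
   thus ?thesis unfolding std_normal_iexp .
  qed
  let ?a = "LINT ze|?nu. g ze * iexp (ze * x)"
  have "?a = (LINT ze|?nu. of_real c * (LINT y|lborel. of_real (f y) * iexp ((x - y) * ze)))"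
  proof (intro LINT_cong refl)
   fix ze
   have e: "iexp (- (y * ze)) * iexp (ze * x) = iexp ((x - y) * ze)" for y
    by (simp add: exp_add[symmetric] algebra_simps)
   show "g ze * iexp (ze * x) = of_real c * (LINT y|lborel. of_real (f y) * iexp ((x - y) * ze))"
    unfolding g_def mult.assoc integral_mult_left_zero[symmetric] e[symmetric] by auto
  qed
  also have "... = of_real c * (LINT y|lborel. of_real (f y) * (LINT ze|?nu. iexp ((x - y) * ze)))"
   unfolding integral_mult_right_zero using Fubini_integral[OF int] by auto
  also have "... = of_real c * (LINT y|lborel. complex_of_real (f y * exp (- (((x - y) / dl)^2) / 2)))"
   unfolding kern by auto
  also have "... = of_real (c * (LINT y|lborel. f y * exp (- (((x - y) / dl)^2) / 2)))"
   by (simp only: of_real_mult integral_complex_of_real[symmetric])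
  also have "c * (LINT y|lborel. f y * exp (- (((x - y) / dl)^2) / 2)) = (LINT et|std_normal. f (x + dl * et))"
  proof -
   have "(LINT y|lborel. f y * exp (- (((x - y) / dl)^2) / 2)) = abs dl *R (LINT et|lborel. f (x + dl * et) * exp (- (((x - (x + dl * et)) / dl)^2) / 2))"
    by (rule lborel_integral_real_affine[where f="%y. f y * exp (- (((x - y) / dl)^2) / 2)" and c=dl and t=x]) (use dl in simp)
   moreover have "(x - (x + dl * et)) / dl = - et" for et using dl by simp
   ultimately have "c * (LINT y|lborel. f y * exp (- (((x - y) / dl)^2) / 2)) = (c * dl) * (LINT et|lborel. f (x + dl * et) * exp (- (et^2) / 2))"
    using dl by simp
   also have "... = (LINT et|lborel. std_normal_density et *R f (x + dl * et))"
    using dl by (simp add: std_normal_density_def c_def algebra_simps)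
   also have "... = (LINT et|std_normal. f (x + dl * et))"
    by (rule integral_density[symmetric]) (auto simp: normal_density_nonneg)
   finally show ?thesis .
  qed
  finally have "norm (of_real (f x) - ?a) = abs (f x - (LINT et|std_normal. f (x + dl * et)))"
   by (simp only: of_real_diff[symmetric] norm_of_real)
  also have "f x - (LINT et|std_normal. f (x + dl * et)) = (LINT et|std_normal. f x - f (x + dl * et))"
  proof -
   have "integrable std_normal (%et. f (x + dl * et))"
    by (rule N.integrable_bounded[of _ 1]) (use b in auto)
   thus ?thesis using N.prob_space by simp
  qed
  also have "abs ... <= (LINT et|std_normal. abs (f x - f (x + dl * et)))"
   by auto
  also have "... <= (LINT et|std_normal. (L * dl) * abs et)"
  proof (rule integral_mono)
   have "norm (abs (f x - f (x + dl * et))) <= 2" for et using b[of x] b[of "x + dl * et"] by simp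
   thus "integrable std_normal (%et. abs (f x - f (x + dl * et)))"
    by (rule N.integrable_bounded[rotated]) measurable
   show "integrable std_normal (%et. L * dl * abs et)" using intabs by simp
   show "abs (f x - f (x + dl * et)) <= L * dl * abs et" for et
    using lip[of x "x + dl * et"] dl by (simp add: abs_mult)
  qed
  also have "... = L * dl * C" unfolding C_def by simp
  also have "... <= ep"
  proof -
   have "0 < L * C + 1" using L0 C0 by (intro add_nonneg_pos mult_nonneg_nonneg) auto
   thus ?thesis unfolding dl_def using ep by (simp add: field_simps)
  qed
  finally show "norm (complex_of_real (f x) - (LINT xi|?nu. g xi * iexp (xi * x))) <= ep" .
 qed simp
qed

text \<open>For l <= u: a compactly supported Lipschitz substitute for the indicator of the interval
  from l to u, equal to 1 there and 0 at distance dl or more from it.\<close>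

definition trapezoid :: "real => real => real => real => real" where
 "trapezoid l u dl x = max 0 (min 1 (min ((x - l) / dl + 1) ((u - x) / dl + 1)))"

lemma fourier_approx_trapezoid:
 assumes "0 < dl" shows "fourier_approx (trapezoid l u dl)"
proof (rule fourier_approx_lipschitz[where L="1 / dl" and R="abs l + abs u + dl"])
 let ?a = "trapezoid l u dl"
 show "abs (?a x) <= 1" for x by (auto simp: trapezoid_def)
 show "abs (?a x - ?a y) <= 1 / dl * abs (x - y)" for x y
 proof -
  define a b where "a = (x - l) / dl + 1" and "b = (u - x) / dl + 1"
  define d where "d = (y - x) / dl"
  have "(y - l) / dl + 1 = a + d" "(u - y) / dl + 1 = b - d" "1 / dl * abs (x - y) = abs d"
   using assms by (auto simp: a_def b_def d_def field_simps abs_mult abs_divide)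
  thus ?thesis unfolding trapezoid_def a_def[symmetric] b_def[symmetric]
   by (auto simp: max_def min_def abs_if split: if_splits)
 qed
 show "?a x = 0" if "abs l + abs u + dl < abs x" for x
 proof -
  have "(x - l) / dl + 1 <= 0 \<or> (u - x) / dl + 1 <= 0"
   using that assms by (auto simp: field_simps split: if_splits)
  thus ?thesis by (auto simp: trapezoid_def)
 qed
qed

text \<open>Equality is read as convergence of a constant sequence, so
  \<open>fdd_prod_tendsto\<close> gives equal expectations for products of trapezoids. These
  converge to indicators of lower orthants in finitely many coordinates, an intersection-stable
  generator of the product sigma-algebra.\<close>

lemma law_eq_of_char:
 fixes X :: "nat => 'a => real" and Y :: "nat => 'b => real"
 assumes M: "prob_space M" and N: "prob_space N"
  and X[measurable]: "!!j. X j : bmeas M" and Y[measurable]: "!!j. Y j : bmeas N"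
  and char: "!!J a. finite J ==> (LINT om|M. iexp (SUM j:J. a j * X j om)) = (LINT om|N. iexp (SUM j:J. a j * Y j om))"
 shows "distr M (PiM UNIV (%_. borel)) (%om j. X j om) = distr N (PiM UNIV (%_. borel)) (%om j. Y j om)"
proof -
 interpret M: prob_space M by fact
 interpret N: prob_space N by fact
 let ?B = "PiM UNIV (%_::nat. borel :: real measure)"
 define E where "E = {{z :: nat => real. ALL j:J. z j <= a j} | J a. finite J}"
 have EI: "{z. ALL j:J. z j <= a j} : E" if "finite J" for J a
  unfolding E_def by (rule CollectI, rule exI[of _ J], rule exI[of _ a]) (use that in simp)
 let ?a = "%om j. X j om"
 let ?c = "%om j. Y j om"
 have XM[measurable]: "?a : M \<rightarrow>\<^sub>M ?B" and YM[measurable]: "?c : N \<rightarrow>\<^sub>M ?B"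
  by (rule measurable_PiM_single', auto)+
 have EB: "E <= sets ?B"
 proof (clarsimp simp: E_def)
  fix J :: "nat set" and a :: "nat => real" assume "finite J"
  hence "{z : space ?B. ALL j:J. z j <= a j} : sets ?B" by measurable
  thus "{z. ALL j:J. z j <= a j} : sets ?B" by (simp add: space_PiM)
 qed
 let ?b = "sigma_sets UNIV E"
 have gen: "sets ?B = ?b"
 proof
  show "?b <= sets ?B"
   using sets.sigma_sets_subset[OF EB] by (simp add: space_PiM)
  let ?S = "sigma UNIV E"
  have "(%z. z) : ?S \<rightarrow>\<^sub>M ?B"
  proof (rule measurable_PiM_single')
   fix i :: nat
   show "(%z. z i) : bmeas ?S"
   proof (rule borel_measurableI_le)
    fix y :: real
    have "{z. ALL j:{i}. z j <= (%_. y) j} : E" by (rule EI) simp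
    hence "{z. ALL j:{i}. z j <= (%_. y) j} : sets ?S" by simp
    thus "{x : space ?S. x i <= y} : sets ?S" by simp
   qed
  qed auto
  hence "A : sets ?S" if "A : sets ?B" for A
   using measurable_sets[OF _ that, of "%z. z" ?S] by simp
  thus "sets ?B <= ?b" by auto
 qed
 have eq: "measure M {om:space M. ALL j:J. X j om <= a j} = measure N {om:space N. ALL j:J. Y j om <= a j}"
  if J: "finite J" for J a
 proof -
  \<comment> \<open>The left end runs to minus infinity and the width of the slopes to 0, so that
    the pointwise limit is the indicator of the closed half-line.\<close>
  define f where "f = (%(m::nat) j. trapezoid (- real m) (a j) (1 / real (Suc m)))"
  have fa: "fourier_approx (f m j)" for m j unfolding f_def by (rule fourier_approx_trapezoid) simp
  have fb: "abs (f m j x) <= 1" and [measurable]: "f m j : bmeas borel" for m j x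
   using fa[of m j] by (auto simp: fourier_approx_def f_def trapezoid_def)
  have prodb: "abs (PROD j:J. f m j (y j)) <= 1" for m y unfolding abs_prod by (rule prod_le_1) (use fb in auto)
  have fl: "(%m. f m j x) ----> indicator {..a j} x" for j x
  proof (cases "x <= a j")
   case True
   have "f m j x = 1" if "real m >= abs x" for m
    using True that unfolding f_def trapezoid_def by simp
   hence "EV m. f m j x = 1"
    using eventually_sequentiallyI[of "nat \<lceil>abs x\<rceil>" "%m. f m j x = 1"] by auto
   thus ?thesis using True by (simp add: tendsto_eventually)
  next
   case False
   have "f m j x = 0" if "real m >= 1 / (x - a j)" for m
   proof -
    have "(a j - x) / (1 / real (Suc m)) + 1 <= 0"
     using that False by (simp add: field_simps)
    moreover have "max 0 (min 1 (min p q)) = (0::real)" if "q <= 0" for p q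
     using that by simp
    ultimately show ?thesis unfolding f_def trapezoid_def by simp
   qed
   hence "EV m. f m j x = 0"
    using eventually_sequentiallyI[of "nat \<lceil>1 / (x - a j)\<rceil>" "%m. f m j x = 0"] by auto
   thus ?thesis using False by (simp add: tendsto_eventually)
  qed
  have same: "(LINT om|M. (PROD j:J. f m j (X j om))) = (LINT om|N. (PROD j:J. f m j (Y j om)))" for m
  proof -
   have "(%n::nat. (LINT om|M. (PROD j:J. f m j (X j om)))) ----> (LINT om|N. (PROD j:J. f m j (Y j om)))"
    by (rule fdd_prod_tendsto[OF M N X Y J _ fa]) (use char[OF J] in auto)
   from LIMSEQ_unique[OF tendsto_const this] show ?thesis .
  qed
  let ?d = "LINT om|M. (PROD j:J. indicator {..a j} (X j om))"
  have limX: "(%m. (LINT om|M. (PROD j:J. f m j (X j om)))) ----> ?d"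
   by (rule integral_dominated_convergence[where w="%_. 1"]) (use prodb fl in \<open>auto intro!: tendsto_prod\<close>)
  let ?e = "LINT om|N. (PROD j:J. indicator {..a j} (Y j om))"
  have limY: "(%m. (LINT om|N. (PROD j:J. f m j (Y j om)))) ----> ?e"
   by (rule integral_dominated_convergence[where w="%_. 1"]) (use prodb fl in \<open>auto intro!: tendsto_prod\<close>)
  have ind: "(PROD j:J. indicator {..a j} (y j) :: real) = indicator {z. ALL j:J. z j <= a j} y" for y
   using J by (auto simp: indicator_def)
  have "?d = measure M {om:space M. ALL j:J. X j om <= a j}"
  proof -
   have "?d = (LINT om|M. indicat_real {om:space M. ALL j:J. X j om <= a j} om)"
   proof (rule LINT_cong[OF refl])
    fix om assume "om : space M"
    thus "(PROD j:J. indicator {..a j} (X j om) :: real) = indicator {om:space M. ALL j:J. X j om <= a j} om"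
     using ind[of "%j. X j om"] by (simp add: indicator_def)
   qed
   thus ?thesis by simp
  qed
  moreover have "?e = measure N {om:space N. ALL j:J. Y j om <= a j}"
  proof -
   have "?e = (LINT om|N. indicat_real {om:space N. ALL j:J. Y j om <= a j} om)"
   proof (rule LINT_cong[OF refl])
    fix om assume "om : space N"
    thus "(PROD j:J. indicator {..a j} (Y j om) :: real) = indicator {om:space N. ALL j:J. Y j om <= a j} om"
     using ind[of "%j. Y j om"] by (simp add: indicator_def)
   qed
   thus ?thesis by simp
  qed
  ultimately show ?thesis using LIMSEQ_unique[OF limX[unfolded same] limY] by simp
 qed
 show ?thesis
 proof (rule measure_eqI_generator_eq[where \<Omega>=UNIV and E=E and A="%_. UNIV"])
  show "Int_stable E"
  proof (rule Int_stableI)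
   fix A B assume "A : E" "B : E"
   then obtain J a K b where JK: "finite J" "finite K" and AB: "A = {z. ALL j:J. z j <= a j}" "B = {z. ALL j:K. z j <= b j}"
    unfolding E_def by blast
   have "A Int B = {z. ALL j:J Un K. z j <= (if j : J & j : K then min (a j) (b j) else if j : J then a j else b j)}"
    unfolding AB by auto
   thus "A Int B : E" using EI[of "J Un K"] JK by simp
  qed
  fix A assume "A : E"
  then obtain J a where J: "finite J" and A: "A = {z. ALL j:J. z j <= a j}" unfolding E_def by blast
  have AB: "A : sets ?B" using \<open>A : E\<close> EB by auto
  have "emeasure (distr M ?B ?a) A = emeasure M {om:space M. ALL j:J. X j om <= a j}"
   using AB by (subst emeasure_distr[OF XM]) (auto simp: A intro!: arg_cong[where f="emeasure M"])
  moreover have "emeasure (distr N ?B ?c) A = emeasure N {om:space N. ALL j:J. Y j om <= a j}"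
   using AB by (subst emeasure_distr[OF YM]) (auto simp: A intro!: arg_cong[where f="emeasure N"])
  ultimately show "emeasure (distr M ?B ?a) A = emeasure (distr N ?B ?c) A"
   using eq[OF J] by (simp add: M.emeasure_eq_measure N.emeasure_eq_measure)
 next
  have "{z. ALL j:{}. z j <= (%_::nat. 0::real) j} : E" by (rule EI) simp
  thus "range (%_::nat. UNIV) <= E" by auto
  show "emeasure (distr M ?B ?a) UNIV ~= \<infinity>"
   using finite_measure.emeasure_finite[OF M.finite_measure_distr[OF XM]] by simp
 qed (auto simp: gen)
qed

section \<open>Distribution functions and atoms from Laplace transforms\<close>

lemma (in prob_space) integral_poly_exp:
 assumes [measurable]: "U : bmeas M" and U0: "!!om. 0 <= U om" and pa: "p = (%x::real. SUM i<=d. a i * x ^ i)"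
 shows "(LINT om|M. p (exp (- U om))) = (SUM i<=d. a i * (LINT om|M. exp (- real i * U om)))"
proof -
 have pw: "exp (- U om) ^ i = exp (- real i * U om)" for i om by (simp flip: exp_of_nat_mult)
 have "norm (exp (- real i * U om)) <= 1" for i om using U0[of om] by simp
 hence i1: "integrable M (%om. a i * exp (- real i * U om))" for i
  by (intro integrable_mult_right integrable_bounded[of _ 1]) auto
 show ?thesis unfolding pa pw using i1 by (subst LINT_sum) auto
qed

lemma (in prob_space) integral_exp_poly_approx:
 assumes [measurable]: "U : bmeas M" and U0: "!!om. 0 <= U om" and f: "continuous_on UNIV f"
  and pa: "p = (%x::real. SUM i<=d. a i * x ^ i)" and pf: "!!x. x : {0..1} ==> abs (f x - p x) < r"
 shows "abs ((LINT om|M. f (exp (- U om))) - (LINT om|M. p (exp (- U om)))) <= r"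
proof -
 have [measurable]: "f : bmeas borel" by (rule borel_measurable_continuous_onI[OF f])
 have [measurable]: "p : bmeas borel" unfolding pa by measurable
 have "continuous_on {0..1} f" using f by (rule continuous_on_subset) simp
 hence "bounded (f ` {0..1})" by (intro compact_imp_bounded compact_continuous_image) auto
 then obtain B where B: "!!x. x : {0..1} ==> abs (f x) <= B" unfolding bounded_iff real_norm_def by blast
 have e01: "exp (- U om) : {0..1}" for om using U0[of om] by auto
 have "norm (p (exp (- U om))) <= B + r" for om using B[OF e01[of om]] pf[OF e01[of om]] by simp
 hence i1: "integrable M (%om. p (exp (- U om)))" by (rule integrable_bounded[rotated]) measurable
 have i2: "integrable M (%om. f (exp (- U om)))"
  by (rule integrable_bounded[of _ B]) (use B[OF e01] in auto)
 have "(LINT om|M. f (exp (- U om))) - (LINT om|M. p (exp (- U om))) = (LINT om|M. f (exp (- U om)) - p (exp (- U om)))"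
  using i1 i2 by simp
 also have "norm ... <= r"
  by (rule norm_expectation_le) (use less_imp_le[OF pf[OF e01]] in auto)
 finally show ?thesis by simp
qed

text \<open>As V is nonnegative, exp (-V) lies in [0,1]. A polynomial in exp (-V) is a combination
  of Laplace transforms at integers, and Weierstrass approximation does the rest; integer arguments
  therefore suffice.\<close>

lemma laplace_continuous_tendsto:
 fixes V :: "nat => 'a => real" and W :: "'b => real"
 assumes N: "!!n. prob_space (N n)" and M: "prob_space M"
  and V[measurable]: "!!n. V n : bmeas (N n)" and W[measurable]: "W : bmeas M"
  and V0: "!!n om. 0 <= V n om" and W0: "!!om. 0 <= W om"
  and lap: "!!k::nat. (%n. (LINT om|(N n). exp (- real k * V n om))) ----> (LINT om|M. exp (- real k * W om))"
  and f: "continuous_on UNIV (f :: real => real)"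
 shows "(%n. (LINT om|(N n). f (exp (- V n om)))) ----> (LINT om|M. f (exp (- W om)))"
proof (rule LIMSEQ_I)
 interpret M: prob_space M by fact
 interpret N: prob_space "N n" for n by (rule N)
 have [measurable]: "f : bmeas borel" by (rule borel_measurable_continuous_onI[OF f])
 fix r :: real assume r: "0 < r"
 have f01: "continuous_on {0..1} f" using f continuous_on_subset by blast
 obtain p where p: "real_polynomial_function p" and pf: "!!x. x : {0..1} ==> abs (f x - p x) < r / 4"
  using Stone_Weierstrass_real_polynomial_function[OF compact_Icc f01, of "r / 4"] r by auto
 then obtain a d where pa: "p = (%x. SUM i<=d. a i * x ^ i)"
  unfolding real_polynomial_function_iff_sum by blast
 have [measurable]: "p : bmeas borel" unfolding pa by measurable
 note pE = prob_space.integral_poly_exp[OF _ _ _ pa] and fE = prob_space.integral_exp_poly_approx[OF _ _ _ f pa pf]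
 let ?a = "SUM i<=d. a i * (LINT om|M. exp (- real i * W om))"
 have "(%n. SUM i<=d. a i * (LINT om|(N n). exp (- real i * V n om))) ----> ?a"
  by (rule tendsto_sum, rule tendsto_mult[OF tendsto_const lap])
 from LIMSEQ_D[OF this, of "r / 4"] r obtain n0
  where n0: "!!n. n >= n0 ==> abs ((SUM i<=d. a i * (LINT om|(N n). exp (- real i * V n om))) - ?a) < r / 4"
  by auto
 let ?b = "LINT om|M. f (exp (- W om))"
 show "EX no. ALL n>=no. norm ((LINT om|(N n). f (exp (- V n om))) - ?b) < r"
 proof (intro exI allI impI)
  fix n assume "n >= n0"
  show "norm ((LINT om|(N n). f (exp (- V n om))) - ?b) < r"
   using n0[OF \<open>n >= n0\<close>] fE[OF N V V0, of n] fE[OF M W W0]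
   unfolding pE[OF N V V0, of n] pE[OF M W W0] real_norm_def by linarith
 qed
qed

lemma (in prob_space) cdf_complement:
 assumes [measurable]: "U : bmeas M"
 shows "1 - cdf (distr M borel U) c = measure M {om:space M. U om > c}"
proof -
 have "cdf (distr M borel U) c = measure M {om:space M. U om <= c}"
  unfolding cdf_def by (subst measure_distr) (auto simp: vimage_def Int_def conj_commute)
 moreover have "{om:space M. U om > c} = space M - {om:space M. U om <= c}" by auto
 ultimately show ?thesis by (simp add: prob_compl)
qed

lemma laplace_tendsto_prob:
 fixes V :: "nat => 'a => real" and W :: "'b => real"
 assumes N: "!!n. prob_space (N n)" and M: "prob_space M"
  and V[measurable]: "!!n. V n : bmeas (N n)" and W[measurable]: "W : bmeas M"
  and V0: "!!n om. 0 <= V n om" and W0: "!!om. 0 <= W om"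
  and lap: "!!k::nat. (%n. (LINT om|(N n). exp (- real k * V n om))) ----> (LINT om|M. exp (- real k * W om))"
  and atom: "measure M {om:space M. W om = c} = 0"
 shows "(%n. measure (N n) {om:space (N n). V n om > c}) ----> measure M {om:space M. W om > c}"
proof -
 interpret M: prob_space M by fact
 interpret N: prob_space "N n" for n by (rule N)
 have rN: "real_distribution (distr (N n) borel (V n))" for n
  by simp
 have rM: "real_distribution (distr M borel W)"
  by simp
 have "weak_conv_m (%n. distr (N n) borel (V n)) (distr M borel W)"
 proof (rule integral_cts_step_conv_imp_weak_conv[OF rN rM])
  fix a b :: real assume ab: "a < b"
  let ?a = "cts_step a b"
  \<comment> \<open>The step function in the variable y = exp (-v). The maximum keeps the logarithm
    away from 0 and changes nothing, since the step already vanishes beyond b.\<close>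
  define f where "f = (%y. ?a (- ln (max y (exp (- b - 1)))))"
  have "continuous_on UNIV (?a)"
   using cts_step_uniformly_continuous[OF ab] uniformly_continuous_imp_continuous by blast
  moreover have "continuous_on UNIV (%y::real. - ln (max y (exp (- b - 1))))"
   by (intro continuous_intros) (auto simp: max_def not_le intro: less_le_trans[OF exp_gt_zero])
  ultimately have "continuous_on UNIV f"
   unfolding f_def by (rule continuous_on_compose2[of UNIV]) auto
  from laplace_continuous_tendsto[OF N M V W V0 W0 lap this]
  have lim: "(%n. (LINT om|(N n). f (exp (- V n om)))) ----> (LINT om|M. f (exp (- W om)))" .
  have f_eq: "f (exp (- v)) = ?a v" for v
  proof (cases "v <= b + 1")
   case True
   hence "max (exp (- v)) (exp (- b - 1)) = exp (- v)" by auto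
   thus ?thesis by (simp add: f_def)
  next
   case False
   hence "f (exp (- v)) = ?a (b + 1)" by (simp add: f_def add.commute)
   thus ?thesis using False ab by (simp add: cts_step_def)
  qed
  have [measurable]: "?a : bmeas borel" unfolding cts_step_def[abs_def] by measurable
  show "(%n. integral\<^sup>L (distr (N n) borel (V n)) (?a)) ----> integral\<^sup>L (distr M borel W) (?a)"
   using lim unfolding f_eq by (simp add: integral_distr)
 qed
 moreover have "isCont (cdf (distr M borel W)) c"
 proof -
  have "measure (distr M borel W) {c} = 0"
   using atom by (subst measure_distr) (auto simp: vimage_def Int_def conj_commute)
  moreover have "finite_borel_measure (distr M borel W)"
   by (simp add: finite_borel_measure_def finite_borel_measure_axioms_def M.finite_measure_distr)
  ultimately show ?thesis by (simp add: finite_borel_measure.isCont_cdf)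
 qed
 ultimately have "(%n. 1 - cdf (distr (N n) borel (V n)) c) ----> 1 - cdf (distr M borel W) c" by (auto simp: weak_conv_m_def weak_conv_def intro!: tendsto_diff[OF tendsto_const])
 moreover note N.cdf_complement[OF V] M.cdf_complement[OF W]
 ultimately show ?thesis by simp
qed

lemma (in prob_space) spike_tendsto:
 assumes [measurable]: "U : bmeas M"
 shows "(%m. (LINT om|M. max 0 (1 - real m * abs (exp (- U om) - exp (- c))))) ----> measure M {om:space M. U om = c}"
proof -
 have "(%m. (LINT om|M. max 0 (1 - real m * abs (exp (- U om) - exp (- c))))) ----> (LINT om|M. indicat_real {om:space M. U om = c} om)"
 proof (rule integral_dominated_convergence[where w="%_. 1"])
  show "AE om in M. (%m. max 0 (1 - real m * abs (exp (- U om) - exp (- c)))) ----> indicat_real {om:space M. U om = c} om"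
  proof (rule AE_I2)
   fix om assume "om : space M"
   show "(%m. max 0 (1 - real m * abs (exp (- U om) - exp (- c)))) ----> indicat_real {om:space M. U om = c} om"
   proof (cases "U om = c")
    case True thus ?thesis using \<open>om : space M\<close> by simp
   next
    case False
    define d where "d = abs (exp (- U om) - exp (- c))"
    have d: "d > 0" using False by (simp add: d_def)
    have "max 0 (1 - real m * d) = 0" if "real m >= 1 / d" for m
     using that d by (simp add: field_simps)
    hence "EV m. max 0 (1 - real m * d) = 0"
     using eventually_sequentiallyI[of "nat \<lceil>1 / d\<rceil>" "%m. max 0 (1 - real m * d) = 0"] by auto
    thus ?thesis using False by (simp add: tendsto_eventually d_def)
   qed
  qed
 qed auto
 thus ?thesis by simp
qed

text \<open>Tents in exp (-V) shrinking to the point exp (-c) detect the mass at c, and their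
  expectations are determined by the Laplace transform. It serves to compare a limit functional with
  its resampled version.\<close>

lemma laplace_eq_atom:
 fixes V :: "'a => real" and W :: "'b => real"
 assumes N: "prob_space N" and M: "prob_space M"
  and V[measurable]: "V : bmeas N" and W[measurable]: "W : bmeas M"
  and V0: "!!om. 0 <= V om" and W0: "!!om. 0 <= W om"
  and lap: "!!k::nat. (LINT om|N. exp (- real k * V om)) = (LINT om|M. exp (- real k * W om))"
 shows "measure N {om:space N. V om = c} = measure M {om:space M. W om = c}"
proof -
 define f where "f = (%(m::nat) y. max 0 (1 - real m * abs (y - exp (- c))))"
 have fc: "continuous_on UNIV (f m)" for m unfolding f_def by (intro continuous_intros)
 have fm[measurable]: "f m : bmeas borel" for m by (rule borel_measurable_continuous_onI[OF fc])
 have same: "(LINT om|N. f m (exp (- V om))) = (LINT om|M. f m (exp (- W om)))" for m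
 proof -
  have "(%n::nat. (LINT om|N. f m (exp (- V om)))) ----> (LINT om|M. f m (exp (- W om)))"
   by (rule laplace_continuous_tendsto[where N="%_. N" and V="%_. V", OF N M V W V0 W0 _ fc])
    (unfold lap, rule tendsto_const)
  from LIMSEQ_unique[OF tendsto_const this] show ?thesis .
 qed
 have "(%m. (LINT om|N. f m (exp (- V om)))) ----> measure N {om:space N. V om = c}"
  unfolding f_def by (rule prob_space.spike_tendsto[OF N V])
 moreover have "(%m. (LINT om|M. f m (exp (- W om)))) ----> measure M {om:space M. W om = c}"
  unfolding f_def by (rule prob_space.spike_tendsto[OF M W])
 ultimately show ?thesis unfolding same by (rule LIMSEQ_unique)
qed

section \<open>Gaussian variables and their moments\<close>

lemma exp_diff_of_real: "exp (A - complex_of_real y) = exp A * of_real (exp (- y))"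
 by (simp add: exp_diff exp_minus divide_inverse exp_of_real)

lemma gaussian_rv_law:
 assumes M: "prob_space M" and Y: "gaussian_rv M Y"
 shows "EX mu sg. distr M borel Y = distr std_normal borel (%x. mu + sg * x)"
proof -
 interpret M: prob_space M by fact
 let ?b = "distr M borel Y"
 interpret N: prob_space std_normal by (rule prob_space_std_normal)
 from Y obtain mu s where [measurable]: "Y : bmeas M" and s: "0 <= s"
  and ch: "!!t. char (?b) t = exp (\<i> * complex_of_real (t * mu) - complex_of_real (s * t^2 / 2))"
  unfolding gaussian_rv_def by blast
 let ?a = "%x. mu + sqrt s * x"
 have "?b = distr std_normal borel ?a"
 proof (rule Levy_uniqueness)
  show "real_distribution (?b)"
   by simp
  show "real_distribution (distr std_normal borel ?a)"
   by simp
  show "char (?b) = char (distr std_normal borel ?a)"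
  proof
   fix t
   have "char (distr std_normal borel ?a) t = (LINT x|std_normal. iexp (t * mu) * iexp ((t * sqrt s) * x))"
    by (subst char_distr) (simp_all add: distrib_left exp_add mult.assoc)
   also have "... = iexp (t * mu) * of_real (exp (- ((t * sqrt s)^2) / 2))"
    unfolding integral_mult_right_zero std_normal_iexp ..
   also have "... = char (?b) t"
    unfolding ch exp_diff_of_real using s by (simp add: power_mult_distrib)
   finally show "char (?b) t = char (distr std_normal borel ?a) t" ..
  qed
 qed
 thus ?thesis by blast
qed

text \<open>The definition of a Gaussian process prescribes values of Bochner integrals, and these
  are 0 by default for non-integrable functions; that the moments are genuine has to come from the
  Gaussian law. With sg = 0 the degenerate case is included.\<close>

lemma gaussian_rv_moments:
 assumes M: "prob_space M" and Y: "gaussian_rv M Y"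
 shows "integrable M Y" "integrable M (%om. (Y om)^2)"
  and "(LINT om|M. iexp (Y om)) = exp (\<i> * of_real (LINT om|M. Y om) - of_real ((LINT om|M. (Y om - (LINT om|M. Y om))^2) / 2))"
proof -
 interpret M: prob_space M by fact
 interpret N: prob_space std_normal by (rule prob_space_std_normal)
 have [measurable]: "Y : bmeas M" using Y by (simp add: gaussian_rv_def)
 obtain mu sg where law: "distr M borel Y = distr std_normal borel (%x. mu + sg * x)"
  using gaussian_rv_law[OF M Y] by blast
 have tr: "(LINT om|M. g (Y om)) = (LINT x|std_normal. g (mu + sg * x))"
  if [measurable]: "g : bmeas borel" for g :: "real => real"
  using arg_cong[OF law, of "%D. integral\<^sup>L D g"] by (simp add: integral_distr)
 have trc: "(LINT om|M. g (Y om)) = (LINT x|std_normal. g (mu + sg * x))"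
  if [measurable]: "g : bmeas borel" for g :: "real => complex"
  using arg_cong[OF law, of "%D. integral\<^sup>L D g"] by (simp add: integral_distr)
 have tri: "integrable M (%om. g (Y om)) = integrable std_normal (%x. g (mu + sg * x))"
  if [measurable]: "g : bmeas borel" for g :: "real => real"
  using arg_cong[OF law, of "%D. integrable D g"] by (simp add: integrable_distr_eq)
 have i1: "integrable std_normal (%x. x)" and i2: "integrable std_normal (%x. x^2)"
  using integrable_std_normal_distribution_moment[of 1] integrable_std_normal_distribution_moment[of 2] by auto
 have e1: "(LINT x|std_normal. x) = 0" and e2: "(LINT x|std_normal. x^2) = 1"
  using integral_std_normal_distribution_moment_odd[of 1] std_normal_distribution_even_moments(1)[of 1] by auto
 have "integrable M (%om. Y om) = integrable std_normal (%x. mu + sg * x)" by (rule tri) measurable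
 moreover have "integrable std_normal (%x. mu + sg * x)"
  by (intro Lint_add integrable_mult_right i1) simp
 ultimately show "integrable M Y" by simp
 have eq: "(mu + sg * x)^2 = mu^2 + (2 * mu * sg) * x + sg^2 * x^2" for x
  unfolding power2_sum power_mult_distrib by simp
 have "integrable std_normal (%x. (mu + sg * x)^2)"
  unfolding eq by (intro Lint_add integrable_mult_right i1 i2) simp
 moreover have "integrable M (%om. (Y om)^2) = integrable std_normal (%x. (mu + sg * x)^2)"
  by (rule tri) measurable
 ultimately show "integrable M (%om. (Y om)^2)" by simp
 let ?a = "LINT om|M. Y om"
 have "?a = (LINT x|std_normal. mu + sg * x)" by (rule tr) measurable
 also have "... = mu" using i1 e1 N.prob_space by simp
 finally have mean: "?a = mu" .
 have "(LINT om|M. (Y om - mu)^2) = (LINT x|std_normal. (mu + sg * x - mu)^2)" by (rule tr) measurable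
 also have "... = sg^2" using e2 by (simp add: power_mult_distrib)
 finally have var: "(LINT om|M. (Y om - mu)^2) = sg^2" .
 have "(LINT om|M. iexp (Y om)) = (LINT x|std_normal. iexp mu * iexp (sg * x))" by (use trc[of iexp] in \<open>simp add: distrib_left exp_add\<close>)
 also have "... = iexp mu * of_real (exp (- (sg^2) / 2))"
  unfolding integral_mult_right_zero std_normal_iexp ..
 also have "... = exp (\<i> * of_real mu - of_real (sg^2 / 2))"
  unfolding exp_diff_of_real by simp
 finally show "(LINT om|M. iexp (Y om)) = exp (\<i> * of_real ?a - of_real ((LINT om|M. (Y om - ?a)^2) / 2))"
  unfolding mean var .
qed

section \<open>Quadratic functionals of Gaussian processes\<close>

lemma abs_mult_le_squares: "abs (x * y) <= x^2 + y^2" for x y :: real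
proof -
 have "0 <= (abs x - abs y)^2" by simp
 hence "2 * (abs x * abs y) <= x^2 + y^2" by (simp add: power2_diff)
 moreover have "0 <= abs x * abs y" by simp
 ultimately show ?thesis unfolding abs_mult by linarith
qed

lemma gaussian_process_real_facts:
 assumes G: "gaussian_process_real M I Z m K"
 shows "prob_space M" and "!!s. s : I ==> Z s : bmeas M" and "!!s. s : I ==> integrable M (Z s)"
  and "!!s. s : I ==> integrable M (%om. (Z s om - m s)^2)"
  and "!!s t. s : I ==> t : I ==> integrable M (%om. (Z s om - m s) * (Z t om - m t))"
  and "!!s. s : I ==> (LINT om|M. Z s om) = m s"
  and "!!s t. s : I ==> t : I ==> (LINT om|M. (Z s om - m s) * (Z t om - m t)) = K s t"
proof -
 show M: "prob_space M" and Zm: "!!s. s : I ==> Z s : bmeas M"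
  and "!!s. s : I ==> (LINT om|M. Z s om) = m s"
  and "!!s t. s : I ==> t : I ==> (LINT om|M. (Z s om - m s) * (Z t om - m t)) = K s t"
  using G by (auto simp: gaussian_process_real_def)
 interpret M: prob_space M by fact
 have gr: "gaussian_rv M (Z s)" if "s : I" for s
 proof -
  have "gaussian_rv M (%om. SUM k:{0::nat}. 1 * Z ((%_. s) k) om)"
   using G that unfolding gaussian_process_real_def by (elim conjE allE[where x="{0::nat}"] allE[where x="%_. s"] allE[where x="%_. 1"]) auto
  thus ?thesis by simp
 qed
 show int: "integrable M (Z s)" if "s : I" for s using gaussian_rv_moments(1)[OF M gr[OF that]] .
 show sq: "integrable M (%om. (Z s om - m s)^2)" if "s : I" for s
  by (simp add: power2_diff gaussian_rv_moments M gr that)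
 show "integrable M (%om. (Z s om - m s) * (Z t om - m t))" if st: "s : I" "t : I" for s t
 proof (rule Lint_bound)
  show "integrable M (%om. (Z s om - m s)^2 + (Z t om - m t)^2)" using sq st by auto
  show "(%om. (Z s om - m s) * (Z t om - m t)) : bmeas M" using Zm[OF st(1)] Zm[OF st(2)] by measurable
  show "AE om in M. norm ((Z s om - m s) * (Z t om - m t)) <= norm ((Z s om - m s)^2 + (Z t om - m t)^2)"
   using abs_mult_le_squares by (intro AE_I2) simp
 qed
qed

lemma gaussian_process_real_char:
 assumes G: "gaussian_process_real M I Z m K" and S: "finite S" and u: "u ` S <= I"
 shows "(LINT om|M. iexp (SUM k:S. a k * Z (u k) om)) =
  exp (\<i> * of_real (SUM k:S. a k * m (u k)) - of_real ((SUM k:S. SUM l:S. a k * a l * K (u k) (u l)) / 2))"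
proof -
 note facts = gaussian_process_real_facts[OF G]
 interpret M: prob_space M by (rule facts(1))
 have uI: "k : S ==> u k : I" for k using u by auto
 \<comment> \<open>The definition of the process quantifies over index sets of naturals, so S is
   enumerated first.\<close>
 let ?a = "{0..<card S}"
 obtain b where b: "bij_betw b ?a S" using ex_bij_betw_nat_finite[OF S] by blast
 have "gaussian_rv M (%om. SUM k:?a. (a \<circ> b) k * Z ((u \<circ> b) k) om)"
 proof -
  have "(u \<circ> b) ` ?a <= I" using b u by (auto simp: bij_betw_def)
  thus ?thesis using G unfolding gaussian_process_real_def by blast
 qed
 moreover have "(SUM k:?a. (a \<circ> b) k * Z ((u \<circ> b) k) om) = (SUM k:S. a k * Z (u k) om)" for om
  using sum.reindex_bij_betw[OF b, of "%k. a k * Z (u k) om"] by simp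
 ultimately have gr: "gaussian_rv M (%om. SUM k:S. a k * Z (u k) om)" by simp
 have mean: "(LINT om|M. (SUM k:S. a k * Z (u k) om)) = (SUM k:S. a k * m (u k))"
  using facts(3,6) uI by (subst LINT_sum) auto
 have "((SUM k:S. a k * Z (u k) om) - (SUM k:S. a k * m (u k)))^2
   = (SUM k:S. SUM l:S. (a k * a l) * ((Z (u k) om - m (u k)) * (Z (u l) om - m (u l))))" for om
 proof -
  have "(SUM k:S. a k * Z (u k) om) - (SUM k:S. a k * m (u k)) = (SUM k:S. a k * (Z (u k) om - m (u k)))"
   by (simp add: sum_subtractf right_diff_distrib)
  thus ?thesis by (simp only: power2_eq_square sum_product) (simp add: mult_ac)
 qed
 hence "(LINT om|M. ((SUM k:S. a k * Z (u k) om) - (SUM k:S. a k * m (u k)))^2)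
   = (LINT om|M. (SUM k:S. SUM l:S. (a k * a l) * ((Z (u k) om - m (u k)) * (Z (u l) om - m (u l)))))" by simp
 also have "... = (SUM k:S. (LINT om|M. (SUM l:S. (a k * a l) * ((Z (u k) om - m (u k)) * (Z (u l) om - m (u l))))))"
  by (rule LINT_sum, rule Lint_sum, rule integrable_mult_right) (intro facts(5) uI)
 also have "... = (SUM k:S. SUM l:S. (LINT om|M. (a k * a l) * ((Z (u k) om - m (u k)) * (Z (u l) om - m (u l)))))"
  by (intro sum.cong refl, rule LINT_sum, rule integrable_mult_right) (intro facts(5) uI)
 also have "... = (SUM k:S. SUM l:S. a k * a l * K (u k) (u l))"
  by (intro sum.cong refl) (simp only: integral_mult_right_zero facts(7)[OF uI uI])
 finally have var: "(LINT om|M. ((SUM k:S. a k * Z (u k) om) - (SUM k:S. a k * m (u k)))^2) = (SUM k:S. SUM l:S. a k * a l * K (u k) (u l))" .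
 show ?thesis using gaussian_rv_moments(3)[OF facts(1) gr] unfolding mean var .
qed

lemma L2_mult_integrable:
 fixes f g :: "'s => real"
 assumes "f : bmeas mu" "g : bmeas mu" "integrable mu (%s. (f s)^2)" "integrable mu (%s. (g s)^2)"
 shows "integrable mu (%s. f s * g s)"
proof (rule Lint_bound)
 show "integrable mu (%s. (f s)^2 + (g s)^2)" using assms by auto
 show "(%s. f s * g s) : bmeas mu" using assms(1,2) by measurable
 show "AE s in mu. norm (f s * g s) <= norm ((f s)^2 + (g s)^2)" using abs_mult_le_squares by (intro AE_I2) simp
qed

lemma L2_Cauchy_Schwarz:
 fixes f g :: "'s => real"
 assumes m: "f : bmeas mu" "g : bmeas mu" "integrable mu (%s. (f s)^2)" "integrable mu (%s. (g s)^2)"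
 shows "(LINT s|mu. f s * g s)^2 <= (LINT s|mu. (f s)^2) * (LINT s|mu. (g s)^2)"
proof -
 define A B C where "A = (LINT s|mu. (f s)^2)" and "B = (LINT s|mu. f s * g s)" and "C = (LINT s|mu. (g s)^2)"
 have A0: "0 <= A" and C0: "0 <= C" by (auto simp: A_def C_def)
 have q: "0 <= A - 2 * x * B + x^2 * C" for x
 proof -
  have "(LINT s|mu. (f s - x * g s)^2) = (LINT s|mu. (f s)^2 - (2 * x) * (f s * g s) + x^2 * (g s)^2)"
   by (intro LINT_cong refl) (simp add: power2_diff power_mult_distrib)
  also have "... = A - 2 * x * B + x^2 * C"
   unfolding A_def B_def C_def using m L2_mult_integrable[OF m] by simp
  finally show ?thesis using integral_nonneg_AE[of "%s. (f s - x * g s)^2" mu] by simp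
 qed
 have "B^2 <= A * C"
 proof (cases "C = 0")
  case True
  have "B = 0"
  proof (rule ccontr)
   assume "B ~= 0"
   thus False using q[of "(A + 1) / B"] True A0 by simp
  qed
  thus ?thesis using True by simp
 next
  case False
  hence "C > 0" using C0 by simp
  thus ?thesis using q[of "B / C"] by (simp add: power2_eq_square field_simps)
 qed
 thus ?thesis by (simp add: A_def B_def C_def)
qed

lemma L2_norm_diff_le:
 fixes f g :: "'s => real"
 assumes m: "f : bmeas mu" "g : bmeas mu" "integrable mu (%s. (f s)^2)" "integrable mu (%s. (g s)^2)"
 shows "abs (sqrt (LINT s|mu. (f s)^2) - sqrt (LINT s|mu. (g s)^2)) <= sqrt (LINT s|mu. (f s - g s)^2)"
proof -
 define A B C where "A = (LINT s|mu. (f s)^2)" and "B = (LINT s|mu. f s * g s)" and "C = (LINT s|mu. (g s)^2)"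
 have A0: "0 <= A" and C0: "0 <= C" by (auto simp: A_def C_def)
 have BAC: "B <= sqrt A * sqrt C"
  using L2_Cauchy_Schwarz[OF m] unfolding A_def[symmetric] B_def[symmetric] C_def[symmetric]
  by (metis real_le_rsqrt real_sqrt_mult)
 have "(LINT s|mu. (f s - g s)^2) = (LINT s|mu. (f s)^2 - 2 * (f s * g s) + (g s)^2)"
  by (intro LINT_cong refl) (simp add: power2_diff)
 also have "... = A - 2 * B + C"
  unfolding A_def B_def C_def using m L2_mult_integrable[OF m] by simp
 also have "... >= (sqrt A - sqrt C)^2" using BAC A0 C0 by (simp add: power2_diff)
 finally have "sqrt ((sqrt A - sqrt C)^2) <= sqrt (LINT s|mu. (f s - g s)^2)" by (rule real_sqrt_le_mono)
 thus ?thesis by (simp add: A_def C_def)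
qed

text \<open>The derivative of exp (-z^2) has modulus at most 1 because 2|z| <= 1 + z^2 <= exp (z^2).
  Applied to square roots of integrals, it makes the Laplace functional Lipschitz in the L2 norm of
  the path, so first moments of L2 distances are all that is needed.\<close>

lemma exp_neg_square_lipschitz:
 fixes a b t :: real assumes "0 <= t"
 shows "abs (exp (- t * a^2) - exp (- t * b^2)) <= sqrt t * abs (a - b)"
proof -
 have *: "abs (exp (- (x^2)) - exp (- (y^2))) <= abs (x - y)" if "x < y" for x y :: real
 proof -
  have "EX z. x < z & z < y & exp (- (y^2)) - exp (- (x^2)) = (y - x) * (- (2 * z) * exp (- (z^2)))"
   by (rule MVT2[OF that]) (auto intro!: derivative_eq_intros)
  then obtain z where z: "exp (- (y^2)) - exp (- (x^2)) = (y - x) * (- (2 * z) * exp (- (z^2)))" by blast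
  have "2 * abs z <= 1 + z^2" using zero_le_power2[of "abs z - 1"] by (simp add: power2_diff)
  also have "... <= exp (z^2)" by auto
  finally have "2 * abs z * exp (- (z^2)) <= exp (z^2) * exp (- (z^2))" by (intro mult_right_mono) auto
  hence "abs (- (2 * z) * exp (- (z^2))) <= 1" by (simp add: abs_mult exp_minus)
  hence "abs (exp (- (y^2)) - exp (- (x^2))) <= abs (y - x) * 1" unfolding z abs_mult by (intro mult_left_mono) (auto simp: abs_mult)
  thus ?thesis by auto
 qed
 have **: "abs (exp (- (x^2)) - exp (- (y^2))) <= abs (x - y)" for x y :: real
  using *[of x y] *[of y x] by (cases x y rule: linorder_cases) (auto simp: abs_minus_commute)
 have "abs (exp (- ((sqrt t * a)^2)) - exp (- ((sqrt t * b)^2))) <= abs (sqrt t * a - sqrt t * b)" by (rule **)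
 thus ?thesis using assms by (simp add: power_mult_distrib right_diff_distrib[symmetric] abs_mult)
qed

lemma integral_finite_range:
 fixes g :: "'s => real"
 assumes mu: "finite_measure mu" and pj: "p : mu \<rightarrow>\<^sub>M count_space UNIV" and fin: "finite (p ` space mu)"
 shows "(LINT s|mu. g (p s)) = (SUM j:p ` space mu. measure mu {s:space mu. p s = j} * g j)"
  and "integrable mu (%s. g (p s))"
proof -
 interpret finite_measure mu by fact
 have [measurable]: "{s:space mu. p s = j} : sets mu" for j
  using measurable_sets[OF pj, of "{j}"] by (simp add: Int_def conj_commute)
 have eq: "g (p s) = (SUM j:p ` space mu. g j * indicator {s:space mu. p s = j} s)" if "s : space mu" for s
  using that fin by (subst sum.remove[of _ "p s"]) (auto simp: indicator_def intro!: sum.neutral)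
 have int: "integrable mu (%s. SUM j:p ` space mu. g j * indicator {s:space mu. p s = j} s)"
  by (intro Lint_sum integrable_mult_right integrable_real_indicator) (auto simp: emeasure_eq_measure)
 show "integrable mu (%s. g (p s))"
  using int by (subst Bochner_Integration.integrable_cong[OF refl eq]) auto
 have "(LINT s|mu. g (p s)) = (LINT s|mu. (SUM j:p ` space mu. g j * indicator {s:space mu. p s = j} s))"
  by (rule LINT_cong[OF refl eq])
 also have "... = (SUM j:p ` space mu. (LINT s|mu. g j * indicator {s:space mu. p s = j} s))"
  by (rule LINT_sum, rule integrable_mult_right, rule integrable_real_indicator) (auto simp: emeasure_eq_measure)
 also have "... = (SUM j:p ` space mu. measure mu {s:space mu. p s = j} * g j)"
  by (simp add: mult.commute)
 finally show "(LINT s|mu. g (p s)) = (SUM j:p ` space mu. measure mu {s:space mu. p s = j} * g j)" .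
qed

text \<open>The mean L2 distance of a random path from its discretisation along \<open>pj k\<close>
  is at most \<open>ta k\<close>. One rate \<open>ta\<close> is meant to serve all sample sizes and
  the limit at once.\<close>

definition L2_approx :: "'a measure => 's measure => ('a => 's => real) => (nat => 's => 's) => (nat => real) => bool" where
 "L2_approx N mu X pj ta \<longleftrightarrow> prob_space N & (%(om, s). X om s) : bmeas (N >< mu) &
  (AE om in N. integrable mu (%s. (X om s)^2)) &
  (ALL k. nn_int N (%om. sqrt (LINT s|mu. (X om s - X om (pj k s))^2)) <= ennreal (ta k))"

text \<open>A discretised path s |-> X (pj k s) depends on finitely many coordinates.
  \<open>pj k\<close> has to be measurable both into the space itself and into the discrete space,
  so that its level sets are measurable.\<close>

locale finite_projections =
 fixes mu :: "'s measure" and pj :: "nat => 's => 's"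
 assumes mu: "finite_measure mu"
  and pj_self [measurable]: "!!k. pj k : mu \<rightarrow>\<^sub>M mu" and pj_count: "!!k. pj k : mu \<rightarrow>\<^sub>M count_space UNIV"
  and pj_finite: "!!k. finite (pj k ` space mu)"
begin

sublocale finite_measure mu by (rule mu)

lemma pj_range: "pj k ` space mu <= space mu"
 using measurable_space[OF pj_self] by auto

lemma L2_approx_laplace:
 assumes X: "L2_approx N mu X pj ta" and t: "0 <= t" and ta: "0 <= ta k"
 shows "abs ((LINT om|N. exp (- t * (LINT s|mu. (X om s)^2))) - (LINT om|N. exp (- t * (LINT s|mu. (X om (pj k s))^2)))) <= sqrt t * ta k"
proof -
 interpret N: prob_space N using X by (simp add: L2_approx_def)
 have [measurable]: "(%(om, s). X om s) : bmeas (N >< mu)" using X by (simp add: L2_approx_def)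
 have "(%z. (fst z, pj k (snd z))) : N >< mu \<rightarrow>\<^sub>M N >< mu" by measurable
 from measurable_compose[OF this, of "%(om, s). X om s" borel]
 have [measurable]: "(%(om, s). X om (pj k s)) : bmeas (N >< mu)" by auto
 define a b D where "a = (%om. (LINT s|mu. (X om s)^2))" and "b = (%om. (LINT s|mu. (X om (pj k s))^2))"
  and "D = (%om. sqrt (LINT s|mu. (X om s - X om (pj k s))^2))"
 have [measurable]: "a : bmeas N" "b : bmeas N" "D : bmeas N"
  unfolding a_def b_def D_def by measurable
 have a0: "0 <= a om" and b0: "0 <= b om" and D0: "0 <= D om" for om by (auto simp: a_def b_def D_def)
 have i: "integrable N (%om. exp (- t * a om))" "integrable N (%om. exp (- t * b om))"
  using t a0 b0 by (auto intro!: N.integrable_bounded[of _ 1])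
 have ae: "AE om in N. abs (exp (- t * a om) - exp (- t * b om)) <= sqrt t * D om"
 proof -
  have "AE om in N. integrable mu (%s. (X om s)^2)" using X by (simp add: L2_approx_def)
  with AE_space show ?thesis
  proof eventually_elim
   case (elim om)
   have [measurable]: "X om : bmeas mu"
    using measurable_Pair2[OF _ elim(1), of "%(om, s). X om s" mu borel] by simp
   have "abs (sqrt (a om) - sqrt (b om)) <= D om"
    unfolding a_def b_def D_def
    by (rule L2_norm_diff_le) (use elim integral_finite_range(2)[OF mu pj_count pj_finite, of "%s. (X om s)^2"] in auto)
   hence "sqrt t * abs (sqrt (a om) - sqrt (b om)) <= sqrt t * D om" using t by (intro mult_left_mono) auto
   thus ?case using exp_neg_square_lipschitz[OF t, of "sqrt (a om)" "sqrt (b om)"] a0 b0 by simp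
  qed
 qed
 have nnD: "nn_int N (%om. D om) <= ennreal (ta k)" using X unfolding L2_approx_def D_def by blast
 hence iD: "integrable N D" using D0 by (intro integrableI_bounded) (auto simp: le_less_trans)
 let ?a = "LINT om|N. D om"
 have "abs ((LINT om|N. exp (- t * a om)) - (LINT om|N. exp (- t * b om))) = abs (LINT om|N. exp (- t * a om) - exp (- t * b om))"
  using i by simp
 also have "... <= (LINT om|N. abs (exp (- t * a om) - exp (- t * b om)))" by auto
 also have "... <= (LINT om|N. sqrt t * D om)"
  by (rule integral_mono_AE) (use i iD ae in auto)
 also have "... = sqrt t * ?a" by simp
 also have "?a <= ta k"
 proof -
  have "ennreal ?a <= ennreal (ta k)" using nnD iD D0 by (simp add: nn_integral_eq_integral)
  thus ?thesis using ta by auto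
 qed
 finally show ?thesis using t by (simp add: a_def b_def mult_left_mono)
qed

text \<open>For a discretised path the integral is a finite weighted sum of squares, so its
  exponential splits into Gaussian factors covered by \<open>fdd_prod_tendsto\<close>.
  Discretisation costs sqrt t * ta k for every n and for the limit alike.\<close>

theorem L2_laplace_tendsto:
 assumes X: "!!n. L2_approx (N n) mu (X n) pj ta" and Z: "L2_approx M mu Z pj ta"
  and ta0: "!!k. 0 <= ta k" and ta: "ta ----> 0" and t: "0 <= t"
  and char: "!!J a. finite J ==> J <= space mu ==>
   (%n. (LINT om|(N n). iexp (SUM j:J. a j * X n om j))) ----> (LINT om|M. iexp (SUM j:J. a j * Z om j))"
 shows "(%n. (LINT om|(N n). exp (- t * (LINT s|mu. (X n om s)^2)))) ----> (LINT om|M. exp (- t * (LINT s|mu. (Z om s)^2)))"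
proof (rule LIMSEQ_I)
 have N: "prob_space (N n)" for n using X by (simp add: L2_approx_def)
 have M: "prob_space M" using Z by (simp add: L2_approx_def)
 fix r :: real assume r: "0 < r"
 have "(%k. sqrt t * ta k) ----> 0" using tendsto_mult[OF tendsto_const ta, of "sqrt t"] by simp
 from LIMSEQ_D[OF this, of "r / 4"] r obtain k where "norm (sqrt t * ta k - 0) < r / 4" by auto
 hence k: "sqrt t * ta k < r / 4" by auto
 define J where "J = pj k ` space mu"
 have J: "finite J" "J <= space mu" using pj_finite pj_range by (auto simp: J_def)
 define c where "c = (%j. measure mu {s:space mu. pj k s = j})"
 have fin: "exp (- t * (LINT s|mu. (Y (pj k s))^2)) = (PROD j:J. exp (- (t * c j) * (Y j)^2))" for Y
  unfolding integral_finite_range(1)[OF mu pj_count pj_finite, of "%s. (Y s)^2"] J_def[symmetric]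
  using J by (simp add: exp_sum[symmetric] sum_distrib_left mult.assoc c_def)
 have Xm: "(%om. X n om j) : bmeas (N n)" if "j : J" for n j
  using X[of n] J that measurable_Pair1[of "%(om, s). X n om s" "N n" mu borel j] by (auto simp: L2_approx_def)
 have Zm: "(%om. Z om j) : bmeas M" if "j : J" for j
  using Z J that measurable_Pair1[of "%(om, s). Z om s" M mu borel j] by (auto simp: L2_approx_def)
 have "(%n. (LINT om|(N n). (PROD j:J. exp (- (t * c j) * (X n om j)^2)))) ----> (LINT om|M. (PROD j:J. exp (- (t * c j) * (Z om j)^2)))"
  using fdd_prod_tendsto[where f="%j x. exp (- (t * c j) * x^2)" and J=J and N=N and M=M and X="%n j om. X n om j" and Z="%j om. Z om j",
   OF N M Xm Zm J(1) char[OF J]] fourier_approx_gauss t by (simp add: c_def)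
 from LIMSEQ_D[OF this[folded fin], of "r / 4"] r obtain n0 where
  n0: "!!n. n >= n0 ==> abs ((LINT om|(N n). exp (- t * (LINT s|mu. (X n om (pj k s))^2))) - (LINT om|M. exp (- t * (LINT s|mu. (Z om (pj k s))^2)))) < r / 4"
  by auto
 let ?a = "LINT om|M. exp (- t * (LINT s|mu. (Z om s)^2))"
 show "EX no. ALL n>=no. norm ((LINT om|(N n). exp (- t * (LINT s|mu. (X n om s)^2))) - ?a) < r"
 proof (intro exI allI impI)
  fix n assume n: "n >= n0"
  show "norm ((LINT om|(N n). exp (- t * (LINT s|mu. (X n om s)^2))) - ?a) < r"
   using L2_approx_laplace[OF X[of n] t ta0[of k]] L2_approx_laplace[OF Z t ta0[of k]] n0[OF n] k
   unfolding real_norm_def by linarith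
 qed
qed

end

lemma ennreal_power2_le_cancel:
 assumes "x^2 <= ennreal (a^2)" "0 <= a" shows "x <= ennreal a"
proof (cases x)
 case (real r)
 hence "r <= a"
  using assms assms(2) by (simp add: ennreal_power ennreal_le_iff)
 thus ?thesis using real by auto
next
 case top
 thus ?thesis using assms by (simp add: power2_eq_square top_unique)
qed

lemma ennreal_integral_le_nn_integral:
 fixes f :: "'a => real"
 assumes "f : bmeas M" "!!x. 0 <= f x"
 shows "ennreal (LINT x|M. f x) <= nn_int M (%x. f x)"
 using assms by (subst integral_eq_nn_integral) (auto simp: ennreal_enn2real_if)

lemma (in prob_space) nn_integral_power2_le:
 assumes [measurable]: "f : bmeas M"
 shows "(nn_integral M (%x. f x))^2 <= nn_integral M (%x. (f x)^2)"
 using Cauchy_Schwarz_nn_integral[of f M "%_. 1"] by (simp add: emeasure_space_1)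

lemma std_normal_countable_null:
 assumes "countable S" shows "emeasure std_normal S = 0"
proof -
 have "S : null_sets lborel" by (rule countable_imp_null_set_lborel[OF assms])
 moreover have "absolutely_continuous lborel std_normal"
  by (rule absolutely_continuousI_density) simp
 ultimately have "S : null_sets std_normal" by (auto simp: absolutely_continuous_def)
 thus ?thesis by auto
qed

context finite_projections begin

text \<open>The second fact keeps the mean-square form, because \<open>GP_Q\<close> applies
  Cauchy-Schwarz against the likelihood ratio and needs second moments under the null law.\<close>

lemma L2_approxI:
 assumes N: "prob_space N" and Xm: "(%(om, s). X om s) : bmeas (N >< mu)"
  and fin: "nn_integral mu (%s. nn_int N (%om. (X om s)^2)) < top"
  and ta0: "!!k. 0 <= ta k" and ta: "!!k. nn_integral mu (%s. nn_int N (%om. (X om s - X om (pj k s))^2)) <= ennreal ((ta k)^2)"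
 shows "L2_approx N mu X pj ta"
  and "!!k. nn_integral N (%om. (ennreal (sqrt (LINT s|mu. (X om s - X om (pj k s))^2)))^2) <= ennreal ((ta k)^2)"
proof -
 interpret N: prob_space N by fact
 interpret pair_sigma_finite N mu by unfold_locales
 note [measurable] = Xm
 have Xpj[measurable]: "(%(om, s). X om (pj k s)) : bmeas (N >< mu)" for k
  by simp
 have "nn_integral N (%om. nn_int mu (%s. (X om s)^2)) < top"
  by (use Fubini' fin in simp)
 hence "AE om in N. (nn_int mu (%s. (X om s)^2)) ~= \<infinity>"
  by (intro nn_integral_PInf_AE) (auto simp: split_beta')
 with AE_space have ae: "AE om in N. integrable mu (%s. (X om s)^2)"
  by (auto simp: measurable_Pair2 Xm integrableI_bounded top.not_eq_extremum)
 show sq: "nn_integral N (%om. (ennreal (sqrt (LINT s|mu. (X om s - X om (pj k s))^2)))^2) <= ennreal ((ta k)^2)" for k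
 proof -
  have "nn_integral N (%om. (ennreal (sqrt (LINT s|mu. (X om s - X om (pj k s))^2)))^2) <= nn_integral N (%om. nn_int mu (%s. (X om s - X om (pj k s))^2))"
   by (simp add: nn_integral_mono measurable_Pair2 Xm ennreal_power ennreal_integral_le_nn_integral)
  also have "... = nn_integral mu (%s. nn_int N (%om. (X om s - X om (pj k s))^2))"
   by (rule Fubini'[symmetric]) measurable
  finally show ?thesis using ta[of k] by auto
 qed
 have "nn_int N (%om. sqrt (LINT s|mu. (X om s - X om (pj k s))^2)) <= ennreal (ta k)" for k
 proof (rule ennreal_power2_le_cancel[OF _ ta0])
  let ?a = "nn_int N (%om. sqrt (LINT s|mu. (X om s - X om (pj k s))^2))"
  have "?a^2 <= nn_integral N (%om. (ennreal (sqrt (LINT s|mu. (X om s - X om (pj k s))^2)))^2)"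
   by (rule N.nn_integral_power2_le) measurable
  thus "?a^2 <= ennreal ((ta k)^2)"
   using sq by (rule order_trans)
 qed
 thus "L2_approx N mu X pj ta" unfolding L2_approx_def using N Xm ae by blast
qed

end

text \<open>The integrand in the last assumption is the second moment of Z s - Z (pj k s): the
  squared mean increment plus the variance of the increment.\<close>

locale gaussian_L2 = finite_projections mu pj for mu :: "'s measure" and pj +
 fixes M :: "'b measure" and Z :: "'s => 'b => real" and m :: "'s => real" and K :: "'s => 's => real" and ta :: "nat => real"
 assumes G: "gaussian_process_real M (space mu) Z m K"
  and Zm: "(%(om, s). Z s om) : bmeas (M >< mu)"
  and fin: "nn_int mu (%s. K s s + (m s)^2) < top"
  and ta0: "!!k. 0 <= ta k" and ta_lim: "ta ----> 0"
  and ta: "!!k. nn_int mu (%s. (m s - m (pj k s))^2 + (K s s - 2 * K s (pj k s) + K (pj k s) (pj k s))) <= ennreal ((ta k)^2)"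
begin

lemmas facts = gaussian_process_real_facts[OF G]

sublocale M: prob_space M by (rule facts(1))

lemma nn_second_moment:
 assumes s: "s : space mu"
 shows "nn_int M (%om. (Z s om)^2) = ennreal (K s s + (m s)^2)"
proof -
 have eq: "(Z s om)^2 = (Z s om - m s) * (Z s om - m s) + (2 * m s) * Z s om - (m s)^2" for om
  by (simp add: power2_eq_square algebra_simps)
 have int: "integrable M (%om. (Z s om)^2)"
  unfolding eq using facts(3)[OF s] facts(5)[OF s s] by simp
 have "(LINT om|M. (Z s om)^2) = K s s + (m s)^2"
  unfolding eq using facts(3)[OF s] facts(5)[OF s s] facts(6)[OF s] facts(7)[OF s s] M.prob_space
  by (simp add: power2_eq_square)
 thus ?thesis using int by (subst nn_integral_eq_integral) auto
qed

lemma nn_increment: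
 assumes s: "s : space mu" and t: "t : space mu"
 shows "nn_int M (%om. (Z s om - Z t om)^2) = ennreal ((m s - m t)^2 + (K s s - 2 * K s t + K t t))"
proof -
 let ?a = "m s - m t"
 have eq: "(Z s om - Z t om)^2 = (Z s om - m s) * (Z s om - m s) - 2 * ((Z s om - m s) * (Z t om - m t)) + (Z t om - m t) * (Z t om - m t)
   + (2 * ?a) * Z s om - (2 * ?a) * Z t om - ?a^2" for om
  by (simp add: power2_eq_square algebra_simps)
 note i = facts(3)[OF s] facts(3)[OF t] facts(5)[OF s s] facts(5)[OF s t] facts(5)[OF t t]
 have int: "integrable M (%om. (Z s om - Z t om)^2)"
  unfolding eq using i by (intro Lint_diff Lint_add integrable_mult_right) auto
 have "(LINT om|M. (Z s om - Z t om)^2) = K s s - 2 * K s t + K t t + (2 * ?a) * m s - (2 * ?a) * m t - ?a^2"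
  unfolding eq using i facts(6)[OF s] facts(6)[OF t] facts(7)[OF s s] facts(7)[OF s t] facts(7)[OF t t] M.prob_space
  by simp
 also have "... = ?a^2 + (K s s - 2 * K s t + K t t)"
  by (simp add: power2_eq_square algebra_simps)
 finally show ?thesis using int by (subst nn_integral_eq_integral) auto
qed

lemma L2_approx_Z: "L2_approx M mu (%om s. Z s om) pj ta"
proof (rule L2_approxI(1)[OF facts(1) Zm _ ta0])
 show "nn_integral mu (%s. nn_int M (%om. (Z s om)^2)) < top"
  using fin by (simp add: nn_second_moment cong: nn_integral_cong)
 have "pj k s : space mu" if "s : space mu" for k s using pj_range that by blast
 thus "nn_integral mu (%s. nn_int M (%om. (Z s om - Z (pj k s) om)^2)) <= ennreal ((ta k)^2)" for k
  using ta[of k] by (simp add: nn_increment cong: nn_integral_cong)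
qed

lemma m_measurable [measurable]: "m : bmeas mu"
proof -
 have "(%s. (LINT om|M. Z s om)) : bmeas mu"
  using Zm by (intro M.borel_measurable_lebesgue_integral) (simp add: measurable_split_conv measurable_pair_swap_iff[of _ mu] split_beta')
 thus ?thesis by (subst measurable_cong[of mu m "%s. (LINT om|M. Z s om)"]) (simp_all add: facts(6))
qed

lemma Z_swap_measurable [measurable]: "(%(s, om). Z s om) : bmeas (mu >< M)"
 using measurable_pair_swap[OF Zm] by simp

lemma K_measurable: "t : space mu ==> (%s. K s t) : bmeas mu"
 and K_diag_measurable: "(%s. K s s) : bmeas mu"
proof -
 assume t: "t : space mu"
 note [measurable] = facts(2)[OF t]
 have "(%s. (LINT om|M. (Z s om - m s) * (Z t om - m t))) : bmeas mu" by measurable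
 thus "(%s. K s t) : bmeas mu"
  by (subst measurable_cong[of mu "%s. K s t" "%s. (LINT om|M. (Z s om - m s) * (Z t om - m t))"]) (simp_all add: facts(7) t)
next
 have "(%s. (LINT om|M. (Z s om - m s) * (Z s om - m s))) : bmeas mu" by measurable
 thus "(%s. K s s) : bmeas mu"
  by (subst measurable_cong[of mu "%s. K s s" "%s. (LINT om|M. (Z s om - m s) * (Z s om - m s))"]) (simp_all add: facts(7))
qed

lemma K_sym: "s : space mu ==> t : space mu ==> K s t = K t s"
 using facts(7)[of s t] facts(7)[of t s] by (simp add: mult.commute)

lemma K_diag_nonneg: "s : space mu ==> 0 <= K s s"
 using facts(7)[of s s] integral_nonneg_AE[of "%om. (Z s om - m s) * (Z s om - m s)" M] by simp

text \<open>Covariances with a fixed Z t inherit size and increments from the variances; this is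
  what makes the resampled process as regular as the original one.\<close>

lemma K_Cauchy_Schwarz:
 assumes "s : space mu" "s' : space mu" "t : space mu"
 shows "(K s t - K s' t)^2 <= (K s s - 2 * K s s' + K s' s') * K t t" and "(K s t)^2 <= K s s * K t t"
proof -
 note [measurable] = facts(2)[OF assms(1)] facts(2)[OF assms(2)] facts(2)[OF assms(3)]
 let ?f = "%om. (Z s om - m s) - (Z s' om - m s')" and ?g = "%om. Z t om - m t"
 note i = facts(5)[OF assms(1,1)] facts(5)[OF assms(1,2)] facts(5)[OF assms(2,2)] facts(5)[OF assms(1,3)] facts(5)[OF assms(2,3)] facts(5)[OF assms(3,3)]
 have sq: "(?f om)^2 = (Z s om - m s) * (Z s om - m s) - 2 * ((Z s om - m s) * (Z s' om - m s')) + (Z s' om - m s') * (Z s' om - m s')" for om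
  by (simp add: power2_eq_square algebra_simps)
 let ?a = "LINT om|M. ?f om * ?g om"
 let ?b = "LINT om|M. (?g om)^2"
 have "?a^2 <= (LINT om|M. (?f om)^2) * ?b"
  by (rule L2_Cauchy_Schwarz) (use i facts(4)[OF assms(3)] in \<open>auto simp only: sq intro!: Lint_diff Lint_add integrable_mult_right, measurable\<close>)
 moreover have "?a = K s t - K s' t"
 proof -
  have "?a = (LINT om|M. (Z s om - m s) * (Z t om - m t) - (Z s' om - m s') * (Z t om - m t))"
   by (simp only: left_diff_distrib)
  also have "... = K s t - K s' t"
   by (subst LINT_diff[OF i(4,5)]) (simp add: facts(7) assms)
  finally show ?thesis .
 qed
 moreover have "(LINT om|M. (?f om)^2) = K s s - 2 * K s s' + K s' s'"
  unfolding sq using i by (simp add: facts(7) assms)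
 moreover have gg: "?b = K t t"
  using facts(7)[OF assms(3,3)] by (simp add: power2_eq_square)
 ultimately show "(K s t - K s' t)^2 <= (K s s - 2 * K s s' + K s' s') * K t t" by simp
 let ?c = "LINT om|M. (Z s om - m s)^2"
 have "(LINT om|M. (Z s om - m s) * ?g om)^2 <= ?c * ?b"
  by (rule L2_Cauchy_Schwarz) (use facts(4)[OF assms(3)] facts(4)[OF assms(1)] in auto)
 moreover have "?c = K s s"
  using facts(7)[OF assms(1,1)] by (simp add: power2_eq_square)
 ultimately show "(K s t)^2 <= K s s * K t t" using facts(7)[OF assms(1,3)] gg by simp
qed

end

text \<open>Regression on the standardised Z t splits Z into a residual and a multiple of the
  direction g; the multiplier, independent of the residual, is replaced by a fresh standard normal.
  Independence is not invoked: in characteristic functions the residual combination has variance V -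
  q^2 and the fresh normal restores q^2.\<close>

lemma gaussian_resample_char:
 fixes Z :: "'s => 'b => real" and u :: "'j => 's"
 assumes G: "gaussian_process_real M I Z m K" and J: "finite J" "u ` J <= I" and t: "t : I" and Kt: "0 < K t t"
 shows "(LINT p|(M >< std_normal). iexp (SUM j:J. a j * (Z (u j) (fst p) - (Z t (fst p) - m t) / sqrt (K t t) * (K (u j) t / sqrt (K t t)) + snd p * (K (u j) t / sqrt (K t t)))))
  = (LINT om|M. iexp (SUM j:J. a j * Z (u j) om))"
proof -
 note facts = gaussian_process_real_facts[OF G]
 let ?N = std_normal
 let ?M = "M >< ?N"
 interpret M: prob_space M by (rule facts(1))
 interpret N: prob_space ?N by (rule prob_space_std_normal)
 interpret MN: pair_prob_space M ?N by unfold_locales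
 define sg where "sg = sqrt (K t t)"
 have sg: "0 < sg" "sg * sg = K t t" "sg^2 = K t t" using Kt by (auto simp: sg_def)
 define xi where "xi = (%om. (Z t om - m t) / sg)"
 define g where "g = (%j. K (u j) t / sg)"
 have K_sym: "K (u j) t = K t (u j)" if "j : J" for j
  using facts(7)[of "u j" t] facts(7)[of t "u j"] t J that by (auto simp: mult.commute)
  define q where "q = (SUM j:J. a j * g j)"
  \<comment> \<open>The residual combination is again a finite combination of Z: the index None
    carries the extra coefficient -q/sg of Z t.\<close>
  define S where "S = insert None (Some ` J)"
  define u' where "u' = (%k. case k of None => t | Some j => u j)"
  define b where "b = (%k. case k of None => - q / sg | Some j => a j)"
  have S: "finite S" "u' ` S <= I" using J t by (auto simp: S_def u'_def)
  have sumS: "(SUM k:S. f k) = f None + (SUM j:J. f (Some j))" for f :: "'j option => real"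
   unfolding S_def using J by (subst sum.insert) (auto simp: sum.reindex inj_on_def)
  define V where "V = (SUM i:J. SUM j:J. a i * a j * K (u i) (u j))"
  define A where "A = (%om. SUM k:S. b k * Z (u' k) om)"
  have mA: "(SUM k:S. b k * m (u' k)) + q * m t / sg = (SUM j:J. a j * m (u j))"
   unfolding sumS by (simp add: b_def u'_def)
  have vA: "(SUM k:S. SUM l:S. b k * b l * K (u' k) (u' l)) = V - q^2"
  proof -
   have q1: "(SUM j:J. a j * K (u j) t) = sg * q"
    using sg(1) by (simp add: q_def g_def sum_distrib_left)
   have q2: "(SUM j:J. a j * K t (u j)) = sg * q"
    unfolding q1[symmetric] by (intro sum.cong refl) (simp add: K_sym)
   have "(SUM k:S. SUM l:S. b k * b l * K (u' k) (u' l)) =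
     (q / sg)^2 * K t t + (SUM j:J. (- q / sg) * (a j * K t (u j))) + ((SUM j:J. (- q / sg) * (a j * K (u j) t)) + V)"
    unfolding sumS by (simp add: b_def u'_def V_def sum_subtractf sum_negf power2_eq_square mult_ac)
   also have "... = q^2 + (- q / sg) * (sg * q) + ((- q / sg) * (sg * q) + V)"
    unfolding sum_distrib_left[symmetric] q1 q2 using sg Kt by (simp add: power_divide)
   also have "... = V - q^2" using sg(1) by (simp add: power2_eq_square)
   finally show ?thesis .
  qed
  have Am[measurable]: "A : bmeas M"
   unfolding A_def using S by (intro borel_measurable_sum borel_measurable_times facts(2)) auto
  have YA: "(SUM j:J. a j * (Z (u j) om - xi om * g j + x * g j)) = (A om + q * m t / sg) + x * q" for om x
  proof -
   have "(SUM j:J. a j * (Z (u j) om - xi om * g j + x * g j)) = (SUM j:J. a j * Z (u j) om) - xi om * q + x * q"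
    unfolding q_def by (simp add: sum.distrib sum_subtractf sum_distrib_left algebra_simps)
   moreover have "A om = (SUM j:J. a j * Z (u j) om) - q / sg * Z t om"
    unfolding A_def sumS by (simp add: b_def u'_def)
   ultimately show ?thesis by (simp add: xi_def diff_divide_distrib algebra_simps)
  qed
  define B where "B = (%om. A om + q * m t / sg)"
  have Bm[measurable]: "B : bmeas M" unfolding B_def by measurable
  have YB: "(SUM j:J. a j * (Z (u j) om - xi om * g j + x * g j)) = B om + x * q" for om x unfolding B_def by (rule YA)
  have int: "integrable ?M (%p. iexp (B (fst p)) * iexp (q * snd p))"
   by (rule MN.integrable_bounded[of _ 1]) (auto simp: norm_mult)
  have "(LINT p|?M. iexp (SUM j:J. a j * (Z (u j) (fst p) - xi (fst p) * g j + snd p * g j))) = (LINT p|?M. iexp (B (fst p)) * iexp (q * snd p))"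
  proof (intro LINT_cong refl)
   fix p :: "'b \<times> real"
   obtain om x where p: "p = (om, x)" by (cases p)
   show "iexp (SUM j:J. a j * (Z (u j) (fst p) - xi (fst p) * g j + snd p * g j)) = iexp (B (fst p)) * iexp (q * snd p)"
    unfolding p fst_conv snd_conv YB by (simp add: distrib_left exp_add mult.commute)
  qed
  also have "... = (LINT om|M. (LINT x|?N. iexp (B om) * iexp (q * x)))"
   using MN.integral_fst[of "%om x. iexp (B om) * iexp (q * x)"] int by (simp add: split_beta')
  also have "... = (LINT om|M. iexp (B om)) * of_real (exp (- (q^2) / 2))"
   unfolding integral_mult_right_zero std_normal_iexp integral_mult_left_zero ..
  also have "(LINT om|M. iexp (B om)) = (LINT om|M. iexp (A om) * iexp (q * m t / sg))"
   unfolding B_def by (intro LINT_cong refl) (simp only: of_real_add distrib_left exp_add)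
  also have "... = exp (\<i> * of_real (SUM k:S. b k * m (u' k)) - of_real ((V - q^2) / 2)) * iexp (q * m t / sg)"
   unfolding A_def integral_mult_left_zero gaussian_process_real_char[OF G S] vA ..
  also have "... * of_real (exp (- (q^2) / 2)) = exp (\<i> * of_real (SUM j:J. a j * m (u j)) - of_real (V / 2))"
  proof -
   have "exp (- ((V - q^2) / 2)) * exp (- (q^2) / 2) = exp (- (V / 2))"
    unfolding exp_add[symmetric] by (simp add: field_simps)
   hence e1: "complex_of_real (exp (- ((V - q^2) / 2))) * of_real (exp (- (q^2) / 2)) = of_real (exp (- (V / 2)))"
    unfolding of_real_mult[symmetric] by auto
   have e2: "iexp (x + y) = iexp x * iexp y" for x y by (simp only: of_real_add distrib_left exp_add)
   show ?thesis unfolding mA[symmetric] exp_diff_of_real e2 e1[symmetric] by auto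
  qed
  also have "... = (LINT om|M. iexp (SUM j:J. a j * Z (u j) om))"
   unfolding V_def using gaussian_process_real_char[OF G J] by simp
  finally show ?thesis unfolding xi_def g_def sg_def .
qed

context gaussian_L2 begin

text \<open>Otherwise K s t = 0 for almost every s, whatever t. The projections take countably many
  values, so the covariances K s (pj k s) vanish for all k simultaneously outside one null set. The
  increment bound then dominates the integral of K s s by (ta k)^2, which tends to 0.\<close>

lemma direction_exists:
 assumes nondeg: "~ (AE s in mu. K s s = 0)"
 shows "EX t:space mu. 0 < K t t & ~ (AE s in mu. K s t = 0)"
proof (rule ccontr)
 assume no: "~ ?thesis"
 have zero: "AE s in mu. K s t = 0" if t: "t : space mu" for t
 proof (cases "0 < K t t")
  case True thus ?thesis using no t by blast
 next
  case False
  hence "K t t = 0" using K_diag_nonneg[OF t] by simp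
  thus ?thesis using K_Cauchy_Schwarz(2)[of _ t t] t by (intro AE_I2) simp
 qed
 define T where "T = (UN k. pj k ` space mu)"
 have T: "countable T" "T <= space mu" unfolding T_def using pj_finite pj_range by (auto intro: countable_finite)
 have "AE s in mu. ALL t:T. K s t = 0"
  using zero T by (intro AE_ball_countable') auto
 hence ae: "AE s in mu. ALL k. K s (pj k s) = 0"
  using AE_space by eventually_elim (auto simp: T_def)
 let ?a = "%s. K s s"
 have le: "nn_int mu ?a <= ennreal ((ta k)^2)" for k
 proof -
  have "nn_int mu ?a <= nn_int mu (%s. (m s - m (pj k s))^2 + (K s s - 2 * K s (pj k s) + K (pj k s) (pj k s)))"
  proof (rule nn_integral_mono_AE)
   show "AE s in mu. ennreal (K s s) <= ennreal ((m s - m (pj k s))^2 + (K s s - 2 * K s (pj k s) + K (pj k s) (pj k s)))"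
    using ae AE_space
   proof eventually_elim
    case (elim s)
    have "0 <= K (pj k s) (pj k s)" using pj_range elim by (intro K_diag_nonneg) blast
    thus ?case using elim by (intro ennreal_leI) (auto simp: add_increasing)
   qed
  qed
  thus ?thesis using ta[of k] by auto
 qed
 have "(%k. ennreal ((ta k)^2)) ----> ennreal (0^2)"
  by (intro tendsto_ennrealI tendsto_power ta_lim)
 hence "nn_int mu ?a <= 0"
  using LIMSEQ_le_const[of _ "ennreal (0^2)" "nn_int mu ?a"] le by auto
 hence "nn_int mu ?a = 0" by simp
 hence "AE s in mu. ennreal (K s s) = 0"
  using K_diag_measurable by (subst (asm) nn_integral_0_iff_AE) auto
 hence "AE s in mu. K s s = 0"
  using AE_space by eventually_elim (use K_diag_nonneg in force)
 thus False using nondeg by simp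
qed

text \<open>For a fixed residual path the functional of the resampled process is a quadratic
  polynomial in the fresh normal variable, with nonzero leading coefficient, the integral of g^2. It
  takes the value c at finitely many points only, a null set. Equality of Laplace transforms carries
  this back to Z.\<close>

theorem no_atom:
 assumes nondeg: "~ (AE s in mu. K s s = 0)"
 shows "measure M {om:space M. (LINT s|mu. (Z s om)^2) = c} = 0"
proof -
 obtain t where t: "t : space mu" and Kt: "0 < K t t" and Kt': "~ (AE s in mu. K s t = 0)"
  using direction_exists[OF nondeg] by blast
 define sg where "sg = sqrt (K t t)"
 have sg: "0 < sg" "sg * sg = K t t" "sg^2 = K t t" using Kt by (auto simp: sg_def)
 define xi where "xi = (%om. (Z t om - m t) / sg)"
 define g where "g = (%s. K s t / sg)"
 let ?N = std_normal
 let ?M = "M >< ?N"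
 interpret N: prob_space ?N by (rule prob_space_std_normal)
 interpret MN: pair_prob_space M ?N by unfold_locales
 note [measurable] = facts(2)[OF t] K_measurable[OF t] Zm K_diag_measurable m_measurable
 have xim[measurable]: "xi : bmeas M" unfolding xi_def by measurable
 have gm[measurable]: "g : bmeas mu" unfolding g_def by measurable
 define Y where "Y = (%(om, x) s. Z s om - xi om * g s + x * g s)"
 have YY: "Y (om, x) s = Z s om - xi om * g s + x * g s" for om x s by (simp add: Y_def)
 have Ym: "(%(p, s). Y p s) : bmeas (?M >< mu)"
  by (simp add: measurable_compose Zm Y_def split_beta')
 have x2: "nn_int ?N (%x. x^2) = 1"
 proof -
  have "integrable ?N (%x. x^2)" using integrable_std_normal_distribution_moment[of 2] .
  moreover have "(LINT x|?N. x^2) = 1" using std_normal_distribution_even_moments(1)[of 1] by simp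
  ultimately show ?thesis by (subst nn_integral_eq_integral) auto
 qed
 have xi2: "nn_int M (%om. (xi om)^2) = 1"
 proof -
  have "(LINT om|M. (xi om)^2) = (LINT om|M. (Z t om - m t) * (Z t om - m t)) / K t t"
   by (simp add: xi_def power_divide sg(3)) (simp add: power2_eq_square)
  moreover have "integrable M (%om. (xi om)^2)"
   using facts(4)[OF t] by (simp add: xi_def power_divide)
  ultimately show ?thesis using Kt facts(7)[OF t t] by (subst nn_integral_eq_integral) auto
 qed
 let ?b = "nn_int ?M"
 \<comment> \<open>The factor 3 comes from the square of three terms; \<open>xi\<close> and the
   fresh normal both have second moment 1 and together give 6.\<close>
 have bound: "?b (%p. (A (fst p) - xi (fst p) * d + snd p * d)^2) <= 3 * nn_int M (%om. (A om)^2) + 6 * ennreal (d^2)"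
  if [measurable]: "A : bmeas M" for A d
 proof -
  have le: "(a - b + e)^2 <= 3 * a^2 + 3 * b^2 + 3 * e^2" for a b e :: real
  proof -
   have "0 <= (a + b)^2 + (a - e)^2 + (b + e)^2" by simp
   thus ?thesis by (simp add: power2_eq_square algebra_simps)
  qed
  have "?b (%p. (A (fst p) - xi (fst p) * d + snd p * d)^2)
   = nn_integral M (%om. nn_int ?N (%x. (A om - xi om * d + x * d)^2))"
   using N.nn_integral_fst[of "%p. ennreal ((A (fst p) - xi (fst p) * d + snd p * d)^2)" M] by simp
  also have "... <= nn_integral M (%om. nn_integral ?N (%x. 3 * ennreal ((A om)^2) + 3 * (ennreal (d^2) * ennreal ((xi om)^2)) + 3 * (ennreal (d^2) * ennreal (x^2))))"
  proof (intro nn_integral_mono)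
   fix om x
   let ?d = "ennreal ((A om - xi om * d + x * d)^2)"
   have "?d <= ennreal (3 * (A om)^2 + 3 * (d^2 * (xi om)^2) + 3 * (d^2 * x^2))"
    using le[of "A om" "xi om * d" "x * d"] by (intro ennreal_leI) (simp add: power_mult_distrib mult.commute)
   thus "?d <= 3 * ennreal ((A om)^2) + 3 * (ennreal (d^2) * ennreal ((xi om)^2)) + 3 * (ennreal (d^2) * ennreal (x^2))"
    by (simp add: ennreal_mult)
  qed
  also have "... = 3 * nn_int M (%om. (A om)^2) + 3 * ennreal (d^2) + 3 * ennreal (d^2)"
   using N.emeasure_space_1 M.emeasure_space_1 by (simp add: nn_integral_add nn_integral_cmult x2 xi2)
  also have "... = 3 * nn_int M (%om. (A om)^2) + 6 * ennreal (d^2)"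
   by (simp flip: distrib_right)
  finally show ?thesis .
 qed
 \<comment> \<open>Since g and its increments are dominated by the variances, the constants 3 + 6 =
   9 add up to the square of 3 * ta k.\<close>
 have approxY: "L2_approx ?M mu Y pj (%k. 3 * ta k)"
 proof (rule L2_approxI(1)[OF MN.prob_space_axioms Ym])
  show "0 <= 3 * ta k" for k using ta0[of k] by simp
  let ?e = "nn_integral mu"
  have "?b (%p. (Y p s)^2) <= 9 * ennreal (K s s + (m s)^2)" if s: "s : space mu" for s
  proof -
   let ?f = "ennreal (K s s + (m s)^2)"
   have "(g s)^2 <= K s s"
    using K_Cauchy_Schwarz(2)[OF s t t] Kt by (simp add: g_def power_divide sg(3) divide_le_eq)
   hence g2: "ennreal ((g s)^2) <= ?f" by (intro ennreal_leI) (simp add: add_increasing2)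
   have "?b (%p. (Y p s)^2) <= 3 * ?f + 6 * ennreal ((g s)^2)"
    using bound[of "Z s" "g s", OF facts(2)[OF s]] by (simp add: Y_def split_beta' nn_second_moment[OF s])
   also have "... <= 3 * ?f + 6 * ?f"
    using g2 by (intro add_left_mono mult_left_mono) auto
   also have "... = 9 * ?f" by (simp flip: distrib_right)
   finally show ?thesis .
  qed
  hence "?e (%s. ?b (%p. (Y p s)^2)) <= ?e (%s. 9 * ennreal (K s s + (m s)^2))"
   by (rule nn_integral_mono)
  also have "... = 9 * nn_int mu (%s. K s s + (m s)^2)"
   by (rule nn_integral_cmult) measurable
  also have "... < top" using fin by (simp add: ennreal_mult_less_top)
  finally show "?e (%s. ?b (%p. (Y p s)^2)) < top" .
  fix k
  let ?De = "%s. (m s - m (pj k s))^2 + (K s s - 2 * K s (pj k s) + K (pj k s) (pj k s))"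
  have "?b (%p. (Y p s - Y p (pj k s))^2) <= 9 * ennreal (?De s)" if s: "s : space mu" for s
  proof -
   have s': "pj k s : space mu" using pj_range s by blast
   note [measurable] = facts(2)[OF s] facts(2)[OF s']
   let ?g = "pj k s"
   let ?h = "ennreal (?De s)"
   let ?i = "g s - g ?g"
   have "?i^2 <= K s s - 2 * K s ?g + K ?g ?g"
    using K_Cauchy_Schwarz(1)[OF s s' t] Kt by (simp add: g_def power_divide sg(3) divide_le_eq flip: diff_divide_distrib)
   hence g2: "ennreal (?i^2) <= ?h" by (intro ennreal_leI) (simp add: add_increasing)
   have "Y p s - Y p ?g = (Z s (fst p) - Z ?g (fst p)) - xi (fst p) * ?i + snd p * ?i" for p
    by (simp add: Y_def split_beta' algebra_simps)
   hence "?b (%p. (Y p s - Y p ?g)^2) <= 3 * ?h + 6 * ennreal (?i^2)"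
    using bound[of "%om. Z s om - Z ?g om" "g s - g ?g"] by (simp add: nn_increment[OF s s'])
   also have "... <= 3 * ?h + 6 * ?h"
    using g2 by (intro add_left_mono mult_left_mono) auto
   also have "... = 9 * ?h" by (simp flip: distrib_right)
   finally show ?thesis .
  qed
  hence "?e (%s. ?b (%p. (Y p s - Y p (pj k s))^2)) <= ?e (%s. 9 * ennreal (?De s))"
   by (rule nn_integral_mono)
  also have "... = 9 * nn_int mu (%s. ?De s)"
  proof (rule nn_integral_cmult)
   have "(%s. nn_int M (%om. (Z s om - Z (pj k s) om)^2)) : bmeas mu"
    by simp
   moreover have "nn_int M (%om. (Z s om - Z (pj k s) om)^2) = ennreal (?De s)" if "s : space mu" for s
    using that pj_range by (intro nn_increment) auto
   ultimately show "(%s. ennreal (?De s)) : bmeas mu"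
    by (subst measurable_cong[of mu _ "%s. nn_int M (%om. (Z s om - Z (pj k s) om)^2)"]) auto
  qed
  also have "... <= 9 * ennreal ((ta k)^2)" using ta[of k] by (intro mult_left_mono) auto
  also have "... = ennreal ((3 * ta k)^2)" by (simp add: ennreal_mult)
  finally show "?e (%s. ?b (%p. (Y p s - Y p (pj k s))^2)) <= ennreal ((3 * ta k)^2)" .
 qed
 have char: "(LINT p|?M. iexp (SUM j:J. a j * Y p j)) = (LINT om|M. iexp (SUM j:J. a j * Z j om))"
  if J: "finite J" "J <= space mu" for J a
 proof -
  have "(%j. j) ` J <= space mu" using J by simp
  from gaussian_resample_char[OF G J(1) this t Kt, of a]
  show ?thesis by (simp only: Y_def split_beta' xi_def g_def sg_def)
 qed
 have lap: "(LINT p|?M. exp (- r * (LINT s|mu. (Y p s)^2))) = (LINT om|M. exp (- r * (LINT s|mu. (Z s om)^2)))" if r: "0 <= r" for r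
 proof -
  have approxZ: "L2_approx M mu (%om s. Z s om) pj (%k. 3 * ta k)"
  proof -
   have "ennreal (ta k) <= ennreal (3 * ta k)" for k using ta0[of k] by (intro ennreal_leI) simp
   thus ?thesis using L2_approx_Z unfolding L2_approx_def by (meson order_trans)
  qed
  have "(%n::nat. (LINT p|?M. exp (- r * (LINT s|mu. (Y p s)^2)))) ----> (LINT om|M. exp (- r * (LINT s|mu. (Z s om)^2)))"
  proof (rule L2_laplace_tendsto[OF approxY approxZ _ _ r])
   show "0 <= 3 * ta k" for k using ta0[of k] by simp
   show "(%k. 3 * ta k) ----> 0" using tendsto_mult[OF tendsto_const ta_lim, of 3] by simp
  qed (simp add: char del: of_real_sum of_real_mult)
  from LIMSEQ_unique[OF tendsto_const this] show ?thesis .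
 qed
 note [measurable] = Ym
 let ?a = "{p:space ?M. (LINT s|mu. (Y p s)^2) = c}"
 let ?c = "LINT s|mu. (g s)^2"
 have "measure ?M ?a = measure M {om:space M. (LINT s|mu. (Z s om)^2) = c}"
  by (rule laplace_eq_atom[OF MN.prob_space_axioms facts(1)]) (use lap in auto)
 moreover have "measure ?M ?a = 0"
 proof -
  have Em: "?a : sets ?M" by measurable
  have g2: "integrable mu (%s. (g s)^2)"
  proof (rule integrableI_bounded)
   have "nn_int mu (%s. norm ((g s)^2)) <= nn_int mu (%s. K s s + (m s)^2)"
   proof (rule nn_integral_mono)
    fix s assume s: "s : space mu"
    have "(g s)^2 <= K s s"
     using K_Cauchy_Schwarz(2)[OF s t t] Kt by (simp add: g_def power_divide sg(3) divide_le_eq)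
    thus "ennreal (norm ((g s)^2)) <= ennreal (K s s + (m s)^2)" by (intro ennreal_leI) (simp add: add_increasing2)
   qed
   thus "nn_int mu (%s. norm ((g s)^2)) < \<infinity>" using fin by auto
  qed measurable
  have C: "?c ~= 0"
  proof
   assume "?c = 0"
   hence "AE s in mu. (g s)^2 = 0" using integral_nonneg_eq_0_iff_AE[OF g2] by simp
   hence "AE s in mu. K s t = 0" by eventually_elim (use sg(1) in \<open>auto simp: g_def\<close>)
   thus False using Kt' by simp
  qed
  have "AE om in M. integrable mu (%s. (Z s om)^2)" using L2_approx_Z by (simp add: L2_approx_def)
  hence ae: "AE om in M. emeasure ?N (Pair om -` ?a) = 0"
   using AE_space
  proof eventually_elim
   case (elim om)
   have [measurable]: "(%s. Z s om) : bmeas mu" using measurable_Pair2[OF Zm elim(2)] by simp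
   define p where "p = (%s. Z s om - xi om * g s)"
   have [measurable]: "p : bmeas mu" unfolding p_def by measurable
   have psq: "(p s)^2 = (Z s om)^2 - (2 * xi om) * (Z s om * g s) + (xi om)^2 * (g s)^2" for s
    by (simp add: p_def power2_eq_square algebra_simps)
   have ip: "integrable mu (%s. (p s)^2)"
    unfolding psq using elim(1) g2 L2_mult_integrable[OF _ gm elim(1) g2] by (intro Lint_add Lint_diff integrable_mult_right) auto
   have ipg: "integrable mu (%s. p s * g s)" by (rule L2_mult_integrable[OF _ gm ip g2]) measurable
   define a0 b0 c0 where "a0 = (LINT s|mu. (p s)^2)" and "b0 = (LINT s|mu. p s * g s)" and "c0 = ?c"
   have quad: "(LINT s|mu. (Y (om, x) s)^2) = a0 + 2 * x * b0 + x^2 * c0" for x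
   proof -
    have "(Y (om, x) s)^2 = (p s)^2 + (2 * x) * (p s * g s) + x^2 * (g s)^2" for s
     by (simp add: YY p_def power2_eq_square algebra_simps)
    thus ?thesis unfolding a0_def b0_def c0_def using ip ipg g2 by simp
   qed
   \<comment> \<open>The exceptional values are roots of a polynomial that is nonzero because its
     top coefficient c0 is.\<close>
   let ?j = "{x. a0 + 2 * x * b0 + x^2 * c0 = c}"
   let ?k = "{x. poly [:a0 - c, 2 * b0, c0:] x = 0}"
   have "?j = ?k"
    by (auto simp: power2_eq_square algebra_simps)
   moreover have "finite ?k"
    using C by (intro poly_roots_finite) (simp add: c0_def)
   ultimately have "finite ?j" by simp
   moreover have "Pair om -` ?a = ?j"
    using elim(2) by (auto simp: space_pair_measure quad)
   ultimately show ?case by (simp add: std_normal_countable_null countable_finite)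
  qed
  have "emeasure ?M ?a = nn_integral M (%om. 0)"
   unfolding N.emeasure_pair_measure_alt[OF Em] by (rule nn_integral_cong_AE[OF ae])
  thus ?thesis by (simp add: measure_def)
 qed
 ultimately show ?thesis by simp
qed

end

section \<open>Integral tests built from standardised sums\<close>

lemma Gsum_sum: "Gsum n (%x. SUM j:J. a j * f j x) X = (SUM j:J. a j * Gsum n (f j) X)"
proof -
 have "(SUM i<n. SUM j:J. a j * f j (X i)) = (SUM j:J. a j * (SUM i<n. f j (X i)))"
  by (subst sum.swap) (simp add: sum_distrib_left)
 thus ?thesis
  unfolding Gsum_def by (simp only: sum_divide_distrib[of "%j. a j * (SUM i<n. f j (X i))" J] times_divide_eq_right)
qed

lemma Gsum_diff: "Gsum n (%x. f x - g x) X = Gsum n f X - Gsum n g X"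
 by (simp add: Gsum_def sum_subtractf diff_divide_distrib)

lemma (in prob_space) Gsum_second_moment_le:
 assumes [measurable]: "f : bmeas M" and B: "!!x. abs (f x) <= B" and zero: "expectation f = 0"
 shows "nn_int (PiM {..<n} (%_. M)) (%X. (Gsum n f X)^2) <= ennreal (LINT x|M. (f x)^2)"
proof (cases "n = 0")
 case False
 let ?a = "PiM {..<n} (%_. M)"
 have "integrable ?a (%X. (Gsum n f X)^2)"
 proof (rule iid_integrable_bounded)
  fix X
  have "abs (Gsum n f X)^2 <= (sqrt n * B)^2" by (rule power_mono[OF Gsum_bound[OF B]]) simp
  thus "norm ((Gsum n f X)^2) <= (sqrt n * B)^2" by simp
 qed measurable
 hence "nn_int ?a (%X. (Gsum n f X)^2) = ennreal (LINT X|?a. (Gsum n f X)^2)"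
  by (rule nn_integral_eq_integral) simp
 thus ?thesis using Gsum_second_moment[OF assms(1) B zero] False by simp
qed (simp add: Gsum_def)

lemma dens_AE_lborel: "(AE x in lborel. R x) ==> f : bmeas borel ==> AE x in dens f. R x"
 unfolding dens_def by (subst AE_density) auto

text \<open>Common frame of the two integral statistics: \<open>bt x s\<close> is the centred
  contribution of one observation x at index s. Continuity in s is asked only along the projections
  and for almost every x, since indicators of orthants and unit vectors have
  discontinuities.\<close>

locale L2_test = local_alternatives f0 h ga + finite_projections mu pj
 for f0 h :: "real^'n => real" and ga and mu :: "'s measure" and pj +
 fixes bt :: "real^'n => 's => real" and B :: real
 assumes btm: "(%(x, s). bt x s) : bmeas (borel >< mu)"
  and btB: "!!x s. abs (bt x s) <= B"
  and bt0: "!!s. s : space mu ==> (LINT x|F. bt x s) = 0"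
  and btpj: "!!s. s : space mu ==> AE x in lborel. (%k. bt x (pj k s)) ----> bt x s"
begin

definition mean :: "'s => real" where "mean s = ga * (LINT x|H. bt x s)"
definition cov :: "'s => 's => real" where "cov s t = (LINT x|F. bt x s * bt x t)"
text \<open>Second moment of the increment of the limit process. As \<open>bt\<close> is centred
  under F, the last summand alone also bounds the increment of the standardised sum under the null
  law.\<close>

definition incr :: "nat => 's => real" where
 "incr k s = (mean s - mean (pj k s))^2 + (LINT x|F. (bt x s - bt x (pj k s))^2)"
definition ta :: "nat => real" where "ta k = sqrt (LINT s|mu. incr k s)"

lemma B_nonneg: "0 <= B" using btB[of undefined undefined] by auto

lemma bt_meas [measurable]: "s : space mu ==> (%x. bt x s) : bmeas borel"
 using measurable_Pair1[OF btm] by simp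

lemma btpj_meas: "(%(x, s). bt x (pj k s)) : bmeas (borel >< mu)"
 by (use measurable_compose btm split_beta' in simp)

lemma pj_space: "s : space mu ==> pj k s : space mu" using pj_range by blast

lemma bt_mult_bound: "abs (bt x s * bt x t) <= B * B"
 unfolding abs_mult by (rule mult_mono[OF btB btB B_nonneg]) simp

lemma bt_diff_bound: "abs (bt x s - bt x t) <= 2 * B" "(bt x s - bt x t)^2 <= (2 * B)^2"
proof -
 show 1: "abs (bt x s - bt x t) <= 2 * B" using btB[of x s] btB[of x t] by auto
 show "(bt x s - bt x t)^2 <= (2 * B)^2" using power_mono[OF 1, of 2] by simp
qed

lemma bt_integrable: "s : space mu ==> integrable F (%x. bt x s)" "s : space mu ==> integrable H (%x. bt x s)"
 by (rule F.integrable_bounded H.integrable_bounded[of _ B], use btB in auto)+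

lemma btbt_integrable: "s : space mu ==> t : space mu ==> integrable F (%x. bt x s * bt x t)"
 by (rule F.integrable_bounded[of _ "B * B"]) (use bt_mult_bound in auto)

lemma incr_eq:
 assumes s: "s : space mu"
 shows "incr k s = (mean s - mean (pj k s))^2 + (cov s s - 2 * cov s (pj k s) + cov (pj k s) (pj k s))"
 by (simp add: pj_space s power2_eq_square algebra_simps incr_def cov_def btbt_integrable)

lemma incr_measurable [measurable]: "incr k : bmeas mu"
proof -
 let ?a = "%(s, x). bt x (pj k s)"
 let ?b = "bmeas (mu >< borel)"
 let ?e = "%(s, x). bt x s"
 have sw: "?e : ?b" "?a : ?b"
  using measurable_pair_swap[OF btm] by auto
 let ?c = "bmeas (mu >< F)"
 let ?d = "bmeas (mu >< H)"
 have sF[measurable]: "?e : ?c" "?a : ?c"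
  and sH[measurable]: "?e : ?d" "?a : ?d"
  using sw by (auto simp: measurable_cong_sets[OF sets_pair_measure_cong[OF refl sets_dens]])
 show ?thesis unfolding incr_def mean_def by measurable
qed

lemma incr_bounds: "0 <= incr k s" "s : space mu ==> incr k s <= (2 * ga * B)^2 + (2 * B)^2"
proof -
 show "0 <= incr k s" unfolding incr_def by simp
 assume s: "s : space mu"
 note s' = pj_space[OF s, of k]
 have "(LINT x|F. (bt x s - bt x (pj k s))^2) <= (2 * B)^2"
  using F.norm_expectation_le[of "%x. (bt x s - bt x (pj k s))^2" "(2 * B)^2"] bt_diff_bound(2) s s' by auto
 moreover have "(mean s - mean (pj k s))^2 <= (2 * ga * B)^2"
 proof -
  have b: "abs (mean u) <= ga * B" if "u : space mu" for u
   unfolding mean_def abs_mult using gamma_pos H.norm_expectation_le[of "%x. bt x u" B] btB that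
   by (intro mult_mono) auto
  have "abs (mean s - mean (pj k s)) <= 2 * ga * B" using b[OF s] b[OF s'] by auto
  from power_mono[OF this, of 2] show ?thesis by simp
 qed
 ultimately show "incr k s <= (2 * ga * B)^2 + (2 * B)^2" unfolding incr_def by auto
qed

lemma incr_tendsto:
 assumes s: "s : space mu" shows "(%k. incr k s) ----> 0"
proof -
 have "(%k. (LINT x|F. (bt x s - bt x (pj k s))^2)) ----> (LINT x|F. 0)"
 proof (rule integral_dominated_convergence[where w="%_. (2 * B)^2"])
  have "AE x in F. (%k. bt x (pj k s)) ----> bt x s" using btpj[OF s] by (rule dens_AE_lborel) measurable
  thus "AE x in F. (%k. (bt x s - bt x (pj k s))^2) ----> 0"
  proof eventually_elim
   case (elim x)
   from tendsto_power[OF tendsto_diff[OF tendsto_const elim], of "bt x s" 2] show ?case by simp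
  qed
 qed (use s pj_space[OF s] bt_diff_bound(2) in auto)
 moreover have "(%k. mean (pj k s)) ----> mean s"
  unfolding mean_def
 proof (rule tendsto_mult[OF tendsto_const integral_dominated_convergence[where w="%_. B"]])
  show "AE x in H. (%k. bt x (pj k s)) ----> bt x s" using btpj[OF s] by (rule dens_AE_lborel) measurable
 qed (use s pj_space[OF s] btB in auto)
 from tendsto_power[OF tendsto_diff[OF tendsto_const this], of "mean s" 2]
 have "(%k. (mean s - mean (pj k s))^2) ----> 0" by simp
 ultimately show ?thesis unfolding incr_def using tendsto_add by fastforce
qed

lemma ta_nonneg: "0 <= ta k" unfolding ta_def using incr_bounds(1) by simp

lemma incr_integrable: "integrable mu (incr k)"
 by (rule integrable_const_bound[where B="(2 * ga * B)^2 + (2 * B)^2"]) (use incr_bounds in auto)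

lemma ta_tendsto: "ta ----> 0"
proof -
 have "(%k. (LINT s|mu. incr k s)) ----> (LINT s|mu. 0)"
  by (rule integral_dominated_convergence[where w="%_. (2 * ga * B)^2 + (2 * B)^2"])
   (use incr_bounds incr_tendsto in \<open>auto intro!: AE_I2\<close>)
 from tendsto_real_sqrt[OF this] show ?thesis unfolding ta_def[abs_def] by simp
qed

lemma nn_incr: "nn_int mu (%s. incr k s) = ennreal ((ta k)^2)"
 unfolding ta_def using incr_integrable incr_bounds(1) by (simp add: nn_integral_eq_integral)

definition GP :: "nat => (nat => real^'n) => 's => real" where
 "GP n X s = Gsum n (%x. bt x s) X"

lemma GP_measurable: "(%(X, s). GP n X s) : bmeas (P n >< mu)"
proof -
 have "(%z. bt (fst z i) (snd z)) : bmeas (P n >< mu)" if "i < n" for i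
 proof -
  have "(%z. (fst z i, snd z)) : P n >< mu \<rightarrow>\<^sub>M borel >< mu"
   unfolding sample_law_def using that
   by (intro measurable_Pair measurable_snd measurable_compose[OF measurable_fst]) (auto simp: measurable_cong_sets[OF refl sets_dens[symmetric, of f0]] intro!: measurable_component_singleton)
  from measurable_compose[OF this btm] show ?thesis by simp
 qed
 thus ?thesis unfolding GP_def Gsum_def split_beta' by (intro borel_measurable_divide borel_measurable_sum) auto
qed

lemma GP_P:
 shows "L2_approx (P n) mu (GP n) pj ta"
  and "nn_integral (P n) (%X. (ennreal (sqrt (LINT s|mu. (GP n X s - GP n X (pj k s))^2)))^2) <= ennreal ((ta k)^2)"
proof -
 let ?a = "nn_int (P n)"
 have fin: "nn_integral mu (%s. ?a (%X. (GP n X s)^2)) < top"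
 proof -
  have "?a (%X. (GP n X s)^2) <= ennreal (B^2)" if s: "s : space mu" for s
  proof -
   let ?b = "LINT x|F. (bt x s)^2"
   have "?a (%X. (GP n X s)^2) <= ennreal ?b"
    unfolding GP_def sample_law_def by (rule F.Gsum_second_moment_le[of _ B]) (use s btB bt0[OF s] in auto)
   also have "... <= ennreal (B^2)"
   proof (rule ennreal_leI)
    have "norm ((bt x s)^2) <= B^2" for x using power_mono[OF btB[of x s], of 2] by simp
    hence "norm ?b <= B^2" using s by (intro F.norm_expectation_le) auto
    thus "?b <= B^2" by simp
   qed
   finally show ?thesis .
  qed
  hence "nn_integral mu (%s. ?a (%X. (GP n X s)^2)) <= nn_int mu (%s. B^2)" by (rule nn_integral_mono)
  also have "... < top" by (simp add: emeasure_eq_measure ennreal_mult_less_top)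
  finally show ?thesis .
 qed
 have inc: "nn_integral mu (%s. ?a (%X. (GP n X s - GP n X (pj k s))^2)) <= ennreal ((ta k)^2)" for k
 proof -
  have "?a (%X. (GP n X s - GP n X (pj k s))^2) <= ennreal (incr k s)" if s: "s : space mu" for s
  proof -
   note s' = pj_space[OF s, of k]
   have "?a (%X. (GP n X s - GP n X (pj k s))^2) <= ennreal (LINT x|F. (bt x s - bt x (pj k s))^2)"
    unfolding GP_def sample_law_def Gsum_diff[symmetric]
    by (rule F.Gsum_second_moment_le[of _ "2 * B"]) (use s s' bt_diff_bound(1) bt0[OF s] bt0[OF s'] bt_integrable(1)[OF s] bt_integrable(1)[OF s'] in auto)
   also have "... <= ennreal (incr k s)" unfolding incr_def by (intro ennreal_leI) simp
   finally show ?thesis .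
  qed
  hence "nn_integral mu (%s. ?a (%X. (GP n X s - GP n X (pj k s))^2)) <= nn_int mu (%s. incr k s)" by (rule nn_integral_mono)
  thus ?thesis unfolding nn_incr .
 qed
 show "L2_approx (P n) mu (GP n) pj ta"
  by (rule L2_approxI(1)[OF P.prob_space_axioms GP_measurable fin ta_nonneg inc])
 show "nn_integral (P n) (%X. (ennreal (sqrt (LINT s|mu. (GP n X s - GP n X (pj k s))^2)))^2) <= ennreal ((ta k)^2)"
  by (rule L2_approxI(2)[OF P.prob_space_axioms GP_measurable fin ta_nonneg inc])
qed

lemma GP_Q: "L2_approx (Q n) mu (GP n) pj (%k. sqrt CQ * ta k)"
 unfolding L2_approx_def
proof (intro conjI allI)
 have G[measurable]: "(%(X, s). GP n X s) : bmeas (P n >< mu)" by (rule GP_measurable)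
 show "prob_space (Q n)" by (rule Q.prob_space_axioms)
 show "(%(X, s). GP n X s) : bmeas (Q n >< mu)"
  using GP_measurable by (simp add: measurable_cong_sets[OF sets_pair_measure_cong[OF sets_Q refl]])
 have "integrable mu (%s. (GP n X s)^2)" if X: "X : space (P n)" for X
 proof (rule integrable_const_bound[where B="(sqrt n * B)^2"])
  have [measurable]: "GP n X : bmeas mu" using measurable_Pair2[OF GP_measurable X] by simp
  show "(%s. (GP n X s)^2) : bmeas mu" by measurable
  have "abs (GP n X s)^2 <= (sqrt n * B)^2" for s
   unfolding GP_def by (rule power_mono[OF F.Gsum_bound[OF btB]]) simp
  thus "AE s in mu. norm ((GP n X s)^2) <= (sqrt n * B)^2" by simp
 qed
 thus "AE X in Q n. integrable mu (%s. (GP n X s)^2)" by (intro AE_I2) (simp add: space_Q)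
 fix k
 let ?D = "%X. ennreal (sqrt (LINT s|mu. (GP n X s - GP n X (pj k s))^2))"
 have "(%z. (fst z, pj k (snd z))) : P n >< mu \<rightarrow>\<^sub>M P n >< mu" by measurable
 from measurable_compose[OF this G] have [measurable]: "(%(X, s). GP n X (pj k s)) : bmeas (P n >< mu)" by auto
 have "(nn_integral (Q n) (%X. ?D X))^2 <= ennreal CQ * nn_integral (P n) (%X. (?D X)^2)"
  by (rule nn_integral_Q_le) measurable
 also have "... <= ennreal CQ * ennreal ((ta k)^2)" by (intro mult_left_mono GP_P(2)) auto
 also have "... = ennreal ((sqrt CQ * ta k)^2)"
  using CQ_ge_1 by (simp add: power_mult_distrib ennreal_mult)
 finally show "nn_integral (Q n) (%X. ?D X) <= ennreal (sqrt CQ * ta k)"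
  by (rule ennreal_power2_le_cancel) (use CQ_ge_1 ta_nonneg in auto)
qed

lemma GP_char:
 assumes J: "finite J" "u ` J <= space mu" and G: "gaussian_process_real M (space mu) Z mean cov"
 shows "(%n. (LINT X|(Q n). iexp (SUM j:J. a j * GP n X (u j)))) ----> (LINT om|M. iexp (SUM j:J. a j * Z (u j) om))"
proof -
 define f where "f = (%x. SUM j:J. a j * bt x (u j))"
 have jJ: "j : J ==> u j : space mu" for j using J by auto
 have [measurable]: "f : bmeas borel"
  unfolding f_def by (intro borel_measurable_sum borel_measurable_times bt_meas jJ) auto
 have fB: "abs (f x) <= (SUM j:J. abs (a j) * B)" for x
  unfolding f_def using btB by (intro order_trans[OF sum_abs] sum_mono) (auto simp: abs_mult intro!: mult_left_mono)
 have f0: "(LINT x|F. f x) = 0"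
  unfolding f_def using bt_integrable(1)[OF jJ] bt0[OF jJ] by (subst LINT_sum) auto
 have fH: "ga * (LINT x|H. f x) = (SUM j:J. a j * mean (u j))"
  unfolding f_def mean_def using bt_integrable(2)[OF jJ]
  by (subst LINT_sum) (auto simp: sum_distrib_left mult_ac)
 let ?b = "LINT x|F. (f x)^2"
 have "(f x)^2 = (SUM i:J. SUM j:J. (a i * a j) * (bt x (u i) * bt x (u j)))" for x
  unfolding f_def power2_eq_square sum_product by (simp add: mult_ac)
 hence "?b = (LINT x|F. (SUM i:J. SUM j:J. (a i * a j) * (bt x (u i) * bt x (u j))))" by simp
 also have "... = (SUM i:J. (LINT x|F. (SUM j:J. (a i * a j) * (bt x (u i) * bt x (u j)))))"
  by (rule LINT_sum, rule Lint_sum, rule integrable_mult_right) (intro btbt_integrable jJ)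
 also have "... = (SUM i:J. SUM j:J. (LINT x|F. (a i * a j) * (bt x (u i) * bt x (u j))))"
  by (intro sum.cong refl, rule LINT_sum, rule integrable_mult_right) (intro btbt_integrable jJ)
 finally have f2: "?b = (SUM i:J. SUM j:J. a i * a j * cov (u i) (u j))"
  by (simp add: cov_def)
 let ?a = "exp (\<i> * of_real (ga * (LINT x|H. f x)) - of_real (?b / 2))"
 have "(%n. (LINT X|(Q n). iexp (Gsum n f X))) ----> ?a"
  by (rule char_Gsum_limit[OF _ fB f0]) measurable
 moreover have "Gsum n f X = (SUM j:J. a j * GP n X (u j))" for n X
  unfolding f_def GP_def by (rule Gsum_sum)
 moreover have "(LINT om|M. iexp (SUM j:J. a j * Z (u j) om)) = ?a"
  unfolding fH f2 using gaussian_process_real_char[OF G J] by simp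
 ultimately show ?thesis by simp
qed

text \<open>The statistic V is compared with the L2 norm of the linear process on the square-root
  scale, in probability under the null law; the bound on likelihood ratios moves this to the
  alternatives. Laplace transforms then converge, and \<open>no_atom\<close> makes c a continuity
  point for every c.\<close>

theorem power_limit:
 fixes M :: "'b measure" and Z :: "'s => 'b => real" and V :: "nat => (nat => real^'n) => real"
 assumes G: "gaussian_process_real M (space mu) Z mean cov"
  and Zm: "(%(om, s). Z s om) : bmeas (M >< mu)"
  and nondeg: "~ (AE s in mu. cov s s = 0)"
  and V[measurable]: "!!n. V n : bmeas (P n)" and V0: "!!n X. 0 <= V n X"
  and rem: "!!ep. 0 < ep ==> (%n. measure (P n) {X:space (P n). abs (sqrt (V n X) - sqrt (LINT s|mu. (GP n X s)^2)) > ep}) ----> 0"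
 shows "(%n. measure (Q n) {X:space (Q n). V n X > c}) ----> measure M {om:space M. (LINT s|mu. (Z s om)^2) > c}"
proof -
 interpret gaussian_L2 mu pj M Z mean cov ta
 proof unfold_locales
  show "nn_int mu (%s. (mean s - mean (pj k s))^2 + (cov s s - 2 * cov s (pj k s) + cov (pj k s) (pj k s))) <= ennreal ((ta k)^2)" for k
   by (simp add: incr_eq[symmetric] nn_incr cong: nn_integral_cong)
  let ?a = "nn_int mu (%s. cov s s + (mean s)^2)"
  show "?a < top"
  proof -
   have "cov s s + (mean s)^2 <= B * B + (ga * B)^2" if s: "s : space mu" for s
   proof (rule add_mono)
    show "cov s s <= B * B" unfolding cov_def
     using F.norm_expectation_le[of "%x. bt x s * bt x s" "B * B"] bt_mult_bound[of _ s s] s by auto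
    have "abs (mean s) <= ga * B"
     unfolding mean_def abs_mult using gamma_pos H.norm_expectation_le[of "%x. bt x s" B] btB s
     by (intro mult_mono) auto
    from power_mono[OF this, of 2] show "(mean s)^2 <= (ga * B)^2" by simp
   qed
   hence "?a <= nn_int mu (%s. B * B + (ga * B)^2)"
    by (intro nn_integral_mono ennreal_leI)
   also have "... < top" by (simp add: emeasure_eq_measure ennreal_mult_less_top)
   finally show ?thesis .
  qed
 qed (use G Zm ta_nonneg ta_tendsto in auto)
 define ta' where "ta' = (%k. sqrt CQ * ta k)"
 have ta'0: "0 <= ta' k" for k unfolding ta'_def using CQ_ge_1 ta_nonneg by simp
 have ta'lim: "ta' ----> 0" unfolding ta'_def using tendsto_mult[OF tendsto_const ta_tendsto, of "sqrt CQ"] by simp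
 have aZ: "L2_approx M mu (%om s. Z s om) pj ta'"
 proof -
  have "1 * ta k <= sqrt CQ * ta k" for k using CQ_ge_1 ta_nonneg by (intro mult_right_mono) auto
  hence "ennreal (ta k) <= ennreal (ta' k)" for k unfolding ta'_def by (intro ennreal_leI) simp
  thus ?thesis using L2_approx_Z unfolding L2_approx_def by (meson order_trans)
 qed
 have aG: "L2_approx (Q n) mu (GP n) pj ta'" for n using GP_Q unfolding ta'_def .
 define T where "T = (%n X. (LINT s|mu. (GP n X s)^2))"
 have T0: "0 <= T n X" for n X unfolding T_def by simp
 have Tm[measurable]: "T n : bmeas (P n)" for n
  using GP_measurable[of n] unfolding T_def by measurable
 have VQ[measurable]: "V n : bmeas (Q n)" and TQ[measurable]: "T n : bmeas (Q n)" for n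
  using V[of n] Tm[of n] by (simp_all add: measurable_cong_sets[OF sets_Q refl])
 have lapT: "(%n. (LINT X|(Q n). exp (- t * T n X))) ----> (LINT om|M. exp (- t * (LINT s|mu. (Z s om)^2)))" if "0 <= t" for t
  unfolding T_def by (rule L2_laplace_tendsto[OF aG aZ ta'0 ta'lim that GP_char[where u="%j. j", OF _ _ G]]) simp_all
 have diff: "(%n. (LINT X|(Q n). exp (- t * V n X)) - (LINT X|(Q n). exp (- t * T n X))) ----> 0" if t: "0 <= t" for t
 proof (rule LIMSEQ_I)
  fix r :: real assume r: "0 < r"
  \<comment> \<open>Ensures sqrt t * ep <= r/2, also for t = 0.\<close>
  define ep where "ep = r / (2 * (sqrt t + 1))"
  have st: "0 < sqrt t + 1" using t by (simp add: add_nonneg_pos)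
  have ep: "0 < ep" using r st by (simp add: ep_def)
  have epr: "sqrt t * ep <= r / 2"
  proof -
   have "sqrt t * ep <= (sqrt t + 1) * ep" using ep by simp
   also have "... = r / 2"
   proof -
    have "q * (r / (2 * q)) = r / 2" if "0 < q" for q using that by simp
    from this[OF st] show ?thesis by (simp only: ep_def)
   qed
   finally show ?thesis .
  qed
  define A where "A = (%n. {X:space (P n). abs (sqrt (V n X) - sqrt (T n X)) > ep})"
  have Am[measurable]: "A n : sets (P n)" for n unfolding A_def by measurable
  have AQ[measurable]: "A n : sets (Q n)" for n by (simp add: sets_Q)
  have "(%n. sqrt CQ * sqrt (measure (P n) (A n))) ----> 0"
   using tendsto_mult[OF tendsto_const tendsto_real_sqrt[OF rem[OF ep]], of "sqrt CQ"] by (simp add: A_def T_def)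
  from LIMSEQ_D[OF this, of "r / 2"] r obtain n0 where n0: "!!n. n >= n0 ==> abs (sqrt CQ * sqrt (measure (P n) (A n))) < r / 2" by auto
  show "EX no. ALL n>=no. norm ((LINT X|(Q n). exp (- t * V n X)) - (LINT X|(Q n). exp (- t * T n X)) - 0) < r"
  proof (intro exI allI impI)
   fix n assume "n >= n0"
   have qA: "measure (Q n) (A n) < r / 2" using measure_Q_le[OF Am, of n] n0[OF \<open>n >= n0\<close>] by auto
   let ?b = "integrable (Q n)"
   have i: "?b (%X. exp (- t * V n X))" "?b (%X. exp (- t * T n X))"
    using t V0 T0 by (auto intro!: Q.integrable_bounded[of _ _ 1])
   let ?c = "LINT X|(Q n). exp (- t * V n X)"
   let ?d = "LINT X|(Q n). exp (- t * T n X)"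
   have "abs (?c - ?d) = abs (LINT X|(Q n). exp (- t * V n X) - exp (- t * T n X))"
    using i by simp
   also have "... <= (LINT X|(Q n). abs (exp (- t * V n X) - exp (- t * T n X)))" by auto
   also have "... <= (LINT X|(Q n). sqrt t * ep + indicator (A n) X)"
   proof (rule integral_mono)
    show "?b (%X. abs (exp (- t * V n X) - exp (- t * T n X)))" using i by auto
    show "?b (%X. sqrt t * ep + indicator (A n) X)"
     by (rule Q.integrable_bounded[of _ _ "abs (sqrt t * ep) + 1"]) (auto simp: indicator_def)
    fix X assume X: "X : space (Q n)"
    show "abs (exp (- t * V n X) - exp (- t * T n X)) <= sqrt t * ep + indicator (A n) X"
    proof (cases "X : A n")
     case True
     have "exp (- t * V n X) <= 1" "exp (- t * T n X) <= 1" using t V0 T0 by auto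
     hence "abs (exp (- t * V n X) - exp (- t * T n X)) <= 1"
      using exp_gt_zero[of "- t * V n X"] exp_gt_zero[of "- t * T n X"] by linarith
     moreover have "0 <= sqrt t * ep" using t ep by simp
     ultimately show ?thesis using True by simp
    next
     case False
     hence "abs (sqrt (V n X) - sqrt (T n X)) <= ep" using X by (auto simp: A_def space_Q)
     hence "sqrt t * abs (sqrt (V n X) - sqrt (T n X)) <= sqrt t * ep" using t by (intro mult_left_mono) auto
     thus ?thesis
      using exp_neg_square_lipschitz[OF t, of "sqrt (V n X)" "sqrt (T n X)"] False V0 T0 by simp
    qed
   qed
   also have "... = sqrt t * ep + measure (Q n) (A n)"
    using Q.prob_space[of n] sets.Int_space_eq2[OF AQ[of n]] by (subst LINT_add) (auto simp: Q.emeasure_eq_measure)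
   finally show "norm (?c - ?d - 0) < r"
    using epr qA by simp
  qed
 qed
 have lapV: "(%n. (LINT X|(Q n). exp (- real k * V n X))) ----> (LINT om|M. exp (- real k * (LINT s|mu. (Z s om)^2)))" for k :: nat
  using tendsto_add[OF diff[of "real k"] lapT[of "real k"]] by simp
 have Wm: "(%om. (LINT s|mu. (Z s om)^2)) : bmeas M" using Zm by measurable
 show ?thesis
  by (rule laplace_tendsto_prob[OF Q.prob_space_axioms facts(1) VQ Wm V0 _ lapV no_atom[OF nondeg]]) simp
qed

end

section \<open>The empirical distribution function\<close>

lemma vec_nth_borel [measurable]: "(%x::real^'n. x $ i) : bmeas borel"
 by (intro borel_measurable_continuous_onI continuous_intros)

lemma borel_measurable_vec:
 fixes f :: "'a => real^'n"
 assumes "!!i. (%x. f x $ i) : bmeas M" shows "f : bmeas M"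
proof (subst borel_measurable_euclidean_space, rule ballI)
 fix b :: "real^'n" assume "b : Basis"
 then obtain i where "b = axis i 1" by (auto simp: Basis_vec_def)
 thus "(%x. f x \<bullet> b) : bmeas M" using assms by (simp add: inner_axis)
qed

lemma tendsto_vec_iff:
 fixes f :: "nat => real^'n"
 shows "f ----> v \<longleftrightarrow> (ALL i. (%n. f n $ i) ----> v $ i)"
 using vec_tendstoI[of f v sequentially] tendsto_vec_nth[of f v sequentially] by auto

text \<open>Rounding is towards 0, so norms never grow and closed balls around 0 are mapped into
  themselves; sending large values to 0 makes the range finite.\<close>

definition round_zero :: "nat => real => real" where
 "round_zero k x = (if abs x <= 2^k then sgn x * (of_int \<lfloor>2^k * abs x\<rfloor> / 2^k) else 0)"

lemma round_zero_measurable [measurable]: "round_zero k : bmeas borel"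
 unfolding round_zero_def[abs_def] sgn_real_def by measurable

lemma abs_round_zero_le: "abs (round_zero k x) <= abs x"
 by (simp add: field_simps round_zero_def abs_mult sgn_real_def)

lemma round_zero_dist: assumes "abs x <= 2^k" shows "abs (round_zero k x - x) <= 1 / 2^k"
proof -
 define y where "y = 2^k * abs x"
 let ?a = "of_int \<lfloor>y\<rfloor> / 2^k - abs x"
 let ?b = "abs (of_int \<lfloor>y\<rfloor> - y)"
 have "of_int \<lfloor>y\<rfloor> <= y" "y < of_int \<lfloor>y\<rfloor> + 1" by auto
 hence "?b <= 1" by linarith
 hence "?b / 2^k <= 1 / 2^k" by (intro divide_right_mono) auto
 hence "abs ?a <= 1 / 2^k" by (simp add: y_def abs_divide field_simps)
 moreover have "x = sgn x * abs x" by (simp add: sgn_real_def)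
 hence "round_zero k x - x = sgn x * ?a"
  unfolding round_zero_def y_def using assms by (simp add: right_diff_distrib)
 ultimately show ?thesis by (auto simp: abs_mult)
qed

lemma round_zero_tendsto: "(%k. round_zero k x) ----> x"
proof (rule LIM_zero_cancel, rule Lim_null_comparison)
 have "EV k. abs x <= 2^k"
 proof -
  obtain n where "abs x < 2^n" using real_arch_pow[of 2 "abs x"] by auto
  moreover have "(2::real)^n <= 2^k" if "n <= k" for k using that by (rule power_increasing) simp
  ultimately show ?thesis by (intro eventually_sequentiallyI[of n]) (meson less_imp_le order_trans)
 qed
 thus "EV k. norm (round_zero k x - x) <= (1/2)^k"
  by eventually_elim (use round_zero_dist in \<open>simp add: power_one_over\<close>)
 show "(%k. (1/2::real)^k) ----> 0" by (rule LIMSEQ_power_zero) simp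
qed

lemma round_zero_finite: "finite (range (round_zero k))"
proof (rule finite_subset)
 show "range (round_zero k) <= (%j. of_int j / 2^k) ` {- (4^k) .. 4^k :: int}"
 proof
  fix z assume "z : range (round_zero k)"
  then obtain x where z: "z = round_zero k x" by auto
  show "z : (%j. of_int j / 2^k) ` {- (4^k) .. 4^k :: int}"
  proof (cases "abs x <= 2^k")
   case True
   define j where "j = \<lfloor>2^k * abs x\<rfloor>"
   have "2^k * abs x <= 2^k * 2^k" using True by (intro mult_left_mono) auto
   hence "2^k * abs x <= of_int (4^k)" by (simp flip: power_mult_distrib)
   hence "j <= 4^k" unfolding j_def by linarith
   moreover have "0 <= j" unfolding j_def by simp
   moreover have "z = of_int (if x > 0 then j else if x < 0 then - j else 0) / 2^k"
    unfolding z round_zero_def j_def using True by auto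
   ultimately show ?thesis by (intro image_eqI[where x="if x > 0 then j else if x < 0 then - j else 0"]) auto
  next
   case False
   thus ?thesis unfolding z round_zero_def by (intro image_eqI[where x=0]) auto
  qed
 qed
qed simp

definition round_vec :: "nat => real^'n => real^'n" where
 "round_vec k v = (\<chi> i. round_zero k (v $ i))"

lemma round_vec_measurable [measurable]: "round_vec k : bmeas borel"
 unfolding round_vec_def[abs_def] by (rule borel_measurable_vec) simp

lemma norm_round_vec_le: "norm (round_vec k v) <= norm v"
 by (rule norm_le_componentwise_cart) (simp add: round_vec_def abs_round_zero_le)

lemma round_vec_tendsto: "(%k. round_vec k v) ----> v"
 unfolding tendsto_vec_iff by (simp add: round_vec_def round_zero_tendsto)

lemma round_vec_finite: "finite (range (round_vec k :: real^'n => real^'n))"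
proof (rule finite_subset)
 show "range (round_vec k :: real^'n => real^'n) <= vec_lambda ` (Pi\<^sub>E UNIV (%_. range (round_zero k)))"
  unfolding round_vec_def[abs_def] by auto
 show "finite (vec_lambda ` (Pi\<^sub>E (UNIV :: 'n set) (%_. range (round_zero k))) :: (real^'n) set)"
  by (intro finite_imageI finite_PiE round_zero_finite) simp
qed

lemma finite_range_measurable_count:
 fixes f :: "'a => 'b::t1_space"
 assumes f: "f : bmeas M" and fin: "finite (f ` space M)"
 shows "f : M \<rightarrow>\<^sub>M count_space UNIV"
proof (rule measurableI)
 fix A :: "'b set" assume "A : sets (count_space UNIV)"
 have "f -` A Int space M = f -` (A Int f ` space M) Int space M" by auto
 moreover have "A Int f ` space M : sets borel" using fin by (intro borel_closed finite_imp_closed) auto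
 ultimately show "f -` A Int space M : sets M" using measurable_sets[OF f] by metis
qed simp

lemma finite_projections_round_vec:
 fixes mu :: "(real^'n) measure"
 assumes "finite_measure mu" "sets mu = sets (restrict_space borel S)" "!!v k. v : S ==> round_vec k v : S"
 shows "finite_projections mu round_vec"
proof (rule finite_projections.intro)
 have sp: "space mu = S" using sets_eq_imp_space_eq[OF assms(2)] by (simp add: space_restrict_space)
 fix k
 let ?a = "round_vec k"
 have b: "?a : bmeas mu"
  by (simp add: measurable_cong_sets[OF assms(2) refl] measurable_restrict_space1)
 show "?a : mu \<rightarrow>\<^sub>M mu"
  unfolding measurable_cong_sets[OF refl assms(2)]
  by (rule measurable_restrict_space2) (use b sp assms(3) in auto)
 have fin: "finite (?a ` space mu)" by (rule finite_subset[OF _ round_vec_finite[of k]]) auto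
 thus "finite (?a ` space mu)" .
 show "?a : mu \<rightarrow>\<^sub>M count_space UNIV" by (rule finite_range_measurable_count[OF b fin])
qed (rule assms(1))

text \<open>Step processes along \<open>pj k\<close> are finite sums of products and hence jointly
  measurable, and they converge pointwise. This supplies the joint measurability that continuous
  paths provide.\<close>

lemma (in finite_projections) Caratheodory_measurable:
 fixes Z :: "'s => 'b => real"
 assumes Z: "!!s. s : space mu ==> Z s : bmeas M"
  and lim: "!!s om. s : space mu ==> om : space M ==> (%k. Z (pj k s) om) ----> Z s om"
 shows "(%(om, s). Z s om) : bmeas (M >< mu)"
proof (rule borel_measurable_LIMSEQ_real)
 let ?a = "M >< mu"
 show "(%k. (%(om, s). Z (pj k s) om) p) ----> (%(om, s). Z s om) p" if "p : space ?a" for p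
  using that lim by (auto simp: space_pair_measure)
 fix k
 have [measurable]: "{s:space mu. pj k s = j} : sets mu" for j
  using measurable_sets[OF pj_count, of "{j}" k] by (simp add: Int_def conj_commute)
 have "(%p. SUM j:pj k ` space mu. Z j (fst p) * indicator {s:space mu. pj k s = j} (snd p)) : bmeas ?a"
 proof (intro borel_measurable_sum borel_measurable_times)
  fix j assume "j : pj k ` space mu"
  hence "j : space mu" using pj_range by blast
  from measurable_compose[OF measurable_fst Z[OF this]]
  show "(%p. Z j (fst p)) : bmeas ?a" .
 qed measurable
 moreover have "(%(om, s). Z (pj k s) om) p = (SUM j:pj k ` space mu. Z j (fst p) * indicator {s:space mu. pj k s = j} (snd p))"
  if "p : space ?a" for p
  using that pj_finite by (subst sum.remove[of _ "pj k (snd p)"]) (auto simp: space_pair_measure indicator_def intro!: sum.neutral)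
 ultimately show "(%(om, s). Z (pj k s) om) : bmeas ?a"
  by (subst measurable_cong) auto
qed

definition orthant :: "real^'n => (real^'n) set" where "orthant t = {x. ALL i. x $ i <= t $ i}"

lemma orthant_measurable [measurable]: "orthant t : sets borel"
 by (simp add: orthant_def)

lemma orthant_joint_measurable: "(%(x, t :: real^'n). indicat_real (orthant t) x) : bmeas (borel >< borel)"
 by (simp add: borel_measurable_indicator fun_eq_iff indicator_def orthant_def space_pair_measure)

lemma orthant_Int: "orthant s Int orthant t = orthant (vmin s t)"
 by (auto simp: orthant_def vmin_def)

lemma cdf_vec_orthant: "cdf_vec M t = measure M (orthant t)"
 by (simp add: cdf_vec_def orthant_def)

text \<open>Hyperplanes are null, and off them the indicator of an orthant is locally constant in
  its corner.\<close>

lemma AE_coordinates_neq: "AE x in lborel. ALL i. (x :: real^'n) $ i ~= t $ i"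
proof -
 have "AE x in lborel. (x :: real^'n) $ i ~= t $ i" for i
 proof (rule AE_I')
  show "{x :: real^'n. x $ i = t $ i} : null_sets lborel"
   using negligible_hyperplane[of "axis i 1 :: real^'n" "t $ i"] by (force simp: negligible_iff_null_sets inner_axis')
 qed auto
 thus ?thesis by (simp add: AE_all_countable)
qed

lemma indicator_orthant_tendsto:
 assumes x: "ALL i. x $ i ~= t $ i" and lim: "f ----> t"
 shows "(%k. indicat_real (orthant (f k)) x) ----> indicator (orthant t) x"
proof (rule tendsto_eventually)
 have "EV k. (x $ i <= f k $ i) = (x $ i <= t $ i)" for i
 proof -
  have lim_i: "(%k. f k $ i) ----> t $ i" using lim tendsto_vec_iff by blast
  show ?thesis
  proof (cases "x $ i < t $ i")
   case True
   from order_tendstoD(1)[OF lim_i True] show ?thesis by eventually_elim (use True in auto)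
  next
   case False
   hence "t $ i < x $ i" using x by (metis linorder_neqE_linordered_idom)
   from order_tendstoD(2)[OF lim_i this] show ?thesis by eventually_elim (use False x in auto)
  qed
 qed
 hence "EV k. ALL i. (x $ i <= f k $ i) = (x $ i <= t $ i)"
  by (simp add: eventually_all_finite)
 thus "EV k. indicat_real (orthant (f k)) x = indicator (orthant t) x"
  by eventually_elim (simp add: orthant_def indicator_def)
qed

lemma cdf_vec_tendsto:
 assumes f: "prob_space (dens f)" "f : bmeas borel" and lim: "s ----> t"
 shows "(%k. cdf_vec (dens f) (s k)) ----> cdf_vec (dens f) t"
proof -
 interpret prob_space "dens f" by (rule f)
 have "(%k. (LINT x|(dens f). indicat_real (orthant (s k)) x)) ----> (LINT x|(dens f). indicat_real (orthant t) x)"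
 proof (rule integral_dominated_convergence[where w="%_. 1"])
  show "AE x in dens f. (%k. indicat_real (orthant (s k)) x) ----> indicator (orthant t) x"
   using AE_coordinates_neq[of t] by (intro dens_AE_lborel[OF _ f(2)]) (auto elim!: eventually_mono intro: indicator_orthant_tendsto[OF _ lim])
 qed (auto simp: indicator_def)
 thus ?thesis by (simp add: cdf_vec_orthant)
qed

lemma cdf_vec_measurable [measurable]:
 assumes "prob_space (dens f)" shows "cdf_vec (dens f) : bmeas borel"
proof -
 interpret prob_space "dens f" by (rule assms)
 have "(%(t, x). indicat_real (orthant t) x) : bmeas (borel >< dens f)"
  using measurable_pair_swap[OF orthant_joint_measurable] by (simp add: measurable_cong_sets[OF sets_pair_measure_cong[OF refl sets_dens]])
 hence "(%t. (LINT x|(dens f). indicat_real (orthant t) x)) : bmeas borel" by measurable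
 thus ?thesis by (simp add: cdf_vec_orthant[abs_def])
qed

lemma dens_open_pos:
 assumes f: "!!x. 0 < f x" "f : bmeas borel" and U: "open U" "U ~= {}" "U <= A" and A: "A : sets borel"
 shows "emeasure (dens f) A ~= 0"
proof
 assume "emeasure (dens f) A = 0"
 hence "nn_integral lborel (%x. ennreal (f x) * indicator A x) = 0" unfolding dens_def using f A by (simp add: emeasure_density)
 hence "AE x in lborel. ennreal (f x) * indicator A x = 0" using f A by (subst (asm) nn_integral_0_iff_AE) auto
 hence "AE x in lborel. x ~: U"
 proof eventually_elim
  case (elim x)
  show ?case
  proof
   assume "x : U"
   hence "ennreal (f x) = 0" using elim U by auto
   thus False using f(1)[of x] by auto
  qed
 qed
 hence "U : null_sets lborel" using U(1) by (subst (asm) AE_iff_null_sets[symmetric]) auto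
 hence "negligible U" by (simp add: negligible_iff_null_sets null_sets_completionI)
 thus False using open_not_negligible[OF U(1,2)] by simp
qed

lemma cdf_vec_strict:
 assumes f: "!!x. 0 < f x" "f : bmeas borel" and "prob_space (dens f)"
 shows "0 < cdf_vec (dens f) t" "cdf_vec (dens f) t < 1"
proof -
 interpret prob_space "dens f" by fact
 let ?a = "{x. ALL i. x $ i < t $ i}"
 let ?b = "orthant t"
 let ?c = "dens f"
 let ?d = "\<Inter>i. {x. x $ i < t $ i}"
 have "emeasure ?c (?b) ~= 0"
 proof (rule dens_open_pos[OF f, of "?a"])
  have "open ?d" by (intro open_INT ballI open_Collect_less continuous_intros) auto
  moreover have "?d = ?a" by auto
  ultimately show "open ?a" by simp
  have "t - (\<chi> i. 1) : ?a" by simp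
  thus "?a ~= {}" by blast
 qed (auto simp: orthant_def less_imp_le)
 thus "0 < cdf_vec ?c t" by (simp add: cdf_vec_orthant emeasure_eq_measure zero_less_measure_iff)
 have "emeasure ?c (- ?b) ~= 0"
 proof (rule dens_open_pos[OF f, of "{x. t $ i < x $ i}" for i])
  fix i
  show "open {x. t $ i < x $ i}" by (intro open_Collect_less continuous_intros)
  have "t + (\<chi> i. 1) : {x. t $ i < x $ i}" by simp
  thus "{x. t $ i < x $ i} ~= {}" by blast
  show "{x. t $ i < x $ i} <= - ?b" by (auto simp: orthant_def) (metis not_le)
 qed auto
 moreover have "measure ?c (- ?b) = 1 - measure ?c (?b)"
  using prob_compl[of "?b"] by (simp add: Compl_eq_Diff_UNIV)
 ultimately show "cdf_vec ?c t < 1"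
  by (auto simp: cdf_vec_orthant emeasure_eq_measure less_le)
qed

lemma emp_cdf_orthant: "emp_cdf X n t = (SUM i<n. indicator (orthant t) (X i)) / real n"
proof -
 have "{k:{..<n}. ALL i. X k $ i <= t $ i} = {..<n} Int {k. X k : orthant t}" by (auto simp: orthant_def)
 thus ?thesis unfolding emp_cdf_def by (simp add: indicator_def)
qed

context local_alternatives begin

definition ebeta :: "real^'n => real^'n => real" where
 "ebeta x t = indicator (orthant t) x - cdf_vec F t"

lemma ebeta_measurable [measurable]: "(%x. ebeta x t) : bmeas borel"
 unfolding ebeta_def by measurable

lemma ebeta_bound: "abs (ebeta x t) <= 1"
 using cdf_vec_strict[OF f0_pos f0_measurable F0_prob, of t] by (auto simp: ebeta_def indicator_def)

lemma ebeta_mean_zero: "(LINT x|F. ebeta x t) = 0"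
 unfolding ebeta_def by (subst LINT_diff) (auto simp: cdf_vec_orthant F.emeasure_eq_measure)

lemma ebeta_mean_H: "(LINT x|H. ebeta x t) = cdf_vec H t - cdf_vec F t"
 unfolding ebeta_def by (subst LINT_diff) (auto simp: cdf_vec_orthant H.emeasure_eq_measure)

lemma ebeta_cov: "(LINT x|F. ebeta x s * ebeta x t) = k3 F s t"
proof -
 have eq: "ebeta x s * ebeta x t = indicator (orthant (vmin s t)) x - cdf_vec F t * indicator (orthant s) x - cdf_vec F s * indicator (orthant t) x + cdf_vec F s * cdf_vec F t" for x
  unfolding ebeta_def orthant_Int[symmetric] by (simp add: indicator_inter_arith algebra_simps)
 have i: "integrable F (indicat_real (orthant u))" for u by (rule F.integrable_bounded[of _ 1]) (auto simp: indicator_def)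
 show ?thesis unfolding eq using i by (simp add: cdf_vec_orthant k3_def)
qed

lemma Gsum_ebeta: "Gsum n (%x. ebeta x t) X = sqrt (real n) * (emp_cdf X n t - cdf_vec F t)"
proof (cases "n = 0")
 case False
 hence "Gsum n (%x. ebeta x t) X = real n * (emp_cdf X n t - cdf_vec F t) / sqrt (real n)" by (simp add: emp_cdf_orthant Gsum_def ebeta_def sum_subtractf right_diff_distrib)
 also have "... = sqrt (real n) * (emp_cdf X n t - cdf_vec F t)"
  using real_div_sqrt[of "real n"] by (metis times_divide_eq_left of_nat_0_le_iff mult.commute)
 finally show ?thesis .
qed (simp add: Gsum_def)

lemma L2_test_ebeta: "L2_test f0 h ga F round_vec ebeta 1"
proof -
 interpret finite_projections F round_vec
  by (rule finite_projections_round_vec[where S=UNIV]) (auto simp: F.finite_measure_axioms)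
 show ?thesis
 proof unfold_locales
  show "(%(x, t). ebeta x t) : bmeas (borel >< F)"
  proof -
   have "(%z. cdf_vec F (snd z)) : bmeas (borel >< borel)"
    by (rule measurable_compose[OF measurable_snd cdf_vec_measurable[OF F0_prob]])
   from borel_measurable_diff[OF orthant_joint_measurable this]
   show ?thesis by (simp add: ebeta_def split_beta' measurable_cong_sets[OF sets_pair_measure_cong[OF refl sets_dens]])
  qed
  show "AE x in lborel. (%k. ebeta x (round_vec k t)) ----> ebeta x t" for t
   using AE_coordinates_neq[of t]
   by eventually_elim
    (unfold ebeta_def, intro tendsto_diff indicator_orthant_tendsto cdf_vec_tendsto[OF F0_prob f0_measurable] round_vec_tendsto)
 qed (auto simp: ebeta_bound ebeta_mean_zero)
qed

text \<open>The statistic is exactly the squared L2 norm of the linear process, with F as index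
  measure, so the remainder in \<open>power_limit\<close> is 0.\<close>

theorem CvM_power:
 fixes Z :: "real^'n => 'b => real"
 assumes Z: "gaussian_process_real M UNIV Z (%t. ga * (cdf_vec H t - cdf_vec F t)) (k3 F)"
  and cont: "ALL om:space M. continuous_on UNIV (%t. Z t om)"
 shows "(%n. measure (Q n) {X:space (Q n). CvM_stat F n X > c}) ----> measure M {om:space M. (LINT t|F. (Z t om)^2) > c}"
proof -
 interpret L2_test f0 h ga F round_vec ebeta 1 by (rule L2_test_ebeta)
 have stat: "CvM_stat F n X = (LINT t|F. (GP n X t)^2)" for n X
  by (simp add: CvM_stat_def GP_def Gsum_ebeta power_mult_distrib)
 show ?thesis
 proof (rule power_limit)
  have "mean = (%t. ga * (cdf_vec H t - cdf_vec F t))" "cov = k3 F"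
   by (auto simp: fun_eq_iff mean_def cov_def ebeta_mean_H ebeta_cov)
  thus "gaussian_process_real M (space F) Z mean cov" using Z by simp
  show "(%(om, s). Z s om) : bmeas (M >< F)"
  proof (rule Caratheodory_measurable)
   show "Z s : bmeas M" for s using gaussian_process_real_facts(2)[OF Z] by simp
   fix s om assume "om : space M"
   hence "continuous_on UNIV (%t. Z t om)" using cont by blast
   thus "(%k. Z (round_vec k s) om) ----> Z s om"
    using round_vec_tendsto[of s] by (rule continuous_on_tendsto_compose) auto
  qed
  show "~ (AE s in F. cov s s = 0)"
  proof
   assume "AE s in F. cov s s = 0"
   moreover have "cov s s ~= 0" for s
   proof -
    have "cov s s = cdf_vec F s * (1 - cdf_vec F s)"
     unfolding cov_def ebeta_cov by (simp add: k3_def vmin_def algebra_simps)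
    thus ?thesis using cdf_vec_strict[OF f0_pos f0_measurable F0_prob, of s] by simp
   qed
   ultimately have "AE s in F. False" by simp
   thus False by simp
  qed
  show "CvM_stat F n : bmeas (P n)" for n
   unfolding stat[abs_def] using GP_measurable[of n] by measurable
  show "0 <= CvM_stat F n X" for n X unfolding stat by simp
  show "(%n. measure (P n) {X:space (P n). abs (sqrt (CvM_stat F n X) - sqrt (LINT s|F. (GP n X s)^2)) > ep}) ----> 0" if "0 < ep" for ep
   unfolding stat using that by simp
 qed
qed

end

section \<open>Chaining for the empirical process\<close>

lemma exp_neg_le_power:
 assumes "0 < y" "0 < m" shows "exp (- y) <= (real m / y) ^ m"
proof -
 have "y / m <= exp (y / m)" using exp_ge_add_one_self[of "y / m"] by linarith
 hence "(y / m) ^ m <= exp (y / m) ^ m" using assms by (intro power_mono) auto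
 also have "... = exp y" using assms by (simp flip: exp_of_nat_mult)
 finally have "(y / m) ^ m <= exp y" .
 moreover have "0 < (y / m) ^ m" using assms by simp
 ultimately have "inverse (exp y) <= inverse ((y / m) ^ m)" by (intro le_imp_inverse_le)
 moreover have "(real m / y) ^ m = inverse ((y / m) ^ m)" by (simp add: power_divide)
 ultimately show ?thesis by (simp add: exp_minus)
qed

context local_alternatives begin

text \<open>Marginal distribution functions. In their scale every coordinate is uniform, so grid
  cells have controlled probability whatever the tails of f0.\<close>

definition U :: "'n => real => real" where "U i x = measure F {y. y $ i <= x}"

lemma half_space_measurable [measurable]: "{y :: real^'n. y $ i <= x} : sets borel"
 by simp

lemma U_strict: assumes "x < x'" shows "U i x < U i x'"
proof -
 have [measurable]: "{y :: real^'n. x < y $ i & y $ i <= x'} : sets borel"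
  by simp
 let ?a = "{y. x < y $ i & y $ i <= x'}"
 let ?b = "{y. y $ i < x'}"
 have "emeasure F ?a ~= 0"
 proof (rule dens_open_pos[OF f0_pos f0_measurable, of "{y. x < y $ i} Int ?b"])
  show "open ({y :: real^'n. x < y $ i} Int ?b)" by (intro open_Int open_Collect_less continuous_intros)
  have "(\<chi> j. (x + x') / 2) : {y :: real^'n. x < y $ i} Int ?b" using assms by simp
  thus "{y :: real^'n. x < y $ i} Int ?b ~= {}" by blast
 qed auto
 hence "0 < measure F ?a" by (simp add: F.emeasure_eq_measure zero_less_measure_iff)
 moreover have "?a = {y. y $ i <= x'} - {y. y $ i <= x}" by auto
 moreover have "measure F ({y. y $ i <= x'} - {y. y $ i <= x}) = U i x' - U i x"
  unfolding U_def using assms by (intro F.finite_measure_Diff) auto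
 ultimately show ?thesis by simp
qed

lemma U_le_iff: "U i x <= U i x' \<longleftrightarrow> x <= x'"
 using U_strict[of x x' i] U_strict[of x' x i] by (cases x x' rule: linorder_cases) auto

lemma U_pos: "0 < U i x" and U_less_1: "U i x < 1"
proof -
 have "U i (x - 1) < U i x" "U i x < U i (x + 1)" by (rule U_strict, simp)+
 moreover have "0 <= U i (x - 1)" "U i (x + 1) <= 1" unfolding U_def by auto
 ultimately show "0 < U i x" "U i x < 1" by auto
qed

lemma U_measurable [measurable]: "U i : bmeas borel"
 by (rule borel_measurable_mono) (auto simp: mono_def U_le_iff)

lemma U_surj: assumes v: "0 < v" "v < 1" shows "EX x. U i x = v"
proof -
 let ?D = "distr F borel (%y. y $ i)"
 have "prob_space ?D" by (rule F.prob_space_distr) simp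
 then interpret D: real_distribution ?D by simp
 have cdf: "cdf ?D x = U i x" for x
  unfolding cdf_def U_def by (subst measure_distr) (auto simp: vimage_def)
 have "isCont (cdf ?D) x" for x
 proof -
  have "AE y in F. y $ i ~= x"
   using AE_coordinates_neq[of "\<chi> j. x"] by (intro dens_AE_lborel) (auto elim!: eventually_mono)
  hence "measure F {y : space F. ~ (y $ i ~= x)} = 0"
   by (subst F.prob_Collect_eq_0) (auto simp: vec_nth_borel)
  hence "measure ?D {x} = 0" by (subst measure_distr) (auto simp: vimage_def)
  thus ?thesis by (simp add: D.isCont_cdf)
 qed
 hence cont: "isCont (U i) x" for x unfolding cdf[abs_def] by simp
 have "((%x. U i x) \<longlongrightarrow> 0) at_bot" "((%x. U i x) \<longlongrightarrow> 1) at_top"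
  using D.cdf_lim_at_bot D.cdf_lim_at_top_prob unfolding cdf[abs_def] by auto
 hence "\<forall>\<^sub>F x in at_bot. U i x < v" "\<forall>\<^sub>F x in at_top. v < U i x"
  using v by (auto intro: order_tendstoD)
 then obtain a b where "U i a < v" "v < U i b"
  by (metis eventually_at_bot_linorder eventually_at_top_linorder order_refl)
 moreover have "a <= b" using calculation U_le_iff[of i a b] by auto
 ultimately show ?thesis using IVT[of "U i" a v b] cont by auto
qed

lemma U_prob:
 assumes "0 <= v" "v <= 1" shows "measure F {y. U i (y $ i) <= v} = v"
proof -
 consider "v = 0" | "v = 1" | "0 < v" "v < 1" using assms by linarith
 thus ?thesis
 proof cases
  case 1
  hence "{y. U i (y $ i) <= v} = {}" using U_pos by (auto simp: not_le)
  thus ?thesis using 1 by simp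
 next
  case 2
  hence "{y. U i (y $ i) <= v} = UNIV" using less_imp_le[OF U_less_1] by auto
  thus ?thesis using 2 by simp
 next
  case 3
  then obtain x where x: "U i x = v" using U_surj by blast
  have "{y. U i (y $ i) <= v} = {y. y $ i <= x}" unfolding x[symmetric] U_le_iff ..
  thus ?thesis using x by (simp add: U_def)
 qed
qed

text \<open>Orthants in the uniform scale. Corners on the boundary of the cube are allowed: a zero
  corner gives the empty set, which anchors the bound for small variances.\<close>

definition Aset :: "real^'n => (real^'n) set" where "Aset v = {x. ALL i. U i (x $ i) <= v $ i}"

definition Uvec :: "real^'n => real^'n" where "Uvec t = (\<chi> i. U i (t $ i))"

lemma Aset_measurable [measurable]: "Aset v : sets borel"
 by (simp add: Aset_def)

lemma Aset_Uvec: "Aset (Uvec t) = orthant t"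
 by (simp add: Aset_def Uvec_def orthant_def U_le_iff)

lemma Aset_mono: "(!!i. v $ i <= z $ i) ==> Aset v <= Aset z"
 by (auto simp: Aset_def intro: order_trans)

lemma Aset_diff_measure:
 fixes dl :: real
 assumes vz: "!!i. 0 <= v $ i" "!!i. v $ i <= z $ i" "!!i. z $ i <= 1" "!!i. z $ i - v $ i <= dl"
 shows "measure F (Aset z - Aset v) <= CARD('n) * dl"
proof -
 define S where "S = (%i. {y. U i (y $ i) <= z $ i} - {y. U i (y $ i) <= v $ i})"
 have m[measurable]: "{y. U i (y $ i) <= c} : sets borel" for i c
  by simp
 have S: "measure F (S i) <= dl" for i
 proof -
  have "measure F (S i) = z $ i - v $ i"
   unfolding S_def
   by (subst F.finite_measure_Diff) (use vz(1-3)[of i] order_trans[OF vz(1,2)] order_trans[OF vz(2,3)] in \<open>auto simp: U_prob intro: order_trans\<close>)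
  thus ?thesis using vz(4)[of i] by simp
 qed
 have "Aset z - Aset v <= (UN i. S i)" by (auto simp: Aset_def S_def)
 hence "measure F (Aset z - Aset v) <= measure F (UN i. S i)"
  unfolding S_def by (intro F.finite_measure_mono) auto
 also have "... <= (SUM i:UNIV. measure F (S i))"
  unfolding S_def by (rule measure_UNION_le) auto
 also have "... <= (SUM i:(UNIV::'n set). dl)" by (rule sum_mono) (rule S)
 also have "... = CARD('n) * dl" by simp
 finally show ?thesis .
qed

definition W :: "nat => (real^'n) set => (nat => real^'n) => real" where
 "W n S X = Gsum n (%x. indicator S x - measure F S) X"

lemma W_orthant: "W n (orthant t) X = Gsum n (%x. ebeta x t) X"
 by (simp add: W_def ebeta_def[abs_def] cdf_vec_orthant)

lemma W_Diff:
 assumes "S <= T" and [measurable]: "S : sets borel" "T : sets borel"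
 shows "W n (T - S) X = W n T X - W n S X"
proof -
 have m: "measure F (T - S) = measure F T - measure F S" using assms by (intro F.finite_measure_Diff) auto
 have ind: "indicat_real (T - S) x = indicator T x - indicator S x" for x using assms by (auto simp: indicator_def)
 have "(%x. indicat_real (T - S) x - (measure F T - measure F S)) = (%x. (indicator T x - measure F T) - (indicator S x - measure F S))"
  by (rule ext, subst ind) simp
 thus ?thesis unfolding W_def m Gsum_diff[symmetric] by simp
qed

text \<open>Bracketing: the count in S is at most the count in T, and the centring terms cost at
  most sqrt n times the mass of T. It closes the chain at its finest level.\<close>

lemma W_squeeze:
 assumes "S <= T" and [measurable]: "S : sets borel" "T : sets borel"
 shows "abs (W n S X) <= abs (W n T X) + sqrt n * measure F T"
proof (cases "n = 0")
 case False
 define a where "a = (%S. (SUM i<n. indicat_real S (X i)))"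
 have W: "W n S X = a S / sqrt n - sqrt n * measure F S" for S
 proof -
  have "real n * c / sqrt n = (real n / sqrt n) * c" for c by simp
  thus ?thesis by (simp add: W_def Gsum_def a_def sum_subtractf diff_divide_distrib real_div_sqrt)
 qed
 have a: "0 <= a S" "a S <= a T"
  unfolding a_def by (rule sum_nonneg, simp, rule sum_mono, use assms(1) in \<open>auto simp: indicator_def\<close>)
 hence "a S / sqrt n <= a T / sqrt n" "0 <= a S / sqrt n" by (auto intro: divide_right_mono)
 moreover have "measure F S <= measure F T" using assms by (intro F.finite_measure_mono) auto
 hence "sqrt n * measure F S <= sqrt n * measure F T" by (intro mult_left_mono) auto
 moreover have "0 <= sqrt n * measure F S" by simp
 ultimately show ?thesis unfolding W by linarith
qed (simp add: W_def Gsum_def)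

lemma W_measurable [measurable]: "S : sets borel ==> W n S : bmeas (P n)"
 unfolding W_def[abs_def] sample_law_def
 by (subst measurable_cong[of _ _ "Gsum n (%x. indicator S x - measure F S)"]) (auto intro!: F.Gsum_measurable)

text \<open>Chernoff's bound with s = 1/sqrt p. The condition 1 <= n p says exactly that this s is
  admissible for a summand bounded by 1, and s^2 p = 1 accounts for the factor exp 1.\<close>

lemma W_tail:
 assumes [measurable]: "S : sets borel" and var: "measure F S * (1 - measure F S) <= p"
  and p: "0 < p" "1 <= real n * p"
 shows "measure (P n) {X:space (P n). abs (W n S X) >= l} <= 2 * exp 1 * exp (- l / sqrt p)"
proof -
 have n: "n > 0" using p by (cases n) auto
 let ?f = "%x. indicat_real S x - measure F S"
 have b: "abs (?f x) <= 1" for x by (auto simp: indicator_def)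
 have zero: "(LINT x|F. ?f x) = 0" by (subst LINT_diff) (auto simp: F.emeasure_eq_measure)
 have "(LINT x|F. (?f x)^2) = (LINT x|F. (1 - 2 * measure F S) * indicat_real S x + (measure F S)^2)"
  by (intro LINT_cong refl) (auto simp: indicator_def power2_eq_square algebra_simps)
 also have "... = measure F S * (1 - measure F S)"
  by (subst LINT_add) (auto simp: F.emeasure_eq_measure power2_eq_square algebra_simps)
 finally have sq: "(LINT x|F. (?f x)^2) <= p" using var by simp
 let ?a = "1 / sqrt p"
 have "1 / sqrt p <= sqrt n"
 proof -
  have "1 <= sqrt (real n * p)" using p by simp
  thus ?thesis using p by (simp add: real_sqrt_mult divide_le_eq)
 qed
 hence "measure (P n) {X:space (P n). abs (W n S X) >= l} <= 2 * exp (?a^2 * p - ?a * l)"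
  unfolding W_def sample_law_def
  by (intro F.Gsum_tail[OF _ b zero sq _ _ n]) (use p in auto)
 also have "?a^2 * p - ?a * l = 1 + - l / sqrt p" using p by (simp add: power_divide)
 finally show ?thesis by (simp only: exp_add mult.assoc)
qed

text \<open>With mesh 16^-k, differences between neighbouring levels have standard deviation of
  order 4^-k, while the chain allows 2^-k at level k; the ratio 2^k is what beats the number of grid
  points.\<close>

definition Grid :: "nat => (real^'n) set" where
 "Grid k = {v. ALL i. EX j<=(16::nat)^k. v $ i = real j / 16^k}"

lemma Grid_finite: "finite (Grid k)" and Grid_card: "card (Grid k) <= (2 * 16^k) ^ CARD('n)"
proof -
 define G where "G = (%j. real j / 16^k) ` {..(16::nat)^k}"
 have G: "finite G" "card G <= Suc (16^k)" unfolding G_def using card_image_le[of "{..(16::nat)^k}"] by auto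
 let ?a = "Pi\<^sub>E UNIV (%_. G)"
 have eq: "Grid k = vec_lambda ` ?a"
 proof
  show "Grid k <= vec_lambda ` ?a"
  proof
   fix v assume "v : Grid k"
   hence "vec_nth v : Pi\<^sub>E UNIV (%_. G)" by (auto simp: Grid_def G_def)
   thus "v : vec_lambda ` ?a" by (metis image_eqI vec_nth_inverse)
  qed
  show "vec_lambda ` ?a <= Grid k"
   by (force simp: Grid_def G_def)
 qed
 have fin: "finite (Pi\<^sub>E (UNIV::'n set) (%_. G))" using G by (intro finite_PiE) auto
 show "finite (Grid k)" unfolding eq using fin by simp
 have "card (Grid k) <= card G ^ CARD('n)" by (use card_image_le[OF fin] in \<open>force simp: card_PiE eq\<close>)
 also have "... <= (2 * 16^k) ^ CARD('n)" using G by (intro power_mono) (auto intro: order_trans)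
 finally show "card (Grid k) <= (2 * 16^k) ^ CARD('n)" .
qed

lemma Grid_Suc: "Grid k <= Grid (Suc k)"
proof
 fix v assume v: "v : Grid k"
 show "v : Grid (Suc k)"
  unfolding Grid_def
 proof (rule CollectI, rule allI)
  fix i
  obtain j where "j <= 16^k" "v $ i = real j / 16^k" using v by (auto simp: Grid_def)
  hence "16 * j <= 16^Suc k" "v $ i = real (16 * j) / 16^Suc k" by auto
  thus "EX j<=16 ^ Suc k. v $ i = real j / 16 ^ Suc k" by blast
 qed
qed

definition fl :: "nat => real^'n => real^'n" where "fl k v = (\<chi> i. of_int \<lfloor>16^k * v $ i\<rfloor> / 16^k)"

lemma fl_bounds:
 assumes "!!i. 0 <= v $ i" "!!i. v $ i < 1"
 shows "fl k v : Grid k" "fl k v + (\<chi> i. 1 / 16^k) : Grid k"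
  and "fl k v $ i <= v $ i" "v $ i <= fl k v $ i + 1 / 16^k" "fl k v $ i <= fl (Suc k) v $ i"
  "fl (Suc k) v $ i <= fl k v $ i + 1 / 16^k" "0 <= fl k v $ i" "fl k v $ i + 1 / 16^k <= 1" "fl k v $ i <= 1"
proof -
 have fl: "fl k v $ i = of_int \<lfloor>16^k * v $ i\<rfloor> / 16^k" for k i by (simp add: fl_def)
 define J where "J = (%k i. nat \<lfloor>16^k * v $ i\<rfloor>)"
 have J0: "0 <= \<lfloor>16^k * v $ i\<rfloor>" for k i using assms(1)[of i] by simp
 hence J: "real (J k i) = of_int \<lfloor>16^k * v $ i\<rfloor>" for k i by (simp add: J_def)
 have flJ: "fl k v $ i = real (J k i) / 16^k" for k i by (simp add: fl J)
 have lt: "16^k * v $ i < 16^k" for k i using assms(2)[of i] by simp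
 have J1: "J k i < 16^k" for k i
  by (simp add: lt floor_less_iff J0 J_def nat_less_iff)
 show "fl k v : Grid k" unfolding Grid_def using flJ J1 by (auto intro!: less_imp_le)
 have s: "fl k v $ i + 1 / 16^k = real (Suc (J k i)) / 16^k" for k i by (simp add: flJ add_divide_distrib)
 show "fl k v + (\<chi> i. 1 / 16^k) : Grid k" unfolding Grid_def using s J1
  by (auto intro!: exI[of _ "Suc (J k _)"] Suc_leI)
 have J2: "Suc (J k i) <= 16^k" for k i using J1 by (rule Suc_leI)
 show "fl k v $ i + 1 / 16^k <= 1" unfolding s
 proof -
  have "real (Suc (J k i)) <= 16^k" using J2[of k i] by (metis of_nat_le_iff of_nat_numeral of_nat_power)
  thus "real (Suc (J k i)) / 16^k <= 1" by simp
 qed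
 thus "fl k v $ i <= 1" by (meson add_increasing2 order_trans zero_le_divide_1_iff zero_le_numeral zero_le_power order_refl add_le_cancel_left le_add_same_cancel1)
 show "0 <= fl k v $ i" by (simp add: flJ)
 have low: "fl k v $ i <= v $ i" for k unfolding fl by (simp add: field_simps)
 have up: "v $ i <= fl k v $ i + 1 / 16^k" for k
 proof -
  have "16^k * v $ i <= of_int \<lfloor>16^k * v $ i\<rfloor> + 1" by auto
  thus ?thesis unfolding fl by (simp add: field_simps)
 qed
 show "fl k v $ i <= v $ i" "v $ i <= fl k v $ i + 1 / 16^k" by (rule low, rule up)
 show "fl (Suc k) v $ i <= fl k v $ i + 1 / 16^k" using low[of "Suc k"] up[of k] by auto
 have "16 * \<lfloor>16^k * v $ i\<rfloor> <= \<lfloor>16^Suc k * v $ i\<rfloor>"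
  by (subst le_floor_iff) (simp add: mult.assoc)
 hence "16 * real_of_int \<lfloor>16^k * v $ i\<rfloor> <= of_int \<lfloor>16^Suc k * v $ i\<rfloor>" by auto
 thus "fl k v $ i <= fl (Suc k) v $ i" unfolding fl by (simp add: field_simps)
qed

end

context local_alternatives begin

text \<open>Union bound over pairs of grid points. The ratio of the allowed increment ep/2^(k+1) to
  sqrt p is c 2^k, so every tail is of order exp (-c 2^k), while the number of pairs grows like
  2^(8dk).\<close>

lemma grid_tail:
 assumes ep: "0 < ep"
 shows "EX C>0. ALL k n. 1 <= real n * ((real CARD('n) + 1) / 16^k) -->
  (EX B:sets (P n). measure (P n) B <= C / 2^k &
   (ALL X:space (P n) - B. ALL x:Grid (Suc k). ALL y:Grid (Suc k).
    measure F (Aset x - Aset y) * (1 - measure F (Aset x - Aset y)) <= (real CARD('n) + 1) / 16^k -->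
    abs (W n (Aset x - Aset y) X) < ep / 2^Suc k))"
proof -
 define d where "d = CARD('n)"
 \<comment> \<open>The exponential tail is traded for the power 2^(-km); m is one more than the
   exponent 8d of the number of pairs, which leaves 2^-k.\<close>
 define m where "m = 8 * d + 1"
 define c where "c = ep / (2 * sqrt (real d + 1))"
 have c: "0 < c" using ep by (simp add: c_def)
 define C where "C = 32 ^ (2 * d) * (2 * exp 1) * (real m / c) ^ m"
 have C: "0 < C" unfolding C_def using c by (simp add: m_def)
 show ?thesis unfolding d_def[symmetric]
 proof (intro exI[of _ C] conjI allI impI)
  fix k n assume n: "1 <= real n * ((real d + 1) / 16^k)"
  \<comment> \<open>A cell difference has mass at most d/16^k. The additional 1/16^k is spent in
    \<open>chaining\<close> on sets of small variance.\<close>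
  define p where "p = (real d + 1) / 16^k"
  have p: "0 < p" by (simp add: p_def)
  let ?b = "Grid (Suc k)"
  define S where "S = {q : ?b \<times> ?b. measure F (Aset (fst q) - Aset (snd q)) * (1 - measure F (Aset (fst q) - Aset (snd q))) <= p}"
  define E where "E = (%q. {X:space (P n). abs (W n (Aset (fst q) - Aset (snd q)) X) >= ep / 2^Suc k})"
  have S: "finite S" "card S <= card (?b) * card (?b)"
   using Grid_finite[of "Suc k"] card_mono[of "?b \<times> ?b" S]
   by (auto simp: S_def)
  have Em: "E q : sets (P n)" for q
   by (simp add: W_measurable E_def)
  have sqrt16: "sqrt (16^k) = 4^k"
  proof -
   have "(16::real)^k = (4^k)^2" by (simp add: power2_eq_square flip: power_mult_distrib)
   thus ?thesis by simp
  qed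
  let ?c = "measure (P n)"
  have tail: "?c (E q) <= (2 * exp 1) * ((real m / c) ^ m / 2^(k * m))" if "q : S" for q
  proof -
   have "?c (E q) <= 2 * exp 1 * exp (- (ep / 2^Suc k) / sqrt p)"
    unfolding E_def by (rule W_tail) (use that p n in \<open>auto simp: S_def p_def\<close>)
   also have "- (ep / 2^Suc k) / sqrt p = - (c * 2^k)"
   proof -
    have "(4::real)^k = 2^k * 2^k" by (simp flip: power_mult_distrib)
    hence sp: "sqrt p = sqrt (real d + 1) / (2^k * 2^k)" by (simp add: p_def real_sqrt_divide sqrt16)
    have "(ep / (2 * u)) / (q / (u * u)) = (ep / (2 * q)) * u" if "0 < u" "0 < q" for u q :: real
     using that by auto
    from this[of "2^k" "sqrt (real d + 1)"] show ?thesis unfolding sp c_def by simp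
   qed
   also have "exp (- (c * 2^k)) <= (real m / (c * 2^k)) ^ m" by (rule exp_neg_le_power) (use c in \<open>auto simp: m_def\<close>)
   also have "... = (real m / c) ^ m / 2^(k * m)" by (simp add: power_divide power_mult_distrib power_mult)
   finally show ?thesis by simp
  qed
  let ?a = "2 * 16^Suc k"
  let ?d = "UN q:S. E q"
  have "?c ?d <= (SUM q:S. ?c (E q))"
   by (rule measure_UNION_le[OF S(1)]) (rule Em)
  also have "... <= (SUM q:S. (2 * exp 1) * ((real m / c) ^ m / 2^(k * m)))" by (rule sum_mono[OF tail])
  also have "... = real (card S) * ((2 * exp 1) * ((real m / c) ^ m / 2^(k * m)))" by simp
  also have "... <= (?a ^ d * ?a ^ d) * ((2 * exp 1) * ((real m / c) ^ m / 2^(k * m)))"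
  proof (rule mult_right_mono)
   have "card S <= ?a ^ d * ?a ^ d"
    using S(2) mult_mono[OF Grid_card[of "Suc k"] Grid_card[of "Suc k"]] by (simp add: d_def)
   hence "real (card S) <= real (?a ^ d * ?a ^ d)" by linarith
   thus "real (card S) <= ?a ^ d * ?a ^ d" by simp
  qed (use c in simp)
  also have "... = C / 2^k"
  proof -
   have "(?a ^ d * ?a ^ d :: real) = 32^(2*d) * 2^(k * (8 * d))"
   proof -
    have "(?a ^ d * ?a ^ d :: real) = (32 * 2^(4 * k))^(2 * d)" by (simp add: power_mult mult_2 power_add)
    also have "... = 32^(2*d) * 2^(k * (8 * d))" by (simp flip: power_mult)
    finally show ?thesis .
   qed
   moreover have "(2::real)^(k * m) = 2^(k * (8 * d)) * 2^k" by (simp add: m_def power_add)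
   ultimately show ?thesis by (simp add: C_def)
  qed
  finally have meas: "?c ?d <= C / 2^k" .
  show "EX B:sets (P n). ?c B <= C / 2^k &
   (ALL X:space (P n) - B. ALL x:?b. ALL y:?b.
    measure F (Aset x - Aset y) * (1 - measure F (Aset x - Aset y)) <= (real d + 1) / 16^k -->
    abs (W n (Aset x - Aset y) X) < ep / 2^Suc k)"
  proof (intro bexI[of _ "UN q:S. E q"] conjI ballI impI meas)
   show "?d : sets (P n)" using S(1) Em by auto
   fix X x y assume X: "X : space (P n) - ?d" and "x : ?b" "y : ?b"
    and v: "measure F (Aset x - Aset y) * (1 - measure F (Aset x - Aset y)) <= (real d + 1) / 16^k"
   hence "X ~: E (x, y)"
    using X by (simp add: S_def p_def)
   thus "abs (W n (Aset x - Aset y) X) < ep / 2^Suc k" using X by (auto simp: E_def)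
  qed
 qed (rule C)
qed

lemma Uvec_bounds: "0 <= Uvec t $ i" "Uvec t $ i < 1"
 using U_pos[of i "t $ i"] U_less_1[of i "t $ i"] by (auto simp: Uvec_def)

lemma exists_power16: assumes "1 <= (x::real)" shows "EX K. x <= 16^K & 16^K <= 16 * x"
proof -
 obtain N where N: "x <= 16^N" using real_arch_pow[of 16 x] by (auto intro: less_imp_le)
 define K where "K = (LEAST K. x <= 16^K)"
 have K: "x <= 16^K" unfolding K_def by (rule LeastI[of _ N]) (rule N)
 show ?thesis
 proof (cases K)
  case 0 thus ?thesis using K assms by (intro exI[of _ 0]) simp
 next
  case (Suc K')
  hence "~ x <= 16^K'" unfolding K_def using not_less_Least[of K' "%K. x <= 16^K"] by simp
  thus ?thesis using K Suc by (intro exI[of _ K]) simp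
 qed
qed

text \<open>The final level K must be fine enough for the bracket to cost at most ep, that is 16^K
  >= sqrt n d/ep, and coarse enough for \<open>W_tail\<close>, that is 16^K <= n (d+1). Powers of 16
  meet this window because sqrt n is eventually much smaller than n.\<close>

lemma levels_eventually:
 assumes ep: "0 < ep"
 shows "EV n. EX K>=k0. sqrt (real n) * CARD('n) <= ep * 16^K & 16^K <= real n * (real CARD('n) + 1)"
proof -
 define d where "d = real CARD('n)"
 have d1: "1 <= d" unfolding d_def by auto
 let ?a = "max 1 (max (ep * 16^k0) (16 / ep))"
 define N where "N = (?a + ep)^2"
 show ?thesis
 proof (rule eventually_sequentiallyI[of "nat \<lceil>N\<rceil>"])
  fix n assume "nat \<lceil>N\<rceil> <= n"
  hence "N <= n" by auto
  hence s: "?a + ep <= sqrt n"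
   unfolding N_def by (simp add: real_le_rsqrt)
  define L where "L = ?a"
  have "1 <= L" "ep * 16^k0 <= L" "16 / ep <= L" by (simp_all add: L_def)
  hence s1: "1 <= sqrt n" "ep * 16^k0 <= sqrt n" "16 / ep <= sqrt n" "ep <= sqrt n"
   using s ep unfolding L_def[symmetric] by linarith+
  define x where "x = sqrt n * d / ep"
  have sd: "sqrt n <= sqrt n * d" using d1 s1(1) by simp
  have "ep <= sqrt n * d" using s1(4) sd by auto
  hence x1: "1 <= x" using ep by (simp add: x_def)
  obtain K where K: "x <= 16^K" "16^K <= 16 * x" using exists_power16[OF x1] by blast
  have "16^k0 <= x" using s1(2) sd ep by (simp add: x_def field_simps)
  hence "(16::real)^k0 <= 16^K" using K by linarith
  hence "k0 <= K" by auto
  moreover have "sqrt n * d <= ep * 16^K" using K(1) ep by (simp add: x_def field_simps)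
  moreover have "16^K <= real n * (d + 1)"
  proof -
   have "16 * x = (16 / ep) * (sqrt n * d)" by (simp add: x_def)
   also have "... <= sqrt n * (sqrt n * d)" using s1 d1 by (intro mult_right_mono) auto
   also have "... = real n * d" by simp
   also have "... <= real n * (d + 1)" by (intro mult_left_mono) auto
   finally show ?thesis using K(2) by auto
  qed
  ultimately show "EX K>=k0. sqrt (real n) * CARD('n) <= ep * 16^K & 16^K <= real n * (real CARD('n) + 1)"
   unfolding d_def by blast
 qed
qed

lemma sum_half_powers: "(SUM k=k0..K. C / 2^k) <= 2 * C / 2^k0" if "0 <= (C::real)"
proof -
 \<comment> \<open>The geometric bound is sharpened by the last summand, so that the induction
   closes.\<close>
 have "(SUM k=k0..K. C / 2^k) <= 2 * C / 2^k0 - (if k0 <= K then C / 2^K else 0)"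
 proof (induction K)
  case 0 thus ?case using that by simp
 next
  case (Suc K)
  show ?case
  proof (cases "k0 <= Suc K")
   case True
   thus ?thesis using Suc that by (cases "k0 <= K") (auto simp: le_Suc_eq)
  qed (use that in simp)
 qed
 moreover have "0 <= (if k0 <= K then C / 2^K else 0)" using that by simp
 ultimately show ?thesis by auto
qed

lemma cell_bound:
 fixes v :: "real^'n"
 assumes "!!i. 0 <= v $ i" "!!i. v $ i < 1"
 shows "measure F (Aset (fl k v + (\<chi> i. 1 / 16^k)) - Aset (fl k v)) <= CARD('n) * (1 / 16^k)"
  "measure F (Aset (fl (Suc k) v) - Aset (fl k v)) <= CARD('n) * (1 / 16^k)"
  "Aset (fl k v) <= Aset v" "Aset v <= Aset (fl k v + (\<chi> i. 1 / 16^k))" "Aset (fl k v) <= Aset (fl (Suc k) v)"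
proof -
 note b = fl_bounds[OF assms]
 let ?a = "Aset (fl k v + (\<chi> i. 1 / 16^k))"
 let ?b = "Aset (fl k v)"
 show "measure F (?a - ?b) <= CARD('n) * (1 / 16^k)"
  by (rule Aset_diff_measure) (use b(7,8) in auto)
 show "measure F (Aset (fl (Suc k) v) - ?b) <= CARD('n) * (1 / 16^k)"
  by (rule Aset_diff_measure) (use b(5,6,7,9) in \<open>auto simp: diff_le_eq add.commute\<close>)
 show "?b <= Aset v" by (rule Aset_mono) (rule b)
 show "Aset v <= ?a" by (rule Aset_mono) (use b(4) in simp)
 show "?b <= Aset (fl (Suc k) v)" by (rule Aset_mono) (rule b)
qed

lemma var_le_measure: "measure F S * (1 - measure F S) <= measure F S"
 by (simp add: mult_left_le)

text \<open>The chain runs through the lower grid corners from level k0 to K and then to the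
  orthant. The links at level k cost ep/2^(k+1), in total less than ep, and the final bracket costs
  about another ep. The start k0 is so large that the exceptional probabilities C/2^k sum to at most
  et. If the variance at t is small, so is that of its corner at level k0, and that set is compared
  with the empty set.\<close>

lemma chaining:
 assumes ep: "0 < ep" and et: "0 < et"
 shows "EX k0>=ka. EV n. EX B:sets (P n). measure (P n) B <= et &
  (ALL X:space (P n) - B. ALL t. abs (W n (orthant t) X - W n (Aset (fl k0 (Uvec t))) X) <= 2 * ep &
    (k3 F t t <= 1 / 16^k0 --> abs (W n (orthant t) X) <= 3 * ep))"
proof -
 define d where "d = real CARD('n)"
 obtain C where C: "0 < C" and CB: "!!k n. 1 <= real n * ((d + 1) / 16^k) ==>
  (EX B:sets (P n). measure (P n) B <= C / 2^k &
   (ALL X:space (P n) - B. ALL x:Grid (Suc k). ALL y:Grid (Suc k).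
    measure F (Aset x - Aset y) * (1 - measure F (Aset x - Aset y)) <= (d + 1) / 16^k -->
    abs (W n (Aset x - Aset y) X) < ep / 2^Suc k))"
  using grid_tail[OF ep] unfolding d_def by blast
 obtain k2 where k2: "2 * C / et < 2^k2" using real_arch_pow[of 2 "2 * C / et"] by auto
 define k0 where "k0 = max ka k2"
 have "(2::real)^k2 <= 2^k0" unfolding k0_def by (intro power_increasing) auto
 hence "2 * C / et <= 2^k0" using k2 by linarith
 hence Ck0: "2 * C / 2^k0 <= et" using et by (simp add: field_simps)
 show ?thesis
 proof (intro exI[of _ k0] conjI)
  show "k0 >= ka" by (simp add: k0_def)
  show "EV n. EX B:sets (P n). measure (P n) B <= et &
  (ALL X:space (P n) - B. ALL t. abs (W n (orthant t) X - W n (Aset (fl k0 (Uvec t))) X) <= 2 * ep &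
    (k3 F t t <= 1 / 16^k0 --> abs (W n (orthant t) X) <= 3 * ep))"
   using levels_eventually[OF ep, of k0, folded d_def]
  proof eventually_elim
   case (elim n)
   then obtain K where K: "k0 <= K" "sqrt n * d <= ep * 16^K" "16^K <= real n * (d + 1)" by blast
   have lev: "1 <= real n * ((d + 1) / 16^k)" if "k <= K" for k
   proof -
    have "(16::real)^k <= 16^K" using that by (intro power_increasing) auto
    hence "16^k <= real n * (d + 1)" using K(3) by linarith
    thus ?thesis by auto
   qed
   let ?a = "measure (P n)"
   have "ALL k:{k0..K}. EX B. B : sets (P n) & ?a B <= C / 2^k &
    (ALL X:space (P n) - B. ALL x:Grid (Suc k). ALL y:Grid (Suc k).
    measure F (Aset x - Aset y) * (1 - measure F (Aset x - Aset y)) <= (d + 1) / 16^k -->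
    abs (W n (Aset x - Aset y) X) < ep / 2^Suc k)"
    using CB[OF lev] by (metis atLeastAtMost_iff)
   then obtain BB where BB: "!!k. k : {k0..K} ==> BB k : sets (P n)" "!!k. k : {k0..K} ==> ?a (BB k) <= C / 2^k"
    and small: "!!k X x y. k : {k0..K} ==> X : space (P n) - BB k ==> x : Grid (Suc k) ==> y : Grid (Suc k) ==>
     measure F (Aset x - Aset y) * (1 - measure F (Aset x - Aset y)) <= (d + 1) / 16^k ==> abs (W n (Aset x - Aset y) X) < ep / 2^Suc k"
    by (metis (no_types, lifting) bchoice)
   define B where "B = (UN k:{k0..K}. BB k)"
   have "?a B <= (SUM k:{k0..K}. ?a (BB k))"
    unfolding B_def by (rule measure_UNION_le) (use BB in auto)
   also have "... <= (SUM k=k0..K. C / 2^k)" by (rule sum_mono) (use BB in auto)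
   also have "... <= 2 * C / 2^k0" using C by (intro sum_half_powers) simp
   finally have mB: "?a B <= et" using Ck0 by auto
   have main: "abs (W n (orthant t) X - W n (Aset (fl k0 (Uvec t))) X) <= 2 * ep &
    (k3 F t t <= 1 / 16^k0 --> abs (W n (orthant t) X) <= 3 * ep)" if X: "X : space (P n) - B" for X t
   proof -
    define v where "v = Uvec t"
    have v01: "0 <= v $ i" "v $ i < 1" for i unfolding v_def by (rule Uvec_bounds)+
    note flb = fl_bounds[OF v01] and cb = cell_bound[OF v01, folded d_def]
    have XB: "X : space (P n) - BB k" if "k : {k0..K}" for k using X that by (auto simp: B_def)
    have d1: "d * (1 / 16^k) <= (d + 1) / 16^k" for k by (simp add: divide_right_mono)
    have inc: "abs (W n (Aset (fl (Suc k) v)) X - W n (Aset (fl k v)) X) <= ep / 2^Suc k" if k: "k : {k0..K}" for k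
    proof -
     have "abs (W n (Aset (fl (Suc k) v) - Aset (fl k v)) X) < ep / 2^Suc k"
      by (rule small[OF k XB[OF k]]) (use flb(1) Grid_Suc order_trans[OF var_le_measure order_trans[OF cb(2) d1]] in blast)+
     thus ?thesis using W_Diff[OF cb(5)] by simp
    qed
    let ?b = "Aset (fl k0 v)"
    \<comment> \<open>Geometric sum of the links in closed form; the negative term later absorbs the
      bracket at level K.\<close>
    have tele: "abs (W n (Aset (fl k v)) X - W n (?b) X) <= ep / 2^k0 - ep / 2^k" if "k0 <= k" "k <= K" for k
     using that
    proof (induction k rule: dec_induct)
     case (step k)
     have "abs (W n (Aset (fl (Suc k) v)) X - W n (Aset (fl k v)) X) <= ep / 2^Suc k" using step by (intro inc) auto
     moreover have "ep / 2^k = 2 * (ep / 2^Suc k)" by simp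
     moreover have "abs (W n (Aset (fl k v)) X - W n (?b) X) <= ep / 2^k0 - ep / 2^k"
      using step.IH step.prems by simp
     ultimately show ?case by auto
    qed simp
    let ?c = "Aset (fl K v)"
    \<comment> \<open>The cell of level K containing v, as a difference of two grid sets; the gap
      between the orthant and its lower corner set lies inside it.\<close>
    define R where "R = Aset (fl K v + (\<chi> i. 1 / 16^K)) - ?c"
    have Rm: "R : sets borel" unfolding R_def by measurable
    have WR: "abs (W n R X) < ep / 2^Suc K"
     unfolding R_def
     by (rule small[OF _ XB]) (use K(1) flb(1,2) Grid_Suc order_trans[OF var_le_measure order_trans[OF cb(1) d1]] in \<open>auto\<close>)
    have PR: "sqrt n * measure F R <= ep"
    proof -
     have "sqrt n * measure F R <= sqrt n * (d * (1 / 16^K))" unfolding R_def using cb(1) by (intro mult_left_mono) auto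
     also have "... <= ep" using K(2) by (simp add: field_simps)
     finally show ?thesis .
    qed
    have last: "abs (W n (Aset v) X - W n (?c) X) <= ep / 2^Suc K + ep"
    proof -
     have "W n (Aset v) X - W n (?c) X = W n (Aset v - ?c) X" by (rule W_Diff[OF cb(3), symmetric]) auto
     moreover have "abs (W n (Aset v - ?c) X) <= abs (W n R X) + sqrt n * measure F R"
      by (rule W_squeeze[OF _ _ Rm]) (use cb(4) in \<open>auto simp: R_def\<close>)
     ultimately show ?thesis using WR PR by auto
    qed
    have "ep / 2^k <= ep" for k using frac_le[of ep ep 1 "2^k"] ep by simp
    moreover have "ep / 2^Suc K <= ep / 2^K" using ep by (simp add: field_simps)
    ultimately have e: "ep / 2^k0 <= ep" "ep / 2^Suc K <= ep / 2^K" "ep / 2^Suc k0 <= ep" by blast+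
    have A: "abs (W n (orthant t) X - W n (?b) X) <= 2 * ep"
     using last tele[OF K(1) order_refl] e unfolding Aset_Uvec[symmetric] v_def[symmetric] by auto
    have "abs (W n (orthant t) X) <= 3 * ep" if k3: "k3 F t t <= 1 / 16^k0"
    proof -
     define p q where "p = measure F (Aset v)" and "q = measure F (?b)"
     have "k3 F t t = p * (1 - p)"
      by (simp add: k3_def vmin_def cdf_vec_orthant p_def v_def Aset_Uvec algebra_simps)
     have pq: "q <= p" "p - q <= d * (1 / 16^k0)" "0 <= q" "p <= 1"
     proof -
      show "q <= p" unfolding p_def q_def using cb(3) by (intro F.finite_measure_mono) auto
      have "p - q = measure F (Aset v - ?b)" unfolding p_def q_def by (rule F.finite_measure_Diff[symmetric]) (use cb(3) in auto)
      also have "... <= measure F (Aset (fl k0 v + (\<chi> i. 1 / 16^k0)) - ?b)" using cb(4) by (intro F.finite_measure_mono) auto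
      also have "... <= d * (1 / 16^k0)" by (rule cb(1))
      finally show "p - q <= d * (1 / 16^k0)" .
     qed (auto simp: p_def q_def)
     have "q * (1 - q) - p * (1 - p) = (p - q) * (p + q - 1)" by (simp add: algebra_simps)
     also have "... <= (p - q) * 1" using pq by (intro mult_left_mono) auto
     finally have var: "q * (1 - q) <= (d + 1) / 16^k0"
      using k3 \<open>k3 F t t = p * (1 - p)\<close> pq(2) by (simp add: add_divide_distrib)
     \<comment> \<open>The zero corner has an empty \<open>Aset\<close>, so the bound for pairs of
       grid points also bounds a single grid set.\<close>
     have z: "(0::real^'n) : Grid (Suc k0)" unfolding Grid_def by auto
     have A0: "Aset 0 = {}" unfolding Aset_def using U_pos by (auto simp: not_le)
     have "abs (W n (?b - Aset 0) X) < ep / 2^Suc k0"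
      by (rule small[OF _ XB]) (use K(1) flb(1) Grid_Suc z var in \<open>auto simp: A0 q_def\<close>)
     thus ?thesis using A e(3) by (simp add: A0)
    qed
    with A show ?thesis by (simp add: v_def)
   qed
   have "B : sets (P n)" unfolding B_def using BB(1) by auto
   with mB main show ?case by blast
  qed
 qed
qed

definition emp_process :: "nat => (nat => real^'n) => real^'n => real" where
 "emp_process n X t = Gsum n (%x. ebeta x t) X"

text \<open>The two indicators differ only on the cell. The factor 2 covers the difference of the
  indicators and that of their means.\<close>

lemma k3_cell:
 assumes "fl k (Uvec s) = fl k (Uvec t)"
 shows "abs (k3 F t s - k3 F t t) <= 2 * (CARD('n) / 16^k)"
proof -
 let ?c = "fl k (Uvec t)"
 let ?d = "Aset (?c + (\<chi> i. 1 / 16^k))"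
 define R where "R = ?d - Aset ?c"
 have [measurable]: "R : sets borel" unfolding R_def by measurable
 have sub: "Aset ?c <= orthant u & orthant u <= ?d" if "u = s \<or> u = t" for u
  using cell_bound(3,4)[of "Uvec u" k, OF Uvec_bounds] that assms by (auto simp: Aset_Uvec)
 have PR: "measure F R <= CARD('n) / 16^k"
  unfolding R_def using cell_bound(1)[of "Uvec t" k, OF Uvec_bounds] by simp
 let ?a = "indicat_real (orthant s)"
 let ?b = "indicator (orthant t)"
 have ind: "abs (?a x - ?b x) <= indicator R x" for x
  using sub[of s] sub[of t] by (auto simp: indicator_def R_def)
 have i: "integrable F (indicat_real A)" if "A : sets borel" for A
  by (rule F.integrable_bounded[of _ 1]) (use that in \<open>auto simp: indicator_def\<close>)
 have dF: "abs (cdf_vec F s - cdf_vec F t) <= measure F R"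
 proof -
  have "cdf_vec F s - cdf_vec F t = (LINT x|F. ?a x - ?b x)"
   using i by (simp add: cdf_vec_orthant)
  also have "abs ... <= (LINT x|F. abs (?a x - ?b x))" by auto
  also have "... <= (LINT x|F. indicat_real R x)" by (rule integral_mono) (use i ind in auto)
  finally show ?thesis by simp
 qed
 have ie: "integrable F (%x. ebeta x t * ebeta x u)" for u
  by (rule F.integrable_bounded[of _ 1]) (auto simp: abs_mult intro!: mult_le_one ebeta_bound)
 have "k3 F t s - k3 F t t = (LINT x|F. ebeta x t * (ebeta x s - ebeta x t))"
  using ie by (simp add: right_diff_distrib ebeta_cov)
 also have "abs ... <= (LINT x|F. abs (ebeta x t * (ebeta x s - ebeta x t)))" by auto
 also have "... <= (LINT x|F. indicat_real R x + measure F R)"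
 proof (rule integral_mono)
  show "integrable F (%x. abs (ebeta x t * (ebeta x s - ebeta x t)))"
   using ie by (intro integrable_abs) (simp add: right_diff_distrib)
  show "integrable F (%x. indicat_real R x + measure F R)" using i by simp
  fix x
  have "abs (ebeta x s - ebeta x t) <= indicator R x + measure F R"
   unfolding ebeta_def using ind[of x] dF by auto
  hence "abs (ebeta x t) * abs (ebeta x s - ebeta x t) <= 1 * (indicator R x + measure F R)"
   by (intro mult_mono ebeta_bound) auto
  thus "abs (ebeta x t * (ebeta x s - ebeta x t)) <= indicat_real R x + measure F R" by (simp add: abs_mult)
 qed
 also have "... = 2 * measure F R" using i by simp
 finally show ?thesis using PR by auto
qed

text \<open>Every t is represented by one of finitely many points. The covariance clause makes t
  substantially correlated with its representative unless its variance is small, and the last clause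
  handles the small variances that occur near infinity; together they replace compactness of the
  index set.\<close>

theorem emp_process_equicontinuous:
 assumes ep: "0 < ep" and et: "0 < et"
 shows "EX ta dl. 0 < dl & finite (range ta) & (ALL t. abs (k3 F t (ta t) - k3 F t t) <= et) &
  (EV n. EX B:sets (P n). measure (P n) B <= et &
   (ALL X:space (P n) - B. ALL t. abs (emp_process n X t - emp_process n X (ta t)) <= ep &
     (k3 F t t <= dl --> abs (emp_process n X t) <= ep)))"
proof -
 obtain ka where ka: "2 * real CARD('n) / et < 16^ka" using real_arch_pow[of 16 "2 * real CARD('n) / et"] by auto
 have ep4: "0 < ep / 4" using ep by simp
 obtain k0 where k0: "k0 >= ka" and ev: "EV n. EX B:sets (P n). measure (P n) B <= et &
  (ALL X:space (P n) - B. ALL t. abs (W n (orthant t) X - W n (Aset (fl k0 (Uvec t))) X) <= 2 * (ep / 4) &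
    (k3 F t t <= 1 / 16^k0 --> abs (W n (orthant t) X) <= 3 * (ep / 4)))"
  using chaining[OF ep4 et, of ka] by blast
 \<comment> \<open>One point of each occupied cell; finiteness of the grid makes the range of
   \<open>ta\<close> finite.\<close>
 define g where "g = (%c. SOME s. fl k0 (Uvec s) = c)"
 define ta where "ta = (%t. g (fl k0 (Uvec t)))"
 have cell: "fl k0 (Uvec (ta t)) = fl k0 (Uvec t)" for t
  unfolding ta_def g_def by (rule someI_ex) blast
 have "range ta <= g ` Grid k0" unfolding ta_def using fl_bounds(1)[OF Uvec_bounds] by auto
 hence fin: "finite (range ta)" using Grid_finite finite_surj by blast
 have close: "abs (k3 F t (ta t) - k3 F t t) <= et" for t
 proof -
  have "(16::real)^ka <= 16^k0" using k0 by (intro power_increasing) auto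
  hence "2 * real CARD('n) / et <= 16^k0" using ka by linarith
  hence "2 * (real CARD('n) / 16^k0) <= et" using et by (simp add: field_simps)
  thus ?thesis using k3_cell[OF cell, of t] by auto
 qed
 have "EV n. EX B:sets (P n). measure (P n) B <= et &
   (ALL X:space (P n) - B. ALL t. abs (emp_process n X t - emp_process n X (ta t)) <= ep &
     (k3 F t t <= 1 / 16^k0 --> abs (emp_process n X t) <= ep))"
  using ev
 proof eventually_elim
  case (elim n)
  then obtain B where B: "B : sets (P n)" "measure (P n) B <= et"
   and b: "!!X t. X : space (P n) - B ==> abs (W n (orthant t) X - W n (Aset (fl k0 (Uvec t))) X) <= 2 * (ep / 4)"
    "!!X t. X : space (P n) - B ==> k3 F t t <= 1 / 16^k0 ==> abs (W n (orthant t) X) <= 3 * (ep / 4)" by blast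
  let ?a = "emp_process n"
  have "abs (?a X t - ?a X (ta t)) <= ep & (k3 F t t <= 1 / 16^k0 --> abs (?a X t) <= ep)"
   if X: "X : space (P n) - B" for X t
  proof
   show "abs (?a X t - ?a X (ta t)) <= ep"
    using b(1)[OF X, of t] b(1)[OF X, of "ta t"] unfolding cell emp_process_def W_orthant[symmetric] by linarith
   show "k3 F t t <= 1 / 16^k0 --> abs (?a X t) <= ep"
   proof
    assume "k3 F t t <= 1 / 16^k0"
    from b(2)[OF X this] show "abs (?a X t) <= ep" unfolding emp_process_def W_orthant[symmetric] by auto
   qed
  qed
  with B show ?case by blast
 qed
 thus ?thesis using fin close by (intro exI[of _ ta] exI[of _ "1 / 16^k0"]) auto
qed

end

section \<open>Probabilities of finite-dimensional boxes\<close>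

lemma trapezoid_sandwich:
 assumes "a < b"
 shows "(if abs x <= a then 1 else 0) <= trapezoid (- a) a (b - a) x" "trapezoid (- a) a (b - a) x <= (if abs x <= b then 1 else 0)"
proof -
 show "(if abs x <= a then 1 else 0) <= trapezoid (- a) a (b - a) x"
  using assms by (simp add: trapezoid_def le_max_iff_disj abs_le_iff)
 have "(x + a) / (b - a) + 1 <= 0 \<or> (a - x) / (b - a) + 1 <= 0" if "~ abs x <= b"
  using assms that by (auto simp: field_simps)
 thus "trapezoid (- a) a (b - a) x <= (if abs x <= b then 1 else 0)"
  by (auto simp: trapezoid_def)
qed

lemma trapezoid_prod_sandwich:
 fixes Y :: "'j => 'a => real"
 assumes R: "prob_space R" and Y: "!!j. j : J ==> Y j : bmeas R" and J: "finite J" and ab: "a < b"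
 shows "measure R {x:space R. ALL j:J. abs (Y j x) <= a} <= (LINT x|R. (PROD j:J. trapezoid (- a) a (b - a) (Y j x)))"
  and "(LINT x|R. (PROD j:J. trapezoid (- a) a (b - a) (Y j x))) <= measure R {x:space R. ALL j:J. abs (Y j x) <= b}"
proof -
 interpret R: prob_space R by (rule R)
 let ?f = "trapezoid (- a) a (b - a)"
 have f: "fourier_approx ?f" using ab by (intro fourier_approx_trapezoid) simp
 have fm[measurable]: "?f : bmeas borel" using f by (simp add: fourier_approx_def)
 have f01: "0 <= ?f x" "?f x <= 1" for x by (auto simp: trapezoid_def)
 have Sm: "{x:space R. ALL j:J. abs (Y j x) <= d} : sets R" for d
  by (rule sets.sets_Collect_finite_All[OF _ J]) (use Y in measurable)
 have ind: "measure R {x:space R. ALL j:J. abs (Y j x) <= d} = (LINT x|R. (PROD j:J. if abs (Y j x) <= d then 1 else 0))" for d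
 proof -
  have "measure R {x:space R. ALL j:J. abs (Y j x) <= d} = (LINT x|R. indicat_real {x:space R. ALL j:J. abs (Y j x) <= d} x)" using Sm by simp
  also have "... = (LINT x|R. (PROD j:J. if abs (Y j x) <= d then 1 else 0))"
   using J by (intro LINT_cong refl) (auto simp: indicator_def prod_zero_iff intro!: prod.neutral)
  finally show ?thesis .
 qed
 have i1: "integrable R (%x. PROD j:J. ?f (Y j x))"
 proof (rule R.integrable_bounded[of _ 1])
  show "(%x. PROD j:J. ?f (Y j x)) : bmeas R"
   by (intro borel_measurable_prod measurable_compose[OF Y fm])
  show "norm (PROD j:J. ?f (Y j x)) <= 1" for x
   using f01 by (auto simp: abs_prod intro!: prod_le_1)
 qed
 have i2: "integrable R (%x. PROD j:J. if abs (Y j x) <= d then 1 else 0 :: real)" for d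
 proof (rule R.integrable_bounded[of _ 1])
  show "(%x. PROD j:J. if abs (Y j x) <= d then 1 else 0 :: real) : bmeas R"
   by (intro borel_measurable_prod) (use Y in measurable)
  show "norm (PROD j:J. if abs (Y j x) <= d then 1 else 0 :: real) <= 1" for x
   by (auto simp: abs_prod intro!: prod_le_1)
 qed
 let ?a = "LINT x|R. (PROD j:J. ?f (Y j x))"
 show "measure R {x:space R. ALL j:J. abs (Y j x) <= a} <= ?a"
  unfolding ind using trapezoid_sandwich(1)[OF ab] by (intro integral_mono i1 i2 prod_mono) auto
 show "?a <= measure R {x:space R. ALL j:J. abs (Y j x) <= b}"
  unfolding ind using trapezoid_sandwich(2)[OF ab] f01 by (intro integral_mono i1 i2 prod_mono) auto
qed

text \<open>A trapezoid fits between the boxes of half-widths a and b. The gap a < b replaces any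
  condition that the boundary of the box be null.\<close>

lemma fdd_box:
 fixes X :: "nat => 'j => 'a => real" and Z :: "'j => 'b => real"
 assumes N: "!!n. prob_space (N n)" and M: "prob_space M"
  and X: "!!n j. j : J ==> X n j : bmeas (N n)" and Z: "!!j. j : J ==> Z j : bmeas M"
  and J: "finite J"
  and char: "!!a. (%n. (LINT om|(N n). iexp (SUM j:J. a j * X n j om))) ----> (LINT om|M. iexp (SUM j:J. a j * Z j om))"
  and ab: "a < b" and et: "0 < et"
 shows "EV n. measure (N n) {x:space (N n). ALL j:J. abs (X n j x) <= a} <= measure M {om:space M. ALL j:J. abs (Z j om) <= b} + et"
  and "EV n. measure M {om:space M. ALL j:J. abs (Z j om) <= a} - et <= measure (N n) {x:space (N n). ALL j:J. abs (X n j x) <= b}"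
proof -
 let ?f = "trapezoid (- a) a (b - a)"
 have f: "fourier_approx ?f" using ab by (intro fourier_approx_trapezoid) simp
 have lim: "(%n. (LINT x|(N n). (PROD j:J. ?f (X n j x)))) ----> (LINT om|M. (PROD j:J. ?f (Z j om)))"
  by (rule fdd_prod_tendsto[OF N M X Z J char f])
 have sX: "measure (N n) {x:space (N n). ALL j:J. abs (X n j x) <= a} <= (LINT x|(N n). (PROD j:J. ?f (X n j x)))"
  "(LINT x|(N n). (PROD j:J. ?f (X n j x))) <= measure (N n) {x:space (N n). ALL j:J. abs (X n j x) <= b}" for n
  using trapezoid_prod_sandwich[of "N n" J "X n", OF N X J ab] by auto
 note sZ = trapezoid_prod_sandwich[of M J Z, OF M Z J ab]
 show "EV n. measure (N n) {x:space (N n). ALL j:J. abs (X n j x) <= a} <= measure M {om:space M. ALL j:J. abs (Z j om) <= b} + et"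
  using tendstoD[OF lim et]
 proof eventually_elim
  case (elim n)
  thus ?case using sX(1)[of n] sZ(2) by (simp add: dist_real_def)
 qed
 show "EV n. measure M {om:space M. ALL j:J. abs (Z j om) <= a} - et <= measure (N n) {x:space (N n). ALL j:J. abs (X n j x) <= b}"
  using tendstoD[OF lim et]
 proof eventually_elim
  case (elim n)
  thus ?case using sX(2)[of n] sZ(1) by (simp add: dist_real_def)
 qed
qed

section \<open>The supremum of the limit process\<close>

lemma countable_no_three:
 fixes S :: "real set"
 assumes "!!x y z. x : S ==> y : S ==> z : S ==> x < y ==> y < z ==> False"
 shows "countable S"
proof (cases "EX a b. S <= {a, b}")
 case True thus ?thesis by (meson countable_finite finite.emptyI finite.insertI finite_subset)
next
 case False
 then obtain a where a: "a : S" by blast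
 obtain b where b: "b : S" "b ~= a" using False by blast
 obtain d where d: "d : S" "d ~= a" "d ~= b" using False by blast
 have False using assms[OF a b(1) d(1)] assms[OF a d(1) b(1)] assms[OF b(1) a d(1)] assms[OF b(1) d(1) a]
   assms[OF d(1) a b(1)] assms[OF d(1) b(1) a] b d by linarith
 thus ?thesis ..
qed

text \<open>After resampling along Z t every coordinate is affine in the fresh normal variable, with
  slope g j. If three points x < y < z of such a line belonged to the event, take a j with |g j| >=
  dl/sg at which the value for y is close to c in modulus. The values at x and z lie on either side
  of that value at distance at least d, and both lie in [-c,c], so the value at y has modulus at
  most c - d, a contradiction. Each line meets the event in a countable set.\<close>

lemma gaussian_sup_line_null:
 fixes Z :: "'s => 'b => real" and e :: "nat => 's"
 assumes G: "gaussian_process_real M I Z m K" and e: "range e <= I" and t: "t : I" and Kt: "0 < K t t" and dl: "0 < dl"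
 shows "measure M {om:space M. (ALL j. abs (Z (e j) om) <= c) & (ALL k. EX j. dl <= abs (K (e j) t) & c - 1 / Suc k < abs (Z (e j) om))} = 0"
proof -
 note facts = gaussian_process_real_facts[OF G]
 interpret M: prob_space M by (rule facts(1))
 let ?N = std_normal
 let ?M = "M >< ?N"
 interpret N: prob_space ?N by (rule prob_space_std_normal)
 interpret MN: pair_prob_space M ?N by unfold_locales
 define sg where "sg = sqrt (K t t)"
 have sg: "0 < sg" using Kt by (simp add: sg_def)
 define g where "g = (%j. K (e j) t / sg)"
 define a where "a = (%j om. Z (e j) om - (Z t om - m t) / sg * g j)"
 define Y where "Y = (%j p. a j (fst p) + snd p * g j)"
 define A where "A = {y :: nat => real. (ALL j. abs (y j) <= c) & (ALL k. EX j. dl <= abs (K (e j) t) & c - 1 / Suc k < abs (y j))}"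
 let ?R = "PiM UNIV (%_::nat. borel :: real measure)"
 have A: "A : sets ?R"
 proof -
  have "{y:space ?R. (ALL j. abs (y j) <= c) & (ALL k. EX j. dl <= abs (K (e j) t) & c - 1 / Suc k < abs (y j))} : sets ?R" by measurable
  thus ?thesis by (simp add: A_def space_PiM)
 qed
 have Zm[measurable]: "Z (e j) : bmeas M" "Z t : bmeas M" for j using facts(2) e t by auto
 have am[measurable]: "a j : bmeas M" for j unfolding a_def by measurable
 have Ym[measurable]: "Y j : bmeas ?M" for j unfolding Y_def by measurable
 let ?a = "%om j. Z (e j) om"
 let ?b = "%p j. Y j p"
 have law: "distr ?M ?R ?b = distr M ?R ?a"
 proof (rule law_eq_of_char[OF MN.prob_space_axioms M.prob_space_axioms Ym Zm(1)])
  fix J :: "nat set" and b assume J: "finite J"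
  have "e ` J <= I" using e by auto
  from gaussian_resample_char[OF G J this t Kt, of b]
  show "(LINT p|?M. iexp (SUM j:J. b j * Y j p)) = (LINT om|M. iexp (SUM j:J. b j * Z (e j) om))"
   by (simp add: Y_def a_def g_def sg_def)
 qed
 have YR: "?b : ?M \<rightarrow>\<^sub>M ?R" by (rule measurable_PiM_single') auto
 have ZR: "?a : M \<rightarrow>\<^sub>M ?R" by (rule measurable_PiM_single') auto
 have "measure M (?a -` A Int space M) = measure ?M (?b -` A Int space ?M)"
  using measure_distr[OF YR A] measure_distr[OF ZR A] by (simp only: law)
 also have "... = 0"
 proof -
  let ?E = "?b -` A Int space ?M"
  have Em: "?E : sets ?M" by (rule measurable_sets[OF YR A])
  have cnt: "countable (Pair om -` ?E)" if "om : space M" for om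
  proof (rule countable_no_three)
   fix x y z assume x: "x : Pair om -` ?E" and y: "y : Pair om -` ?E" and z: "z : Pair om -` ?E" and xyz: "x < y" "y < z"
   \<comment> \<open>The least change of a coordinate with |g j| >= dl/sg between y and its nearer
     neighbour.\<close>
   define d where "d = dl / sg * min (y - x) (z - y)"
   have d: "0 < d" unfolding d_def using dl sg xyz by simp
   obtain k :: nat where k: "1 / Suc k < d" using nat_approx_posE[OF d] .
   have "EX j. dl <= abs (K (e j) t) & c - 1 / Suc k < abs (Y j (om, y))" using y by (auto simp: A_def)
   then obtain j where j: "dl <= abs (K (e j) t)" "c - 1 / Suc k < abs (Y j (om, y))" by blast
   have xz: "abs (a j om + x * g j) <= c" "abs (a j om + z * g j) <= c" using x z by (auto simp: A_def Y_def)
   have g: "dl / sg <= abs (g j)" unfolding g_def using j(1) sg by (simp add: divide_right_mono)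
   have d1: "d <= (y - x) * abs (g j)" "d <= (z - y) * abs (g j)"
    unfolding d_def mult.commute[of "dl / sg"] using g xyz dl sg by (auto simp del: times_divide_eq_right intro!: mult_mono)
   have "abs (a j om + y * g j) <= c - d"
   proof (cases "0 <= g j")
    case True
    have "d + x * g j <= y * g j" "d + y * g j <= z * g j" using d1 True by (simp_all add: algebra_simps)
    thus ?thesis using xz by auto
   next
    case False
    have "d + y * g j <= x * g j" "d + z * g j <= y * g j" using d1 False by (simp_all add: algebra_simps)
    thus ?thesis using xz by auto
   qed
   thus False using j(2) k by (simp add: Y_def)
  qed
  have "emeasure ?M ?E = nn_integral M (%om. 0)"
   unfolding N.emeasure_pair_measure_alt[OF Em] by (intro nn_integral_cong std_normal_countable_null cnt)
  thus ?thesis by (simp add: measure_def)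
 qed
 finally show ?thesis by (simp add: A_def Int_def conj_commute)
qed

text \<open>Enumeration of the points with rational coordinates; it makes suprema
  measurable.\<close>

definition qvec :: "nat => real^'n" where
 "qvec m = (\<chi> i. of_rat ((from_nat m :: 'n => rat) i))"

lemma sets_box:
 assumes "countable J" "!!j. j : J ==> Y j : bmeas M"
 shows "{om:space M. ALL j:J. abs (Y j om) <= (a j :: real)} : sets M"
 by (use sets.sets_Collect_countable_All assms in simp)

text \<open>The approach is strictly from above in every coordinate because the empirical process is
  only right-continuous.\<close>

lemma qvec_approach:
 fixes t :: "real^'n"
 shows "EX f. (%k. qvec (f k)) ----> t & (ALL k i. t $ i < qvec (f k) $ i)"
proof -
 define g where "g = (%(k::nat) i. SOME q. t $ i < of_rat q & of_rat q < t $ i + 1 / Suc k)"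
 have g: "t $ i < of_rat (g k i)" "of_rat (g k i) < t $ i + 1 / Suc k" for k i
  using someI_ex[OF of_rat_dense[of "t $ i" "t $ i + 1 / Suc k"]] by (auto simp: g_def)
 have q: "qvec (to_nat (g k)) $ i = of_rat (g k i)" for k i by (simp add: qvec_def)
 have "(%k. qvec (to_nat (g k)) $ i) ----> t $ i" for i
  unfolding q
 proof (rule tendsto_sandwich[OF _ _ tendsto_const])
  show "EV k. t $ i <= of_rat (g k i)" using g(1) by (simp add: less_imp_le)
  show "EV k. of_rat (g k i) <= t $ i + 1 / Suc k" using g(2) by (simp add: less_imp_le)
  show "(%k. t $ i + 1 / Suc k) ----> t $ i" using tendsto_add[OF tendsto_const LIMSEQ_inverse_real_of_nat, of "t $ i"] by (simp add: field_simps)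
 qed
 thus ?thesis using g(1) unfolding tendsto_vec_iff by (intro exI[of _ "%k. to_nat (g k)"]) (simp add: q)
qed

lemma indicator_orthant_right_continuous:
 assumes lim: "s ----> t" and gt: "!!k i. t $ i < s k $ i"
 shows "(%k. indicat_real (orthant (s k)) x) ----> indicator (orthant t) x"
proof (cases "x : orthant t")
 case True
 have "x $ i <= s k $ i" for i k using True gt[of i k] by (auto simp: orthant_def intro: order_trans)
 hence "x : orthant (s k)" for k by (simp add: orthant_def)
 thus ?thesis using True by simp
next
 case False
 then obtain i where i: "t $ i < x $ i" by (auto simp: orthant_def not_le)
 have "(%k. s k $ i) ----> t $ i" using lim by (simp add: tendsto_vec_iff)
 from order_tendstoD(2)[OF this i] have "EV k. indicat_real (orthant (s k)) x = 0"
  by eventually_elim (auto simp: orthant_def indicator_def not_le intro!: exI[of _ i])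
 thus ?thesis using False by (simp add: tendsto_eventually)
qed

context local_alternatives begin

lemma emp_process_right_continuous:
 assumes lim: "s ----> t" and gt: "!!k i. t $ i < s k $ i"
 shows "(%k. emp_process n X (s k)) ----> emp_process n X t"
 by (simp add: ebeta_def tendsto_diff indicator_orthant_right_continuous lim gt cdf_vec_tendsto F0_prob f0_measurable tendsto_mult tendsto_sum tendsto_const emp_process_def Gsum_def divide_inverse)

text \<open>\<open>KS_stat\<close> is a supremum of reals and says something only for a bounded
  family; sqrt n is a bound.\<close>

lemma KS_le_iff: "KS_stat F n X <= c \<longleftrightarrow> (ALL t. abs (emp_process n X t) <= c)"
proof -
 let ?a = "emp_process n X"
 have eq: "sqrt (real n) * abs (emp_cdf X n t - cdf_vec F t) = abs (?a t)" for t
  by (simp add: emp_process_def Gsum_ebeta abs_mult)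
 have "abs (?a t) <= sqrt (real n) * 1" for t
  unfolding emp_process_def by (rule F.Gsum_bound[OF ebeta_bound])
 hence "bdd_above (range (%t. abs (?a t)))" by (intro bdd_aboveI2)
 thus ?thesis unfolding KS_stat_def eq by (simp add: cSUP_le_iff)
qed

lemma emp_process_le_iff: "(ALL t. abs (emp_process n X t) <= c) \<longleftrightarrow> (ALL j. abs (emp_process n X (qvec j)) <= c)"
proof safe
 fix t :: "real^'n" assume all: "ALL j. abs (emp_process n X (qvec j)) <= c"
 obtain f where f: "(%k. qvec (f k)) ----> t" "!!k i. t $ i < qvec (f k) $ i" using qvec_approach by blast
 show "abs (emp_process n X t) <= c"
  by (rule LIMSEQ_le_const2[OF tendsto_rabs[OF emp_process_right_continuous[OF f]]]) (use all in auto)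
qed auto

lemma continuous_le_qvec_iff:
 fixes z :: "real^'n => real"
 assumes "continuous_on UNIV z"
 shows "(ALL t. abs (z t) <= c) \<longleftrightarrow> (ALL j. abs (z (qvec j)) <= c)"
proof safe
 fix t :: "real^'n" assume all: "ALL j. abs (z (qvec j)) <= c"
 obtain f where f: "(%k. qvec (f k)) ----> t" using qvec_approach by blast
 have "(%k. z (qvec (f k))) ----> z t" by (rule continuous_on_tendsto_compose[OF assms f]) auto
 thus "abs (z t) <= c"
  by (rule LIMSEQ_le_const2[OF tendsto_rabs]) (use all in auto)
qed auto

lemma k3_diag_pos: "0 < k3 F t t"
 by (simp add: vmin_def vec_eq_iff cdf_vec_strict f0_pos F.prob_space_axioms k3_def algebra_simps)

lemma emp_process_measurable [measurable]: "(%X. emp_process n X t) : bmeas (P n)"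
 unfolding emp_process_def sample_law_def by (rule F.Gsum_measurable) (use ebeta_measurable in \<open>simp add: measurable_cong_sets[OF sets_dens refl]\<close>)

lemma emp_process_measurable_Q [measurable]: "(%X. emp_process n X t) : bmeas (Q n)"
 using emp_process_measurable by (simp add: measurable_cong_sets[OF sets_Q refl])

lemma KS_box:
 assumes Z: "gaussian_process_real M UNIV Z (%t. ga * (cdf_vec H t - cdf_vec F t)) (k3 F)"
  and J: "finite J" and ab: "a < b" and et: "0 < et"
 shows "EV n. measure (Q n) {X:space (Q n). ALL j:J. abs (emp_process n X (u j)) <= a} <= measure M {om:space M. ALL j:J. abs (Z (u j) om) <= b} + et"
  and "EV n. measure M {om:space M. ALL j:J. abs (Z (u j) om) <= a} - et <= measure (Q n) {X:space (Q n). ALL j:J. abs (emp_process n X (u j)) <= b}"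
proof -
 interpret E: L2_test f0 h ga F round_vec ebeta 1 by (rule L2_test_ebeta)
 note facts = gaussian_process_real_facts[OF Z]
 have mean: "E.mean = (%t. ga * (cdf_vec H t - cdf_vec F t))" by (simp add: fun_eq_iff E.mean_def ebeta_mean_H)
 have cov: "E.cov = k3 F" by (simp add: fun_eq_iff E.cov_def ebeta_cov)
 have G: "gaussian_process_real M (space F) Z E.mean E.cov" using Z unfolding mean cov by simp
 have char: "(%n. (LINT X|(Q n). iexp (SUM j:J. a j * emp_process n X (u j)))) ----> (LINT om|M. iexp (SUM j:J. a j * Z (u j) om))" for a
  using E.GP_char[OF J _ G, of u a] by (simp add: E.GP_def emp_process_def)
 note box = fdd_box[where N=Q and X="%n j X. emp_process n X (u j)" and Z="%j. Z (u j)", OF Q.prob_space_axioms facts(1) emp_process_measurable_Q facts(2)[OF UNIV_I] J char ab et]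
 show "EV n. measure (Q n) {X:space (Q n). ALL j:J. abs (emp_process n X (u j)) <= a} <= measure M {om:space M. ALL j:J. abs (Z (u j) om) <= b} + et" by (rule box)
 show "EV n. measure M {om:space M. ALL j:J. abs (Z (u j) om) <= a} - et <= measure (Q n) {X:space (Q n). ALL j:J. abs (emp_process n X (u j)) <= b}" by (rule box)
qed

lemma measure_Q_bound:
 assumes "A : sets (P n)" "measure (P n) A <= (et / sqrt CQ)^2" "0 < et"
 shows "measure (Q n) A <= et"
proof -
 have "measure (Q n) A <= sqrt CQ * sqrt (measure (P n) A)" by (rule measure_Q_le) (rule assms(1))
 also have "... <= sqrt CQ * sqrt ((et / sqrt CQ)^2)" using CQ_ge_1 by (intro mult_left_mono real_sqrt_le_mono assms(2)) simp
 also have "... = et" using CQ_ge_1 assms(3) by simp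
 finally show ?thesis .
qed

context
 fixes M :: "'b measure" and Z :: "real^'n => 'b => real"
 assumes Z: "gaussian_process_real M UNIV Z (%t. ga * (cdf_vec H t - cdf_vec F t)) (k3 F)"
begin

interpretation M: prob_space M by (rule gaussian_process_real_facts(1)[OF Z])

lemmas Zm [measurable] = gaussian_process_real_facts(2)[OF Z UNIV_I]

text \<open>The hypotheses give no control of the paths of Z near infinity. It is inherited from the
  empirical process: finite boxes pass to the limit, and then the boxes decrease to the countable
  intersection.\<close>

lemma limit_small_near_zero_variance:
 assumes ep: "0 < ep" and et: "0 < et"
 shows "EX dl>0. 1 - et <= measure M {om:space M. ALL j. k3 F (qvec j) (qvec j) <= dl --> abs (Z (qvec j) om) <= ep}"
proof -
 let ?b = "et / 2 / sqrt CQ"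
 have "0 < ?b^2" using et CQ_ge_1 by simp
 from emp_process_equicontinuous[OF half_gt_zero[OF ep] this] obtain ta dl where dl: "0 < dl"
  and ev: "EV n. EX B:sets (P n). measure (P n) B <= ?b^2 &
   (ALL X:space (P n) - B. ALL t. abs (emp_process n X t - emp_process n X (ta t)) <= ep / 2 &
     (k3 F t t <= dl --> abs (emp_process n X t) <= ep / 2))" by blast
 \<comment> \<open>The asserted inequality does not involve n, so holding eventually is
   holding.\<close>
 have fin: "1 - et <= measure M {om:space M. ALL j:{j. j < m & k3 F (qvec j) (qvec j) <= dl}. abs (Z (qvec j) om) <= ep}" for m :: nat
 proof -
  let ?J = "{j. j < m & k3 F (qvec j) (qvec j) <= dl}"
  let ?c = "measure M {om:space M. ALL j:?J. abs (Z (qvec j) om) <= ep}"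
  have "EV n. measure (Q n) {X:space (Q n). ALL j:?J. abs (emp_process n X (qvec j)) <= ep / 2} <= ?c + et / 2"
   by (rule KS_box(1)[OF Z]) (use ep et in auto)
  hence "EV n. 1 - et <= ?c"
   using ev
  proof eventually_elim
   case (elim n)
   then obtain B where B: "B : sets (P n)" "measure (P n) B <= ?b^2"
    "!!X t. X : space (P n) - B ==> k3 F t t <= dl ==> abs (emp_process n X t) <= ep / 2" by blast
   have "1 - et / 2 <= measure (Q n) (space (Q n) - B)"
    using measure_Q_bound[OF B(1,2)] et Q.prob_compl[of B n] B(1) by (simp add: sets_Q)
   also have "... <= measure (Q n) {X:space (Q n). ALL j:?J. abs (emp_process n X (qvec j)) <= ep / 2}"
    by (rule Q.finite_measure_mono[OF _ sets_box[OF _ emp_process_measurable_Q]]) (use B(3) in \<open>auto simp: space_Q\<close>)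
   also note elim(1)
   finally show ?case by simp
  qed
  thus ?thesis by simp
 qed
 let ?a = "\<Inter>m. {om:space M. ALL j:{j. j < m & k3 F (qvec j) (qvec j) <= dl}. abs (Z (qvec j) om) <= ep}"
 have "(%m. measure M {om:space M. ALL j:{j. j < m & k3 F (qvec j) (qvec j) <= dl}. abs (Z (qvec j) om) <= ep}) ---->
   measure M ?a"
 proof (rule M.finite_Lim_measure_decseq)
  have "{om:space M. ALL j:{j. j < m & k3 F (qvec j) (qvec j) <= dl}. abs (Z (qvec j) om) <= ep} : sets M" for m
   by (rule sets_box[OF _ Zm]) auto
  thus "range (%m. {om:space M. ALL j:{j. j < m & k3 F (qvec j) (qvec j) <= dl}. abs (Z (qvec j) om) <= ep}) <= sets M" by blast
 qed (auto simp: decseq_def)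
 from LIMSEQ_le_const[OF this, of "1 - et"] fin
 have "1 - et <= measure M ?a" by blast
 also have "?a
   = {om:space M. ALL j. k3 F (qvec j) (qvec j) <= dl --> abs (Z (qvec j) om) <= ep}" by auto
 finally show ?thesis using dl by blast
qed

text \<open>Off an event of probability et, values near c are attained only at points of variance
  above dl. Such a point has covariance at least dl/2 with one of finitely many representatives, and
  for each representative \<open>gaussian_sup_line_null\<close> applies.\<close>

lemma limit_sup_no_atom:
 assumes c: "0 < c"
 shows "measure M {om:space M. (ALL j. abs (Z (qvec j) om) <= c) & (ALL k. EX j. c - 1 / Suc k < abs (Z (qvec j) om))} = 0" (is "measure M ?N = 0")
proof -
 have "measure M ?N <= et" if et: "0 < et" for et
 proof -
  obtain dl where dl: "0 < dl" and G: "1 - et <= measure M {om:space M. ALL j. k3 F (qvec j) (qvec j) <= dl --> abs (Z (qvec j) om) <= c / 2}" (is "_ <= measure M ?G")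
   using limit_small_near_zero_variance[OF half_gt_zero[OF c] et] by blast
  obtain ta where ta: "finite (range ta)" "!!t. abs (k3 F t (ta t) - k3 F t t) <= dl / 2"
   using emp_process_equicontinuous[OF zero_less_one half_gt_zero[OF dl]] by blast
  define E where "E = (%s. {om:space M. (ALL j. abs (Z (qvec j) om) <= c) & (ALL k. EX j. dl / 2 <= abs (k3 F (qvec j) s) & c - 1 / Suc k < abs (Z (qvec j) om))})"
  have E0: "measure M (E s) = 0" for s
   unfolding E_def by (rule gaussian_sup_line_null[OF Z _ UNIV_I k3_diag_pos]) (use dl in auto)
  have Em: "E s : sets M" for s unfolding E_def by measurable
  have Gm: "?G : sets M"
   by simp
  let ?c = "range ta"
  let ?a = "UN s:?c. E s"
  let ?b = "space M - ?G"
  have sub: "?N <= ?b Un ?a"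
  proof
   fix om assume om: "om : ?N"
   show "om : ?b Un ?a"
   proof (rule ccontr)
    assume no: "om ~: ?b Un ?a"
    hence g: "!!j. k3 F (qvec j) (qvec j) <= dl ==> abs (Z (qvec j) om) <= c / 2" using om by auto
    have "ALL s:?c. EX k. ALL j. dl / 2 <= abs (k3 F (qvec j) s) --> ~ c - 1 / Suc k < abs (Z (qvec j) om)"
     using no om unfolding E_def by auto
    then obtain kp where kp: "!!s j. s : ?c ==> dl / 2 <= abs (k3 F (qvec j) s) ==> ~ c - 1 / Suc (kp s) < abs (Z (qvec j) om)"
     unfolding bchoice_iff by blast
    obtain k0 :: nat where k0: "1 / Suc k0 < c / 2" using nat_approx_posE[OF half_gt_zero[OF c]] .
    \<comment> \<open>Large enough for \<open>k0\<close> and for all representatives together, so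
      that a single point j near the supremum contradicts all of them.\<close>
    define k where "k = Max (insert k0 (kp ` ?c))"
    have k: "k0 <= k" "!!s. s : ?c ==> kp s <= k" unfolding k_def by (rule Max_ge; use ta(1) in auto)+
    have mono: "1 / Suc k <= 1 / Suc l" if "l <= k" for l using that by (simp add: frac_le)
    obtain j where j: "c - 1 / Suc k < abs (Z (qvec j) om)" using om by blast
    hence "dl < k3 F (qvec j) (qvec j)"
     using k0 mono[OF k(1)] g[of j] by linarith
    hence "dl / 2 <= abs (k3 F (qvec j) (ta (qvec j)))" using ta(2)[of "qvec j"] by linarith
    from kp[OF _ this] show False using j mono[OF k(2)[of "ta (qvec j)"]] by auto
   qed
  qed
  have "measure M ?N <= measure M (?b Un ?a)"
   by (rule M.finite_measure_mono[OF sub]) (intro sets.Un sets.compl_sets Gm sets.finite_UN ta(1) Em)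
  also have "... <= measure M ?b + measure M ?a"
   by (intro measure_Un_le sets.compl_sets Gm sets.finite_UN ta(1) Em)
  also have "... <= measure M ?b + (SUM s:?c. measure M (E s))"
   by (intro add_left_mono measure_UNION_le ta(1) Em)
  also have "... <= et" using M.prob_compl[OF Gm] G by (simp add: E0)
  finally show ?thesis .
 qed
 hence "measure M ?N <= 0" by (rule field_le_epsilon) simp
 thus ?thesis by (simp add: measure_le_0_iff)
qed

text \<open>The upper bound for the acceptance probability uses finitely many rational points and a
  slack 1/(m+1). The lower bound starts from paths staying below c - 1/(k+1), loses only the event
  that the supremum equals c, and returns from finitely many points to all of them by
  equicontinuity.\<close>

theorem KS_power:
 assumes cont: "ALL om:space M. continuous_on UNIV (%t. Z t om)" and c: "0 < c"
 shows "(%n. measure (Q n) {X:space (Q n). KS_stat F n X > c}) ----> measure M {om:space M. (SUP t. ereal (abs (Z t om))) > ereal c}"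
proof -
 let ?a = "{om:space M. ALL j. abs (Z (qvec j) om) <= c}"
 define p where "p = measure M ?a"
 define q where "q = (%n. measure (Q n) {X:space (Q n). ALL j. abs (emp_process n X (qvec j)) <= c})"
 have cle: "(ALL t. abs (Z t om) <= d) \<longleftrightarrow> (ALL j. abs (Z (qvec j) om) <= d)" if "om : space M" for om d
  by (rule continuous_le_qvec_iff) (use cont that in auto)
 let ?b = "{om:space M. (SUP t. ereal (abs (Z t om))) > ereal c}"
 have eqM: "measure M ?b = 1 - p"
 proof -
  have "?b = space M - ?a"
   unfolding not_le[symmetric] SUP_le_iff by (auto simp: cle[symmetric])
  thus ?thesis unfolding p_def by (simp add: M.prob_compl)
 qed
 have eqQ: "measure (Q n) {X:space (Q n). KS_stat F n X > c} = 1 - q n" for n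
 proof -
  have "{X:space (Q n). KS_stat F n X > c} = space (Q n) - {X:space (Q n). ALL j. abs (emp_process n X (qvec j)) <= c}"
   by (auto simp: emp_process_le_iff[symmetric] KS_le_iff[symmetric])
  thus ?thesis unfolding q_def by (simp add: Q.prob_compl)
 qed
 have upper: "EV n. q n < p + et" if et: "0 < et" for et
 proof -
  let ?A = "%m::nat. {om:space M. ALL j:{..<m}. abs (Z (qvec j) om) <= c + 1 / Suc m}"
  let ?c = "\<Inter>m. ?A m"
  have "(%m. measure M (?A m)) ----> measure M ?c"
  proof (rule M.finite_Lim_measure_decseq)
   show "range ?A <= sets M" by auto
   show "decseq ?A"
   proof (unfold decseq_def, safe)
    fix k m :: nat and om j assume "k <= m" and all: "ALL j:{..<m}. abs (Z (qvec j) om) <= c + 1 / Suc m" and "j < k"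
    hence "abs (Z (qvec j) om) <= c + 1 / Suc m" "1 / Suc m <= 1 / Suc k" by (auto simp: frac_le)
    thus "abs (Z (qvec j) om) <= c + 1 / Suc k" by auto
   qed
  qed
  also have "?c = ?a"
  proof (intro set_eqI iffI)
   fix om assume om: "om : ?c"
   have "abs (Z (qvec j) om) <= c" for j
   proof (rule field_le_epsilon)
    fix e :: real assume e: "0 < e"
    obtain k :: nat where k: "1 / Suc k < e" using nat_approx_posE[OF e] .
    have "abs (Z (qvec j) om) <= c + 1 / Suc (max k (Suc j))" using om by auto
    moreover have "1 / Suc (max k (Suc j)) <= 1 / Suc k" by (simp add: frac_le)
    ultimately show "abs (Z (qvec j) om) <= c + e" using k by auto
   qed
   thus "om : ?a" using om by auto
  next
   fix om assume om: "om : ?a"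
   hence "abs (Z (qvec j) om) <= c + 1 / Suc m" for j m by (auto intro: add_increasing2)
   thus "om : ?c" using om by auto
  qed
  finally have "EV m. measure M (?A m) < p + et / 2"
   using et by (auto simp: p_def intro!: order_tendstoD)
  then obtain m where m: "measure M (?A m) < p + et / 2" by (auto dest: eventually_happens)
  have "EV n. measure (Q n) {X:space (Q n). ALL j:{..<m}. abs (emp_process n X (qvec j)) <= c} <= measure M (?A m) + et / 2"
   by (rule KS_box(1)[OF Z]) (use et in auto)
  thus ?thesis
  proof eventually_elim
   case (elim n)
   have "q n <= measure (Q n) {X:space (Q n). ALL j:{..<m}. abs (emp_process n X (qvec j)) <= c}"
    unfolding q_def by (rule Q.finite_measure_mono[OF _ sets_box[OF _ emp_process_measurable_Q]]) auto
   thus ?case using elim m by auto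
  qed
 qed
 have lower: "EV n. p - et < q n" if et: "0 < et" for et
 proof -
  let ?A = "%k::nat. {om:space M. ALL j. abs (Z (qvec j) om) <= c - 1 / Suc k}"
  let ?N = "{om:space M. (ALL j. abs (Z (qvec j) om) <= c) & (ALL k. EX j. c - 1 / Suc k < abs (Z (qvec j) om))}"
  let ?d = "measure M (UN k. ?A k)"
  have lim: "(%k. measure M (?A k)) ----> ?d"
  proof (rule M.finite_Lim_measure_incseq)
   show "range ?A <= sets M" by auto
   show "incseq ?A"
   proof (unfold incseq_def, safe)
    fix k m :: nat and om j assume "k <= m" and all: "ALL j. abs (Z (qvec j) om) <= c - 1 / Suc k"
    hence "abs (Z (qvec j) om) <= c - 1 / Suc k" "1 / Suc m <= 1 / Suc k" by (auto simp: frac_le)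
    thus "abs (Z (qvec j) om) <= c - 1 / Suc m" by auto
   qed
  qed
  have "p <= ?d + measure M ?N"
  proof -
   have "p <= measure M ((UN k. ?A k) Un ?N)"
    unfolding p_def
   proof (rule M.finite_measure_mono)
    show "?a <= (UN k. ?A k) Un ?N" unfolding not_le[symmetric] by blast
   qed measurable
   also have "... <= ?d + measure M ?N" by (rule measure_Un_le) auto
   finally show ?thesis .
  qed
  hence "p - et / 4 < ?d" using limit_sup_no_atom[OF c] et by simp
  from order_tendstoD(1)[OF lim this] obtain k where k: "p - et / 4 < measure M (?A k)" by (auto dest: eventually_happens)
  \<comment> \<open>Half of the gap 1/(k+1): one half is the slack of the box, the other half pays
    for equicontinuity.\<close>
  define ep where "ep = 1 / (2 * Suc k)"
  have ep: "0 < ep" "c - 1 / Suc k < c - ep" by (auto simp: ep_def field_simps)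
  let ?e = "et / 4 / sqrt CQ"
  have "0 < ?e^2" using et CQ_ge_1 by simp
  from emp_process_equicontinuous[OF ep(1) this] obtain ta dl where ta: "finite (range ta)"
   and ev: "EV n. EX B:sets (P n). measure (P n) B <= ?e^2 &
    (ALL X:space (P n) - B. ALL t. abs (emp_process n X t - emp_process n X (ta t)) <= ep &
      (k3 F t t <= dl --> abs (emp_process n X t) <= ep))" by blast
  let ?f = "range ta"
  have Ak: "measure M (?A k) <= measure M {om:space M. ALL s:?f. abs (Z s om) <= c - 1 / Suc k}"
   by (rule M.finite_measure_mono[OF _ sets_box[OF countable_finite[OF ta] Zm]]) (use cle in auto)
  have "EV n. measure M {om:space M. ALL s:?f. abs (Z s om) <= c - 1 / Suc k} - et / 4 <=
    measure (Q n) {X:space (Q n). ALL s:?f. abs (emp_process n X s) <= c - ep}"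
   by (rule KS_box(2)[OF Z ta ep(2), of "et / 4" "%s. s"]) (use et in auto)
  thus ?thesis using ev
  proof eventually_elim
   case (elim n)
   then obtain B where B: "B : sets (P n)" "measure (P n) B <= ?e^2"
    "!!X t. X : space (P n) - B ==> abs (emp_process n X t - emp_process n X (ta t)) <= ep" by blast
   let ?g = "emp_process n"
   have BQ: "B : sets (Q n)" using B(1) by (simp add: sets_Q)
   let ?h = "{X:space (Q n). ALL s:?f. abs (?g X s) <= c - ep}"
   let ?i = "{X:space (Q n). ALL j. abs (?g X (qvec j)) <= c}"
   let ?j = "measure (Q n)"
   have "?j ?h
     <= ?j (?i Un B)"
   proof (rule Q.finite_measure_mono)
    show "?h <= ?i Un B"
    proof safe
     fix X j assume X: "X : space (Q n)" "ALL s:?f. abs (?g X s) <= c - ep" "X ~: B"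
     have "abs (?g X (qvec j) - ?g X (ta (qvec j))) <= ep" using X by (intro B(3)) (auto simp: space_Q)
     moreover have "abs (?g X (ta (qvec j))) <= c - ep" using X by auto
     ultimately show "abs (?g X (qvec j)) <= c" by auto
    qed
   qed (use BQ in auto)
   also have "... <= q n + ?j B" unfolding q_def by (rule measure_Un_le) (use BQ in auto)
   also have "?j B <= et / 4" by (rule measure_Q_bound[OF B(1,2)]) (use et in simp)
   finally show ?case using elim(1) Ak k et by auto
  qed
 qed
 have "q ----> p"
 proof (rule order_tendstoI)
  show "EV n. a < q n" if "a < p" for a using lower[of "p - a"] that by simp
  show "EV n. q n < a" if "p < a" for a using upper[of "a - p"] that by simp
 qed
 thus ?thesis unfolding eqM eqQ by (intro tendsto_diff tendsto_const)
qed

end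
end

section \<open>Spatial quantiles\<close>

lemma norm_unitv_le: "norm (unitv y) <= 1" by (simp add: unitv_def)

lemma norm_unitv: "y ~= 0 ==> norm (unitv y) = 1" by (simp add: unitv_def)

lemma inner_unitv_self: "inner y (unitv y) = norm y"
 by (simp add: unitv_def dot_square_norm power2_eq_square)

lemma unitv_measurable [measurable]: "unitv : bmeas borel"
 unfolding unitv_def by measurable

lemma unitv_tendsto: "(f \<longlongrightarrow> y) A ==> y ~= 0 ==> ((%k. unitv (f k)) \<longlongrightarrow> unitv y) A"
 unfolding unitv_def by (intro tendsto_intros) auto

lemma norm_unitv_diff:
 assumes y: "y ~= 0"
 shows "norm (unitv y - unitv z) <= 2 * norm (y - z) / norm y"
proof (cases "z = 0")
 case True thus ?thesis by (simp add: unitv_def)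
next
 case False
 let ?a = "1 / norm y - 1 / norm z"
 have "unitv y - unitv z = (1 / norm y) *R (y - z) + ?a *R z"
  by (simp add: unitv_def algebra_simps)
 also have "norm ... <= norm (y - z) / norm y + abs ?a * norm z"
  by (rule order_trans[OF norm_triangle_ineq]) simp
 also have "abs ?a * norm z <= norm (y - z) / norm y"
  using y False norm_triangle_ineq3[of z y] by (simp add: field_simps norm_minus_commute)
 finally show ?thesis by simp
qed

lemma norm_subgradient: "norm b + inner (unitv b) (a - b) <= norm a"
proof -
 let ?a = "inner (unitv b)"
 have "?a (a - b) = ?a a - norm b" by (simp add: inner_diff_right inner_commute inner_unitv_self)
 moreover have "?a a <= norm (unitv b) * norm a" by (rule norm_cauchy_schwarz)
 moreover have "... <= 1 * norm a" by (intro mult_right_mono norm_unitv_le) simp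
 ultimately show ?thesis by auto
qed

text \<open>Remainder of the first-order expansion of the norm at y for the step -v. It is
  nonnegative by convexity and stands in for the second derivative, which does not exist at y =
  0.\<close>

definition norm_rem :: "real^'n => real^'n => real" where
 "norm_rem y v = norm (y - v) - norm y + inner (unitv y) v"

lemma norm_rem_measurable [measurable]: "(%(y, v). norm_rem y v) : bmeas (borel >< borel)"
 unfolding norm_rem_def by measurable

lemma norm_rem_0 [simp]: "norm_rem y 0 = 0" by (simp add: norm_rem_def)

lemma norm_rem_nonneg: "0 <= norm_rem y v"
 using norm_subgradient[of y "y - v"] by (simp add: norm_rem_def)

lemma norm_rem_le: "norm_rem y v <= 2 * norm v"
proof -
 have "inner (unitv y) v <= 1 * norm v"
  by (rule order_trans[OF norm_cauchy_schwarz mult_right_mono[OF norm_unitv_le]]) simp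
 thus ?thesis using norm_triangle_ineq4[of y v] by (simp add: norm_rem_def)
qed

text \<open>Convexity bounds the increment by the change of the subgradient, unitv y - unitv (y -
  v), which is at most 2 norm v/norm y.\<close>

lemma norm_rem_lipschitz:
 assumes y: "y ~= 0"
 shows "abs (norm_rem y v - norm_rem y v') <= 2 * max (norm v) (norm v') * norm (v - v') / norm y"
proof -
 have *: "norm_rem y v' - norm_rem y v <= 2 * max (norm v) (norm v') * norm (v - v') / norm y" for v v'
 proof -
  have "norm_rem y v' - norm_rem y v <= inner (unitv y - unitv (y - v')) (v' - v)"
   using norm_subgradient[of "y - v'" "y - v"] by (simp add: norm_rem_def algebra_simps)
  also have "... <= norm (unitv y - unitv (y - v')) * norm (v' - v)" by (rule norm_cauchy_schwarz)
  also have "... <= (2 * norm v' / norm y) * norm (v' - v)"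
   using norm_unitv_diff[OF y, of "y - v'"] by (intro mult_right_mono) auto
  also have "... <= (2 * max (norm v) (norm v') / norm y) * norm (v' - v)"
   by (intro mult_right_mono divide_right_mono) auto
  finally show ?thesis by (simp add: norm_minus_commute)
 qed
 from *[of v v'] *[of v' v] show ?thesis by (simp add: max.commute norm_minus_commute)
qed

lemma norm_rem_le_square: "y ~= 0 ==> norm_rem y v <= 2 * (norm v)^2 / norm y"
 using norm_rem_lipschitz[of y v 0] by (simp add: power2_eq_square)

text \<open>\<open>norm_rem\<close> is the difference of norm (y - v) and norm y - inner (unitv y)
  v; multiplied by their sum it becomes a difference of squares. The second-order lower bound and
  limit follow without differentiation.\<close>

lemma norm_rem_mult:
 assumes y: "y ~= 0"
 shows "norm_rem y v * (norm (y - v) + (norm y - inner (unitv y) v)) = (norm v)^2 - (inner (unitv y) v)^2"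
proof -
 have "(norm (y - v))^2 = (norm y)^2 - 2 * inner y v + (norm v)^2"
  by (simp add: power2_norm_eq_inner algebra_simps inner_commute)
 moreover have "inner y v = norm y * inner (unitv y) v" by (simp add: unitv_def)
 ultimately show ?thesis by (simp add: norm_rem_def power2_eq_square algebra_simps)
qed

lemma norm_rem_lower:
 assumes y: "y ~= 0"
 shows "((norm v)^2 - (inner (unitv y) v)^2) / (2 * (norm y + norm v)) <= norm_rem y v"
proof -
 let ?a = "inner (unitv y) v"
 let ?b = "norm y + norm v"
 have "norm (y - v) + (norm y - ?a) <= 2 * ?b"
 proof -
  have "- ?a <= 1 * norm v"
   using norm_cauchy_schwarz[of "- unitv y" v] mult_right_mono[OF norm_unitv_le[of y], of "norm v"] by simp
  thus ?thesis using norm_triangle_ineq4[of y v] by simp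
 qed
 from mult_left_mono[OF this norm_rem_nonneg[of y v]]
 have "(norm v)^2 - (?a)^2 <= norm_rem y v * (2 * ?b)"
  by (simp add: norm_rem_mult[OF y])
 moreover have "0 < 2 * ?b" using y by (simp add: add_pos_nonneg)
 ultimately show ?thesis by (simp add: pos_divide_le_eq)
qed

lemma norm_rem_second_order:
 assumes y: "y ~= 0"
 shows "(%n. real n * norm_rem y ((1 / sqrt n) *R v)) ----> ((norm v)^2 - (inner (unitv y) v)^2) / (2 * norm y)"
proof -
 define z where "z = (%n::nat. (1 / sqrt n) *R v)"
 let ?a = "inner (unitv y)"
 define b where "b = (norm v)^2 - (?a v)^2"
 define d where "d = (%n. norm (y - z n) + (norm y - ?a (z n)))"
 have "(%n. 1 / sqrt (real n)) ----> 0" by real_asymp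
 hence z: "z ----> 0" unfolding z_def using tendsto_scaleR[OF _ tendsto_const, of _ 0 _ v] by simp
 have "d ----> norm (y - 0) + (norm y - ?a 0)" unfolding d_def by (intro tendsto_intros z)
 hence d: "d ----> 2 * norm y" by simp
 have "0 < 2 * norm y" using y by simp
 from order_tendstoD(1)[OF d this] eventually_gt_at_top[of 0]
 have "EV n. real n * norm_rem y (z n) = b / d n"
 proof eventually_elim
  case (elim n)
  have "norm_rem y (z n) * d n = b / n"
   unfolding d_def norm_rem_mult[OF y] by (simp add: z_def b_def power_divide diff_divide_distrib)
  thus ?case using elim by (simp add: field_simps)
 qed
 moreover have "(%n. b / d n) ----> b / (2 * norm y)" using y by (intro tendsto_intros d) auto
 ultimately show ?thesis unfolding z_def b_def by (simp add: filterlim_cong)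
qed

text \<open>If x - th lies in such a ball, its direction is close to axis i. Finitely many balls
  suffice to have, for every v, one whose directions are well away from v, which replaces a
  compactness argument on the sphere.\<close>

definition axis_ball :: "'n => (real^'n) set" where
 "axis_ball i = ball ((1/2) *R axis i 1) (1/20)"

lemma axis_ball_norm:
 assumes "y : axis_ball i" shows "9/20 <= norm y" "norm y <= 1"
proof -
 have "norm ((1/2) *R axis i 1 - y) < 1/20" using assms by (simp add: axis_ball_def dist_norm)
 moreover have "norm ((1/2) *R axis i (1::real)) = 1/2" by simp
 ultimately show "9/20 <= norm y" "norm y <= 1"
  using norm_triangle_ineq2[of "(1/2) *R axis i 1" y] norm_triangle_ineq2[of y "(1/2) *R axis i 1"] by (simp_all add: norm_minus_commute)
qed

lemma norm_rem_axis_ball: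
 fixes v :: "real^'n"
 assumes "CARD('n) >= 2"
 shows "EX i. ALL y:axis_ball i. (norm v)^2 / (16 * (1 + norm v)) <= norm_rem y v"
proof -
 let ?a = "norm v"
 have "EX i. (v $ i)^2 <= ?a^2 / 2"
 proof (rule ccontr)
  assume no: "~ ?thesis"
  obtain i j :: 'n where ij: "i ~= j" using assms by (metis card_2_iff' ex_card iso_tuple_UNIV_I)
  have "(SUM k:{i, j}. (v $ k)^2) <= ?a^2" by (auto simp: norm_vec_def L2_set_def sum_nonneg intro!: sum_mono2)
  hence "(v $ i)^2 + (v $ j)^2 <= ?a^2" using ij by simp
  moreover have "?a^2 / 2 < (v $ i)^2" "?a^2 / 2 < (v $ j)^2" using no by (auto simp: not_le)
  ultimately show False by auto
 qed
 then obtain i where i: "(v $ i)^2 <= ?a^2 / 2" by blast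
 \<comment> \<open>71/100 exceeds 1/sqrt 2. With the centre at 1/2 and radius 1/20 this gives
   |<y,v>| <= 81/200 norm v, hence at most 9/10 norm v after division by norm y >= 9/20, and 1 -
   81/100 >= 1/8 remains.\<close>
 have "abs (v $ i) <= 71/100 * norm v"
 proof (rule power2_le_imp_le)
  have "?a^2 / 2 <= (71/100)^2 * ?a^2" by (simp add: power2_eq_square)
  thus "abs (v $ i)^2 <= (71/100 * norm v)^2" unfolding power_mult_distrib using i by simp
 qed simp
 note vi = this
 have "?a^2 / (16 * (1 + norm v)) <= norm_rem y v" if y: "y : axis_ball i" for y
 proof -
  note ny = axis_ball_norm[OF y]
  have y0: "y ~= 0" using ny by auto
  define z where "z = y - (1/2) *R axis i 1"
  have z: "norm z <= 1/20" using y by (simp add: axis_ball_def dist_norm z_def norm_minus_commute)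
  have "abs (inner y v) <= abs (v $ i) / 2 + norm z * norm v"
   using Cauchy_Schwarz_ineq2[of z v] by (simp add: z_def inner_diff_left inner_axis')
  also have "... <= 71/100 * norm v / 2 + 1/20 * norm v" using vi z by (intro add_mono mult_right_mono) auto
  finally have a: "abs (inner y v) <= 81/200 * norm v" by simp
  let ?b = "inner (unitv y) v"
  have "abs ?b = abs (inner y v) / norm y" by (simp add: unitv_def)
  also have "... <= (81/200 * norm v) / (9/20)" using a ny by (intro frac_le) auto
  finally have "abs ?b <= 9/10 * norm v" by simp
  hence "abs ?b^2 <= (9/10 * norm v)^2" by (rule power_mono) simp
  hence b: "?a^2 / 8 <= ?a^2 - ?b^2"
  proof -
   have "(9/10 * norm v)^2 = 81/100 * ?a^2" by (simp add: power2_eq_square)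
   thus ?thesis using \<open>_ <= (9/10 * norm v)^2\<close> zero_le_power2[of "norm v"] unfolding power2_abs by linarith
  qed
  have b0: "0 <= ?a^2 - ?b^2" using b zero_le_power2[of "norm v"] by linarith
  have "?a^2 / (16 * (1 + norm v)) = (?a^2 / 8) / (2 * (1 + norm v))" by simp
  also have "... <= (?a^2 - ?b^2) / (2 * (norm y + norm v))"
   using b b0 ny y0 by (intro frac_le) (auto intro: add_pos_nonneg)
  also have "... <= norm_rem y v" by (rule norm_rem_lower[OF y0])
  finally show ?thesis .
 qed
 thus ?thesis by blast
qed

text \<open>A bounded sequence of minimisers has cluster points, and equi-Lipschitz convergence of
  the objectives makes every cluster point a minimiser of g. Uniqueness is asked of the limit only;
  the p k may be arbitrary choices.\<close>

lemma argmin_tendsto: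
 fixes f :: "nat => 'a::euclidean_space => real"
 assumes lim: "!!q. (%k. f k q) ----> g q" and lip: "!!k q q'. abs (f k q - f k q') <= L * norm (q - q')"
  and min: "!!k q. f k (p k) <= f k q" and bounded: "!!k. norm (p k) <= R"
  and unique: "!!q. (!!q'. g q <= g q') ==> q = p0"
 shows "p ----> p0"
proof (rule ccontr)
 assume "~ p ----> p0"
 then obtain e where e: "0 < e" "~ (EV k. dist (p k) p0 < e)" unfolding tendsto_iff by auto
 obtain s :: "nat => nat" where s: "strict_mono s" "ALL k. ~ dist (p (s k)) p0 < e"
  using not_eventually_sequentiallyD[OF e(2)] by blast
 have "bounded (range (p \<circ> s))" using bounded unfolding bounded_iff by auto
 then obtain l t where t: "strict_mono t" "((p \<circ> s) \<circ> t) ----> l"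
  using bounded_imp_convergent_subsequence by blast
 define m where "m = s \<circ> t"
 have m: "strict_mono m" "(%k. p (m k)) ----> l"
  using strict_mono_o[OF s(1) t(1)] t(2) by (auto simp: m_def o_def)
 have sub: "(%k. f (m k) q) ----> g q" for q using LIMSEQ_subseq_LIMSEQ[OF lim m(1)] by (simp add: o_def)
 have "(%k. f (m k) (p (m k)) - f (m k) l) ----> 0"
 proof (rule Lim_null_comparison)
  show "EV k. norm (f (m k) (p (m k)) - f (m k) l) <= L * norm (p (m k) - l)" using lip by simp
  show "(%k. L * norm (p (m k) - l)) ----> 0"
   by (intro tendsto_mult_right_zero tendsto_norm_zero) (use m(2) in \<open>simp add: LIM_zero_iff\<close>)
 qed
 from tendsto_add[OF this sub[of l]] have lim1: "(%k. f (m k) (p (m k))) ----> g l" by simp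
 have "g l <= g q" for q by (rule LIMSEQ_le[OF lim1 sub]) (use min in auto)
 hence "l = p0" by (rule unique)
 hence "EV k. dist (p (m k)) p0 < e" using tendstoD[OF m(2) e(1)] by simp
 hence "EX k. dist (p (m k)) p0 < e" by (auto dest: eventually_happens)
 thus False using s(2) by (simp add: m_def)
qed

text \<open>Covers the population law and the empirical law at once. The latter carries the discrete
  sigma-algebra, so only measurability of the identity into the Borel sets is required.\<close>

locale borel_law = prob_space M for M :: "(real^'n) measure" +
 assumes id_measurable [measurable]: "(%x. x) : bmeas M"
begin

definition obj :: "real^'n => real^'n => real" where
 "obj u q = (LINT x|M. norm (x - q) - norm x) - inner u q"

lemma norm_diff_integrable: "integrable M (%x. norm (x - q) - norm x)"
proof (rule integrable_bounded)
 show "norm (norm (x - q) - norm x) <= norm q" for x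
  using norm_triangle_ineq3[of "x - q" x] by simp
qed measurable

lemma obj_Phi: "(LINT x|M. Phi u (x - q) - Phi u x) = obj u q"
proof -
 have "(LINT x|M. Phi u (x - q) - Phi u x) = (LINT x|M. (norm (x - q) - norm x) - inner u q)"
  by (intro LINT_cong refl) (simp add: Phi_def inner_diff_right)
 also have "... = obj u q" unfolding obj_def using norm_diff_integrable by (simp add: prob_space)
 finally show ?thesis .
qed

lemma obj_diff:
 "obj u (th + v) - obj u th = (LINT x|M. norm_rem (x - th) v) - inner ((LINT x|M. unitv (x - th)) + u) v"
proof -
 have i1: "integrable M (%x. unitv (x - th))" by (rule integrable_bounded[of _ 1]) (use norm_unitv_le in auto)
 have "(LINT x|M. norm_rem (x - th) v) = (LINT x|M. (norm (x - (th + v)) - norm x) - (norm (x - th) - norm x) + inner (unitv (x - th)) v)"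
  by (intro LINT_cong refl) (simp add: norm_rem_def algebra_simps)
 also have "... = (LINT x|M. norm (x - (th + v)) - norm x) - (LINT x|M. norm (x - th) - norm x) + inner (LINT x|M. unitv (x - th)) v"
  by (subst LINT_add LINT_diff,
    (intro norm_diff_integrable Lint_diff integrable_inner_left i1)+)+
   (use i1 in simp)
 finally show ?thesis by (simp add: obj_def inner_add_right inner_add_left)
qed

lemma obj_lipschitz: "abs (obj u q - obj u q') <= (1 + norm u) * norm (q - q')"
proof -
 let ?a = "norm (q - q')"
 have "abs ((LINT x|M. norm (x - q) - norm x) - (LINT x|M. norm (x - q') - norm x)) = norm (LINT x|M. norm (x - q) - norm (x - q'))"
  using norm_diff_integrable by (subst LINT_diff[symmetric]) auto
 also have "... <= ?a"
 proof (rule norm_expectation_le)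
  show "norm (norm (x - q) - norm (x - q')) <= ?a" for x
   using norm_triangle_ineq3[of "x - q" "x - q'"] by (simp add: norm_minus_commute)
 qed measurable
 finally have "abs (obj u q - obj u q') <= ?a + abs (inner u (q - q'))"
  unfolding obj_def inner_diff_right by auto
 also have "... <= ?a + norm u * ?a" using Cauchy_Schwarz_ineq2[of u "q - q'"] by simp
 finally show ?thesis by (simp add: algebra_simps)
qed

text \<open>On norm x <= R the integrand is at least norm q - 2R, elsewhere at least -norm q. Tail
  mass (1-r)/4 costs (1-r)/2 norm q and the linear term at most r norm q, which leaves (1-r)/2 norm
  q.\<close>

lemma obj_coercive:
 assumes u: "norm u <= r" and R: "0 <= R" "measure M {x:space M. R < norm x} <= (1 - r) / 4"
 shows "(1 - r) / 2 * norm q - 2 * R <= obj u q"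
proof -
 let ?A = "{x:space M. R < norm x}"
 let ?a = "LINT x|M. norm q - 2 * R - 2 * norm q * indicator ?A x"
 let ?b = "LINT x|M. norm (x - q) - norm x"
 have "?a <= ?b"
 proof (rule integral_mono[OF _ norm_diff_integrable])
  fix x assume "x : space M"
  thus "norm q - 2 * R - 2 * norm q * indicator ?A x <= norm (x - q) - norm x"
   using norm_triangle_ineq2[of q x] norm_triangle_ineq2[of x q] R(1)
   by (cases "x : ?A") (auto simp: norm_minus_commute)
 qed (intro Lint_diff integrable_mult_right integrable_const integrable_real_indicator, auto simp: emeasure_eq_measure)
 also have "?a = norm q - 2 * R - 2 * norm q * measure M ?A"
  by (subst LINT_diff) (auto simp: prob_space emeasure_eq_measure intro!: integrable_mult_right integrable_real_indicator)
 finally have "norm q - 2 * R - 2 * norm q * ((1 - r) / 4) <= ?b"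
  using mult_left_mono[OF R(2), of "2 * norm q"] by simp
 moreover have "inner u q <= r * norm q"
  by (rule order_trans[OF norm_cauchy_schwarz mult_right_mono[OF u]]) simp
 ultimately show ?thesis unfolding obj_def by (simp add: field_simps)
qed

lemma minimizer_bound:
 assumes u: "norm u <= r" "r < 1" and R: "0 <= R" "measure M {x:space M. R < norm x} <= (1 - r) / 4"
  and q: "!!q'. obj u q <= obj u q'"
 shows "norm q <= 4 * R / (1 - r)"
proof -
 have "(1 - r) / 2 * norm q - 2 * R <= obj u 0" using obj_coercive[OF u(1) R, of q] q[of 0] by auto
 also have "obj u 0 = 0" by (simp add: obj_def)
 finally show ?thesis using u(2) by (simp add: field_simps)
qed

lemma tail_radius:
 assumes "0 < et" shows "EX R>=0. measure M {x:space M. R < norm x} <= et"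
proof -
 let ?a = "\<Inter>k. {x:space M. real k < norm x}"
 have "(%k. measure M {x:space M. real k < norm x}) ----> measure M ?a"
  by (rule finite_Lim_measure_decseq) (auto simp: decseq_def)
 also have "?a = {}"
 proof (rule equals0I)
  fix x assume x: "x : ?a"
  obtain k where "norm x < real k" using reals_Archimedean2 by blast
  thus False using x by (auto dest: order.asym)
 qed
 finally have "EV k. measure M {x:space M. real k < norm x} < et"
  using assms by (intro order_tendstoD(2)) auto
 then obtain k where "measure M {x:space M. real k < norm x} < et" by (auto dest: eventually_happens)
 thus ?thesis by (intro exI[of _ "real k"]) auto
qed

text \<open>The choice in \<open>spatial_quantile\<close> is meaningful only if a minimiser exists.
  One exists on the ball of radius C by compactness, and outside it coercivity gives values >= 0 =
  obj u 0.\<close>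

lemma spatial_quantile_minimizes:
 assumes u: "norm u < 1" shows "obj u (spatial_quantile M u) <= obj u q"
proof -
 let ?a = "1 - norm u"
 obtain R where R: "0 <= R" "measure M {x:space M. R < norm x} <= ?a / 4"
  using tail_radius[of "?a / 4"] u by auto
 define C where "C = 4 * R / ?a"
 have C: "0 <= C" using R(1) u by (simp add: C_def)
 have "continuous_on (cball 0 C) (obj u)"
 proof (rule continuous_on_subset[OF _ subset_UNIV])
  have "lipschitz_on (1 + norm u) UNIV (obj u)"
   by (rule lipschitz_onI) (use obj_lipschitz in \<open>auto simp: dist_norm\<close>)
  thus "continuous_on UNIV (obj u)" by (rule lipschitz_on_continuous_on)
 qed
 then obtain p where p: "p : cball 0 C" "!!q. q : cball 0 C ==> obj u p <= obj u q"
  using continuous_attains_inf[of "cball 0 C" "obj u"] C by auto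
 have "obj u p <= obj u q" for q
 proof (cases "q : cball 0 C")
  case False
  have "0 <= ?a / 2 * norm q - 2 * R" using False u by (simp add: C_def field_simps)
  also have "... <= obj u q" by (rule obj_coercive[OF order_refl R])
  finally show ?thesis using p(2)[of 0] C by (simp add: obj_def)
 qed (rule p(2))
 hence "EX p. ALL q. obj u p <= obj u q" by blast
 from someI_ex[OF this] show ?thesis unfolding spatial_quantile_def obj_Phi by blast
qed

end

lemma cball_borel [measurable]: "cball (a::'a::metric_space) r : sets borel"
 by auto

lemma norm_axis_vec: "norm (axis i v :: ('b::real_normed_vector)^'n) = norm v"
proof -
 have "(SUM j:UNIV. (norm (axis i v $ j :: 'b))^2) = (SUM j:{i}. (norm (axis i v $ j :: 'b))^2)"
  by (rule sum.mono_neutral_right) (auto simp: axis_def)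
 thus ?thesis by (simp add: norm_vec_def L2_set_def)
qed

lemma integrable_vecI:
 fixes A :: "'a => ('b::euclidean_space)^'n"
 assumes "!!i. integrable M (%x. A x $ i)"
 shows "integrable M A"
proof -
 have bl: "bounded_linear (axis i :: 'b => 'b^'n)" for i
 proof (rule bounded_linear_intro[of _ 1])
  show "axis i (x + y) = axis i x + (axis i y :: 'b^'n)" "axis i (r *R x) = r *R (axis i x :: 'b^'n)" for x y r
   by (simp_all add: axis_def vec_eq_iff)
 qed (simp add: norm_axis_vec)
 let ?a = "%x. SUM i:UNIV. axis i (A x $ i)"
 have "integrable M ?a"
  by (rule Lint_sum, rule integrable_bounded_linear[OF bl assms])
 also have "?a = A"
  by (simp add: fun_eq_iff vec_eq_iff axis_def)
 finally show ?thesis .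
qed

lemma integral_vec_nth:
 fixes A :: "'a => ('b::euclidean_space)^'n"
 assumes "!!i. integrable M (%x. A x $ i)"
 shows "(LINT x|M. A x) $ i = (LINT x|M. A x $ i)"
 using integral_bounded_linear[OF bounded_linear_vec_nth[of i] integrable_vecI[OF assms]] by simp

lemma integral_matrix_nth:
 fixes A :: "'a => real^'n^'m"
 assumes "!!i j. integrable M (%x. A x $ i $ j)"
 shows "(LINT x|M. A x) $ i $ j = (LINT x|M. A x $ i $ j)"
 using assms by (simp add: integral_vec_nth integrable_vecI)

lemma tendsto_uniform_approx:
 fixes a :: "nat => real"
 assumes "!!ep. 0 < ep ==> EX b bt. b ----> bt & (ALL k. abs (a k - b k) <= ep) & abs (al - bt) <= ep"
 shows "a ----> al"
proof (rule tendstoI)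
 fix e :: real assume "0 < e"
 hence "0 < e / 3" by simp
 from assms[OF this] obtain b bt where b: "b ----> bt" "!!k. abs (a k - b k) <= e / 3" "abs (al - bt) <= e / 3" by blast
 from tendstoD[OF b(1) \<open>0 < e / 3\<close>] show "EV k. dist (a k) al < e"
 proof eventually_elim
  case (elim k) thus ?case using b(2)[of k] b(3) unfolding dist_real_def by linarith
 qed
qed

section \<open>Singular kernels in dimension at least two\<close>

lemma dyadic_bracket:
 fixes t :: real
 assumes "0 < t" "t <= 1"
 shows "EX k. t <= (1/2)^k & (1/2)^Suc k < t"
proof -
 define P where "P = (%k. (1/2::real)^k < t)"
 obtain k0 where "P k0" unfolding P_def using real_arch_pow_inv[OF assms(1), of "1/2"] by auto
 define m where "m = (LEAST k. P k)"
 have m: "P m" unfolding m_def using \<open>P k0\<close> by (rule LeastI)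
 hence "m ~= 0" using assms(2) by (cases m) (auto simp: P_def)
 then obtain k where k: "m = Suc k" by (cases m) auto
 have "~ P k" using not_less_Least[of k P] k by (simp add: m_def)
 thus ?thesis using m k by (intro exI[of _ k]) (auto simp: P_def not_less)
qed

text \<open>1/norm y is dominated by the sum of 2^(k+1) over the dyadic balls of radius 2^-k
  containing y. Their volumes are at most a constant times 4^-k when the dimension is at least 2, so
  the series is geometric.\<close>

lemma integrable_inverse_norm:
 assumes dim: "CARD('n) >= 2"
 shows "integrable lborel (%y::real^'n. 1 / norm y * indicator (cball 0 1) y)"
proof (rule integrableI_bounded)
 let ?V = "unit_ball_vol (real DIM(real^'n))"
 have V: "0 <= ?V" by simp
 let ?a = "indicat_real (cball 0 1)"
 have pt: "ennreal (norm (1 / norm y * ?a y)) <= (\<Sum>k. ennreal (2 ^ Suc k) * indicator (cball 0 ((1/2)^k)) y)" for y :: "real^'n"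
 proof (cases "y : cball 0 1 & y ~= 0")
  case True
  obtain k where k: "norm y <= (1/2)^k" "(1/2)^Suc k < norm y" using dyadic_bracket[of "norm y"] True by auto
  have "1 / norm y <= 2 ^ Suc k"
   using k(2) True by (simp add: power_divide field_simps)
  hence "ennreal (norm (1 / norm y * ?a y)) <= ennreal (2 ^ Suc k)"
   using True by (intro ennreal_leI) simp
  also have "... = (SUM k:{k}. ennreal (2 ^ Suc k) * indicator (cball 0 ((1/2)^k)) y)" using k(1) by simp
  also have "... <= (\<Sum>k. ennreal (2 ^ Suc k) * indicator (cball 0 ((1/2)^k)) y)" by (rule sum_le_suminf) auto
  finally show ?thesis .
 qed auto
 have "nn_int lborel (%y. norm (1 / norm y * ?a (y::real^'n))) <= nn_integral lborel (%y. (\<Sum>k. ennreal (2 ^ Suc k) * indicator (cball 0 ((1/2)^k)) (y::real^'n)))"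
  by (intro nn_integral_mono pt)
 also have "... = (\<Sum>k. ennreal (2 ^ Suc k) * emeasure lborel (cball (0::real^'n) ((1/2)^k)))"
  by (subst nn_integral_suminf) (measurable, simp add: nn_integral_cmult del: power_Suc)
 also have "... <= (\<Sum>k. ennreal (2 * ?V * (1/2)^k))"
 proof (intro suminf_le summableI)
  fix k
  have "((1/2)^k)^DIM(real^'n) <= ((1/2::real)^k)^2" using dim by (intro power_decreasing) (auto intro: power_le_one)
  hence "2^Suc k * (?V * ((1/2)^k)^DIM(real^'n)) <= 2^Suc k * (?V * ((1/2)^k)^2)"
   using V by (intro mult_left_mono) auto
  also have "... = 2 * ?V * (2^k * (1/2)^k * (1/2)^k)" by (simp add: power2_eq_square)
  also have "2^k * (1/2::real)^k = 1" by (simp add: power_mult_distrib[symmetric])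
  finally show "ennreal (2 ^ Suc k) * emeasure lborel (cball (0::real^'n) ((1/2)^k)) <= ennreal (2 * ?V * (1/2)^k)"
   using V by (subst emeasure_cball) (auto simp: ennreal_mult[symmetric] simp del: power_Suc intro!: ennreal_leI)
 qed
 also have "... = ennreal (\<Sum>k. 2 * ?V * (1/2)^k)"
  by (rule suminf_ennreal2) (use V in \<open>auto intro!: summable_mult summable_geometric\<close>)
 finally show "nn_int lborel (%y. norm (1 / norm y * ?a (y::real^'n))) < \<infinity>"
  by (rule le_less_trans) simp
qed measurable

text \<open>The \<open>itself\<close> argument records the dimension, which the result type does not
  show. By translation invariance this mass bounds the singular part around every centre.\<close>

definition kernel_mass :: "'n::finite itself => nat => real" where
 "kernel_mass _ m = (LINT y|lborel. 1 / norm y * indicator (cball 0 (1 / Suc m)) (y::real^'n))"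

lemma kernel_mass:
 assumes dim: "CARD('n) >= 2"
 shows "integrable lborel (%y::real^'n. 1 / norm y * indicator (cball 0 (1 / Suc m)) y)"
  and "0 <= kernel_mass TYPE('n) m" and "kernel_mass TYPE('n) ----> 0"
proof -
 have le: "indicat_real (cball 0 (1 / Suc m)) y <= indicat_real (cball 0 1) y" for y :: "real^'n" and m
 proof -
  have "1 / real (Suc m) <= 1" by simp
  thus ?thesis by (auto simp: indicator_def intro: order_trans)
 qed
 show "integrable lborel (%y::real^'n. 1 / norm y * indicator (cball 0 (1 / Suc m)) y)"
  by (rule Lint_bound[OF integrable_inverse_norm[OF dim]]) (measurable, use le in \<open>auto simp: divide_right_mono\<close>)
 show "0 <= kernel_mass TYPE('n) m" unfolding kernel_mass_def by (rule LINT_nonneg) simp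
 have "kernel_mass TYPE('n) ----> integral\<^sup>L lborel (%y::real^'n. 0)"
  unfolding kernel_mass_def
 proof (rule integral_dominated_convergence[OF _ _ integrable_inverse_norm[OF dim]])
  show "AE y in lborel. (%m. 1 / norm y * indicat_real (cball 0 (1 / Suc m)) (y::real^'n)) ----> 0"
  proof (rule AE_I2)
   fix y :: "real^'n"
   show "(%m. 1 / norm y * indicat_real (cball 0 (1 / Suc m)) y) ----> 0"
   proof (cases "y = 0")
    case False
    have "(%m. 1 / real (Suc m)) ----> 0" using LIMSEQ_inverse_real_of_nat by (simp add: field_simps)
    from order_tendstoD(2)[OF this, of "norm y"] False
    have "EV m. 1 / norm y * indicat_real (cball 0 (1 / Suc m)) y = 0"
     by (auto elim!: eventually_mono)
    thus ?thesis by (rule tendsto_eventually)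
   qed simp
  qed
 qed (use le in \<open>auto simp: divide_right_mono\<close>)
 thus "kernel_mass TYPE('n) ----> 0" by simp
qed

lemma nn_integral_translate:
 fixes g :: "'a::euclidean_space => ennreal"
 assumes [measurable]: "g : bmeas borel"
 shows "nn_integral lborel (%x. g (x - th)) = nn_integral lborel (%y. g y)"
proof -
 have "nn_integral lborel (%x. g (x - th)) = nn_integral (distr lborel borel ((+) th)) (%x. g (x - th))" by (simp add: lborel_distr_plus)
 also have "... = nn_integral lborel (%y. g y)" by (subst nn_integral_distr) auto
 finally show ?thesis .
qed

locale pos_density =
 fixes f :: "real^'n => real"
 assumes f_cont: "continuous_on UNIV f" and f_pos: "!!x. 0 < f x" and f_prob: "prob_space (dens f)"
  and dim: "CARD('n) >= 2"
begin

abbreviation F where "F == dens f"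

lemma f_measurable [measurable]: "f : bmeas borel" using f_cont by (rule borel_measurable_continuous_onI)

sublocale borel_law F
proof -
 interpret prob_space F by (rule f_prob)
 show "borel_law F" by unfold_locales simp
qed

lemma density_upper: "EX B>0. ALL x:cball 0 K. f x <= B"
proof -
 have "compact (f ` cball 0 K)" by (intro compact_continuous_image continuous_on_subset[OF f_cont]) auto
 from compact_imp_bounded[OF this] obtain B where B: "ALL y:f ` cball 0 K. norm y <= B" unfolding bounded_iff by blast
 have "f x <= max B 1" if "x : cball 0 K" for x using B that by force
 thus ?thesis by (intro exI[of _ "max B 1"]) simp
qed

lemma density_lower: "EX m>0. ALL x:cball 0 K. m <= f x"
proof (cases "0 <= K")
 case True
 then obtain x where "!!y. y : cball 0 K ==> f x <= f y"
  using continuous_attains_inf[OF compact_cball[of 0 K] _ continuous_on_subset[OF f_cont subset_UNIV]] by (metis cball_eq_empty not_less)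
 thus ?thesis using f_pos[of x] by (intro exI[of _ "f x"]) blast
qed (auto intro: exI[of _ 1])

lemma kernel_near:
 assumes B: "ALL x:cball 0 (K + 1). f x <= B" "0 <= B" and th: "norm th <= K"
 shows "nn_int F (%x. 1 / norm (x - th) * indicator (cball 0 (1 / Suc m)) (x - th)) <= ennreal (B * kernel_mass TYPE('n) m)"
proof -
 let ?a = "cball 0 (1 / Suc m)"
 let ?b = "%x. 1 / norm (x - th) * indicator (?a) (x - th)"
 have "nn_int F ?b
   = nn_integral lborel (%x. ennreal (f x) * ennreal (1 / norm (x - th) * indicator (?a) (x - th)))"
  unfolding dens_def by (rule nn_integral_density) auto
 also have "... <= nn_integral lborel (%x. ennreal B * ennreal (1 / norm (x - th) * indicator (?a) (x - th)))"
 proof (intro nn_integral_mono)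
  fix x
  let ?c = "ennreal (1 / norm (x - th) * indicator (?a) (x - th))"
  show "ennreal (f x) * ?c <= ennreal B * ?c"
  proof (cases "x - th : ?a")
   case True
   have "1 / real (Suc m) <= 1" by simp
   hence "norm x <= K + 1" using True th norm_triangle_sub[of x th] by (simp only: mem_cball dist_0_norm)
   thus ?thesis using B by (intro mult_right_mono ennreal_leI) auto
  qed simp
 qed
 also have "... = ennreal B * nn_int lborel ?b"
  by (rule nn_integral_cmult) measurable
 also have "nn_int lborel ?b = ennreal (kernel_mass TYPE('n) m)"
  unfolding kernel_mass_def using nn_integral_translate[of "%y. ennreal (1 / norm y * indicator (?a) y)" th]
  by (subst nn_integral_eq_integral[OF kernel_mass(1)[OF dim], symmetric]) simp_all
 finally show ?thesis using B(2) kernel_mass(2)[OF dim] by (simp add: ennreal_mult)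
qed

lemma inverse_norm_bound: "EX A>0. ALL th. norm th <= K --> (nn_int F (%x. 1 / norm (x - th))) <= ennreal A"
proof -
 obtain B where B: "0 < B" "ALL x:cball 0 (K + 1). f x <= B" using density_upper by blast
 have "nn_int F (%x. 1 / norm (x - th)) <= ennreal (1 + B * kernel_mass TYPE('n) 0)" if th: "norm th <= K" for th
 proof -
  have "nn_int F (%x. 1 / norm (x - th)) <= nn_integral F (%x. 1 + ennreal (1 / norm (x - th) * indicator (cball 0 (1 / Suc 0)) (x - th)))"
   by (simp add: nn_integral_mono ennreal_leI divide_le_eq add_increasing2 indicator_def add_increasing)
  also have "... = nn_integral F (%x. 1) + nn_int F (%x. 1 / norm (x - th) * indicator (cball 0 (1 / Suc 0)) (x - th))"
   by (rule nn_integral_add) measurable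
  also have "... <= 1 + ennreal (B * kernel_mass TYPE('n) 0)"
  proof (intro add_mono kernel_near[OF B(2) _ th])
   show "nn_integral F (%x. 1) <= 1" unfolding nn_integral_const by (simp only: emeasure_space_1 mult_1)
  qed (use B in simp)
  finally show ?thesis using B kernel_mass(2)[OF dim, of 0] by (simp add: ennreal_plus)
 qed
 thus ?thesis using B kernel_mass(2)[OF dim, of 0] by (intro exI[of _ "1 + B * kernel_mass TYPE('n) 0"]) (auto intro: add_pos_nonneg)
qed

lemma kernel_integrable:
 assumes [measurable]: "ph : bmeas borel" and ph: "!!y. abs (ph y) <= C / norm y"
 shows "integrable F (%x. ph (x - th))"
proof (rule integrableI_bounded)
 let ?c = "nn_int F (%x. 1 / norm (x - th))"
 obtain A where A: "?c <= ennreal A" using inverse_norm_bound[of "norm th"] by auto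
 let ?a = "ennreal (abs C)"
 let ?b = "nn_int F (%x. norm (ph (x - th)))"
 have "?b <= nn_integral F (%x. ?a * ennreal (1 / norm (x - th)))"
 proof (intro nn_integral_mono)
  fix x
  show "ennreal (norm (ph (x - th))) <= ?a * ennreal (1 / norm (x - th))"
   using order_trans[OF ph[of "x - th"] divide_right_mono[OF abs_ge_self norm_ge_zero]] by (simp add: ennreal_mult[symmetric])
 qed
 also have "... = ?a * ?c" by (rule nn_integral_cmult) measurable
 also have "... <= ?a * ennreal A" by (rule mult_left_mono[OF A]) simp
 also have "... < \<infinity>" by (simp add: ennreal_mult_less_top)
 finally show "?b < \<infinity>" .
qed measurable

lemma AE_neq: "AE x in F. x ~= th"
 by (simp add: dens_AE_lborel f_measurable AE_lborel_singleton)

text \<open>The singularity moves with th k, so no fixed dominating function is at hand. It is cut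
  off at an error uniform in the centre, by \<open>kernel_near\<close>, and the truncated kernel is
  bounded.\<close>

lemma kernel_tendsto:
 assumes m[measurable]: "ph : bmeas borel" and ph: "!!y. abs (ph y) <= C / norm y" and C: "0 <= C"
  and cont: "!!y. y ~= 0 ==> isCont ph y" and th: "th ----> th0"
 shows "(%k. (LINT x|F. ph (x - th k))) ----> (LINT x|F. ph (x - th0))"
proof (rule tendsto_uniform_approx)
 fix ep :: real assume ep: "0 < ep"
 have "bounded (range th)" using th convergent_imp_bounded by blast
 then obtain K where K: "!!k. norm (th k) <= K" unfolding bounded_iff by auto
 have K0: "norm th0 <= K" by (rule LIMSEQ_le_const2[OF tendsto_norm[OF th]]) (use K in auto)
 obtain B where B: "0 < B" "ALL x:cball 0 (K + 1). f x <= B" using density_upper by blast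
 have "(%m. C * (B * kernel_mass TYPE('n) m)) ----> C * (B * 0)" by (intro tendsto_mult tendsto_const kernel_mass dim)
 hence "EV m. C * (B * kernel_mass TYPE('n) m) < ep" using ep by (intro order_tendstoD(2)) auto
 then obtain m where m: "C * (B * kernel_mass TYPE('n) m) < ep" by (auto dest: eventually_happens)
 \<comment> \<open>Differs from \<open>ph\<close> only within distance 1/(m+1) of 0 and is bounded
   by C * (m+1).\<close>
 define ps where "ps = (%y. ph y * min 1 (norm y * Suc m))"
 have psm[measurable]: "ps : bmeas borel" unfolding ps_def by measurable
 have psb: "abs (ps y) <= C * Suc m" for y
 proof (cases "y = 0")
  case False
  have "abs (ps y) <= (C / norm y) * (norm y * Suc m)"
   unfolding ps_def abs_mult using ph[of y] by (intro mult_mono) auto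
  thus ?thesis using False by simp
 qed (use C in \<open>simp add: ps_def\<close>)
 have psk: "abs (ps y) <= C / norm y" for y
  using mult_mono[OF ph[of y], of "abs (min 1 (norm y * Suc m))" 1] C unfolding ps_def abs_mult by simp
 have psc: "isCont ps y" if "y ~= 0" for y
  unfolding ps_def using cont[OF that] by (intro continuous_intros)
 have diff: "abs (ph y - ps y) <= C * (1 / norm y * indicator (cball 0 (1 / Suc m)) y)" for y
 proof (cases "norm y <= 1 / Suc m")
  case True
  have "ph y - ps y = ph y * (1 - min 1 (norm y * Suc m))" by (simp add: ps_def algebra_simps)
  also have "abs ... <= (C / norm y) * 1" unfolding abs_mult using ph[of y] C by (intro mult_mono) auto
  finally show ?thesis using True by simp
 next
  case False
  hence "1 < norm y * Suc m" by (simp add: field_simps)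
  thus ?thesis using False by (simp add: ps_def)
 qed
 have close: "abs ((LINT x|F. ph (x - t)) - (LINT x|F. ps (x - t))) <= ep" if t: "norm t <= K" for t
 proof -
  let ?a = "cball 0 (1 / Suc m)"
  have i: "integrable F (%x. C * (1 / norm (x - t) * indicator ?a (x - t)))"
   by (rule kernel_integrable[of "%y. C * (1 / norm y * indicator ?a y)" C])
    (use C in \<open>auto simp: indicator_def\<close>)
  have "abs ((LINT x|F. ph (x - t)) - (LINT x|F. ps (x - t))) = norm (LINT x|F. ph (x - t) - ps (x - t))"
   using kernel_integrable[OF \<open>ph : _\<close> ph, of t] kernel_integrable[OF psm psk, of t] by simp
  also have "... <= (LINT x|F. C * (1 / norm (x - t) * indicator ?a (x - t)))"
   by (rule Bochner_Integration.integral_norm_bound_integral[OF Lint_diff[OF kernel_integrable[OF \<open>ph : _\<close> ph] kernel_integrable[OF psm psk]] i]) (use diff in simp)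
  also have "... <= C * (B * kernel_mass TYPE('n) m)"
  proof (subst integral_mult_right_zero, rule mult_left_mono[OF _ C])
   show "(LINT x|F. 1 / norm (x - t) * indicator ?a (x - t)) <= B * kernel_mass TYPE('n) m"
    using kernel_near[OF B(2) _ t, of m] B(1) kernel_mass(2)[OF dim, of m]
    by (subst integral_eq_nn_integral) (auto intro!: enn2real_leI)
  qed
  finally show ?thesis using m by auto
 qed
 have "(%k. (LINT x|F. ps (x - th k))) ----> (LINT x|F. ps (x - th0))"
 proof (rule integral_dominated_convergence[where w="%_. C * Suc m"])
  show "AE x in F. (%k. ps (x - th k)) ----> ps (x - th0)"
   using AE_neq[of th0]
  proof eventually_elim
   case (elim x)
   show ?case by (rule isCont_tendsto_compose[OF psc tendsto_diff[OF tendsto_const th]]) (use elim in simp)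
  qed
 qed (use psb in auto)
 thus "EX b bt. b ----> bt & (ALL k. abs ((LINT x|F. ph (x - th k)) - b k) <= ep) & abs ((LINT x|F. ph (x - th0)) - bt) <= ep"
  using close K K0 by blast
qed

end

section \<open>Second-order behaviour of the population objective\<close>

lemma matrix_inverse:
 fixes A :: "real^'n^'n"
 assumes "invertible A" shows "A ** matrix_inv A = mat 1" "matrix_inv A ** A = mat 1"
 using someI_ex[OF assms[unfolded invertible_def]] unfolding matrix_inv_def by auto

lemma axis_ball_borel [measurable]: "axis_ball i : sets borel" by (simp add: axis_ball_def)

lemma unitv_isCont: "y ~= 0 ==> isCont unitv y"
 unfolding isCont_def by (rule unitv_tendsto[OF tendsto_ident_at])

context pos_density begin

lemma axis_ball_mass: "EX p>0. ALL th i. norm th <= K --> p <= measure F {x. x - th : axis_ball i}"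
proof -
 obtain m where m: "0 < m" "ALL x:cball 0 (K + 1). m <= f x" using density_lower by blast
 define V where "V = measure lborel (ball (0::real^'n) (1/20))"
 have V: "0 < V" unfolding V_def by auto
 have "m * V <= measure F {x. x - th : axis_ball i}" if th: "norm th <= K" for th i
 proof -
  let ?A = "{x. x - th : axis_ball i}"
  have A: "?A = ball (th + (1/2) *R axis i 1) (1/20)"
   by (auto simp: axis_ball_def dist_norm algebra_simps)
  have "ennreal (m * V) = ennreal m * emeasure lborel ?A"
   using m unfolding A by (simp add: ennreal_mult V_def emeasure_ball content_ball)
  also have "... = nn_integral lborel (%x. ennreal m * indicator ?A x)" unfolding A by (subst nn_integral_cmult_indicator) auto
  also have "... <= nn_integral lborel (%x. ennreal (f x) * indicator ?A x)"
  proof (intro nn_integral_mono)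
   fix x
   show "ennreal m * indicator ?A x <= ennreal (f x) * indicator ?A x"
   proof (cases "x : ?A")
    case True
    hence "norm x <= K + 1"
     using th norm_triangle_sub[of x th] by (auto dest: axis_ball_norm)
    thus ?thesis using m by (intro mult_right_mono ennreal_leI) auto
   qed simp
  qed
  also have "... = emeasure F ?A" unfolding dens_def A by (subst emeasure_density) auto
  finally show ?thesis unfolding emeasure_eq_measure by simp
 qed
 thus ?thesis using m V by (intro exI[of _ "m * V"]) auto
qed

lemma norm_rem_integrable: "integrable F (%x. norm_rem (x - th) v)"
 by (rule integrable_bounded[of _ "2 * norm v"]) (simp_all add: abs_of_nonneg[OF norm_rem_nonneg] norm_rem_le)

lemma norm_rem_expectation_lower:
 assumes p: "!!i. p <= measure F {x. x - th : axis_ball i}"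
 shows "p * ((norm v)^2 / (16 * (1 + norm v))) <= (LINT x|F. norm_rem (x - th) v)"
proof -
 obtain i where i: "!!y. y : axis_ball i ==> (norm v)^2 / (16 * (1 + norm v)) <= norm_rem y v"
  using norm_rem_axis_ball[OF dim, of v] by blast
 let ?A = "{x. x - th : axis_ball i}" and ?c = "(norm v)^2 / (16 * (1 + norm v))"
 have A: "?A : sets F" by measurable
 have c: "0 <= ?c" by simp
 have "p * ?c <= measure F ?A * ?c" using p[of i] c by (rule mult_right_mono)
 also have "... = (LINT x|F. indicator ?A x * ?c)" by simp
 also have "... <= (LINT x|F. norm_rem (x - th) v)"
 proof (rule integral_mono[OF _ norm_rem_integrable])
  show "integrable F (%x. indicator ?A x * ?c)" using A by (intro integrable_mult_left integrable_real_indicator) (auto simp: emeasure_eq_measure)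
  show "indicator ?A x * ?c <= norm_rem (x - th) v" for x
   using i[of "x - th"] norm_rem_nonneg[of "x - th" v] by (auto simp: indicator_def)
 qed
 finally show ?thesis .
qed

lemma norm_rem_expectation_upper:
 "EX A>0. ALL th v. norm th <= K --> (LINT x|F. norm_rem (x - th) v) <= A * (norm v)^2"
proof -
 obtain A where A: "0 < A" "!!th. norm th <= K ==> (nn_int F (%x. 1 / norm (x - th))) <= ennreal A"
  using inverse_norm_bound[of K] by blast
 have "(LINT x|F. norm_rem (x - th) v) <= 2 * A * (norm v)^2" if th: "norm th <= K" for th v
 proof -
  have i: "integrable F (%x. 1 / norm (x - th))" by (rule kernel_integrable[of "%y. 1 / norm y" 1]) auto
  have "(LINT x|F. norm_rem (x - th) v) <= (LINT x|F. 2 * (norm v)^2 * (1 / norm (x - th)))"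
  proof (rule integral_mono_AE[OF norm_rem_integrable integrable_mult_right[OF i]])
   show "AE x in F. norm_rem (x - th) v <= 2 * (norm v)^2 * (1 / norm (x - th))"
    using AE_neq[of th] by eventually_elim (simp add: norm_rem_le_square)
  qed
  also have "... = 2 * (norm v)^2 * (LINT x|F. 1 / norm (x - th))" by (rule integral_mult_right_zero)
  also have "... <= 2 * (norm v)^2 * A"
  proof (intro mult_left_mono)
   show "(LINT x|F. 1 / norm (x - th)) <= A"
    using A(2)[OF th] A(1) by (subst integral_eq_nn_integral) (auto intro: enn2real_leI)
  qed simp
  finally show ?thesis by (simp add: mult_ac)
 qed
 thus ?thesis using A(1) by (intro exI[of _ "2 * A"]) auto
qed

text \<open>A step of 1/(2A) times the vector g would change the objective by at most -(norm
  g)^2/(4A), since the remainder is at most A times the squared step. Minimality forces g = 0, and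
  nothing is differentiated under the integral.\<close>

lemma quantile_stationary:
 assumes u: "norm u < 1"
 shows "(LINT x|F. unitv (x - spatial_quantile F u)) + u = 0"
proof -
 let ?q = "spatial_quantile F u"
 define g where "g = (LINT x|F. unitv (x - ?q)) + u"
 obtain A where A: "0 < A" "!!v. (LINT x|F. norm_rem (x - ?q) v) <= A * (norm v)^2"
  using norm_rem_expectation_upper[of "norm ?q"] by blast
 have "0 <= obj u (?q + (1 / (2 * A)) *R g) - obj u ?q" using spatial_quantile_minimizes[OF u] by simp
 also have "... <= A * (norm ((1 / (2 * A)) *R g))^2 - inner g ((1 / (2 * A)) *R g)"
  unfolding obj_diff g_def[symmetric] by (intro diff_right_mono A(2))
 also have "... = - ((norm g)^2 / (4 * A))"
  by (simp add: power2_norm_eq_inner[symmetric] power_divide field_simps power2_eq_square)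
 finally have "(norm g)^2 <= 0" using A(1) by (simp add: divide_le_0_iff)
 thus ?thesis unfolding g_def[symmetric] by simp
qed

lemma obj_quantile_diff:
 assumes u: "norm u < 1"
 shows "obj u (spatial_quantile F u + v) - obj u (spatial_quantile F u) = (LINT x|F. norm_rem (x - spatial_quantile F u) v)"
 unfolding obj_diff quantile_stationary[OF u] by simp

lemma quantile_unique:
 assumes u: "norm u < 1" and q: "!!q'. obj u q <= obj u q'"
 shows "q = spatial_quantile F u"
proof (rule ccontr)
 let ?q = "spatial_quantile F u"
 assume ne: "q ~= ?q"
 obtain p where p: "0 < p" "!!i. p <= measure F {x. x - ?q : axis_ball i}"
  using axis_ball_mass[of "norm ?q"] by blast
 have "0 < p * ((norm (q - ?q))^2 / (16 * (1 + norm (q - ?q))))"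
  using ne p(1) by (intro mult_pos_pos divide_pos_pos) (auto intro: add_pos_nonneg)
 also have "... <= obj u (?q + (q - ?q)) - obj u ?q"
  unfolding obj_quantile_diff[OF u] by (rule norm_rem_expectation_lower[OF p(2)])
 finally show False using q[of ?q] by simp
qed

lemma quantile_bounded:
 assumes "r < 1" shows "EX K>=0. ALL u:cball 0 r. norm (spatial_quantile F u) <= K"
proof -
 obtain R where R: "0 <= R" "measure F {x:space F. R < norm x} <= (1 - r) / 4"
  using tail_radius[of "(1 - r) / 4"] assms by auto
 have "norm (spatial_quantile F u) <= 4 * R / (1 - r)" if "u : cball 0 r" for u
  using that assms by (intro minimizer_bound[OF _ _ R, of u] spatial_quantile_minimizes) auto
 thus ?thesis using R(1) assms by (intro exI[of _ "4 * R / (1 - r)"]) auto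
qed

lemma quantile_tendsto:
 assumes r: "r < 1" and u: "!!k. u k : cball 0 r" "u0 : cball 0 r" and lim: "u ----> u0"
 shows "(%k. spatial_quantile F (u k)) ----> spatial_quantile F u0"
proof -
 obtain K where K: "!!u. u : cball 0 r ==> norm (spatial_quantile F u) <= K" using quantile_bounded[OF r] by blast
 have u1: "norm (u k) < 1" "norm u0 < 1" for k using u(1)[of k] u(2) r by auto
 show ?thesis
 proof (rule argmin_tendsto[where f="%k. obj (u k)" and g="obj u0" and L=2 and R=K])
  show "(%k. obj (u k) q) ----> obj u0 q" for q unfolding obj_def by (intro tendsto_intros lim)
  show "abs (obj (u k) q - obj (u k) q') <= 2 * norm (q - q')" for k q q'
   by (rule order_trans[OF obj_lipschitz mult_right_mono]) (use u1(1)[of k] in auto)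
 qed (use spatial_quantile_minimizes u1 K u quantile_unique in auto)
qed

text \<open>Entries of the second derivative of the norm at y; \<open>D1\<close> is their
  expectation.\<close>

definition hess :: "real^'n => 'n => 'n => real" where
 "hess y i j = 1 / norm y * ((if i = j then 1 else 0) - unitv y $ i * unitv y $ j)"

lemma hess_bound: "abs (hess y i j) <= 2 / norm y"
proof -
 have a: "abs (unitv y $ k) <= 1" for k using component_le_norm_cart[of "unitv y" k] norm_unitv_le[of y] by auto
 let ?a = "abs ((if i = j then 1 else 0) - unitv y $ i * unitv y $ j)"
 have "?a <= 1 + 1 * 1"
  by (rule order_trans[OF abs_triangle_ineq4]) (unfold abs_mult, intro add_mono mult_mono a, auto)
 hence "1 / norm y * ?a <= 1 / norm y * 2"
  by (intro mult_left_mono) auto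
 thus ?thesis unfolding hess_def abs_mult by simp
qed

lemma hess_measurable [measurable]: "(%y. hess y i j) : bmeas borel"
 unfolding hess_def by measurable

lemma hess_integrable: "integrable F (%x. hess (x - th) i j)"
 by (rule kernel_integrable[OF hess_measurable hess_bound])

lemma D1_nth: "D1 F th $ i $ j = (LINT x|F. hess (x - th) i j)"
proof -
 have eq: "((1 / norm (x - th)) *R (mat 1 - (1 / (norm (x - th))^2) *R outer (x - th) (x - th))) $ i $ j = hess (x - th) i j" for x i j
  by (simp add: hess_def mat_def outer_def unitv_def power2_eq_square)
 show ?thesis unfolding D1_def
  by (subst integral_matrix_nth) (simp_all only: eq hess_integrable)
qed

lemma D1_symmetric: "transpose (D1 F th) = D1 F th"
 by (simp add: vec_eq_iff transpose_def D1_nth hess_def mult.commute)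

lemma D1_quadratic: "inner v (D1 F th *v v) = (LINT x|F. ((norm v)^2 - (inner (unitv (x - th)) v)^2) / norm (x - th))"
proof -
 have eq: "((norm v)^2 - (inner (unitv y) v)^2) / norm y = (SUM i:UNIV. SUM j:UNIV. v $ i * (hess y i j * v $ j))" for y
 proof -
  have "(SUM i:UNIV. SUM j:UNIV. v $ i * (hess y i j * v $ j)) = (SUM i:UNIV. SUM j:UNIV. 1 / norm y * ((if i = j then v $ i * v $ j else 0) - (unitv y $ i * v $ i) * (unitv y $ j * v $ j)))"
   by (intro sum.cong refl) (simp add: hess_def algebra_simps)
  also have "... = 1 / norm y * ((SUM i:UNIV. v $ i * v $ i) - (SUM i:UNIV. unitv y $ i * v $ i) * (SUM j:UNIV. unitv y $ j * v $ j))"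
   by (simp only: sum_distrib_left[symmetric] sum_subtractf sum_product) simp
  also have "... = ((norm v)^2 - (inner (unitv y) v)^2) / norm y"
   by (simp add: power2_norm_eq_inner inner_vec_def power2_eq_square[of "sum _ _"])
  finally show ?thesis by simp
 qed
 show ?thesis
  unfolding eq
  by (subst LINT_sum, intro Lint_sum integrable_mult_right integrable_mult_left hess_integrable)
   (simp add: inner_vec_def matrix_vector_mult_def D1_nth sum_distrib_left LINT_sum hess_integrable)
qed

lemma norm_rem_expectation_second_order:
 "(%n. real n * (LINT x|F. norm_rem (x - th) ((1 / sqrt n) *R v))) ----> inner v (D1 F th *v v) / 2"
proof -
 have i: "integrable F (%x. 2 * (norm v)^2 * (1 / norm (x - th)))"
  by (intro integrable_mult_right kernel_integrable[of "%y. 1 / norm y" 1]) auto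
 have "(%n. (LINT x|F. real n * norm_rem (x - th) ((1 / sqrt n) *R v))) ----> (LINT x|F. ((norm v)^2 - (inner (unitv (x - th)) v)^2) / (2 * norm (x - th)))"
 proof (rule integral_dominated_convergence[OF _ _ i])
  show "AE x in F. (%n. real n * norm_rem (x - th) ((1 / sqrt n) *R v)) ----> ((norm v)^2 - (inner (unitv (x - th)) v)^2) / (2 * norm (x - th))"
   using AE_neq[of th] by eventually_elim (rule norm_rem_second_order, simp)
  show "AE x in F. norm (real n * norm_rem (x - th) ((1 / sqrt n) *R v)) <= 2 * (norm v)^2 * (1 / norm (x - th))" for n :: nat
   using AE_neq[of th]
  proof eventually_elim
   case (elim x)
   have "real n * norm_rem (x - th) ((1 / sqrt n) *R v) <= real n * (2 * (norm ((1 / sqrt n) *R v))^2 / norm (x - th))"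
    using elim by (intro mult_left_mono norm_rem_le_square) auto
   also have "... <= 2 * (norm v)^2 * (1 / norm (x - th))" by (cases "n = 0") (auto simp: power_divide)
   finally show ?case using norm_rem_nonneg[of "x - th"] by simp
  qed
 qed auto
 thus ?thesis unfolding D1_quadratic by (simp add: mult.commute[of 2] flip: divide_divide_eq_left)
qed

text \<open>The lower bound on the expected remainder is applied to v/sqrt n and multiplied by n. In
  the limit the factor 1 + norm v/sqrt n disappears and half the quadratic form appears, so 16
  becomes 8.\<close>

lemma D1_lower:
 assumes p: "!!i. p <= measure F {x. x - th : axis_ball i}"
 shows "p / 8 * (norm v)^2 <= inner v (D1 F th *v v)"
proof -
 let ?a = "(norm v)^2 / (16 * (1 + 0))"
 have l: "(%n. p * ((norm v)^2 / (16 * (1 + norm v / sqrt (real n))))) ----> p * ?a"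
 proof (intro tendsto_intros)
  show "(%n. norm v / sqrt (real n)) ----> 0" by real_asymp
 qed auto
 have "p * ?a <= inner v (D1 F th *v v) / 2"
 proof (rule LIMSEQ_le[OF l norm_rem_expectation_second_order], intro exI[of _ 1] allI impI)
  fix n :: nat assume n: "1 <= n"
  let ?b = "(1 / sqrt n) *R v"
  let ?c = "(norm v)^2 / (16 * (1 + norm v / sqrt n))"
  let ?d = "LINT x|F. norm_rem (x - th) ?b"
  have "p * ?c = real n * (p * ((norm ?b)^2 / (16 * (1 + norm ?b))))"
   using n by (simp add: power_divide)
  also have "... <= real n * ?d"
   by (intro mult_left_mono norm_rem_expectation_lower p) simp
  finally show "p * ?c <= real n * ?d" .
 qed
 thus ?thesis by simp
qed

lemma D1_expand:
 assumes p: "0 < p" "!!i. p <= measure F {x. x - th : axis_ball i}"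
 shows "norm v <= 8 / p * norm (D1 F th *v v)"
proof (cases "v = 0")
 case False
 have "p / 8 * (norm v)^2 <= norm v * norm (D1 F th *v v)"
  by (rule order_trans[OF D1_lower[OF p(2)] norm_cauchy_schwarz])
 thus ?thesis using False p(1) by (simp add: power2_eq_square field_simps)
qed simp

lemma D1_invertible: "invertible (D1 F th)"
proof -
 obtain p where p: "0 < p" "!!i. p <= measure F {x. x - th : axis_ball i}" using axis_ball_mass[of "norm th"] by blast
 have "v = 0" if "D1 F th *v v = 0" for v using D1_expand[OF p, of v] that by simp
 thus ?thesis by (simp add: invertible_left_inverse matrix_left_invertible_ker)
qed

lemma D1_inverse: "D1 F th *v (matrix_inv (D1 F th) *v w) = w" "matrix_inv (D1 F th) *v (D1 F th *v w) = w"
 by (simp_all add: matrix_vector_mul_assoc matrix_inverse[OF D1_invertible])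

lemma D1_inverse_symmetric: "transpose (matrix_inv (D1 F th)) = matrix_inv (D1 F th)"
proof -
 let ?D = "D1 F th" and ?E = "matrix_inv (D1 F th)"
 have "transpose ?E = transpose ?E ** (?D ** ?E)" by (simp add: matrix_inverse[OF D1_invertible])
 also have "... = transpose (?D ** ?E) ** ?E" by (simp add: matrix_mul_assoc matrix_transpose_mul D1_symmetric)
 also have "... = ?E" by (simp add: matrix_inverse[OF D1_invertible])
 finally show ?thesis .
qed

text \<open>Continuity of matrix inversion is avoided: the uniform expansion bound
  \<open>D1_expand\<close> estimates the difference from the limit v by 8/p times norm (w k - D1 v),
  which tends to 0.\<close>

lemma D1_inverse_tendsto:
 assumes th: "th ----> th0" and w: "w ----> w0"
 shows "(%k. matrix_inv (D1 F (th k)) *v w k) ----> matrix_inv (D1 F th0) *v w0"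
proof -
 let ?v = "matrix_inv (D1 F th0) *v w0"
 obtain K where K: "!!k. norm (th k) <= K" using convergent_imp_bounded[OF th] unfolding bounded_iff by auto
 obtain p where p: "0 < p" "!!th i. norm th <= K ==> p <= measure F {x. x - th : axis_ball i}" using axis_ball_mass[of K] by blast
 have "(%k. (D1 F (th k) *v ?v) $ i) ----> (D1 F th0 *v ?v) $ i" for i
  unfolding matrix_vector_mult_def vec_lambda_beta
 proof (intro tendsto_sum tendsto_mult tendsto_const)
  fix j
  show "(%k. D1 F (th k) $ i $ j) ----> D1 F th0 $ i $ j"
   unfolding D1_nth
  proof (rule kernel_tendsto[OF hess_measurable hess_bound _ _ th])
   show "isCont (%y. hess y i j) y" if "y ~= 0" for y
    unfolding hess_def using that by (intro continuous_intros isCont_o2[OF unitv_isCont]) auto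
  qed simp
 qed
 hence Dv: "(%k. D1 F (th k) *v ?v) ----> w0" unfolding D1_inverse by (simp add: tendsto_vec_iff)
 have "(%k. matrix_inv (D1 F (th k)) *v w k - ?v) ----> 0"
 proof (rule Lim_null_comparison)
  show "EV k. norm (matrix_inv (D1 F (th k)) *v w k - ?v) <= 8 / p * norm (w k - D1 F (th k) *v ?v)"
   by (smt (verit) always_eventually allI D1_expand p K matrix_vector_mult_diff_distrib D1_inverse)
  show "(%k. 8 / p * norm (w k - D1 F (th k) *v ?v)) ----> 0"
   by (intro tendsto_mult_right_zero tendsto_norm_zero) (use tendsto_diff[OF w Dv] in simp)
 qed
 thus ?thesis by (rule LIM_zero_cancel)
qed

lemma D1_inverse_bound:
 assumes "0 < p" "!!i. p <= measure F {x. x - th : axis_ball i}"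
 shows "norm (matrix_inv (D1 F th) *v w) <= 8 / p * norm w"
 using D1_expand[OF assms, of "matrix_inv (D1 F th) *v w"] by (simp add: D1_inverse)

end

section \<open>The empirical spatial quantile\<close>

lemma empirical_measure_map: "0 < n ==> empirical_measure X n = measure_pmf (map_pmf X (pmf_of_set {..<n}))"
 unfolding empirical_measure_def by (subst map_pmf_of_set) auto

lemma empirical_integral:
 fixes g :: "'a => real"
 assumes "0 < n" shows "(LINT x|(empirical_measure X n). g x) = (SUM i<n. g (X i)) / n"
 unfolding empirical_measure_map[OF assms] using assms by (simp add: integral_pmf_of_set lessThan_empty_iff)

lemma empirical_prob: "0 < n ==> measure (empirical_measure X n) A = (SUM i<n. indicator A (X i)) / n"
 using empirical_integral[of n X "indicat_real A"] by (simp add: empirical_measure_def)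

lemma empirical_measure_cong: "(!!i. i < n ==> X i = Y i) ==> empirical_measure X n = empirical_measure Y n"
 unfolding empirical_measure_def by (intro arg_cong[where f="%M. measure_pmf (pmf_of_multiset M)"] image_mset_cong) auto

lemma empirical_borel_law: "borel_law (empirical_measure X n)"
proof -
 interpret prob_space "empirical_measure X n" unfolding empirical_measure_def by (rule measure_pmf.prob_space_axioms)
 show ?thesis by unfold_locales (simp add: empirical_measure_def)
qed

abbreviation emp_obj :: "(nat => real^'n) => nat => real^'n => real^'n => real" where
 "emp_obj X n == borel_law.obj (empirical_measure X n)"

abbreviation emp_quantile :: "(nat => real^'n) => nat => real^'n => real^'n" where
 "emp_quantile X n == spatial_quantile (empirical_measure X n)"

lemma emp_obj_eq: "0 < n ==> emp_obj X n u q = (SUM i<n. norm (X i - q) - norm (X i)) / n - inner u q"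
 by (simp add: borel_law.obj_def[OF empirical_borel_law] empirical_integral)

lemma emp_obj_diff:
 assumes n: "0 < n"
 shows "emp_obj X n u (th + v) - emp_obj X n u th
  = ((SUM i<n. norm_rem (X i - th) v) - inner (SUM i<n. unitv (X i - th) + u) v) / n"
proof -
 have star: "(SUM i<n. norm_rem (X i - th) v) = (SUM i<n. norm (X i - (th + v)) - norm (X i)) - (SUM i<n. norm (X i - th) - norm (X i)) + (SUM i<n. inner (unitv (X i - th)) v)"
  unfolding sum_subtractf[symmetric] sum.distrib[symmetric] by (intro sum.cong refl) (simp add: norm_rem_def algebra_simps)
 show ?thesis
  unfolding star emp_obj_eq[OF n] inner_sum_left inner_add_left sum.distrib inner_add_right using n by (simp add: field_simps)
qed

definition tie_set :: "(nat => real^'n) => nat => (real^'n) set" where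
 "tie_set X n = (%(k, i, j). (of_int k / n) *R unitv (X i - X j)) ` ({- int n..int n} \<times> {..<n} \<times> {..<n})"

lemma finite_tie_set: "finite (tie_set X n)" unfolding tie_set_def by simp

text \<open>If the minimiser is not unique then all observations lie on a line, with none of them at some minimiser,
 so stationarity there makes $u$ a multiple $k/n$ of the direction of the line.\<close>
lemma emp_quantile_unique:
 assumes n: "0 < n" and u: "norm u < 1" "u ~: tie_set X n"
  and q1: "!!q. emp_obj X n u q1 <= emp_obj X n u q" and q2: "!!q. emp_obj X n u q2 <= emp_obj X n u q"
 shows "q1 = q2"
proof (rule ccontr)
 assume ne: "q1 ~= q2"
 define q where "q = (1/2) *R (q1 + q2)"
 define v where "v = (1/2) *R (q2 - q1)"
 define y where "y = (%i. X i - q)"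
 have v0: "v ~= 0" using ne by (simp add: v_def)
 have q12: "q + v = q2" "q + - v = q1" by (simp_all add: q_def v_def algebra_simps scaleR_add_left[symmetric])
 let ?a = "emp_obj X n u"
 let ?b = "SUM i<n. norm_rem (y i) v"
 let ?c = "SUM i<n. norm_rem (y i) (- v)"
 \<comment> \<open>The second difference at the midpoint is a sum of nonnegative remainders. As both
   ends are minimisers it is at most 0, so every remainder vanishes; in particular no observation is
   at the midpoint.\<close>
 have "(?a (q + v) - ?a q) + (?a (q + - v) - ?a q) = (?b + ?c) / n"
  unfolding emp_obj_diff[OF n] y_def by (simp add: diff_divide_distrib add_divide_distrib)
 moreover have "0 <= ?b" "0 <= ?c" by (intro sum_nonneg norm_rem_nonneg)+
 moreover have "?a q1 = ?a q2" using q1[of q2] q2[of q1] by auto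
 ultimately have "?b + ?c = 2 * real n * (?a q1 - ?a q)"
  and ge: "0 <= ?b" "0 <= ?c"
  unfolding q12 using n by (auto simp: field_simps)
 moreover have "2 * real n * (?a q1 - ?a q) <= 0" using q1[of q] by (intro mult_nonneg_nonpos) auto
 ultimately have sums: "?b = 0" "2 * real n * (?a q1 - ?a q) = 0" by linarith+
 hence sums: "?b = 0" "?a q = ?a q1" using n by auto
 have rem0: "norm_rem (y i) v = 0" if "i < n" for i
  using sums(1) that by (subst (asm) sum_nonneg_eq_0_iff) (auto intro: norm_rem_nonneg)
 have y0: "y i ~= 0" if "i < n" for i using rem0[OF that] v0 by (auto simp: norm_rem_def unitv_def)
 define e where "e = unitv v"
 have ye: "unitv (y i) = e \<or> unitv (y i) = - e" if i: "i < n" for i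
 proof -
  let ?f = "unitv (y i)"
  let ?e = "inner (?f)"
  have sq: "(norm v)^2 = (?e v)^2"
   using norm_rem_mult[OF y0[OF i], of v] rem0[OF i] by simp
  have "?e v = norm v * ?e e" by (simp add: e_def unitv_def)
  hence "(?e e)^2 = 1^2" using sq v0 by (simp add: power_mult_distrib)
  hence c: "?e e = 1 \<or> ?e e = - 1" by (auto simp only: power2_eq_iff)
  have n1: "norm (?f) = 1" "norm e = 1" using norm_unitv y0[OF i] v0 by (auto simp: e_def)
  have "(norm (?f - e))^2 = 2 - 2 * ?e e" "(norm (?f + e))^2 = 2 + 2 * ?e e"
   using n1 by (simp_all add: power2_norm_eq_inner algebra_simps inner_commute norm_eq_1)
  with c have "(norm (?f - e))^2 = 0 \<or> (norm (?f + e))^2 = 0" by force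
  thus ?thesis by (simp add: eq_neg_iff_add_eq_0)
 qed
 define g where "g = (SUM i<n. unitv (y i) + u)"
 have g0: "g = 0"
 proof -
  \<comment> \<open>Gradient step at the midpoint as in \<open>quantile_stationary\<close>, with the
    sum over observations in place of the expectation.\<close>
  define A where "A = (SUM i<n. 2 / norm (y i)) + 1"
  have A: "0 < A" unfolding A_def by (intro add_nonneg_pos sum_nonneg) auto
  let ?g = "(1 / (2 * A)) *R g"
  have "0 <= ?a (q + (1 / (2 * A)) *R g) - ?a q" using q1 sums(2) by simp
  hence "inner g ?g <= (SUM i<n. norm_rem (y i) ?g)"
   unfolding emp_obj_diff[OF n] g_def[symmetric] y_def[symmetric] using n by (simp add: y_def g_def zero_le_divide_iff)
  also have "... <= (SUM i<n. 2 * (norm ?g)^2 / norm (y i))"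
   by (intro sum_mono norm_rem_le_square y0) auto
  also have "... <= A * (norm ?g)^2" by (simp add: A_def sum_distrib_right algebra_simps)
  also have "... = (norm g)^2 / (4 * A)" by (simp add: field_simps power2_eq_square)
  finally have "(norm g)^2 / (2 * A) <= (norm g)^2 / (4 * A)" by (simp add: power2_norm_eq_inner)
  thus ?thesis using A by (simp add: field_simps)
 qed
 define sg :: "nat => int" where "sg = (%i. if unitv (y i) = e then 1 else - 1)"
 have sg: "unitv (y i) = of_int (sg i) *R e" if "i < n" for i using ye[OF that] by (auto simp: sg_def)
 define k where "k = - (SUM i<n. sg i)"
 have "0 = (SUM i<n. unitv (y i)) + real n *R u" using g0 by (simp add: g_def sum.distrib sum_constant_scaleR del: sum_constant)
 also have "(SUM i<n. unitv (y i)) = - (of_int k *R e)" by (simp add: sg k_def scaleR_sum_left[symmetric])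
 finally have nu: "real n *R u = of_int k *R e" by simp
 have "(1 / real n) *R (real n *R u) = (of_int k / real n) *R e" unfolding nu by simp
 hence ue: "u = (of_int k / real n) *R e" using n by simp
 have kn: "abs k <= int n"
 proof -
  have "abs (SUM i<n. sg i) <= (SUM i<n. abs (sg i))" by auto
  also have "... = int n" by (simp add: sg_def if_distrib cong: if_cong)
  finally show ?thesis by (simp add: k_def)
 qed
 let ?d = "%(k, i, j). (of_int k / n) *R unitv (X i - X j)"
 show False
 \<comment> \<open>If all observations coincide, stationarity gives norm u = 1. Otherwise the line
   has, up to sign, the direction of the difference of two observations, and the sign goes into
   k.\<close>
 proof (cases "ALL i<n. X i = X 0")
  case True
  have yi: "y i = y 0" if "i < n" for i unfolding y_def True[rule_format, OF that] ..
  have "g = (SUM i<n. unitv (y 0) + u)" unfolding g_def by (intro sum.cong refl arg_cong2[where f="(+)"] arg_cong[where f=unitv] yi) simp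
  hence "g = real n *R (unitv (y 0) + u)" by (simp only: sum_constant_scaleR card_lessThan)
  hence "u = - unitv (y 0)" using g0 n by (simp add: eq_neg_iff_add_eq_0 add.commute)
  thus False using u(1) norm_unitv[OF y0[OF n]] by simp
 next
  case False
  then obtain i where i: "i < n" "X i ~= X 0" by blast
  have yn: "y j = norm (y j) *R (of_int (sg j) *R e)" if "j < n" for j
   unfolding sg[OF that, symmetric] by (simp add: unitv_def)
  define t where "t = norm (y i) * of_int (sg i) - norm (y 0) * of_int (sg 0)"
  have "X i - X 0 = y i - y 0" by (simp add: y_def)
  also have "... = t *R e" using yn[OF i(1)] yn[OF n] by (metis t_def scaleR_diff_left scaleR_scaleR)
  finally have Xt: "X i - X 0 = t *R e" .
  have t0: "t ~= 0" using Xt i(2) by auto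
  have ne: "norm e = 1" using v0 norm_unitv by (simp add: e_def)
  let ?h = "unitv (X i - X 0)"
  have "?h = (t / abs t) *R e" unfolding Xt by (simp add: unitv_def ne)
  hence "?h = e \<or> ?h = - e" using t0 by (cases "0 < t") auto
  hence "u : tie_set X n"
  proof
   assume "?h = e"
   hence "u = ?d (k, i, 0)" by (simp add: ue)
   thus ?thesis unfolding tie_set_def by (rule image_eqI) (use i(1) n kn in \<open>auto simp: abs_le_iff\<close>)
  next
   assume "?h = - e"
   hence "u = ?d (- k, i, 0)" by (simp add: ue)
   thus ?thesis unfolding tie_set_def by (rule image_eqI) (use i(1) n kn in \<open>auto simp: abs_le_iff\<close>)
  qed
  thus False using u(2) by auto
 qed
qed

lemma emp_quantile_bound:
 assumes n: "0 < n" and u: "norm u <= r" "r < 1" and R: "0 <= R" "(SUM i<n. indicator {x. R < norm x} (X i)) / n <= (1 - r) / 4"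
 shows "norm (emp_quantile X n u) <= 4 * R / (1 - r)"
proof -
 let ?a = "empirical_measure X n"
 interpret E: borel_law "?a" by (rule empirical_borel_law)
 have "measure (?a) {x : space (?a). R < norm x} <= (1 - r) / 4"
  using R(2) by (simp add: empirical_prob[OF n, symmetric] empirical_measure_def)
 from E.minimizer_bound[OF u R(1) this E.spatial_quantile_minimizes] u show ?thesis by simp
qed

lemma emp_quantile_bounded:
 assumes n: "0 < n" and r: "r < 1" and X: "!!i. i < n ==> (%k. Y k i) ----> X i"
 shows "EX R. ALL k. ALL u:cball 0 r. norm (emp_quantile (Y k) n u) <= R"
proof -
 have "EX B. ALL k. norm (Y k i) <= B" if "i < n" for i
  using convergent_imp_bounded[OF X[OF that]] unfolding bounded_iff by auto
 then obtain B where B: "!!i k. i < n ==> norm (Y k i) <= B i" by metis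
 define R where "R = (SUM i<n. abs (B i))"
 have R: "0 <= R" "norm (Y k i) <= R" if "i < n" for i k
  using B[OF that, of k] member_le_sum[of i "{..<n}" "%i. abs (B i)"] that by (auto simp: R_def)
 have "(SUM i<n. indicat_real {x. R < norm x} (Y k i)) = 0" for k using R(2) by (intro sum.neutral) (auto simp: indicator_def not_less)
 hence "norm (emp_quantile (Y k) n v) <= 4 * R / (1 - r)" if "v : cball 0 r" for k v
  using that r R(1)[OF n] by (intro emp_quantile_bound[OF n]) auto
 thus ?thesis by blast
qed

text \<open>Joint continuity in the sample and in u; only the limit u0 has to avoid the ties of the
  limit sample.\<close>

lemma emp_quantile_tendsto:
 assumes n: "0 < n" and r: "r < 1" and X: "!!i. i < n ==> (%k. Y k i) ----> X i"
  and u: "!!k. u k : cball 0 r" "u0 : cball 0 r" "u0 ~: tie_set X n" and lim: "u ----> u0"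
 shows "(%k. emp_quantile (Y k) n (u k)) ----> emp_quantile X n u0"
proof -
 obtain R where bound: "!!k u. u : cball 0 r ==> norm (emp_quantile (Y k) n u) <= R" using emp_quantile_bounded[of n r Y X, OF n r X] by blast
 have u1: "norm (u k) < 1" "norm u0 < 1" for k using u(1)[of k] u(2) r by auto
 have minim: "emp_obj Z n v (emp_quantile Z n v) <= emp_obj Z n v q" if "norm v < 1" for Z v q
  using borel_law.spatial_quantile_minimizes[OF empirical_borel_law that] .
 let ?a = "emp_obj X n u0"
 show ?thesis
 proof (rule argmin_tendsto[where f="%k. emp_obj (Y k) n (u k)" and g="?a" and L=2 and R=R])
  show "(%k. emp_obj (Y k) n (u k) q) ----> ?a q" for q
   unfolding emp_obj_eq[OF n] using n X by (intro tendsto_intros lim) auto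
  show "abs (emp_obj (Y k) n (u k) q - emp_obj (Y k) n (u k) q') <= 2 * norm (q - q')" for k q q'
   by (rule order_trans[OF borel_law.obj_lipschitz[OF empirical_borel_law] mult_right_mono]) (use u1(1)[of k] in auto)
  show "q = emp_quantile X n u0" if "!!q'. ?a q <= ?a q'" for q
   by (rule emp_quantile_unique[OF n u1(2) u(3) that minim[OF u1(2)]])
 qed (use minim u1 bound u in auto)
qed

lemma emp_quantile_measurable:
 assumes n: "0 < n" and r: "r < 1"
 shows "(%u. indicator (cball 0 r) u *R emp_quantile X n u) : bmeas borel"
proof -
 have "continuous_on (cball 0 r - tie_set X n) (emp_quantile X n)"
  by (rule continuous_on_sequentiallyI, rule emp_quantile_tendsto[OF n r, where Y="%_. X"]) auto
 hence "(%u. indicator (cball 0 r - tie_set X n) u *R emp_quantile X n u) : bmeas borel"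
  by (intro borel_measurable_continuous_on_indicator sets.Diff borel_closed closed_cball finite_imp_closed finite_tie_set)
 thus ?thesis
  by (rule measurable_discrete_difference[OF _ countable_finite[OF finite_tie_set[of X n]]]) (auto simp: indicator_def)
qed

context pos_density begin

lemma quantile_measurable:
 assumes r: "r < 1" shows "(%u. indicator (cball 0 r) u *R spatial_quantile F u) : bmeas borel"
proof (rule borel_measurable_continuous_on_indicator)
 show "continuous_on (cball 0 r) (spatial_quantile F)"
  by (rule continuous_on_sequentiallyI, rule quantile_tendsto[OF r]) auto
qed auto

text \<open>The statistic is continuous in the sample: for almost every u there is no tie, so the
  quantile converges, and quantiles stay bounded along a convergent sequence of samples. Joint
  measurability of the quantile in the sample and u is thereby bypassed.\<close>

lemma V_stat_measurable:
 assumes r: "r < 1"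
 shows "V_stat F r n : bmeas (sample_law F n)"
proof (cases "n = 0")
 case True thus ?thesis by (simp add: V_stat_def[abs_def])
next
 case False
 hence n: "0 < n" by simp
 obtain K where K: "!!u. u : cball 0 r ==> norm (spatial_quantile F u) <= K" using quantile_bounded[OF r] by blast
 let ?g = "%X u. indicat_real (cball 0 r) u *R (norm (emp_quantile X n u - spatial_quantile F u))\<^sup>2"
 have gm: "?g X : bmeas borel" for X
 proof -
  have "?g X = (%u. (norm (indicator (cball 0 r) u *R emp_quantile X n u - indicator (cball 0 r) u *R spatial_quantile F u))^2)"
  proof (rule ext)
   fix u show "?g X u = (norm (indicator (cball 0 r) u *R emp_quantile X n u - indicator (cball 0 r) u *R spatial_quantile F u))^2"
    by (cases "u : cball 0 r") simp_all
  qed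
  also have "... : bmeas borel"
   by (rule borel_measurable_power[OF measurable_compose[OF borel_measurable_diff[OF emp_quantile_measurable[OF n r] quantile_measurable[OF r]] borel_measurable_norm]])
  finally show ?thesis .
 qed
 have "continuous_on UNIV (V_stat F r n)"
 proof (rule continuous_on_sequentiallyI)
  fix Y :: "nat => nat => real^'n" and X assume YX: "Y ----> X"
  have Yi: "(%k. Y k i) ----> X i" for i
   by (rule continuous_on_tendsto_compose[OF continuous_on_product_coordinates YX]) auto
  obtain R where R: "!!k u. u : cball 0 r ==> norm (emp_quantile (Y k) n u) <= R"
   using emp_quantile_bounded[of n r Y X, OF n r Yi] by blast
  let ?a = "indicat_real (cball 0 r)"
  have "(%k. (LINT u|lborel. ?g (Y k) u)) ----> (LINT u|lborel. ?g X u)"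
  proof (rule integral_dominated_convergence[where w="%u. ?a u * (R + K)^2"])
   show "integrable lborel (%u::real^'n. ?a u * (R + K)^2)"
    by (intro integrable_mult_left integrable_real_indicator) (use emeasure_lborel_cball_finite[of "0::real^'n" r] in auto)
   have "AE u in lborel. u ~: tie_set X n"
    by (intro AE_not_in finite_imp_null_set_lborel finite_tie_set)
   thus "AE u in lborel. (%k. ?g (Y k) u) ----> ?g X u"
   proof eventually_elim
    case (elim u)
    show ?case
    proof (cases "u : cball 0 r")
     case True
     have "(%k. emp_quantile (Y k) n u) ----> emp_quantile X n u"
      by (rule emp_quantile_tendsto[OF n r Yi True True elim tendsto_const])
     thus ?thesis by (intro tendsto_intros)
    qed simp
   qed
   have "(norm (emp_quantile (Y k) n u - spatial_quantile F u))^2 <= (R + K)^2" if "u : cball 0 r" for k u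
    by (rule power_mono[OF norm_triangle_le_diff[OF add_mono[OF R[OF that] K[OF that]]]]) simp
   hence "norm (?g (Y k) u) <= ?a u * (R + K)^2" for k u
    by (cases "u : cball 0 r") simp_all
   thus "AE u in lborel. norm (?g (Y k) u) <= ?a u * (R + K)^2" for k
    by auto
  qed (simp_all only: gm measurable_lborel2)
  thus "(%k. V_stat F r n (Y k)) ----> V_stat F r n X"
   unfolding V_stat_def set_lebesgue_integral_def by (rule tendsto_mult_left)
 qed
 from borel_measurable_continuous_onI[OF this]
 have V: "V_stat F r n : bmeas (PiM UNIV (%_. borel))" by (simp add: measurable_cong_sets[OF sets_PiM_equal_borel refl])
 \<comment> \<open>Points of the finite product are undefined beyond n, so they are extended by 0 to
   the full sequence space, where the continuity statement lives.\<close>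
 have ext: "(%X i. if i < n then X i else 0) : sample_law F n \<rightarrow>\<^sub>M PiM UNIV (%_. borel)"
 proof (rule measurable_PiM_single')
  show "(%X. if i < n then X i else 0) : bmeas (sample_law F n)" for i
   unfolding sample_law_def by (cases "i < n") (auto simp: measurable_cong_sets[OF refl sets_dens[symmetric, of f]] intro!: measurable_component_singleton)
 qed auto
 have "V_stat F r n (%i. if i < n then X i else 0) = V_stat F r n X" for X
  unfolding V_stat_def by (subst empirical_measure_cong[of n _ X]) auto
 thus ?thesis using measurable_compose[OF ext V] by simp
qed

end

section \<open>Pointwise bounds for the linearisation error\<close>

lemma sum_power4_le:
 fixes v :: "real^'n" shows "(norm v)^4 <= real CARD('n) * (SUM i:UNIV. (v $ i)^4)"
proof -
 have "(norm v)^2 = (SUM i:UNIV. 1 * (v $ i)^2)" by (simp add: norm_vec_def L2_set_def sum_nonneg)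
 moreover have "(norm v)^4 = ((norm v)^2)^2" by simp
 ultimately have "(norm v)^4 = (SUM i:UNIV. 1 * (v $ i)^2)^2" by simp
 also have "... <= (SUM i:(UNIV::'n set). 1^2) * (SUM i:UNIV. ((v $ i)^2)^2)" by (rule Cauchy_Schwarz_ineq_sum)
 finally show ?thesis by auto
qed

lemma norm_rem_scaled_lipschitz:
 assumes y: "y ~= 0" and n: "1 <= n" and w: "norm w <= L" and t: "norm t <= L"
 shows "abs (norm_rem y ((1 / sqrt (real n)) *R w) - norm_rem y ((1 / sqrt n) *R t)) <= 2 * L * norm (w - t) / n * (1 / norm y)"
proof -
 let ?s = "1 / sqrt (real n)"
 let ?a = "max (norm (?s *R w)) (norm (?s *R t))"
 let ?b = "norm (?s *R w - ?s *R t)"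
 have "abs (norm_rem y (?s *R w) - norm_rem y (?s *R t)) <= 2 * ?a * ?b / norm y"
  by (rule norm_rem_lipschitz[OF y])
 also have "... <= 2 * (?s * L) * (?s * norm (w - t)) / norm y"
 proof (intro divide_right_mono mult_mono)
  have "0 <= L" using w norm_ge_zero[of w] by linarith
  thus "0 <= 2 * (?s * L)" by simp
  show "?a <= ?s * L" using w t by (simp add: divide_right_mono)
  show "?b <= ?s * norm (w - t)" unfolding scaleR_diff_right[symmetric] by simp
 qed (auto simp: le_max_iff_disj)
 also have "... = (?s * ?s) * (2 * L * norm (w - t)) * (1 / norm y)" by auto
 also have "?s * ?s = 1 / n" by simp
 finally show ?thesis by simp
qed

lemma sqrt_power4: "(sqrt (real n))^4 = (real n)^2"
 using power_mult[of "sqrt (real n)" 2 2] by simp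

context pos_density begin

definition score :: "real^'n => real^'n => nat => (nat => real^'n) => real^'n" where
 "score th u n X = (1 / sqrt n) *R (SUM k<n. unitv (X k - th) + u)"

definition hit :: "real^'n => 'n => real^'n => real" where
 "hit th i x = indicator (axis_ball i) (x - th) - measure F {x. x - th : axis_ball i}"

text \<open>One quantity for the size of the score and for the deviation of the hit counts. On the
  bad event the squared error can be of order n; as \<open>fourth\<close> is at least of order n^2
  there, this event still contributes only O(1/n) in the mean. Second moments would not achieve
  that.\<close>

definition fourth :: "real^'n => real^'n => nat => (nat => real^'n) => real" where
 "fourth th u n X = (SUM i:UNIV. (score th u n X $ i)^4) + (SUM i:UNIV. (Gsum n (hit th i) X)^4)"

text \<open>Error of replacing the rescaled convex part of the empirical objective by its quadratic
  limit.\<close>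

definition quad_err :: "real^'n => nat => (nat => real^'n) => real^'n => real" where
 "quad_err th n X t = (SUM k<n. norm_rem (X k - th) ((1 / sqrt n) *R t)) - inner t (D1 F th *v t) / 2"

lemma norm_score_le:
 assumes "norm u <= 1" shows "norm (score th u n X) <= 2 * sqrt n"
proof -
 have "norm (SUM k<n. unitv (X k - th) + u) <= (SUM k<n. 2)"
  by (rule sum_norm_le) (use norm_triangle_le[OF add_mono[OF norm_unitv_le assms]] in simp)
 hence "norm (score th u n X) <= 2 * (real n / sqrt n)" by (simp add: score_def divide_right_mono)
 thus ?thesis by (simp add: real_div_sqrt)
qed

lemma D1_quadratic_lipschitz:
 assumes A: "nn_int F (%x. 1 / norm (x - th)) <= ennreal A" "0 <= A"
  and w: "norm w <= L" and t: "norm t <= L"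
 shows "abs (inner w (D1 F th *v w) / 2 - inner t (D1 F th *v t) / 2) <= 2 * L * norm (w - t) * A"
proof (rule LIMSEQ_le_const2)
 let ?e = "%v n. real n * (LINT x|F. norm_rem (x - th) ((1 / sqrt n) *R v))"
 show "(%n. abs (?e w n - ?e t n)) ----> abs (inner w (D1 F th *v w) / 2 - inner t (D1 F th *v t) / 2)"
  by (intro tendsto_rabs tendsto_diff norm_rem_expectation_second_order)
 have i: "integrable F (%x. 1 / norm (x - th))" by (rule kernel_integrable[of "%y. 1 / norm y" 1]) auto
 let ?a = "norm (w - t)"
 let ?b = "LINT x|F. 1 / norm (x - th)"
 have "abs (?e w n - ?e t n) <= 2 * L * ?a * A" if n: "1 <= n" for n :: nat
 proof -
  let ?s = "1 / sqrt (real n)"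
  let ?c = "?s *R w"
  let ?d = "?s *R t"
  have "abs (?e w n - ?e t n) = real n * norm (LINT x|F. norm_rem (x - th) ?c - norm_rem (x - th) ?d)"
   by (simp add: norm_rem_integrable abs_mult flip: right_diff_distrib)
  also have "... <= real n * (LINT x|F. norm (norm_rem (x - th) ?c - norm_rem (x - th) ?d))"
   by (intro mult_left_mono integral_norm_bound) simp
  also have "... <= real n * (LINT x|F. 2 * L * ?a / n * (1 / norm (x - th)))"
  proof (intro mult_left_mono integral_mono_AE)
   show "AE x in F. norm (norm_rem (x - th) ?c - norm_rem (x - th) ?d) <= 2 * L * ?a / n * (1 / norm (x - th))"
    using AE_neq[of th]
   proof eventually_elim
    case (elim x)
    show ?case unfolding real_norm_def by (rule norm_rem_scaled_lipschitz[OF _ n w t]) (use elim in simp)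
   qed
   show "integrable F (%x. norm (norm_rem (x - th) ?c - norm_rem (x - th) ?d))"
    by (intro integrable_norm Lint_diff norm_rem_integrable)
   show "integrable F (%x. 2 * L * ?a / n * (1 / norm (x - th)))" by (rule integrable_mult_right[OF i])
  qed simp
  also have "... = 2 * L * ?a * ?b"
   unfolding integral_mult_right_zero using n by simp
  also have "... <= 2 * L * ?a * A"
  proof (intro mult_left_mono)
   show "?b <= A"
    using A by (subst integral_eq_nn_integral) (auto intro: enn2real_leI)
   show "0 <= 2 * L * ?a" using order_trans[OF norm_ge_zero w] by simp
  qed
  finally show ?thesis .
 qed
 thus "EX N. ALL n>=N. abs (?e w n - ?e t n) <= 2 * L * ?a * A" by blast
qed

lemma D1_symmetric_inner: "inner v (D1 F th *v w) = inner w (D1 F th *v v)"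
 by (metis dot_lmul_matrix transpose_matrix_vector D1_symmetric inner_commute)

text \<open>Comparing the convex process $w \mapsto n(\mathrm{obj}(\theta + w/\sqrt n) - \mathrm{obj}(\theta))$ with its quadratic limit
 at the two minimisers.\<close>
lemma bahadur_error:
 assumes n: "0 < n" and p: "0 < p" "!!i. p <= measure F {x. x - th : axis_ball i}" and u: "norm u < 1"
  and hits: "!!i. p / 2 <= (SUM k<n. indicator (axis_ball i) (X k - th)) / n"
  and S: "norm (score th u n X) <= p / 64 * sqrt n"
 shows "norm (sqrt n *R (emp_quantile X n u - th)) <= 64 / p * norm (score th u n X)"
  and "p / 16 * (norm (sqrt n *R (emp_quantile X n u - th) - matrix_inv (D1 F th) *v score th u n X))^2
   <= abs (quad_err th n X (sqrt n *R (emp_quantile X n u - th))) + abs (quad_err th n X (matrix_inv (D1 F th) *v score th u n X))"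
proof -
 define S where "S = score th u n X"
 let ?d = "emp_quantile X n u"
 define v where "v = ?d - th"
 define w where "w = sqrt n *R v"
 let ?f = "matrix_inv (D1 F th)"
 define z where "z = ?f *v S"
 have vw: "v = (1 / sqrt n) *R w" using n by (simp add: w_def)
 have Ssum: "(SUM k<n. unitv (X k - th) + u) = sqrt n *R S" by (simp add: S_def score_def)
 let ?g = "emp_obj X n u"
 have minim: "?g (th + v) <= ?g q" for q
  unfolding v_def using borel_law.spatial_quantile_minimizes[OF empirical_borel_law u] by simp
 let ?rh = "%w. SUM k<n. norm_rem (X k - th) ((1 / sqrt n) *R w)"
 have diff: "?g (th + (1 / sqrt n) *R t) - ?g th = (?rh t - inner S t) / n" for t
  unfolding emp_obj_diff[OF n] Ssum by simp
 have min0: "?rh w <= inner S w"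
 proof -
  have "(?rh w - inner S w) / n <= 0" using minim[of th] diff[of w, folded vw] unfolding vw[symmetric] by auto
  thus ?thesis using n by (simp add: divide_le_0_iff)
 qed
 have minz: "?rh w - inner S w <= ?rh z - inner S z"
 proof -
  have "(?rh w - inner S w) / n <= (?rh z - inner S z) / n"
   unfolding diff[symmetric] using minim by (simp add: vw[symmetric])
  thus ?thesis using n by (simp add: divide_le_cancel)
 qed
 let ?e = "1 + norm v"
 let ?a = "(norm v)^2 / (16 * ?e)"
 have low: "real n * (p / 2) * ?a <= ?rh w"
 proof -
  obtain i where i: "!!y. y : axis_ball i ==> (norm v)^2 / (16 * ?e) <= norm_rem y v"
   using norm_rem_axis_ball[OF dim, of v] by blast
  have "real n * (p / 2) * ?a <= (SUM k<n. indicator (axis_ball i) (X k - th)) * ?a"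
   using hits[of i] n by (intro mult_right_mono) (auto simp: field_simps)
  also have "... <= ?rh w"
   unfolding sum_distrib_right vw[symmetric] using i by (intro sum_mono) (auto simp: indicator_def norm_rem_nonneg)
  finally show ?thesis .
 qed
 let ?c = "sqrt n * norm v"
 let ?h = "p / 64 * sqrt n"
 let ?i = "sqrt n *R (?d - th)"
 \<comment> \<open>Away from 0 the remainder sum grows only linearly. Its slope p/32 beats the term
   norm S * norm v because norm S is at most p/64 sqrt n, and half of the slope is left.\<close>
 have "norm w <= 64 / p * norm S"
 proof (cases "v = 0")
  case False
  hence v: "0 < norm v" by simp
  have "real n * (p / 2) * ?a <= norm S * ?c"
   using low min0 norm_cauchy_schwarz[of S w] by (simp add: w_def)
  hence "real n * (p / 32) * norm v <= norm S * sqrt n * ?e"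
   using v by (simp add: power2_eq_square divide_le_eq add_pos_pos mult_ac)
  hence "sqrt n * ((p / 32) * ?c) <= sqrt n * (norm S * ?e)"
   by (simp add: mult_ac)
  hence "(p / 32) * ?c <= norm S * ?e" using n by (subst (asm) mult_le_cancel_left_pos) auto
  also have "... <= norm S + ?h * norm v"
   using mult_right_mono[OF S, of "norm v"] by (simp add: S_def distrib_left)
  finally have "(p / 32) * ?c - ?h * norm v <= norm S" by linarith
  moreover have "(p / 32) * ?c - ?h * norm v = (p / 64) * norm w" by (simp add: w_def)
  ultimately have "(p / 64) * norm w <= norm S" by auto
  thus ?thesis using p(1) by (simp add: field_simps)
 qed (use p(1) in \<open>simp add: w_def\<close>)
 thus "norm ?i <= 64 / p * norm (score th u n X)"
  by (simp add: w_def v_def S_def)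
 have Dz: "D1 F th *v z = S" unfolding z_def by (rule D1_inverse)
 let ?b = "quad_err th n X"
 have "p / 8 * (norm (w - z))^2 <= inner (w - z) (D1 F th *v (w - z))" by (rule D1_lower[OF p(2)])
 also have "... = inner w (D1 F th *v w) - inner z (D1 F th *v z) - 2 * (inner S w - inner S z)"
  using D1_symmetric_inner[of z th w] by (simp add: matrix_vector_mult_diff_distrib inner_diff_left inner_diff_right Dz inner_commute)
 also have "... <= 2 * (?b z - ?b w)"
  using minz by (simp add: quad_err_def)
 also have "... <= 2 * (abs (?b w) + abs (?b z))"
  using abs_ge_self[of "?b z"] abs_ge_minus_self[of "?b w"] by (intro mult_left_mono) simp_all
 finally show "p / 16 * (norm (sqrt n *R (?d - th) - ?f *v score th u n X))^2
   <= abs (?b ?i) + abs (?b (?f *v score th u n X))"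
  by (simp add: w_def v_def S_def z_def)
qed

text \<open>The random minimiser is replaced by a point of a finite net, so that only expectations
  at fixed points are needed later; the cost is controlled by the sample mean of inverse
  distances.\<close>

lemma quad_err_net:
 assumes n: "0 < n" and X: "!!k. k < n ==> X k ~= th" and A: "nn_int F (%x. 1 / norm (x - th)) <= ennreal A" "0 <= A"
  and T: "finite T" "T <= cball 0 L" "!!w. w : cball 0 L ==> EX t:T. norm (w - t) <= ep" and w: "norm w <= L"
 shows "abs (quad_err th n X w) <= (SUM t:T. abs (quad_err th n X t)) + 2 * L * ep * ((SUM k<n. 1 / norm (X k - th)) / n + A)"
proof -
 obtain t where t: "t : T" "norm (w - t) <= ep" using T(3)[of w] w by auto
 have tL: "norm t <= L" using t(1) T(2) by auto
 have L: "0 <= L" using w norm_ge_zero[of w] by linarith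
 let ?s = "1 / sqrt (real n)"
 let ?a = "SUM k<n. 1 / norm (X k - th)"
 let ?b = "quad_err th n X"
 have "abs (?b w - ?b t) <=
   abs (SUM k<n. norm_rem (X k - th) (?s *R w) - norm_rem (X k - th) (?s *R t)) + abs (inner w (D1 F th *v w) / 2 - inner t (D1 F th *v t) / 2)"
  unfolding quad_err_def sum_subtractf by auto
 also have "... <= (SUM k<n. 2 * L * norm (w - t) / n * (1 / norm (X k - th))) + 2 * L * norm (w - t) * A"
  by (intro add_mono order_trans[OF sum_abs] sum_mono norm_rem_scaled_lipschitz D1_quadratic_lipschitz A w tL) (use X n in auto)
 also have "... = 2 * L * norm (w - t) * (?a / n + A)" unfolding sum_distrib_left[symmetric] by (simp add: algebra_simps)
 also have "... <= 2 * L * ep * (?a / n + A)"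
  using t(2) L A(2) by (intro mult_right_mono mult_left_mono) (auto intro!: add_nonneg_nonneg divide_nonneg_nonneg sum_nonneg)
 finally have "abs (?b w) <= abs (?b t) + 2 * L * ep * (?a / n + A)" by auto
 moreover have "abs (?b t) <= (SUM t:T. abs (?b t))" by (rule member_le_sum[OF t(1) _ T(1)]) simp
 ultimately show ?thesis by auto
qed

lemma fourth_bounds:
 shows "(norm (score th u n X))^4 <= real CARD('n) * fourth th u n X" "(Gsum n (hit th i) X)^4 <= fourth th u n X" "0 <= fourth th u n X"
proof -
 let ?a = "SUM i:UNIV. (Gsum n (hit th i) X)^4"
 have a: "0 <= (SUM i:UNIV. (score th u n X $ i)^4)" "0 <= ?a" by (auto intro!: sum_nonneg)
 let ?b = "fourth th u n X"
 show "(norm (score th u n X))^4 <= real CARD('n) * ?b"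
  by (rule order_trans[OF sum_power4_le]) (use a in \<open>simp add: fourth_def mult_left_mono\<close>)
 have "(Gsum n (hit th i) X)^4 <= ?a"
  by (rule member_le_sum[of i UNIV "%i. (Gsum n (hit th i) X)^4"]) auto
 thus "(Gsum n (hit th i) X)^4 <= ?b" using a by (simp add: fourth_def)
 show "0 <= ?b" using a by (simp add: fourth_def)
qed

lemma Gsum_hit: "0 < n ==> Gsum n (hit th i) X = sqrt n * ((SUM k<n. indicator (axis_ball i) (X k - th)) / n - measure F {x. x - th : axis_ball i})"
proof -
 assume n: "0 < n"
 define s where "s = sqrt (real n)"
 have s: "0 < s" "real n = s * s" using n by (auto simp: s_def)
 show ?thesis unfolding Gsum_def hit_def sum_subtractf sum_constant card_lessThan s_def[symmetric] s(2) using s(1) by (simp add: field_simps)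
qed

text \<open>Either some hit count falls short of its mean by p/2 or the score exceeds p/64 sqrt n;
  in both cases a fourth power of order n^2 appears.\<close>

lemma bad_fourth:
 assumes n: "0 < n" and p: "0 < p" "p <= 1" "!!i. p <= measure F {x. x - th : axis_ball i}"
  and bad: "~ ((ALL i. p / 2 <= (SUM k<n. indicator (axis_ball i) (X k - th)) / n) & norm (score th u n X) <= p / 64 * sqrt n)"
 shows "(p / 64)^4 * (real n)^2 <= real CARD('n) * fourth th u n X"
proof (cases "norm (score th u n X) <= p / 64 * sqrt n")
 case True
 then obtain i where i: "(SUM k<n. indicat_real (axis_ball i) (X k - th)) / n < p / 2" using bad by (auto simp: not_le)
 have "(p / 64 * sqrt n)^4 <= (p / 2 * sqrt n)^4" using p(1) by (intro power_mono mult_right_mono) auto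
 also have "... <= abs (Gsum n (hit th i) X)^4"
 proof (rule power_mono)
  have "sqrt n * ((SUM k<n. indicat_real (axis_ball i) (X k - th)) / n - measure F {x. x - th : axis_ball i}) <= sqrt n * (- (p / 2))"
   using i p(3)[of i] by (intro mult_left_mono) (linarith, simp)
  thus "p / 2 * sqrt n <= abs (Gsum n (hit th i) X)" unfolding Gsum_hit[OF n] by (simp add: mult.commute)
 qed (use p(1) in simp)
 also have "... <= fourth th u n X" using fourth_bounds(2)[of n th i X u] by simp
 also have "... <= real CARD('n) * fourth th u n X" using fourth_bounds(3)[of th u n X] by (simp add: mult_le_cancel_right1)
 finally show ?thesis unfolding power_mult_distrib sqrt_power4 .
next
 case False
 hence "(p / 64 * sqrt n)^4 <= (norm (score th u n X))^4" using p(1) by (intro power_mono) auto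
 also have "... <= real CARD('n) * fourth th u n X" by (rule fourth_bounds)
 finally show ?thesis unfolding power_mult_distrib sqrt_power4 .
qed

text \<open>Three regimes share this bound. On the bad event both vectors are O(sqrt n), since the
  quantiles are bounded by K, and \<open>bad_fourth\<close> yields the term in 1/n. On the good
  event with a large score the error is O(norm S), and an additional factor (64/p norm S)^2/L^2 >= 1
  yields the term in 1/L^2. Otherwise both minimisers lie in the ball of radius L and the net
  applies.\<close>

lemma bahadur_bound:
 assumes n: "0 < n" and p: "0 < p" "p <= 1" "!!i. p <= measure F {x. x - th : axis_ball i}" and u: "norm u < 1"
  and A: "nn_int F (%x. 1 / norm (x - th)) <= ennreal A" "0 <= A"
  and K: "norm th <= K" "norm (emp_quantile X n u) <= K"
  and X: "!!k. k < n ==> X k ~= th" and L: "0 < L"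
  and T: "finite T" "T <= cball 0 L" "!!w. w : cball 0 L ==> EX t:T. norm (w - t) <= ep"
 shows "(norm (sqrt n *R (emp_quantile X n u - th) - matrix_inv (D1 F th) *v score th u n X))^2
  <= (2 * K + 128 / p)^2 * (64 / p)^4 * CARD('n) * (1 / n + 1 / L^2) * fourth th u n X
   + 32 / p * ((SUM t:T. abs (quad_err th n X t)) + 2 * L * ep * ((SUM k<n. 1 / norm (X k - th)) / n + A))"
proof -
 define S where "S = score th u n X"
 define w where "w = sqrt n *R (emp_quantile X n u - th)"
 define z where "z = matrix_inv (D1 F th) *v S"
 define H where "H = real CARD('n) * fourth th u n X"
 let ?b = "quad_err th n X"
 define Y where "Y = (SUM t:T. abs (?b t)) + 2 * L * ep * ((SUM k<n. 1 / norm (X k - th)) / n + A)"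
 define C where "C = (2 * K + 128 / p)^2 * (64 / p)^4"
 have K0: "0 <= K" using K(1) norm_ge_zero[of th] by linarith
 have H0: "0 <= H" unfolding H_def using fourth_bounds(3) by simp
 have ep0: "0 <= ep" using T(3)[of 0] L by (auto intro: order_trans[OF norm_ge_zero])
 have Y0: "0 <= Y" unfolding Y_def using A(2) L ep0 by (intro add_nonneg_nonneg mult_nonneg_nonneg divide_nonneg_nonneg sum_nonneg) auto
 have C0: "0 <= C" unfolding C_def by simp
 have CH: "0 <= C * (1 / n) * H" "0 <= C * (1 / L^2) * H" using C0 H0 by auto
 have z: "norm z <= 8 / p * norm S" unfolding z_def by (rule D1_inverse_bound[OF p(1,3)])
 let ?a = "norm (w - z)"
 have "(?a)^2 <= C * (1 / n) * H + C * (1 / L^2) * H + 32 / p * Y"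
 proof (cases "(ALL i. p / 2 <= (SUM k<n. indicator (axis_ball i) (X k - th)) / n) & norm (score th u n X) <= p / 64 * sqrt n")
  case False
  have "norm z <= 8 / p * (2 * sqrt n)"
   using z norm_score_le[of u th n X] u p(1) unfolding S_def by (intro order_trans[OF z[unfolded S_def] mult_left_mono]) auto
  moreover have "norm w <= sqrt n * (K + K)"
   unfolding w_def using norm_triangle_le_diff[OF add_mono[OF K(2,1)]] by (simp add: mult_left_mono)
  ultimately have "?a <= sqrt n * (K + K) + 8 / p * (2 * sqrt n)" by (rule norm_triangle_le_diff[OF add_mono, rotated])
  also have "... = (2 * K + 16 / p) * sqrt n" by (simp add: algebra_simps)
  also have "... <= (2 * K + 128 / p) * sqrt n" using p(1) by (intro mult_right_mono add_left_mono divide_right_mono) auto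
  finally have "(?a)^2 <= ((2 * K + 128 / p) * sqrt n)^2" by (rule power_mono) simp
  also have "... = (2 * K + 128 / p)^2 * (64 / p)^4 * (1 / n) * ((p / 64)^4 * (real n)^2)"
   using p(1) by (simp add: power_divide power2_eq_square)
  also have "... <= C * (1 / n) * H"
   unfolding C_def H_def by (rule mult_left_mono[OF bad_fourth[OF n p False]]) simp
  finally show ?thesis using CH(2) Y0 p(1) by (simp add: add_increasing2)
 next
  case True
  note good = bahadur_error[OF n p(1,3) u, of X, folded S_def w_def z_def]
  have hits: "!!i. p / 2 <= (SUM k<n. indicator (axis_ball i) (X k - th)) / n" and S: "norm S <= p / 64 * sqrt n" using True by (auto simp: S_def)
  have w: "norm w <= 64 / p * norm S" by (rule good(1)[OF hits S])
  have z': "norm z <= 64 / p * norm S" by (rule order_trans[OF z]) (use p(1) in \<open>intro mult_right_mono divide_right_mono; simp\<close>)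
  show ?thesis
  proof (cases "64 / p * norm S <= L")
   case True
   have "p / 16 * (?a)^2 <= abs (?b w) + abs (?b z)" using good(2)[OF hits S] by (simp add: z_def)
   also have "... <= Y + Y"
    unfolding Y_def using w z' True by (intro add_mono quad_err_net[OF n X A T]) auto
   finally have "(?a)^2 <= 32 / p * Y" using p(1) by (simp add: field_simps)
   thus ?thesis using CH by auto
  next
   case False
   hence 1: "1 <= (64 / p * norm S)^2 / L^2" using L by auto
   have "(?a)^2 <= (128 / p * norm S)^2 * 1"
    using norm_triangle_le_diff[OF add_mono[OF w z']] by (auto simp: mult_1_right intro!: power_mono)
   also have "... <= (128 / p * norm S)^2 * ((64 / p * norm S)^2 / L^2)" by (rule mult_left_mono[OF 1]) simp
   also have "... = (128 / p)^2 * (64 / p)^2 * (1 / L^2) * (norm S)^4" by (simp add: power_divide power2_eq_square power4_eq_xxxx)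
   also have "... <= C * (1 / L^2) * H"
   proof (unfold C_def, intro mult_mono)
    show "(128 / p)^2 <= (2 * K + 128 / p)^2" using K0 p(1) by (intro power_mono) auto
    show "(64 / p)^2 <= (64 / p)^4" using p(1,2) by (intro power_increasing) (auto simp: field_simps)
    show "(norm S)^4 <= H" unfolding H_def S_def by (rule fourth_bounds)
   qed (use p in auto)
   finally show ?thesis using CH(1) Y0 p(1) by (simp add: add_increasing2)
  qed
 qed
 thus ?thesis by (simp add: w_def z_def S_def C_def H_def Y_def algebra_simps)
qed

end

section \<open>Expectations of the linearisation error\<close>

lemma norm_rem_measurable_comp [measurable (raw)]:
 assumes [measurable]: "f : bmeas M" "g : bmeas M"
 shows "(%x. norm_rem (f x) (g x)) : bmeas M"
 unfolding norm_rem_def by measurable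

lemma expectation_le_of_square:
 fixes Y :: "'a => real"
 assumes M: "prob_space M" and [measurable]: "Y : bmeas M" and Y: "integrable M (%x. (Y x)^2)" "(LINT x|M. (Y x)^2) <= s^2" and s: "0 < s"
 shows "nn_int M (%x. abs (Y x)) <= ennreal s"
proof -
 interpret prob_space M by (rule M)
 let ?a = "LINT x|M. s / 2 + (Y x)^2 / (2 * s)"
 have "abs y <= s / 2 + y^2 / (2 * s)" for y
 proof -
  have "2 * abs y * s <= s^2 + y^2" using sum_squares_bound[of "abs y" s] by simp
  thus ?thesis using s by (simp add: field_simps power2_eq_square)
 qed
 hence "nn_int M (%x. abs (Y x)) <= nn_int M (%x. s / 2 + (Y x)^2 / (2 * s))" by (intro nn_integral_mono ennreal_leI)
 also have "... = ennreal ?a" using Y s by (intro nn_integral_eq_integral) auto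
 also have "?a = s / 2 + (LINT x|M. (Y x)^2) / (2 * s)" using Y by (simp add: prob_space)
 also have "ennreal ... <= ennreal (s / 2 + s^2 / (2 * s))" using Y(2) s by (intro ennreal_leI add_left_mono divide_right_mono) auto
 also have "s / 2 + s^2 / (2 * s) = s" by (simp add: power2_eq_square)
 finally show ?thesis .
qed

lemma finite_net:
 assumes "0 < ep" shows "EX T. finite T & T <= cball (0::'a::euclidean_space) L & (ALL w:cball 0 L. EX t:T. norm (w - t) <= ep)"
proof -
 have "cball (0::'a) L <= (UN t:cball 0 L. ball t ep)" using assms by force
 from compactE_image[OF compact_cball _ this] obtain T where "T <= cball (0::'a) L" "finite T" "cball 0 L <= (UN t:T. ball t ep)" by auto
 thus ?thesis by (intro exI[of _ T]) (force simp: dist_norm norm_minus_commute)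
qed

lemma (in pos_density) F_UNIV [simp]: "measure F UNIV = 1" "emeasure F UNIV = 1"
 using prob_space emeasure_space_1 by auto

locale quantile_bounds = pos_density f for f :: "real^'n => real" +
 fixes r K p A :: real
 assumes r: "0 <= r" "r < 1" and K: "!!u. u : cball 0 r ==> norm (spatial_quantile F u) <= K" and K0: "0 <= K"
  and p: "0 < p" "p <= 1" "!!th i. norm th <= K ==> p <= measure F {x. x - th : axis_ball i}"
  and A: "0 < A" "!!th. norm th <= K ==> (nn_int F (%x. 1 / norm (x - th))) <= ennreal A"
begin

abbreviation P where "P n == sample_law F n"

text \<open>The cut-off outside the ball makes the quantile map Borel and bounded on the whole
  space.\<close>

definition theta :: "real^'n => real^'n" where "theta u = indicator (cball 0 r) u *R spatial_quantile F u"

lemma theta_measurable [measurable]: "theta : bmeas borel"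
 unfolding theta_def[abs_def] by (rule quantile_measurable[OF r(2)])

lemma theta_bound: "norm (theta u) <= K"
 using K[of u] K0 by (cases "u : cball 0 r") (auto simp: theta_def)

lemma P_prob: "prob_space (P n)" unfolding sample_law_def by (rule prob_space_iid)

lemma coordinate_measurable: "k < n ==> (%X. X k) : bmeas (P n)"
 unfolding sample_law_def by (auto simp: measurable_cong_sets[OF refl sets_dens[symmetric, of f]] intro!: measurable_component_singleton)

lemma coordinate_nn_integral:
 assumes k: "k < n" and [measurable]: "g : bmeas borel"
 shows "nn_integral (P n) (%X. g (X k)) = nn_integral F (%x. g x)"
proof -
 have "nn_integral F (%x. g x) = nn_integral (distr (PiM {..<n} (%_. F)) F (%X. X k)) (%x. g x)"
  using k by (subst distr_PiM_component) (auto intro: prob_space_axioms)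
 also have "... = nn_integral (P n) (%X. g (X k))"
  unfolding sample_law_def using k by (intro nn_integral_distr measurable_component_singleton) (auto simp: measurable_cong_sets[OF sets_dens refl])
 finally show ?thesis ..
qed

lemma score_nth: "score th u n X $ i = Gsum n (%x. unitv (x - th) $ i + u $ i) X"
 by (simp add: score_def Gsum_def)

lemma score_fun:
 assumes u: "u : cball 0 r"
 shows "(%x. unitv (x - theta u) $ i + u $ i) : bmeas borel" "abs (unitv (x - theta u) $ i + u $ i) <= 2"
  and "(LINT x|F. unitv (x - theta u) $ i + u $ i) = 0"
proof -
 show "(%x. unitv (x - theta u) $ i + u $ i) : bmeas borel" by measurable
 have b: "abs (unitv y $ i) <= 1" for y :: "real^'n" by (rule order_trans[OF component_le_norm_cart norm_unitv_le])
 show "abs (unitv (x - theta u) $ i + u $ i) <= 2"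
  using component_le_norm_cart[of u i] u r(2) b[of "x - theta u"] by simp
 have i: "integrable F (%x. unitv (x - theta u) $ i)" for i
  by (rule integrable_bounded[of _ 1]) (use order_trans[OF component_le_norm_cart norm_unitv_le] in auto)
 have "((LINT x|F. unitv (x - theta u)) + u) $ i = 0"
  using u r quantile_stationary[of u] by (simp add: theta_def)
 thus "(LINT x|F. unitv (x - theta u) $ i + u $ i) = 0" using i by (simp add: integral_vec_nth)
qed

lemma hit_fun:
 shows "hit th i : bmeas borel" "abs (hit th i x) <= 2" "(LINT x|F. hit th i x) = 0"
proof -
 let ?a = "{x. x - th : axis_ball i}"
 have m: "?a : sets borel" by measurable
 show "hit th i : bmeas borel" unfolding hit_def[abs_def] by measurable
 let ?b = "indicat_real (axis_ball i)"
 have "0 <= ?b (x - th)" "?b (x - th) <= 1" by auto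
 thus "abs (hit th i x) <= 2"
  using prob_le_1[of "?a"] measure_nonneg[of F "?a"] unfolding hit_def by linarith
 have "(%x. ?b (x - th)) = indicat_real ?a" by (auto simp: indicator_def)
 thus "(LINT x|F. hit th i x) = 0" using m unfolding hit_def by (subst LINT_diff) (auto simp: prob_space emeasure_eq_measure)
qed

lemma fourth_expectation:
 assumes u: "u : cball 0 r" and n: "4 <= n"
 shows "nn_int (P n) (%X. fourth (theta u) u n X) <= ennreal (2 * real CARD('n) * (512 * exp 4))"
proof -
 interpret PP: prob_space "P n" by (rule P_prob)
 have n2: "2 <= sqrt (real n)" using n real_sqrt_le_mono[of 4 "real n"] by simp
 let ?b = "integrable (P n)"
 have g: "?b (%X. (Gsum n g X)^4)" "(LINT X|(P n). (Gsum n g X)^4) <= 512 * exp 4"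
  if [measurable]: "g : bmeas borel" and b: "!!x. abs (g x) <= 2" and z: "(LINT x|F. g x) = 0" for g :: "real^'n => real"
 proof -
  have gF: "g : bmeas F" by simp
  have m: "Gsum n g : bmeas (P n)" unfolding sample_law_def by (rule Gsum_measurable[OF gF])
  show "?b (%X. (Gsum n g X)^4)"
  proof (rule PP.integrable_bounded[of _ "(sqrt n * 2)^4"])
   show "norm ((Gsum n g X)^4) <= (sqrt n * 2)^4" for X
    using power_mono[OF Gsum_bound[of g 2 n X, OF b], of 4] by simp
  qed (use m in measurable)
  show "(LINT X|(P n). (Gsum n g X)^4) <= 512 * exp 4"
   using Gsum_fourth_moment[OF gF b z n2] n unfolding sample_law_def by simp
 qed
 note gs = g[OF score_fun[OF u]] and gh = g[OF hit_fun]
 let ?a = "fourth (theta u) u n"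
 have i: "?b (?a)"
  unfolding fourth_def[abs_def] score_nth by (intro Lint_add Lint_sum gs gh)
 have "nn_int (P n) (%X. ?a X) = ennreal (LINT X|(P n). ?a X)"
  by (rule nn_integral_eq_integral[OF i]) (simp add: fourth_bounds)
 also have "(LINT X|(P n). ?a X) = (SUM i:UNIV. (LINT X|(P n). (score (theta u) u n X $ i)^4)) + (SUM i:UNIV. (LINT X|(P n). (Gsum n (hit (theta u) i) X)^4))"
  unfolding fourth_def score_nth
  by (subst LINT_add[OF Lint_sum Lint_sum])
   (simp_all only: gs gh LINT_sum)
 also have "ennreal ... <= ennreal ((SUM i:(UNIV::'n set). 512 * exp 4) + (SUM i:(UNIV::'n set). 512 * exp 4))"
  unfolding score_nth by (intro ennreal_leI add_mono sum_mono gs gh)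
 also have "... = ennreal (2 * real CARD('n) * (512 * exp 4))" by simp
 finally show ?thesis .
qed

definition rem_err :: "nat => real^'n => real^'n => real" where
 "rem_err n t u = abs (real n * (LINT x|F. norm_rem (x - theta u) ((1 / sqrt n) *R t)) - inner t (D1 F (theta u) *v t) / 2)"

text \<open>Bound for the standard deviation of the sum of remainders; the summand 1 keeps it
  positive at t = 0, as \<open>expectation_le_of_square\<close> requires.\<close>

definition rem_sd :: "nat => real^'n => real" where
 "rem_sd n t = sqrt ((4 * norm t ^ 3 * A + 1) / sqrt n)"

lemma inverse_norm_integral:
 assumes th: "norm th <= K" shows "integrable F (%x. 1 / norm (x - th))" "(LINT x|F. 1 / norm (x - th)) <= A"
proof -
 show "integrable F (%x. 1 / norm (x - th))" by (rule kernel_integrable[of "%y. 1 / norm y" 1]) auto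
 show "(LINT x|F. 1 / norm (x - th)) <= A" using A(2)[OF th] A(1) by (subst integral_eq_nn_integral) (auto intro: enn2real_leI)
qed

text \<open>The square is estimated by the product of the linear and the quadratic bound of
  \<open>norm_rem\<close>. Using the quadratic bound twice would produce 1/norm^2, which is not
  integrable near 0 in dimension 2.\<close>

lemma norm_rem_square_expectation:
 assumes n: "0 < n" and th: "norm th <= K"
 shows "real n * (LINT x|F. (norm_rem (x - th) ((1 / sqrt n) *R t))^2) <= 4 * norm t ^ 3 * A / sqrt n"
proof -
 let ?v = "(1 / sqrt n) *R t"
 let ?a = "LINT x|F. (norm_rem (x - th) ?v)^2"
 have "?a <= (LINT x|F. 4 * norm ?v ^ 3 * (1 / norm (x - th)))"
 proof (rule integral_mono_AE)
  show "AE x in F. (norm_rem (x - th) ?v)^2 <= 4 * norm ?v ^ 3 * (1 / norm (x - th))"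
   using AE_neq[of th]
  proof eventually_elim
   case (elim x)
   have "norm_rem (x - th) ?v * norm_rem (x - th) ?v <= (2 * norm ?v) * (2 * (norm ?v)^2 / norm (x - th))"
    using elim by (intro mult_mono norm_rem_le norm_rem_le_square norm_rem_nonneg) auto
   thus ?case by (simp add: power2_eq_square power3_eq_cube mult_ac)
  qed
  show "integrable F (%x. (norm_rem (x - th) ?v)^2)"
  proof (rule integrable_bounded[of _ "(2 * norm ?v)^2"])
   show "norm ((norm_rem (x - th) ?v)^2) <= (2 * norm ?v)^2" for x
    using power_mono[OF norm_rem_le norm_rem_nonneg, of "x - th" ?v 2] by simp
  qed measurable
  show "integrable F (%x. 4 * norm ?v ^ 3 * (1 / norm (x - th)))" by (intro integrable_mult_right inverse_norm_integral th)
 qed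
 also have "... = 4 * norm ?v ^ 3 * (LINT x|F. 1 / norm (x - th))" by (rule integral_mult_right_zero)
 also have "... <= 4 * norm ?v ^ 3 * A" by (intro mult_left_mono inverse_norm_integral th) simp
 finally have "real n * ?a <= real n * (4 * norm ?v ^ 3 * A)" by (intro mult_left_mono) auto
 also have "... = 4 * norm t ^ 3 * A * (real n / sqrt n ^ 3)" by (simp add: power_divide)
 also have "real n / sqrt n ^ 3 = 1 / sqrt n" by (simp add: power3_eq_cube)
 finally show ?thesis by simp
qed

text \<open>A centred sum, of standard deviation at most \<open>rem_sd\<close>, plus the
  deterministic second-order error of the expectation.\<close>

lemma quad_err_expectation:
 assumes n: "0 < n"
 shows "nn_int (P n) (%X. abs (quad_err (theta u) n X t)) <= ennreal (rem_sd n t + rem_err n t u)"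
proof -
 interpret PP: prob_space "P n" by (rule P_prob)
 let ?v = "(1 / sqrt n) *R t" and ?th = "theta u"
 define m where "m = (LINT x|F. norm_rem (x - ?th) ?v)"
 define g where "g = (%x. norm_rem (x - ?th) ?v - m)"
 have gm[measurable]: "g : bmeas F" unfolding g_def by measurable
 have m: "0 <= m" "m <= 2 * norm ?v"
 proof -
  show "0 <= m" unfolding m_def by (intro LINT_nonneg norm_rem_nonneg)
  have "norm m <= 2 * norm ?v"
   unfolding m_def by (rule norm_expectation_le) (measurable, simp only: real_norm_def abs_of_nonneg[OF norm_rem_nonneg] norm_rem_le)
  thus "m <= 2 * norm ?v" by simp
 qed
 have gb: "abs (g x) <= 2 * norm ?v" for x
  using m norm_rem_le[of "x - ?th" ?v] norm_rem_nonneg[of "x - ?th" ?v] unfolding g_def by auto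
 have gz: "(LINT x|F. g x) = 0" unfolding g_def using norm_rem_integrable by (simp add: m_def)
 let ?d = "2 * norm ?v"
 have i2: "integrable F (%x. (norm_rem (x - ?th) ?v)^2)"
 proof (rule integrable_bounded[of _ "?d^2"])
  show "norm ((norm_rem (x - ?th) ?v)^2) <= ?d^2" for x
   using power_mono[OF norm_rem_le norm_rem_nonneg, of "x - ?th" ?v 2] by simp
 qed measurable
 let ?b = "LINT x|F. (norm_rem (x - ?th) ?v)^2"
 let ?c = "LINT x|F. (g x)^2"
 have g2: "?c <= ?b"
 proof -
  have "?c = ?b - 2 * m * m + m^2"
   using i2 norm_rem_integrable by (simp add: g_def power2_diff algebra_simps m_def[symmetric])
  thus ?thesis by (simp add: power2_eq_square)
 qed
 define Y where "Y = (%X. sqrt n * Gsum n g X)"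
 have Gm: "Gsum n g : bmeas (P n)" unfolding sample_law_def by (rule Gsum_measurable[OF gm])
 have Ym: "Y : bmeas (P n)" unfolding Y_def using Gm by measurable
 have Y2: "(LINT X|(P n). (Y X)^2) <= (rem_sd n t)^2"
 proof -
  have "(LINT X|(P n). (Y X)^2) = real n * ?c"
   unfolding Y_def power_mult_distrib using Gsum_second_moment[OF gm gb gz n] by (simp add: sample_law_def)
  also have "... <= 4 * norm t ^ 3 * A / sqrt n"
   using g2 by (intro order_trans[OF _ norm_rem_square_expectation[OF n theta_bound]] mult_left_mono) auto
  also have "... <= (rem_sd n t)^2" unfolding rem_sd_def using A(1) by (simp add: divide_right_mono)
  finally show ?thesis .
 qed
 have Yi: "integrable (P n) (%X. (Y X)^2)"
 proof (rule PP.integrable_bounded[of _ "(sqrt n * (sqrt n * ?d))^2"])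
  show "norm ((Y X)^2) <= (sqrt n * (sqrt n * ?d))^2" for X
   using power_mono[OF mult_left_mono[OF Gsum_bound[of g "2 * norm ?v" n X, OF gb]], of "sqrt n" 2] by (simp add: Y_def power_mult_distrib)
 qed (use Ym in measurable)
 have s: "0 < rem_sd n t" unfolding rem_sd_def using n A(1) by (auto intro!: divide_pos_pos add_nonneg_pos)
 have eq: "quad_err ?th n X t = Y X + (real n * m - inner t (D1 F ?th *v t) / 2)" for X
  by (simp add: n Y_def Gsum_def g_def sum_subtractf quad_err_def)
 let ?a = "ennreal (rem_err n t u)"
 have "nn_int (P n) (%X. abs (quad_err ?th n X t)) <= nn_integral (P n) (%X. ennreal (abs (Y X)) + ?a)"
  unfolding eq by (intro nn_integral_mono) (simp add: rem_err_def m_def[symmetric] ennreal_leI flip: ennreal_plus)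
 also have "... = nn_int (P n) (%X. abs (Y X)) + ?a"
  using Ym PP.emeasure_space_1 by (subst nn_integral_add) auto
 also have "... <= ennreal (rem_sd n t) + ?a"
  by (intro add_right_mono expectation_le_of_square[OF P_prob Ym Yi Y2 s])
 finally show ?thesis using s by (simp add: rem_err_def)
qed

lemma rem_err_tendsto: "(%n. rem_err n t u) ----> 0"
 unfolding rem_err_def by (rule tendsto_rabs_zero, rule LIM_zero, rule norm_rem_expectation_second_order)

lemma rem_err_bound: "abs (rem_err n t u) <= 4 * A * (norm t)^2"
proof -
 let ?a = "theta u"
 have e: "0 <= real n * (LINT x|F. norm_rem (x - ?a) ((1 / sqrt n) *R t))" "real n * (LINT x|F. norm_rem (x - ?a) ((1 / sqrt n) *R t)) <= 2 * A * (norm t)^2" for n :: nat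
 proof -
  show "0 <= real n * (LINT x|F. norm_rem (x - ?a) ((1 / sqrt n) *R t))" by (intro mult_nonneg_nonneg LINT_nonneg norm_rem_nonneg) simp
  let ?v = "(1 / sqrt n) *R t"
  let ?b = "LINT x|F. norm_rem (x - ?a) ?v"
  let ?c = "norm ?v"
  have "?b <= (LINT x|F. 2 * ?c^2 * (1 / norm (x - ?a)))"
  proof (rule integral_mono_AE[OF norm_rem_integrable integrable_mult_right[OF inverse_norm_integral(1)[OF theta_bound]]])
   show "AE x in F. norm_rem (x - ?a) ?v <= 2 * ?c^2 * (1 / norm (x - ?a))"
    using AE_neq[of "?a"]
   proof eventually_elim
    case (elim x)
    thus ?case using norm_rem_le_square[of "x - ?a" ?v] by simp
   qed
  qed
  also have "... = 2 * ?c^2 * (LINT x|F. 1 / norm (x - ?a))" by (rule integral_mult_right_zero)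
  also have "... <= 2 * ?c^2 * A" by (intro mult_left_mono inverse_norm_integral theta_bound) simp
  finally have "real n * ?b <= real n * (2 * ?c^2 * A)" by (intro mult_left_mono) auto
  also have "... <= 2 * A * (norm t)^2" using A(1) by (cases "n = 0") (auto simp: power_divide)
  finally show "real n * ?b <= 2 * A * (norm t)^2" .
 qed
 have "0 <= inner t (D1 F (?a) *v t) / 2"
  by (rule LIMSEQ_le_const[OF norm_rem_expectation_second_order]) (use e(1) in blast)
 moreover have "inner t (D1 F (?a) *v t) / 2 <= 2 * A * (norm t)^2"
  by (rule LIMSEQ_le_const2[OF norm_rem_expectation_second_order]) (use e(2) in blast)
 ultimately show ?thesis using e[of n] unfolding rem_err_def by auto
qed

lemma shift_measurable: "(%z. snd z - theta (fst z)) : bmeas (borel >< borel)"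
 by (rule borel_measurable_diff[OF measurable_snd measurable_compose[OF measurable_fst theta_measurable]])

lemma D1_quadratic_measurable: "(%u. inner t (D1 F (theta u) *v t)) : bmeas borel"
 unfolding D1_quadratic
proof (rule borel_measurable_lebesgue_integral)
 have "(%z. ((norm t)^2 - (inner (unitv (snd z - theta (fst z))) t)^2) / norm (snd z - theta (fst z))) : bmeas (borel >< borel)"
  by (intro borel_measurable_divide borel_measurable_diff borel_measurable_const borel_measurable_power borel_measurable_inner
    measurable_compose[OF shift_measurable unitv_measurable] measurable_compose[OF shift_measurable borel_measurable_norm])
 thus "(%(u, x). ((norm t)^2 - (inner (unitv (x - theta u)) t)^2) / norm (x - theta u)) : bmeas (borel >< F)"
  unfolding split_beta' measurable_cong_sets[OF sets_pair_measure_cong[OF refl sets_dens] refl] .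
qed

lemma norm_rem_integral_measurable: "(%u. (LINT x|F. norm_rem (x - theta u) v)) : bmeas borel"
proof (rule borel_measurable_lebesgue_integral)
 have "(%z. norm_rem (snd z - theta (fst z)) v) : bmeas (borel >< borel)"
  by (rule norm_rem_measurable_comp[OF shift_measurable borel_measurable_const])
 thus "(%(u, x). norm_rem (x - theta u) v) : bmeas (borel >< F)"
  unfolding split_beta' measurable_cong_sets[OF sets_pair_measure_cong[OF refl sets_dens] refl] .
qed

lemma rem_err_measurable [measurable]: "(%u. rem_err n t u) : bmeas borel"
 unfolding rem_err_def
 by (intro borel_measurable_abs borel_measurable_diff borel_measurable_times borel_measurable_const borel_measurable_divide norm_rem_integral_measurable D1_quadratic_measurable)

lemma rem_sd_tendsto: "(%n. rem_sd n t) ----> 0"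
proof -
 have "(%n. (4 * norm t ^ 3 * A + 1) / sqrt (real n)) ----> 0" by real_asymp
 from tendsto_real_sqrt[OF this] show ?thesis by (simp add: rem_sd_def)
qed

end

lemma ennreal_affine:
 assumes "0 <= c" "0 <= f" "0 <= q" "0 <= s" "0 <= l" "0 <= a"
 shows "ennreal c * ennreal f + ennreal q * (ennreal s + ennreal l * ennreal a) = ennreal (c * f + q * (s + l * a))"
 using assms by (simp add: ennreal_mult)

context quantile_bounds begin

abbreviation Pu where "Pu n == P n >< (borel :: (real^'n) measure)"

definition C0 :: real where "C0 = (2 * K + 128 / p)^2 * (64 / p)^4 * CARD('n)"

lemma C0_nonneg: "0 <= C0" unfolding C0_def by simp

lemma resid_measurable: "k < n ==> (%z. fst z k - theta (snd z)) : bmeas (Pu n)"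
 by (rule borel_measurable_diff[OF measurable_compose[OF measurable_fst coordinate_measurable] measurable_compose[OF measurable_snd theta_measurable]])

lemma score_measurable: "(%z. score (theta (snd z)) (snd z) n (fst z)) : bmeas (Pu n)"
 unfolding score_def
 by (intro borel_measurable_scaleR borel_measurable_const borel_measurable_sum borel_measurable_add measurable_snd
   measurable_compose[OF resid_measurable unitv_measurable]) auto

lemma fourth_measurable: "(%z. fourth (theta (snd z)) (snd z) n (fst z)) : bmeas (Pu n)"
proof -
 let ?a = "bmeas (Pu n)"
 have hit: "(%z. measure F {x. x - theta (snd z) : axis_ball i}) : ?a" for i
 proof -
  let ?b = "indicat_real (axis_ball i)"
  have "(%u. (LINT x|F. ?b (x - theta u))) : bmeas borel"
  proof (rule borel_measurable_lebesgue_integral)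
   show "(%(u, x). ?b (x - theta u)) : bmeas (borel >< F)"
    unfolding split_beta' measurable_cong_sets[OF sets_pair_measure_cong[OF refl sets_dens] refl]
    by (rule measurable_compose[OF shift_measurable borel_measurable_indicator[OF axis_ball_borel]])
  qed
  moreover have "(LINT x|F. ?b (x - th)) = measure F {x. x - th : axis_ball i}" for th
  proof -
   have "(%x. ?b (x - th)) = indicat_real {x. x - th : axis_ball i}" by (auto simp: indicator_def)
   thus ?thesis by simp
  qed
  ultimately have "(%u. measure F {x. x - theta u : axis_ball i}) : bmeas borel" by (simp only:)
  thus ?thesis by (rule measurable_compose[OF measurable_snd])
 qed
 have sc: "(%z. score (theta (snd z)) (snd z) n (fst z) $ i) : ?a" for i
  by (rule measurable_compose[OF score_measurable vec_nth_borel])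
 have G: "(%z. Gsum n (hit (theta (snd z)) i) (fst z)) : ?a" for i
  unfolding Gsum_def hit_def
 proof (rule borel_measurable_divide[OF borel_measurable_sum borel_measurable_const])
  fix k assume "k : {..<n}"
  hence k: "k < n" by simp
  show "(%z. indicat_real (axis_ball i) (fst z k - theta (snd z)) - measure F {x. x - theta (snd z) : axis_ball i}) : ?a"
   by (rule borel_measurable_diff[OF measurable_compose[OF resid_measurable[OF k] borel_measurable_indicator[OF axis_ball_borel]] hit])
 qed
 show ?thesis unfolding fourth_def
  by (rule borel_measurable_add[OF borel_measurable_sum borel_measurable_sum]; rule borel_measurable_power; rule sc G)
qed

lemma quad_err_measurable: "(%z. quad_err (theta (snd z)) n (fst z) t) : bmeas (Pu n)"
 unfolding quad_err_def
proof (rule borel_measurable_diff[OF borel_measurable_sum borel_measurable_divide[OF measurable_compose[OF measurable_snd D1_quadratic_measurable] borel_measurable_const]])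
 show "(%z. norm_rem (fst z k - theta (snd z)) ((1 / sqrt n) *R t)) : bmeas (Pu n)" if "k : {..<n}" for k
  using that by (intro norm_rem_measurable_comp[OF resid_measurable borel_measurable_const]) simp
qed

definition inv_sum :: "nat => (nat => real^'n) => real^'n => ennreal" where
 "inv_sum n X u = (SUM k<n. inverse (ennreal (norm (X k - theta u))))"

lemma inv_sum_measurable: "(%z. inv_sum n (fst z) (snd z)) : bmeas (Pu n)"
 unfolding inv_sum_def
proof (rule borel_measurable_sum)
 fix k assume "k : {..<n}"
 hence "(%z. norm (fst z k - theta (snd z))) : bmeas (Pu n)" by (intro measurable_compose[OF resid_measurable borel_measurable_norm]) simp
 thus "(%z. inverse (ennreal (norm (fst z k - theta (snd z))))) : bmeas (Pu n)" by measurable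
qed

text \<open>The value $\infty$ of an inverse distance covers the samples that hit the population quantile.\<close>
definition err_bound :: "nat => real => real => (real^'n) set => (nat => real^'n) => real^'n => ennreal" where
 "err_bound n L ep T X u = ennreal (C0 * (1 / n + 1 / L^2)) * ennreal (fourth (theta u) u n X)
  + ennreal (32 / p) * ((SUM t:T. ennreal (abs (quad_err (theta u) n X t))) + ennreal (2 * L * ep) * (ennreal (1 / n) * inv_sum n X u + ennreal A))"

lemma err_bound_measurable: "(%z. err_bound n L ep T (fst z) (snd z)) : bmeas (Pu n)"
 by (use fourth_measurable quad_err_measurable inv_sum_measurable err_bound_def in simp)

definition bahadur_rem :: "nat => (nat => real^'n) => real^'n => real^'n" where
 "bahadur_rem n X u = sqrt n *R (emp_quantile X n u - spatial_quantile F u) - matrix_inv (D1 F (spatial_quantile F u)) *v score (spatial_quantile F u) u n X"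

lemma bahadur_rem_le:
 assumes n: "0 < n" and u: "u : cball 0 r" and q: "norm (emp_quantile X n u) <= K" and L: "0 < L" and ep: "0 < ep"
  and T: "finite T" "T <= cball 0 L" "!!w. w : cball 0 L ==> EX t:T. norm (w - t) <= ep"
 shows "ennreal ((norm (bahadur_rem n X u))^2) <= err_bound n L ep T X u"
proof (cases "EX k<n. X k = theta u")
 case True
 then obtain k where k: "k < n" "X k = theta u" by blast
 have "inv_sum n X u = top"
  using k by (auto simp: top_unique inv_sum_def)
 hence "err_bound n L ep T X u = top" using n L ep p(1) by (simp add: err_bound_def ennreal_top_mult)
 thus ?thesis by simp
next
 case False
 have th: "theta u = spatial_quantile F u" using u by (simp add: theta_def)
 have u1: "norm u < 1" using u r by simp
 let ?a = "SUM k<n. 1 / norm (X k - theta u)"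
 have inv: "inv_sum n X u = ennreal ?a"
  unfolding inv_sum_def using False by (subst sum_ennreal[symmetric]) (auto intro!: sum.cong simp: inverse_ennreal inverse_eq_divide)
 let ?b = "SUM t:T. abs (quad_err (theta u) n X t)"
 have "(norm (bahadur_rem n X u))^2 <= C0 * (1 / n + 1 / L^2) * fourth (theta u) u n X
   + 32 / p * (?b + 2 * L * ep * (?a / n + A))"
  unfolding bahadur_rem_def th[symmetric] C0_def
  by (rule bahadur_bound[OF n p(1,2) p(3)[OF theta_bound] u1 A(2)[OF theta_bound] less_imp_le[OF A(1)] theta_bound q _ L T]) (use False in auto)
 hence "ennreal ((norm (bahadur_rem n X u))^2) <= ennreal (C0 * (1 / n + 1 / L^2) * fourth (theta u) u n X
   + 32 / p * (?b + 2 * L * ep * (1 / n * ?a + A)))" by (simp add: ennreal_leI)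
 also have "... = err_bound n L ep T X u"
 proof -
  have a0: "0 <= ?a" "0 <= 1 / n * ?a + A" "0 <= ?b" "0 <= 2 * L * ep" using A(1) L ep by (auto intro!: sum_nonneg add_nonneg_nonneg divide_nonneg_nonneg)
  have c0: "0 <= C0 * (1 / n + 1 / L^2)" using C0_nonneg by simp
  have i: "ennreal (1 / n) * ennreal ?a + ennreal A = ennreal (1 / n * ?a + A)" using a0(1) A(1) by (subst ennreal_mult[symmetric]) (simp_all flip: ennreal_plus)
  have t: "(SUM t:T. ennreal (abs (quad_err (theta u) n X t))) = ennreal ?b" by (rule sum_ennreal) simp
  show ?thesis unfolding err_bound_def inv i t
   by (rule ennreal_affine[symmetric]) (use a0 c0 p(1) fourth_bounds(3) in simp_all)
 qed
 finally show ?thesis .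
qed

lemma inv_sum_expectation:
 assumes n: "0 < n" shows "ennreal (1 / n) * nn_integral (P n) (%X. inv_sum n X u) <= ennreal A"
proof -
 let ?c = "theta u"
 let ?a = "%x. inverse (ennreal (norm (x - ?c)))"
 have g: "?a : bmeas borel" by measurable
 let ?b = "nn_integral (P n) (%X. inv_sum n X u)"
 have "?b = (SUM k<n. nn_integral (P n) (%X. inverse (ennreal (norm (X k - ?c)))))"
  unfolding inv_sum_def
 proof (rule nn_integral_sum)
  fix k assume "k : {..<n}"
  thus "(%X. inverse (ennreal (norm (X k - ?c)))) : bmeas (P n)"
   by (intro measurable_compose[OF coordinate_measurable g]) simp
 qed
 also have "... = (SUM k<n. nn_integral F ?a)"
  by (intro sum.cong refl coordinate_nn_integral[OF _ g]) auto
 also have "nn_integral F ?a = nn_int F (%x. 1 / norm (x - ?c))"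
 proof (rule nn_integral_cong_AE)
  show "AE x in F. inverse (ennreal (norm (x - ?c))) = ennreal (1 / norm (x - ?c))"
   using AE_neq[of "?c"] by eventually_elim (simp add: inverse_ennreal inverse_eq_divide)
 qed
 finally have "?b = of_nat n * nn_int F (%x. 1 / norm (x - ?c))" by simp
 also have "... <= ennreal (real n * A)"
  using A(1) by (auto simp: ennreal_mult ennreal_of_nat_eq_real_of_nat intro!: mult_left_mono[OF A(2)[OF theta_bound]])
 finally have "ennreal (1 / n) * ?b <= ennreal (1 / n) * ennreal (real n * A)" by (rule mult_left_mono) simp
 also have "... = ennreal A" using n A(1) by (simp add: ennreal_mult[symmetric])
 finally show ?thesis .
qed

lemma err_bound_expectation:
 assumes n: "4 <= n" and u: "u : cball 0 r" and L: "0 < L" and ep: "0 < ep"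
 shows "nn_integral (P n) (%X. err_bound n L ep T X u) <= ennreal (C0 * (1 / n + 1 / L^2) * (2 * real CARD('n) * (512 * exp 4))
  + 32 / p * ((SUM t:T. rem_sd n t + rem_err n t u) + 2 * L * ep * (2 * A)))"
proof -
 let ?d = "bmeas (P n)"
 let ?e = "%X. fourth (theta u) u n X"
 have [measurable]: "?e : ?d" "(%X. quad_err (theta u) n X t) : ?d"
  "(%X. inv_sum n X u) : ?d" for t
  using measurable_Pair1[OF fourth_measurable, of u] measurable_Pair1[OF quad_err_measurable, of u] measurable_Pair1[OF inv_sum_measurable, of u] by auto
 interpret PP: prob_space "P n" by (rule P_prob)
 let ?c = "C0 * (1 / n + 1 / L^2)" and ?E4 = "2 * real CARD('n) * (512 * exp 4)"
 have sd0: "0 <= rem_sd n t + rem_err n t u" for t using A(1) by (auto simp: rem_sd_def rem_err_def)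
 let ?a = "SUM t:T. rem_sd n t + rem_err n t u"
 let ?b = "SUM t:T. ennreal (rem_sd n t + rem_err n t u)"
 have "nn_integral (P n) (%X. err_bound n L ep T X u) = ennreal ?c * nn_int (P n) ?e
  + ennreal (32 / p) * ((SUM t:T. nn_int (P n) (%X. abs (quad_err (theta u) n X t))) + ennreal (2 * L * ep) * (ennreal (1 / n) * nn_integral (P n) (%X. inv_sum n X u) + ennreal A))"
  unfolding err_bound_def by (simp add: nn_integral_add nn_integral_cmult nn_integral_sum PP.emeasure_space_1 del: sum_ennreal)
 also have "... <= ennreal ?c * ennreal ?E4 + ennreal (32 / p) * (?b + ennreal (2 * L * ep) * (ennreal A + ennreal A))"
  by (intro add_mono mult_left_mono sum_mono fourth_expectation[OF u n] quad_err_expectation inv_sum_expectation) (use n in auto)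
 also have "... = ennreal (?c * ?E4 + 32 / p * (?a + 2 * L * ep * (2 * A)))"
 proof -
  have s: "0 <= ?a" by (rule sum_nonneg[OF sd0])
  have c: "0 <= ?c" "0 <= 2 * L * ep" "0 <= 32 / p" "0 <= A" "0 <= ?E4" using C0_nonneg L ep p(1) A(1) by auto
  have aa: "ennreal A + ennreal A = ennreal (2 * A)" using A(1) by (simp flip: ennreal_plus)
  have t: "?b = ennreal ?a" by (rule sum_ennreal[OF sd0])
  show ?thesis unfolding aa t by (rule ennreal_affine) (use s c in simp_all)
 qed
 finally show ?thesis .
qed

text \<open>Outside this event the empirical quantiles are bounded by 4R/(1-r). Chebyshev uses the
  margin between the population tail (1-r)/8 and the threshold (1-r)/4.\<close>

lemma emp_tail:
 assumes R: "measure F {x. R < norm x} <= (1 - r) / 8" and n: "0 < n"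
 shows "{X:space (P n). (1 - r) / 4 < (SUM i<n. indicator {x. R < norm x} (X i)) / n} : sets (P n)"
  and "measure (P n) {X:space (P n). (1 - r) / 4 < (SUM i<n. indicator {x. R < norm x} (X i)) / n} <= (8 / (1 - r))^2 / n"
proof -
 interpret PP: prob_space "P n" by (rule P_prob)
 let ?a = "{x. R < norm x}"
 define g where "g = (%x::real^'n. indicat_real ?a x - measure F ?a)"
 have S: "{x::real^'n. R < norm x} : sets borel" by measurable
 have gm: "g : bmeas F" unfolding g_def using S by measurable
 have gb: "abs (g x) <= 1" for x
  by (simp add: indicator_def prob_le_1 measure_nonneg g_def)
 have gz: "(LINT x|F. g x) = 0" unfolding g_def using S by (subst LINT_diff) (auto simp: emeasure_eq_measure)
 have Gm[measurable]: "Gsum n g : bmeas (P n)" unfolding sample_law_def by (rule Gsum_measurable[OF gm])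
 have G: "Gsum n g X = sqrt n * ((SUM i<n. indicator ?a (X i)) / n - measure F ?a)" for X
 proof -
  define s where "s = sqrt (real n)"
  have s: "0 < s" "real n = s * s" using n by (auto simp: s_def)
  show ?thesis unfolding Gsum_def g_def sum_subtractf sum_constant card_lessThan s_def[symmetric] s(2) using s(1) by (simp add: field_simps)
 qed
 have eq: "(SUM i<n. indicat_real ?a (X i)) / n = Gsum n g X / sqrt n + measure F ?a" for X
  unfolding G using n by simp
 show m: "{X:space (P n). (1 - r) / 4 < (SUM i<n. indicator ?a (X i)) / n} : sets (P n)"
  unfolding eq by measurable
 have i: "integrable (P n) (%X. (Gsum n g X)^2)"
 proof (rule PP.integrable_bounded[of _ "(sqrt n * 1)^2"])
  show "norm ((Gsum n g X)^2) <= (sqrt n * 1)^2" for X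
   using power_mono[OF Gsum_bound[of g 1 n X, OF gb], of 2] by simp
 qed measurable
 let ?d = "real n * ((1 - r) / 8)^2"
 have d: "0 < ?d" using n r by simp
 let ?b = "LINT x|F. (g x)^2"
 have "measure (P n) {X:space (P n). (1 - r) / 4 < (SUM i<n. indicator ?a (X i)) / n} <= measure (P n) {X:space (P n). ?d <= (Gsum n g X)^2}"
 proof (rule PP.finite_measure_mono)
  show "{X:space (P n). (1 - r) / 4 < (SUM i<n. indicator ?a (X i)) / n} <= {X:space (P n). ?d <= (Gsum n g X)^2}"
  proof safe
   fix X :: "nat => real^'n" assume "(1 - r) / 4 < (SUM i<n. indicat_real ?a (X i)) / n"
   hence "sqrt n * ((1 - r) / 8) <= Gsum n g X" unfolding G using R by (intro mult_left_mono) (linarith, simp)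
   hence "(sqrt n * ((1 - r) / 8))^2 <= (Gsum n g X)^2" using r by (intro power_mono) auto
   thus "?d <= (Gsum n g X)^2" unfolding power_mult_distrib by simp
  qed
 qed measurable
 also have "... <= (LINT X|(P n). (Gsum n g X)^2) / ?d"
  by (rule integral_Markov_inequality_measure[OF i _ _ d, of "{}"]) auto
 also have "(LINT X|(P n). (Gsum n g X)^2) = ?b"
  using Gsum_second_moment[OF gm gb gz n] by (simp add: sample_law_def)
 also have "... / ?d <= 1 / ?d"
 proof (rule divide_right_mono)
  have "norm ?b <= 1^2"
  proof (rule norm_expectation_le)
   show "norm ((g x)^2) <= 1^2" for x using power_mono[OF gb[of x], of 2] by simp
  qed (use gm in measurable)
  thus "?b <= 1" by simp
 qed (use d in simp)
 also have "... = (8 / (1 - r))^2 / n" by (simp add: power_divide)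
 finally show "measure (P n) {X:space (P n). (1 - r) / 4 < (SUM i<n. indicator ?a (X i)) / n} <= (8 / (1 - r))^2 / n" .
qed

text \<open>The parameters are fixed in the order L, mesh ep, net T, and then n, because the bound
  contains 1/L^2, then L ep, then terms vanishing for each fixed net. The measurable majorant U
  stands in for the integrated remainder, whose own measurability is not at issue.\<close>

theorem bahadur_rem_small:
 assumes R: "0 <= R" "measure F {x. R < norm x} <= (1 - r) / 8" "4 * R / (1 - r) <= K" and dl: "0 < dl"
 shows "EV n. EX B U. B : sets (P n) & measure (P n) B <= dl & U : bmeas (P n) & (nn_integral (P n) (%X. U X)) <= ennreal dl &
  (ALL X:space (P n) - B. nn_integral lborel (%u. indicator (cball 0 r) u * ennreal ((norm (bahadur_rem n X u))^2)) <= U X)"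
proof -
 define v where "v = measure lborel (cball (0::real^'n) r)"
 have v: "0 <= v" by (simp add: v_def)
 define E4 where "E4 = 2 * real CARD('n) * (512 * exp 4)"
 have E4: "0 <= E4" by (simp add: E4_def)
 have dl3: "0 < dl / 3" using dl by simp
 obtain L where L: "0 < L" "C0 * (1 / L^2) * E4 * v < dl / 3"
 proof -
  have "((%L. C0 * (1 / L^2) * E4 * v) \<longlongrightarrow> 0) at_top" by real_asymp
  from order_tendstoD(2)[OF this dl3] eventually_gt_at_top[of 0]
  have "\<forall>\<^sub>F L in at_top. 0 < L & C0 * (1 / L^2) * E4 * v < dl / 3" by eventually_elim simp
  thus ?thesis using that by (auto dest: eventually_happens)
 qed
 \<comment> \<open>Coefficient of ep in the net term after integration over the ball; ep is then a
   third of dl divided by q + 1.\<close>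
 define q where "q = 32 / p * (2 * L * (2 * A)) * v"
 define ep where "ep = dl / 3 / (q + 1)"
 have q0: "0 <= q" unfolding q_def using p A L v by simp
 have ep: "0 < ep" unfolding ep_def using dl3 q0 by (intro divide_pos_pos) auto
 have ep': "32 / p * (2 * L * ep * (2 * A)) * v < dl / 3"
 proof -
  have "32 / p * (2 * L * ep * (2 * A)) * v < (q + 1) * ep"
   using ep by (simp add: q_def algebra_simps)
  also have "... = dl / 3" unfolding ep_def using q0 nonzero_mult_div_cancel_left[of "q + 1" "dl / 3"] unfolding times_divide_eq_right by auto
  finally show ?thesis .
 qed
 obtain T where T: "finite T" "T <= cball (0::real^'n) L" "!!w. w : cball 0 L ==> EX t:T. norm (w - t) <= ep"
  using finite_net[OF ep, of L] by blast
 let ?a = "indicat_real (cball 0 r)"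
 define I where "I = (%n t. (LINT u|lborel. ?a u * rem_err n t u))"
 have cb: "integrable lborel (%u::real^'n. ?a u * c)" for c :: real
  using emeasure_lborel_cball_finite[of "0::real^'n" r] by (intro integrable_mult_left integrable_real_indicator) auto
 have le: "norm (?a u * rem_err n t u) <= ?a u * (4 * A * (norm t)^2)" for n t u
  using rem_err_bound[of n t u] by (simp add: abs_mult mult_left_mono)
 have im: "(%u. ?a u * rem_err n t u) : bmeas lborel" for n t
  using rem_err_measurable[of n t] by (intro borel_measurable_times) auto
 have Ii: "integrable lborel (%u. ?a u * rem_err n t u)" for n t
  by (rule Lint_bound[OF cb im]) (use le in \<open>auto intro!: AE_I2 order_trans[OF _ abs_ge_self]\<close>)
 have Ilim: "(%n. I n t) ----> 0" for t
 proof -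
  have "(%n. I n t) ----> integral\<^sup>L lborel (%u::real^'n. 0)"
   unfolding I_def
  proof (rule integral_dominated_convergence[OF _ im cb])
   show "AE u in lborel. (%n. ?a u * rem_err n t u) ----> 0"
    by (intro AE_I2 tendsto_mult_right_zero rem_err_tendsto)
   show "AE u in lborel. norm (?a u * rem_err n t u) <= ?a u * (4 * A * (norm t)^2)" for n
    by (intro AE_I2 le)
  qed simp
  thus ?thesis by simp
 qed
 define b where "b = (%n::nat. C0 * (1 / n + 1 / L^2) * E4 * v + 32 / p * ((SUM t:T. rem_sd n t * v + I n t) + 2 * L * ep * (2 * A) * v))"
 let ?b = "indicator (cball 0 r)"
 have "b ----> C0 * (0 + 1 / L^2) * E4 * v + 32 / p * ((SUM t:T. 0 * v + 0) + 2 * L * ep * (2 * A) * v)"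
  unfolding b_def by (intro tendsto_add tendsto_mult tendsto_const tendsto_sum rem_sd_tendsto Ilim lim_1_over_n)
 also have "C0 * (0 + 1 / L^2) * E4 * v + 32 / p * ((SUM t:T. 0 * v + 0) + 2 * L * ep * (2 * A) * v)
   = C0 * (1 / L^2) * E4 * v + 32 / p * (2 * L * ep * (2 * A)) * v" by simp
 finally have "EV n. b n < dl" by (rule order_tendstoD(2)) (use L(2) ep' dl in linarith)
 moreover have "(%n. (8 / (1 - r))^2 / real n) ----> 0" by real_asymp
 hence "EV n. (8 / (1 - r))^2 / real n < dl" using dl by (rule order_tendstoD(2))
 ultimately show ?thesis using eventually_ge_at_top[of 4]
 proof eventually_elim
  case (elim n)
  hence n: "0 < n" by simp
  interpret PP: prob_space "P n" by (rule P_prob)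
  interpret PB: pair_sigma_finite "P n" "lborel :: (real^'n) measure" by unfold_locales
  define B where "B = {X:space (P n). (1 - r) / 4 < (SUM i<n. indicator {x. R < norm x} (X i)) / n}"
  let ?d = "err_bound n L ep T"
  define U where "U = (%X. nn_integral lborel (%u. ?b u * ?d X u))"
  have em: "(%z. ?b (snd z) * ?d (fst z) (snd z)) : bmeas (P n >< lborel)"
   by (use err_bound_measurable n L ep T measurable_cong_sets sets_pair_measure_cong sets_lborel in simp)
  have Um: "U : bmeas (P n)"
   unfolding U_def using lborel.borel_measurable_nn_integral_fst[OF em] by simp
  let ?g = "rem_sd n"
  let ?c = "C0 * (1 / n + 1 / L^2) * E4 + 32 / p * ((SUM t:T. ?g t) + 2 * L * ep * (2 * A))"
  let ?e = "rem_err n"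
  let ?f = "nn_integral (P n)"
  have "?f (%X. U X) = nn_integral lborel (%u. ?f (%X. ?b u * ?d X u))"
   unfolding U_def using PB.Fubini[OF em] by simp
  also have "... <= nn_int lborel (%u. ?b u * (C0 * (1 / n + 1 / L^2) * E4 + 32 / p * ((SUM t:T. ?g t + ?e t u) + 2 * L * ep * (2 * A))))"
  proof (intro nn_integral_mono)
   fix u :: "real^'n"
   show "?f (%X. ?b u * ?d X u) <= ennreal (?b u * (C0 * (1 / n + 1 / L^2) * E4 + 32 / p * ((SUM t:T. ?g t + ?e t u) + 2 * L * ep * (2 * A))))"
    using err_bound_expectation[OF elim(3) _ L(1) ep, of u T] by (cases "u : cball 0 r") (simp_all add: E4_def)
  qed
  also have "... = ennreal (b n)"
  proof -
   have eq: "?a u * (C0 * (1 / n + 1 / L^2) * E4 + 32 / p * ((SUM t:T. ?g t + ?e t u) + 2 * L * ep * (2 * A)))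
    = ?b u * ?c + 32 / p * (SUM t:T. ?a u * ?e t u)" for u
    by (simp add: sum.distrib sum_distrib_left[symmetric] algebra_simps)
   have nn: "0 <= ?a u * (C0 * (1 / n + 1 / L^2) * E4 + 32 / p * ((SUM t:T. ?g t + ?e t u) + 2 * L * ep * (2 * A)))" for u
    using C0_nonneg E4 p(1) A(1) L ep by (intro mult_nonneg_nonneg add_nonneg_nonneg sum_nonneg) (auto simp: rem_sd_def rem_err_def intro!: divide_nonneg_nonneg add_nonneg_nonneg)
   have i1: "integrable lborel (%u. 32 / p * (SUM t:T. ?a u * ?e t u))"
    by (intro integrable_mult_right Lint_sum Ii)
   have "integrable lborel (%u. ?a u * (C0 * (1 / n + 1 / L^2) * E4 + 32 / p * ((SUM t:T. ?g t + ?e t u) + 2 * L * ep * (2 * A))))"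
    unfolding eq by (rule Lint_add[OF cb i1])
   note nn_integral_eq_integral[OF this AE_I2[OF nn]]
   also have "(LINT u|lborel. ?a u * (C0 * (1 / n + 1 / L^2) * E4 + 32 / p * ((SUM t:T. ?g t + ?e t u) + 2 * L * ep * (2 * A))))
     = v * ?c + 32 / p * (SUM t:T. I n t)"
    unfolding eq by (subst LINT_add[OF cb i1], unfold integral_mult_right_zero LINT_sum[OF Ii] integral_mult_left_zero)
     (simp add: v_def I_def)
   also have "... = b n" unfolding b_def sum.distrib sum_distrib_right[symmetric] by (simp add: algebra_simps)
   finally show ?thesis .
  qed
  also have "... <= ennreal dl" using elim(1) by (intro ennreal_leI) simp
  finally have UE: "?f (%X. U X) <= ennreal dl" .
  have dom: "nn_integral lborel (%u. ?b u * ennreal ((norm (bahadur_rem n X u))^2)) <= U X" if X: "X : space (P n) - B" for X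
   unfolding U_def
  proof (intro nn_integral_mono)
   fix u :: "real^'n"
   have "norm (emp_quantile X n u) <= K" if u: "u : cball 0 r"
   proof (rule order_trans[OF emp_quantile_bound[OF n _ r(2) R(1)] R(3)])
    show "(SUM i<n. indicator {x. R < norm x} (X i)) / n <= (1 - r) / 4" using X by (auto simp: B_def)
   qed (use u in simp)
   thus "?b u * ennreal ((norm (bahadur_rem n X u))^2) <= ?b u * ?d X u"
    using bahadur_rem_le[OF n _ _ L(1) ep T, of u X] by (cases "u : cball 0 r") auto
  qed
  have "measure (P n) B <= dl" using emp_tail(2)[OF R(2) n] elim(2) unfolding B_def by auto
  thus ?case using emp_tail(1)[OF R(2) n] Um UE dom unfolding B_def by blast
 qed
qed

end

section \<open>The test based on spatial quantiles\<close>

text \<open>A vector process on the ball is coded as a real process indexed by pairs (u, i), so its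
  integrated squared norm is a squared L2 norm of a real process.\<close>

definition ball_index :: "real => ((real^'n) \<times> 'n) measure" where
 "ball_index r = restrict_space lborel (cball 0 r) >< count_space UNIV"

abbreviation cball_space :: "real => (real^'n) measure" where "cball_space r == restrict_space lborel (cball 0 r)"

lemma space_ball_index: "space (ball_index r) = cball 0 r \<times> UNIV"
 by (simp add: ball_index_def space_pair_measure)

lemma finite_cball_space: "finite_measure (cball_space r)"
proof (rule finite_measureI)
 show "emeasure (cball_space r) (space (cball_space r)) ~= \<infinity>"
  using emeasure_lborel_cball_finite[of "0::real^'n" r] by (simp add: emeasure_restrict_space less_top)
qed

lemma measurable_ball_index:
 fixes f :: "'a => real^'n => 'n => real"
 assumes "!!i. (%z. f (fst z) (snd z) i) : bmeas (N >< cball_space r)"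
 shows "(%z. f (fst z) (fst (snd z)) (snd (snd z))) : bmeas (N >< ball_index r)"
proof -
 have g: "(%z. (fst z, fst (snd z))) : N >< ball_index r \<rightarrow>\<^sub>M N >< cball_space r"
  unfolding ball_index_def by (intro measurable_Pair measurable_fst measurable_compose[OF measurable_snd measurable_fst])
 let ?b = "bmeas (N >< ball_index r)"
 have i: "(%z. indicat_real {i} (snd (snd z))) : ?b" for i :: 'n
  unfolding ball_index_def by (rule measurable_compose[OF measurable_compose[OF measurable_snd measurable_snd]]) simp
 let ?a = "%z. SUM i:UNIV. indicat_real {i} (snd (snd z)) * f (fst z) (fst (snd z)) i"
 have "?a : ?b"
  using measurable_compose[OF g assms] by (intro borel_measurable_sum borel_measurable_times i) simp
 also have "?a = (%z. f (fst z) (fst (snd z)) (snd (snd z)))"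
  by simp
 finally show ?thesis .
qed

lemma measurable_ball_index':
 fixes g :: "(real^'n) \<times> 'n => real"
 assumes "!!i. (%u. g (u, i)) : bmeas (cball_space r)"
 shows "g : bmeas (ball_index r)"
proof -
 have "(%z. (%_ u i. g (u, i)) (fst z) (fst (snd z)) (snd (snd z))) : bmeas (count_space (UNIV :: unit set) >< ball_index r)"
  by (rule measurable_ball_index) (rule measurable_compose[OF measurable_snd assms])
 from measurable_Pair2[OF this, of "()"] show ?thesis by simp
qed

lemma nn_integral_ball_index:
 assumes g: "g : bmeas (ball_index r)"
 shows "nn_integral (ball_index r) (%s. g s) = nn_integral lborel (%u. (SUM i:UNIV. g (u, i)) * indicator (cball (0::real^'n) r) u)"
proof -
 interpret S: sigma_finite_measure "count_space (UNIV :: 'n set)" by (rule sigma_finite_measure_count_space_finite) simp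
 have "nn_integral (ball_index r) (%s. g s) = nn_integral (cball_space r) (%u. (SUM i:UNIV. g (u, i)))"
  using S.nn_integral_fst[of g "cball_space r"] g by (simp add: ball_index_def nn_integral_count_space_finite)
 also have "... = nn_integral lborel (%u. (SUM i:UNIV. g (u, i)) * indicator (cball 0 r) u)" by (rule nn_integral_restrict_space) simp
 finally show ?thesis .
qed

lemma finite_ball_index: "finite_measure (ball_index r :: ((real^'n) \<times> 'n) measure)"
proof (rule finite_measureI)
 let ?mu = "ball_index r :: ((real^'n) \<times> 'n) measure"
 have "emeasure ?mu (space ?mu) = nn_integral ?mu (%s. 1)" by simp
 also have "... = of_nat CARD('n) * emeasure lborel (cball (0::real^'n) r)"
  by (subst nn_integral_ball_index) (simp_all add: nn_integral_cmult_indicator)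
 also have "... < \<infinity>" using emeasure_lborel_cball_finite[of "0::real^'n" r] by (simp add: ennreal_mult_less_top ennreal_of_nat_eq_real_of_nat)
 finally show "emeasure ?mu (space ?mu) ~= \<infinity>" by simp
qed

lemma integral_ball_index:
 fixes g :: "(real^'n) \<times> 'n => real"
 assumes g: "g : bmeas (ball_index r)" and b: "!!s. s : space (ball_index r) ==> abs (g s) <= b" and nn: "!!s. 0 <= g s"
 shows "integrable (ball_index r) g" "(LINT s|(ball_index r). g s) = (LINT u:cball 0 r|lborel. (SUM i:UNIV. g (u, i)))"
proof -
 interpret finite_measure "ball_index r :: ((real^'n) \<times> 'n) measure" by (rule finite_ball_index)
 show i: "integrable (ball_index r) g" by (rule integrable_const_bound[of _ b]) (use g b in auto)
 have m: "(%u. indicat_real (cball 0 r) u *R (SUM i:UNIV. g (u, i))) : bmeas lborel"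
 proof -
  have "(%u. SUM i:UNIV. g (u, i)) : bmeas (cball_space r)"
  proof (rule borel_measurable_sum)
   fix i show "(%u. g (u, i)) : bmeas (cball_space r)"
    by (rule measurable_compose[OF _ g[unfolded ball_index_def]]) measurable
  qed
  thus ?thesis by (subst (asm) borel_measurable_restrict_space_iff) auto
 qed
 have "(LINT s|(ball_index r). g s) = enn2real (nn_int (ball_index r) (%s. g s))" by (rule integral_eq_nn_integral) (use g nn in auto)
 also have "nn_int (ball_index r) (%s. g s) = nn_integral lborel (%u. (SUM i:UNIV. ennreal (g (u, i))) * indicator (cball 0 r) u)"
  by (rule nn_integral_ball_index) (use g in measurable)
 also have "... = nn_int lborel (%u. indicator (cball 0 r) u *R (SUM i:UNIV. g (u, i)))"
  by (intro nn_integral_cong) (auto simp: indicator_def sum_ennreal nn)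
 also have "enn2real ... = (LINT u:cball 0 r|lborel. (SUM i:UNIV. g (u, i)))"
  unfolding set_lebesgue_integral_def by (rule integral_eq_nn_integral[symmetric]) (use m nn in \<open>auto intro!: AE_I2 mult_nonneg_nonneg sum_nonneg\<close>)
 finally show "(LINT s|(ball_index r). g s) = (LINT u:cball 0 r|lborel. (SUM i:UNIV. g (u, i)))" .
qed

definition round_pair :: "nat => (real^'n) \<times> 'n => (real^'n) \<times> 'n" where
 "round_pair k s = (round_vec k (fst s), snd s)"

lemma finite_projections_round_pair: "finite_projections (ball_index r :: ((real^'n) \<times> 'n) measure) round_pair" (is "finite_projections ?mu _")
proof (rule finite_projections.intro)
 show "finite_measure ?mu" by (rule finite_ball_index)
 interpret C: finite_projections "cball_space r :: (real^'n) measure" round_vec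
 proof (rule finite_projections_round_vec[OF finite_cball_space])
  show "sets (cball_space r) = sets (restrict_space borel (cball 0 r))" by (simp add: sets_restrict_space)
  show "round_vec k v : cball 0 r" if "v : cball 0 r" for v :: "real^'n" and k
   using that norm_round_vec_le[of k v] by simp
 qed
 show "round_pair k : ?mu \<rightarrow>\<^sub>M ?mu" for k
  unfolding ball_index_def round_pair_def[abs_def]
  by (intro measurable_Pair measurable_compose[OF measurable_fst C.pj_self] measurable_snd)
 have fin: "finite (range (round_pair k :: (real^'n) \<times> 'n => (real^'n) \<times> 'n))" for k
  by (rule finite_subset[of _ "range (round_vec k) \<times> UNIV"]) (auto simp: round_pair_def intro!: finite_cartesian_product round_vec_finite)
 show "finite (round_pair k ` space ?mu)" for k by (rule finite_subset[OF image_mono fin]) simp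
 show "round_pair k : ?mu \<rightarrow>\<^sub>M count_space UNIV" for k
 proof (rule measurableI)
  fix S assume "S : sets (count_space (UNIV :: ((real^'n) \<times> 'n) set))"
  let ?b = "round_pair k"
  let ?c = "%s. round_vec k (fst s)"
  have pt: "?b -` {a} Int space ?mu : sets ?mu" for a :: "(real^'n) \<times> 'n"
  proof -
   let ?d = "snd -` {snd a} Int space ?mu"
   let ?e = "?c -` {fst a} Int space ?mu"
   have "?c : ?mu \<rightarrow>\<^sub>M count_space UNIV" "snd : ?mu \<rightarrow>\<^sub>M count_space UNIV"
    unfolding ball_index_def by (rule measurable_compose[OF measurable_fst C.pj_count], rule measurable_snd)
   from measurable_sets[OF this(1), of "{fst a}"] measurable_sets[OF this(2), of "{snd a}"]
   have "?e Int ?d : sets ?mu" by simp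
   also have "?e Int ?d = ?b -` {a} Int space ?mu"
    by (auto simp: round_pair_def)
   finally show ?thesis .
  qed
  let ?a = "UN a:S Int range (?b). ?b -` {a} Int space ?mu"
  have "?a : sets ?mu"
   using fin by (intro sets.finite_UN pt) auto
  also have "?a = ?b -` S Int space ?mu" by blast
  finally show "?b -` S Int space ?mu : sets ?mu" .
 qed simp
qed

locale quantile_test = local_alternatives f0 h ga + D: quantile_bounds f0 r K p A
 for f0 h :: "real^'n => real" and ga r K p A :: real +
 fixes R :: real
 assumes r_pos: "0 < r" and R: "0 <= R" "measure F {x. R < norm x} <= (1 - r) / 8" "4 * R / (1 - r) <= K"
begin

abbreviation Dinv :: "real^'n => real^'n^'n" where "Dinv u == matrix_inv (D1 F (spatial_quantile F u))"

abbreviation ballm :: "((real^'n) \<times> 'n) measure" where "ballm == ball_index r"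

definition Einv :: "real^'n => 'n => 'n => real" where
 "Einv u i k = indicator (cball 0 r) u *R (Dinv u *v axis k 1) $ i"

text \<open>Influence function of the spatial quantile: a coordinate of D1^-1 applied to unitv (x -
  quantile) + u, written through matrix entries so that measurability in u can be read off.\<close>

definition beta :: "real^'n => (real^'n) \<times> 'n => real" where
 "beta x s = (SUM k:UNIV. Einv (fst s) (snd s) k * (unitv (x - D.theta (fst s)) + fst s) $ k)"

lemma theta_eq: "u : cball 0 r ==> D.theta u = spatial_quantile F u" by (simp add: D.theta_def)

lemma Einv_eq: "u : cball 0 r ==> Einv u i k = Dinv u $ i $ k"
 by (simp add: Einv_def matrix_vector_mul_component inner_axis)

lemma beta_eq: "u : cball 0 r ==> beta x (u, i) = (Dinv u *v (unitv (x - spatial_quantile F u) + u)) $ i"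
 by (simp add: beta_def Einv_eq theta_eq matrix_vector_mult_def)

lemma Dinv_tendsto:
 assumes "!!k. u k : cball 0 r" "u0 : cball 0 r" "u ----> u0" "z ----> z0"
 shows "(%k. Dinv (u k) *v z k) ----> Dinv u0 *v z0"
 by (rule D.D1_inverse_tendsto[OF D.quantile_tendsto[OF D.r(2) assms(1-3)] assms(4)])

lemma Einv_measurable: "(%u. Einv u i k) : bmeas borel"
 unfolding Einv_def
proof (rule borel_measurable_continuous_on_indicator)
 show "continuous_on (cball 0 r) (%u. (Dinv u *v axis k 1) $ i)"
  by (rule continuous_on_sequentiallyI, rule tendsto_vec_nth, rule Dinv_tendsto) auto
qed simp

lemma beta_bound: "abs (beta x s) <= 16 / p"
proof (cases s)
 case (Pair u i)
 show ?thesis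
 proof (cases "u : cball 0 r")
  case True
  let ?w = "unitv (x - spatial_quantile F u) + u"
  have "abs (beta x s) <= norm (Dinv u *v ?w)" unfolding Pair beta_eq[OF True] by (rule component_le_norm_cart)
  also have "... <= 8 / p * norm ?w" by (rule D.D1_inverse_bound[OF D.p(1) D.p(3)[OF D.K[OF True]]])
  also have "... <= 8 / p * 2"
   using norm_triangle_le[OF add_mono[OF norm_unitv_le[of "x - spatial_quantile F u"], of "norm u" 1]] True D.r D.p(1)
   by (intro mult_left_mono) auto
  finally show ?thesis by simp
 qed (use D.p(1) in \<open>simp add: Pair beta_def Einv_def\<close>)
qed

lemma beta_measurable: "(%(x, s). beta x s) : bmeas (borel >< ballm)"
proof -
 have id: "(%u::real^'n. u) : cball_space r \<rightarrow>\<^sub>M borel" by (rule measurable_restrict_space1) simp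
 have snd: "(%z. snd z) : (borel :: (real^'n) measure) >< cball_space r \<rightarrow>\<^sub>M (borel :: (real^'n) measure)"
  by (rule measurable_compose[OF measurable_snd id])
 have th: "(%z. unitv (fst z - D.theta (snd z)) + snd z) : bmeas ((borel :: (real^'n) measure) >< cball_space r)"
  by (rule borel_measurable_add[OF measurable_compose[OF borel_measurable_diff[OF measurable_fst measurable_compose[OF snd D.theta_measurable]] unitv_measurable] snd])
 have "(%z. (%x u i. beta x (u, i)) (fst z) (fst (snd z)) (snd (snd z))) : bmeas (borel >< ballm)"
 proof (rule measurable_ball_index)
  fix i
  show "(%z. beta (fst z) (snd z, i)) : bmeas (borel >< cball_space r)"
   unfolding beta_def fst_conv snd_conv
   by (rule borel_measurable_sum, rule borel_measurable_times[OF measurable_compose[OF snd Einv_measurable] measurable_compose[OF th vec_nth_borel]])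
 qed
 thus ?thesis by auto
qed

lemma L2_test_beta: "L2_test f0 h ga ballm round_pair beta (16 / p)"
proof (intro L2_test.intro L2_test_axioms.intro local_alternatives_axioms finite_projections_round_pair beta_measurable beta_bound)
 fix s assume s: "s : space ballm"
 then obtain u i where ui: "s = (u, i)" "u : cball 0 r" by (auto simp: space_ball_index)
 have int: "integrable F (%x. unitv (x - D.theta u) $ k + u $ k)" for k
  by (rule F.integrable_bounded[of _ 2]) (use D.score_fun[OF ui(2)] in auto)
 have "(LINT x|F. beta x s) = (SUM k:UNIV. Einv u i k * (LINT x|F. unitv (x - D.theta u) $ k + u $ k))"
  using int by (simp add: beta_def ui(1))
 also have "... = 0" using D.score_fun(3)[OF ui(2)] by simp
 finally show "(LINT x|F. beta x s) = 0" .
 have rv: "round_vec k u : cball 0 r" for k using ui(2) norm_round_vec_le[of k u] by simp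
 have "AE x in lborel. x ~= spatial_quantile F u" by (rule AE_lborel_singleton)
 thus "AE x in lborel. (%k. beta x (round_pair k s)) ----> beta x s"
 proof eventually_elim
  case (elim x)
  have "(%k. Dinv (round_vec k u) *v (unitv (x - spatial_quantile F (round_vec k u)) + round_vec k u)) ----> Dinv u *v (unitv (x - spatial_quantile F u) + u)"
   by (intro Dinv_tendsto rv ui(2) round_vec_tendsto tendsto_add unitv_tendsto tendsto_diff tendsto_const D.quantile_tendsto[OF D.r(2) rv ui(2)]) (use elim in simp)
  from tendsto_vec_nth[OF this, of i] show ?case unfolding ui(1) round_pair_def fst_conv snd_conv beta_eq[OF rv] beta_eq[OF ui(2)] .
 qed
qed

sublocale E: L2_test f0 h ga ballm round_pair beta "16 / p" by (rule L2_test_beta)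

lemma mean_eq: "u : cball 0 r ==> E.mean (u, i) = m1 ga F H u $ i"
proof -
 assume u: "u : cball 0 r"
 let ?w = "%x. unitv (x - spatial_quantile F u) + u"
 have int: "integrable H (%x. ?w x $ k)" for k
  by (rule H.integrable_bounded[of _ 2]) (use D.score_fun(2)[OF u, of _ k] theta_eq[OF u] in auto)
 have "(LINT x|H. beta x (u, i)) = (LINT x|H. (SUM k:UNIV. Dinv u $ i $ k * ?w x $ k))"
  unfolding beta_eq[OF u] matrix_vector_mult_def vec_lambda_beta ..
 also have "... = (SUM k:UNIV. Dinv u $ i $ k * (LINT x|H. ?w x $ k))"
  using int by (subst LINT_sum) (auto simp del: vector_add_component)
 also have "... = (Dinv u *v (LINT x|H. ?w x)) $ i"
  unfolding matrix_vector_mult_def vec_lambda_beta integral_vec_nth[OF int] ..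
 finally show ?thesis unfolding E.mean_def m1_def by simp
qed

text \<open>The covariance of a linear image carries the transposed inverse on the right; symmetry
  of \<open>D1\<close> turns it into the inverse that appears in \<open>k1\<close>.\<close>

lemma cov_eq: "u : cball 0 r ==> v : cball 0 r ==> E.cov (u, i) (v, j) = k1 F u v $ i $ j"
proof -
 assume u: "u : cball 0 r" and v: "v : cball 0 r"
 let ?w = "%u x. unitv (x - spatial_quantile F u) + u"
 have b: "abs (?w u x $ k) <= 2" if "u : cball 0 r" for u x k using D.score_fun(2)[OF that, of x k] theta_eq[OF that] by simp
 have int: "integrable F (%x. ?w u x $ k * ?w v x $ l)" for k l
 proof (rule F.integrable_bounded[of _ "2 * 2"])
  show "norm (?w u x $ k * ?w v x $ l) <= 2 * 2" for x
   unfolding real_norm_def abs_mult by (intro mult_mono b u v) auto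
 qed measurable
 have D2: "D2 F (spatial_quantile F u) (spatial_quantile F v) u v $ k $ l = (LINT x|F. ?w u x $ k * ?w v x $ l)" for k l
 proof -
  have o: "outer (?w u x) (?w v x) $ k $ l = ?w u x $ k * ?w v x $ l" for x k l by (simp add: outer_def)
  show ?thesis unfolding D2_def by (subst integral_matrix_nth) (simp_all only: o int)
 qed
 have sym: "Dinv v $ l $ j = Dinv v $ j $ l" for l
  using arg_cong[OF D.D1_inverse_symmetric[of "spatial_quantile F v"], of "%A. A $ j $ l"] by (simp add: transpose_def)
 have "E.cov (u, i) (v, j) = (LINT x|F. (SUM l:UNIV. SUM k:UNIV. (Dinv u $ i $ k * Dinv v $ j $ l) * (?w u x $ k * ?w v x $ l)))"
  unfolding E.cov_def beta_eq[OF u] beta_eq[OF v] matrix_vector_mult_def vec_lambda_beta sum_product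
  by (subst sum.swap) (simp only: mult_ac)
 also have "... = (SUM l:UNIV. SUM k:UNIV. (Dinv u $ i $ k * Dinv v $ j $ l) * (LINT x|F. ?w u x $ k * ?w v x $ l))"
  using int by simp
 also have "... = k1 F u v $ i $ j"
  unfolding k1_def matrix_matrix_mult_def vec_lambda_beta D2 sum_distrib_right sym by (simp only: mult_ac)
 finally show ?thesis .
qed

text \<open>With a the i-th row of the inverse, which is nonzero, the influence at x = quantile + a
  equals norm a + <a,u>, positive since norm u < 1. It stays positive on a neighbourhood, which has
  positive mass.\<close>

lemma cov_pos:
 assumes u: "u : cball 0 r" shows "0 < E.cov (u, i) (u, i)"
proof -
 let ?q = "spatial_quantile F u"
 define a where "a = Dinv u $ i"
 have a0: "a ~= 0"
 proof
  assume a: "a = 0"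
  have "(Dinv u *v (D1 F ?q *v axis i 1)) $ i = 0" by (simp add: matrix_vector_mul_component a_def[symmetric] a)
  thus False unfolding D.D1_inverse by auto
 qed
 have be: "beta x (u, i) = inner a (unitv (x - ?q) + u)" for x
  unfolding beta_eq[OF u] by (simp only: matrix_vector_mul_component a_def)
 have u1: "norm u < 1" using u D.r by simp
 let ?b = "%x. inner a (unitv (x - ?q) + u)"
 define O1 where "O1 = ?b -` {0<..} Int - {?q}"
 have op: "open O1"
 proof -
  have "continuous_on (- {?q}) ?b"
   unfolding unitv_def by (intro continuous_intros) auto
  from this[unfolded continuous_on_open_vimage[OF open_Compl[OF closed_singleton]], rule_format, OF open_greaterThan]
  show ?thesis unfolding O1_def .
 qed
 have "- inner a u <= norm a * norm u" using norm_cauchy_schwarz[of "- a" u] by simp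
 also have "... < norm a * 1" using a0 u1 by (intro mult_strict_left_mono) auto
 finally have "?q + a : O1" using a0 by (simp add: O1_def inner_add_right inner_unitv_self)
 hence O1: "emeasure F O1 ~= 0" using op by (intro dens_open_pos[OF f0_pos f0_measurable op]) auto
 have int: "integrable F (%x. beta x (u, i) * beta x (u, i))" using E.btbt_integrable[of "(u, i)" "(u, i)"] u by (simp add: space_ball_index)
 let ?a = "E.cov (u, i) (u, i)"
 have "?a ~= 0"
 proof
  assume "?a = 0"
  hence "AE x in F. x ~: O1"
   using integral_nonneg_eq_0_iff_AE[OF int] by (auto simp: be O1_def E.cov_def)
  moreover have "O1 : sets F" using op by simp
  ultimately have "emeasure F O1 = 0" by (subst (asm) AE_iff_measurable[of O1]) auto
  thus False using O1 by simp
 qed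
 moreover have "0 <= ?a" unfolding E.cov_def by (intro LINT_nonneg) simp
 ultimately show ?thesis by simp
qed

lemma nondegenerate: "~ (AE s in ballm. E.cov s s = 0)"
proof
 assume "AE s in ballm. E.cov s s = 0"
 hence "AE s in ballm. False"
  using AE_space
 proof eventually_elim
  case (elim s)
  thus ?case using cov_pos[of "fst s" "snd s"] by (auto simp: space_ball_index)
 qed
 hence "nn_integral ballm (%s. 1) = nn_integral ballm (%s. 0)" by (intro nn_integral_cong_AE) (auto elim: eventually_mono)
 hence "nn_integral lborel (%u. of_nat CARD('n) * indicator (cball (0::real^'n) r) u) = 0"
  by (subst (asm) nn_integral_ball_index) simp_all
 hence "emeasure lborel (cball (0::real^'n) r) = 0" by (simp add: nn_integral_cmult_indicator)
 thus False using r_pos unit_ball_vol_pos[of "real CARD('n)"] by (simp add: emeasure_cball)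
qed

lemma gaussian_coordinates:
 assumes G: "gaussian_process_vec M (cball 0 r) Z (m1 ga F H) (k1 F)"
 shows "gaussian_process_real M (space ballm) (%s om. Z (fst s) om $ snd s) E.mean E.cov"
proof -
 note G' = G[unfolded gaussian_process_vec_def]
 note prob = conjunct1[OF G'] and G2 = conjunct2[OF G']
 note meas = conjunct1[OF G2] and G3 = conjunct2[OF G2]
 note gauss = conjunct1[OF G3, rule_format] and G4 = conjunct2[OF G3]
 note means = conjunct1[OF G4, rule_format] and covs = conjunct2[OF G4, rule_format]
 show ?thesis unfolding gaussian_process_real_def space_ball_index
 proof (intro conjI ballI allI impI)
  show "prob_space M" by (rule prob)
  show "(%om. Z (fst s) om $ snd s) : bmeas M" if "s : cball 0 r \<times> UNIV" for s
   by (rule measurable_compose[OF bspec[OF meas] vec_nth_borel]) (use that in auto)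
  have mean: "E.mean s = m1 ga F H (fst s) $ snd s" if "s : cball 0 r \<times> UNIV" for s
   using mean_eq[of "fst s" "snd s"] that by auto
  show "(LINT om|M. Z (fst s) om $ snd s) = E.mean s" if "s : cball 0 r \<times> UNIV" for s
   unfolding mean[OF that] by (rule means) (use that in auto)
  show "(LINT om|M. (Z (fst s) om $ snd s - E.mean s) * (Z (fst t) om $ snd t - E.mean t)) = E.cov s t"
   if st: "s : cball 0 r \<times> UNIV" "t : cball 0 r \<times> UNIV" for s t
   by (use cov_eq st mean covs in auto)
  fix S :: "nat set" and u :: "nat => (real^'n) \<times> 'n" and a :: "nat => real" assume S: "finite S" "u ` S <= cball 0 r \<times> (UNIV :: 'n set)"
  have "gaussian_rv M (%om. SUM k:S. inner (a k *R axis (snd (u k)) 1) (Z (fst (u k)) om))"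
   by (rule gauss[OF S(1)]) (use S(2) in auto)
  thus "gaussian_rv M (%om. SUM k:S. a k * Z (fst (u k)) om $ snd (u k))"
   by (simp add: inner_axis')
 qed
qed

lemma GP_eq:
 assumes u: "u : cball 0 r"
 shows "E.GP n X (u, i) = (Dinv u *v D.score (spatial_quantile F u) u n X) $ i"
proof -
 let ?w = "%x. unitv (x - spatial_quantile F u) + u"
 have "E.GP n X (u, i) = (SUM j<n. SUM k:UNIV. Dinv u $ i $ k * ?w (X j) $ k) / sqrt n"
  unfolding E.GP_def Gsum_def beta_eq[OF u] matrix_vector_mult_def vec_lambda_beta ..
 also have "... = (SUM k:UNIV. Dinv u $ i $ k * ((SUM j<n. ?w (X j) $ k) / sqrt n))"
  by (subst sum.swap) (simp add: sum_distrib_left sum_divide_distrib del: vector_add_component)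
 also have "... = (Dinv u *v D.score (spatial_quantile F u) u n X) $ i"
  by (simp add: matrix_vector_mult_def D.score_nth Gsum_def)
 finally show ?thesis .
qed

definition scaled :: "nat => (nat => real^'n) => (real^'n) \<times> 'n => real" where
 "scaled n X s = sqrt n * (indicator (cball 0 r) (fst s) *R emp_quantile X n (fst s) - D.theta (fst s)) $ snd s"

lemma scaled_measurable: "0 < n ==> scaled n X : bmeas ballm"
proof (rule measurable_ball_index')
 fix i assume n: "0 < n"
 have m: "(%u. sqrt n * (indicator (cball 0 r) u *R emp_quantile X n u - D.theta u) $ i) : bmeas borel"
  by (rule borel_measurable_times[OF borel_measurable_const measurable_compose[OF borel_measurable_diff[OF emp_quantile_measurable[OF n D.r(2)] D.theta_measurable] vec_nth_borel]])
 show "(%u. scaled n X (u, i)) : bmeas (cball_space r)"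
  unfolding scaled_def fst_conv snd_conv
  by (rule measurable_restrict_space1, subst measurable_cong_sets[OF sets_lborel refl], rule m)
qed

lemma scaled_bounded: assumes n: "0 < n" shows "EX b. ALL s:space ballm. abs (scaled n X s) <= b"
proof -
 obtain C where C: "!!u. u : cball 0 r ==> norm (emp_quantile X n u) <= C"
  using emp_quantile_bounded[of n r "%_. X" X, OF n D.r(2) tendsto_const] by blast
 have "abs (scaled n X s) <= sqrt n * (C + K)" if s: "s : space ballm" for s
 proof -
  have u: "fst s : cball 0 r" using s by (auto simp: space_ball_index)
  have "abs (scaled n X s) <= sqrt n * norm (emp_quantile X n (fst s) - D.theta (fst s))"
   unfolding scaled_def abs_mult using u by (simp add: mult_left_mono component_le_norm_cart del: vector_minus_component)
  also have "... <= sqrt n * (C + K)"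
   by (intro mult_left_mono norm_triangle_le_diff add_mono C[OF u] D.theta_bound) simp
  finally show ?thesis .
 qed
 thus ?thesis by blast
qed

lemma V_scaled:
 assumes n: "0 < n"
 shows "V_stat F r n X = (LINT s|ballm. (scaled n X s)^2)" "integrable ballm (%s. (scaled n X s)^2)"
proof -
 let ?a = "scaled n X"
 obtain b where b: "!!s. s : space ballm ==> abs (?a s) <= b" using scaled_bounded[OF n] by blast
 have b2: "abs ((?a s)\<^sup>2) <= b^2" if "s : space ballm" for s using power_mono[OF b[OF that], of 2] by simp
 have m: "(%s. (?a s)^2) : bmeas ballm" by (intro borel_measurable_power scaled_measurable n)
 note I = integral_ball_index[OF m b2]
 show "integrable ballm (%s. (?a s)^2)" by (rule I) auto
 have "(LINT s|ballm. (?a s)^2) = (LINT u:cball 0 r|lborel. (SUM i:UNIV. (?a (u, i))^2))" by (rule I) auto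
 also have "... = (LINT u:cball 0 r|lborel. real n * (norm (emp_quantile X n u - spatial_quantile F u))^2)"
  by (rule set_lebesgue_integral_cong)
   (auto simp: scaled_def D.theta_def power_mult_distrib sum_distrib_left[symmetric] norm_vec_def L2_set_def sum_nonneg)
 also have "... = V_stat F r n X" unfolding V_stat_def by auto
 finally show "V_stat F r n X = (LINT s|ballm. (?a s)^2)" ..
qed

text \<open>The reverse triangle inequality in L2 of the index measure; this is why
  \<open>power_limit\<close> compares square roots.\<close>

lemma V_GP_diff:
 assumes n: "0 < n" and X: "X : space (P n)" and e: "0 <= e" "nn_integral lborel (%u. indicator (cball 0 r) u * ennreal ((norm (D.bahadur_rem n X u))^2)) <= ennreal (e^2)"
 shows "abs (sqrt (V_stat F r n X) - sqrt (LINT s|ballm. (E.GP n X s)^2)) <= e"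
proof -
 let ?c = "E.GP n X"
 have Gm: "?c : bmeas ballm" using measurable_Pair2[OF E.GP_measurable X] by simp
 have Gb: "abs ((?c s)\<^sup>2) <= (sqrt n * (16 / p))^2" for s
  unfolding E.GP_def using power_mono[OF F.Gsum_bound[of "%x. beta x s" "16 / p" n X, OF beta_bound], of 2] by simp
 have Gi: "integrable ballm (%s. (?c s)^2)"
  by (rule integral_ball_index(1)[OF _ Gb]) (use Gm in measurable)
 note sm = scaled_measurable[OF n, of X]
 let ?a = "D.bahadur_rem n X"
 let ?d = "scaled n X"
 have comp: "?d (u, i) - ?c (u, i) = ?a u $ i" if u: "u : cball 0 r" for u i
  unfolding GP_eq[OF u] using u by (simp add: scaled_def D.bahadur_rem_def D.theta_def)
 let ?b = "indicator (cball 0 r)"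
 let ?e = "LINT s|ballm. (?d s - ?c s)^2"
 have "nn_int ballm (%s. (?d s - ?c s)^2) = nn_integral lborel (%u. (SUM i:UNIV. ennreal ((?d (u, i) - ?c (u, i))^2)) * ?b u)"
  by (rule nn_integral_ball_index) (use Gm sm in measurable)
 also have "... = nn_integral lborel (%u. ?b u * ennreal ((norm (?a u))^2))"
 proof (intro nn_integral_cong)
  fix u :: "real^'n"
  show "(SUM i:UNIV. ennreal ((?d (u, i) - ?c (u, i))^2)) * ?b u = ?b u * ennreal ((norm (?a u))^2)"
  proof (cases "u : cball 0 r")
   case True
   have "(SUM i:UNIV. (?a u $ i)^2) = (norm (?a u))^2" by (simp add: norm_vec_def L2_set_def sum_nonneg)
   thus ?thesis using True by (simp add: comp)
  qed simp
 qed
 also note e(2)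
 finally have "?e <= e^2"
  using Gm sm by (subst integral_eq_nn_integral) (auto intro!: enn2real_leI)
 hence "sqrt ?e <= e" using e(1) by (simp add: real_le_lsqrt)
 thus ?thesis using L2_norm_diff_le[OF sm Gm V_scaled(2)[OF n] Gi] unfolding V_scaled(1)[OF n] by auto
qed

lemma remainder_vanishes:
 assumes ep: "0 < ep"
 shows "(%n. measure (P n) {X:space (P n). abs (sqrt (V_stat F r n X) - sqrt (LINT s|ballm. (E.GP n X s)^2)) > ep}) ----> 0"
proof (rule order_tendstoI)
 fix et :: real assume et: "0 < et"
 define q where "q = 1 + 1 / ep^2"
 \<comment> \<open>Leaves dl for the exceptional set and dl/ep^2 for Markov's inequality applied to
   U at level ep^2, together et/2.\<close>
 define dl where "dl = et / (2 * q)"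
 have e2: "0 < q" unfolding q_def using ep by (intro add_pos_pos) auto
 have dl: "0 < dl" unfolding dl_def using et e2 by simp
 have dl': "dl + dl / ep^2 < et"
 proof -
  have "dl + dl / ep^2 = dl * q" by (simp add: q_def algebra_simps)
  also have "... = et / 2" unfolding dl_def using e2 by simp
  finally show ?thesis using et by simp
 qed
 let ?a = "ennreal (1 / ep^2)"
 show "EV n. measure (P n) {X:space (P n). abs (sqrt (V_stat F r n X) - sqrt (LINT s|ballm. (E.GP n X s)^2)) > ep} < et"
  using D.bahadur_rem_small[OF R dl] eventually_gt_at_top[of 0]
 proof eventually_elim
  case (elim n)
  then obtain B U where B: "B : sets (P n)" "measure (P n) B <= dl" and U: "U : bmeas (P n)" "nn_integral (P n) (%X. U X) <= ennreal dl"
   and dom: "!!X. X : space (P n) - B ==> (nn_integral lborel (%u. indicator (cball 0 r) u * ennreal ((norm (D.bahadur_rem n X u))^2))) <= U X"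
   by blast
  let ?c = "nn_integral (P n)"
  let ?E = "{X:space (P n). 1 <= ?a * U X}"
  have Em: "?E : sets (P n)" using U(1) by measurable
  have sub: "{X:space (P n). abs (sqrt (V_stat F r n X) - sqrt (LINT s|ballm. (E.GP n X s)^2)) > ep} <= B Un ?E"
  proof safe
   fix X assume X: "X : space (P n)" "abs (sqrt (V_stat F r n X) - sqrt (LINT s|ballm. (E.GP n X s)^2)) > ep" "X ~: B"
   have "~ U X <= ennreal (ep^2)"
    using V_GP_diff[OF elim(2) X(1) less_imp_le[OF ep]] X order_trans[OF dom] by force
   hence "?a * ennreal (ep^2) <= ?a * U X" by (intro mult_left_mono) auto
   thus "1 <= ?a * U X" using ep by (simp add: ennreal_mult[symmetric])
  qed
  let ?b = "?c (%X. U X * indicator (space (P n)) X)"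
  have "emeasure (P n) ?E <= ?a * ?b"
   by (rule nn_integral_Markov_inequality) (use U(1) in measurable)
  also have "?b = ?c (%X. U X)" by (intro nn_integral_cong) simp
  also have "?a * ?c (%X. U X) <= ?a * ennreal dl"
   by (rule mult_left_mono[OF U(2)]) simp
  also have "... = ennreal (dl / ep^2)" using dl by (simp add: ennreal_mult[symmetric])
  finally have "measure (P n) ?E <= dl / ep^2" using dl by (simp add: P.emeasure_eq_measure)
  hence "measure (P n) (B Un ?E) <= dl + dl / ep^2"
   using B(2) measure_Un_le[OF B(1) Em] by auto
  thus ?case using P.finite_measure_mono[OF sub] B(1) Em dl' by fastforce
 qed
qed (intro always_eventually allI order_less_le_trans[OF _ measure_nonneg])

theorem V_power:
 fixes M :: "'b measure" and Z :: "real^'n => 'b => real^'n"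
 assumes G: "gaussian_process_vec M (cball 0 r) Z (m1 ga F H) (k1 F)"
  and cont: "ALL om:space M. continuous_on (cball 0 r) (%u. Z u om)"
 shows "(%n. measure (Q n) {X:space (Q n). V_stat F r n X > c}) ----> measure M {om:space M. (LINT u:cball 0 r|lborel. (norm (Z u om))^2) > c}"
proof -
 let ?Z = "%s om. Z (fst s) om $ snd s"
 note G' = gaussian_coordinates[OF G]
 have Zm: "(%(om, s). ?Z s om) : bmeas (M >< ballm)"
 proof (rule E.Caratheodory_measurable)
  show "?Z s : bmeas M" if "s : space ballm" for s using gaussian_process_real_facts(2)[OF G' that] .
  show "(%k. ?Z (round_pair k s) om) ----> ?Z s om" if s: "s : space ballm" and om: "om : space M" for s om
  proof -
   have u: "fst s : cball 0 r" using s by (auto simp: space_ball_index)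
   have "(%k. Z (round_vec k (fst s)) om) ----> Z (fst s) om"
    by (rule continuous_on_tendsto_compose[OF bspec[OF cont om] round_vec_tendsto u])
     (use u norm_round_vec_le[of _ "fst s"] in \<open>auto intro!: always_eventually intro: order_trans\<close>)
   thus ?thesis by (simp add: round_pair_def tendsto_vec_nth)
  qed
 qed
 have V0: "0 <= V_stat F r n X" for n X
  unfolding V_stat_def set_lebesgue_integral_def by (intro mult_nonneg_nonneg LINT_nonneg) auto
 let ?a = "{om:space M. (LINT s|ballm. (?Z s om)^2) > c}"
 have lim: "(%n. measure (Q n) {X:space (Q n). V_stat F r n X > c}) ----> measure M ?a"
  by (rule E.power_limit[OF G' Zm nondegenerate D.V_stat_measurable[OF D.r(2)] V0 remainder_vanishes])
 have "(LINT s|ballm. (?Z s om)^2) = (LINT u:cball 0 r|lborel. (norm (Z u om))^2)" if om: "om : space M" for om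
 proof -
  have "compact ((%u. Z u om) ` cball 0 r)" using cont om by (intro compact_continuous_image) auto
  from compact_imp_bounded[OF this] obtain b where b: "!!u. u : cball 0 r ==> norm (Z u om) <= b" unfolding bounded_iff by blast
  have m: "(%s. (?Z s om)^2) : bmeas ballm" using measurable_Pair2[OF Zm om] by (intro borel_measurable_power) simp
  have b2: "abs ((?Z s om)\<^sup>2) <= b^2" if "s : space ballm" for s
  proof -
   have "abs (?Z s om) <= b" using b[of "fst s"] component_le_norm_cart[of "Z (fst s) om" "snd s"] that by (auto simp: space_ball_index)
   from power_mono[OF this, of 2] show ?thesis by simp
  qed
  have "(LINT s|ballm. (?Z s om)^2) = (LINT u:cball 0 r|lborel. (SUM i:UNIV. (?Z (u, i) om)^2))"
   by (rule integral_ball_index(2)[OF m b2]) auto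
  thus ?thesis by (simp add: norm_vec_def L2_set_def sum_nonneg)
 qed
 hence "?a = {om:space M. (LINT u:cball 0 r|lborel. (norm (Z u om))^2) > c}" by auto
 thus ?thesis using lim by simp
qed

end

section \<open>Critical values and choice of constants\<close>

context local_alternatives begin

text \<open>If c <= 0 were possible, Z would vanish at a fixed point with positive probability
  although its variance there is positive. The contradiction is the degenerate instance of
  \<open>gaussian_sup_line_null\<close> with a constant sequence of points and level 0.\<close>

lemma KS_critical_pos:
 assumes Z: "gaussian_process_real M UNIV Z m (k3 F)" and cont: "ALL om:space M. continuous_on UNIV (%t. Z t om)"
  and less: "measure M {om:space M. (SUP t. ereal (abs (Z t om))) > ereal c} < 1"
 shows "0 < c"
proof (rule ccontr)
 assume c: "~ 0 < c"
 interpret M: prob_space M by (rule gaussian_process_real_facts(1)[OF Z])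
 note Zm = gaussian_process_real_facts(2)[OF Z UNIV_I]
 let ?A = "{om:space M. ALL j:UNIV. abs (Z (qvec j) om) <= c}" and ?t = "qvec 0"
 have A: "?A : sets M" by (rule sets_box) (auto intro: Zm)
 let ?a = "{om:space M. ALL j:{0}. abs (Z (qvec j) om) <= 0}"
 have B: "?a : sets M" by (rule sets_box) (auto intro: Zm)
 have "{om:space M. (SUP t. ereal (abs (Z t om))) > ereal c} = space M - ?A"
  unfolding not_le[symmetric] SUP_le_iff using continuous_le_qvec_iff[OF bspec[OF cont]] by auto
 hence "0 < measure M ?A" using less M.prob_compl[OF A] by simp
 also have "... <= measure M ?a"
 proof (rule M.finite_measure_mono[OF _ B], intro subsetI CollectI conjI ballI)
  fix om j assume om: "om : ?A"
  thus "om : space M" by simp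
  have "abs (Z (qvec j) om) <= c" using om by blast
  thus "abs (Z (qvec j) om) <= 0" using c by auto
 qed
 also have "?a
   = {om:space M. (ALL j::nat. abs (Z ?t om) <= 0) & (ALL k. EX j::nat. k3 F ?t ?t <= abs (k3 F ?t ?t) & 0 - 1 / Suc k < abs (Z ?t om))}"
  by auto
 also have "measure M ... = 0"
  by (rule gaussian_sup_line_null[OF Z _ UNIV_I k3_diag_pos k3_diag_pos]) simp
 finally show False by simp
qed

lemma quantile_test_exists:
 assumes dim: "CARD('n) >= 2" and r: "0 < r" "r < 1"
 shows "EX K p A R. quantile_test f0 h ga r K p A R"
proof -
 interpret D: pos_density f0 by unfold_locales (use f0_cont f0_pos F0_prob dim in auto)
 obtain R where R: "0 <= R" "measure F {x:space F. R < norm x} <= (1 - r) / 8"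
  using D.tail_radius[of "(1 - r) / 8"] r by auto
 have R2: "measure F {x. R < norm x} <= (1 - r) / 8" using R(2) by auto
 obtain K0 where K0: "0 <= K0" "!!u. u : cball 0 r ==> norm (spatial_quantile F u) <= K0" using D.quantile_bounded[OF r(2)] by blast
 \<comment> \<open>One radius for the population quantiles and, outside the tail event, for the
   empirical ones.\<close>
 define K where "K = max K0 (4 * R / (1 - r))"
 obtain p0 where p0: "0 < p0" "!!th i. norm th <= K ==> p0 <= measure F {x. x - th : axis_ball i}" using D.axis_ball_mass[of K] by blast
 obtain A where A: "0 < A" "!!th. norm th <= K ==> (nn_int F (%x. 1 / norm (x - th))) <= ennreal A" using D.inverse_norm_bound[of K] by blast
 \<comment> \<open>Capping p at 1 makes 64/p at least 1, so that its powers can be compared in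
   \<open>bahadur_bound\<close>.\<close>
 have "quantile_test f0 h ga r K (min 1 p0) A R"
 proof (intro quantile_test.intro quantile_bounds.intro quantile_bounds_axioms.intro quantile_test_axioms.intro local_alternatives_axioms D.pos_density_axioms)
  show "norm (spatial_quantile F u) <= K" if "u : cball 0 r" for u using K0(2)[OF that] by (simp add: K_def)
  show "min 1 p0 <= measure F {x. x - th : axis_ball i}" if "norm th <= K" for th i
   using p0(2)[OF that, of i] by auto
  show "nn_int F (%x. 1 / norm (x - th)) <= ennreal A" if "norm th <= K" for th using A(2)[OF that] .
  show "measure F {x. R < norm x} <= (1 - r) / 8" by (rule R2)
  show "0 <= r" "r < 1" "0 < r" using r by auto
  show "0 <= K" "4 * R / (1 - r) <= K" unfolding K_def using K0(1) by auto
  show "0 < min 1 p0" "min 1 p0 <= 1" using p0(1) by auto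
  show "0 < A" "0 <= R" by (rule A(1), rule R(1))
 qed
 thus ?thesis by (intro exI)
qed

end

theorem theorem6p1:
  fixes f0 h :: "real^'n \<Rightarrow> real"
    and \<gamma> r \<alpha> c c' c'' :: real
    and M1 M10 :: "'a measure" and Z1 Z10 :: "real^'n \<Rightarrow> 'a \<Rightarrow> real^'n"
    and M2 M20 :: "'b measure" and Z2 Z20 :: "real^'n \<Rightarrow> 'b \<Rightarrow> real"
  assumes dim: "CARD('n) \<ge> 2"
    and f0_cont: "continuous_on UNIV f0" and f0_pos: "\<forall>x. 0 < f0 x" and F0_prob: "prob_space (dens f0)"
    and h_cont: "continuous_on UNIV h" and h_pos: "\<forall>x. 0 < h x" and H_prob: "prob_space (dens h)"
    and chi2: "integrable (dens f0) (\<lambda>x. (h x / f0 x - 1)^2)"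
    and gamma_pos: "0 < \<gamma>"
    and r: "0 < r" "r < 1"
    and alpha: "0 < \<alpha>" "\<alpha> < 1"
    and Z1: "gaussian_process_vec M1 (cball 0 r) Z1 (m1 \<gamma> (dens f0) (dens h)) (k1 (dens f0))"
    and Z1_cont: "\<forall>\<omega>\<in>space M1. continuous_on (cball 0 r) (\<lambda>u. Z1 u \<omega>)"
    and Z10: "gaussian_process_vec M10 (cball 0 r) Z10 (m1 0 (dens f0) (dens h)) (k1 (dens f0))"
    and Z10_cont: "\<forall>\<omega>\<in>space M10. continuous_on (cball 0 r) (\<lambda>u. Z10 u \<omega>)"
    and c: "measure M10 {\<omega>\<in>space M10. (LINT u:cball 0 r|lborel. (norm (Z10 u \<omega>))^2) > c} = \<alpha>"
    and Z2: "gaussian_process_real M2 UNIV Z2 (\<lambda>t. \<gamma> * (cdf_vec (dens h) t - cdf_vec (dens f0) t)) (k3 (dens f0))"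
    and Z2_cont: "\<forall>\<omega>\<in>space M2. continuous_on UNIV (\<lambda>t. Z2 t \<omega>)"
    and Z20: "gaussian_process_real M20 UNIV Z20 (\<lambda>t. 0 * (cdf_vec (dens h) t - cdf_vec (dens f0) t)) (k3 (dens f0))"
    and Z20_cont: "\<forall>\<omega>\<in>space M20. continuous_on UNIV (\<lambda>t. Z20 t \<omega>)"
    and c': "measure M20 {\<omega>\<in>space M20. (SUP t. ereal \<bar>Z20 t \<omega>\<bar>) > ereal c'} = \<alpha>"
    and c'': "measure M20 {\<omega>\<in>space M20. (\<integral>t. (Z20 t \<omega>)^2 \<partial>dens f0) > c''} = \<alpha>"
  shows "contiguous (\<lambda>n. sample_law (alt_law f0 h \<gamma> n) n) (\<lambda>n. sample_law (dens f0) n)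
    \<and> (\<lambda>n. measure (sample_law (alt_law f0 h \<gamma> n) n)
              {X\<in>space (sample_law (alt_law f0 h \<gamma> n) n). V_stat (dens f0) r n X > c})
        \<longlonglongrightarrow> measure M1 {\<omega>\<in>space M1. (LINT u:cball 0 r|lborel. (norm (Z1 u \<omega>))^2) > c}
    \<and> (\<lambda>n. measure (sample_law (alt_law f0 h \<gamma> n) n)
              {X\<in>space (sample_law (alt_law f0 h \<gamma> n) n). KS_stat (dens f0) n X > c'})
        \<longlonglongrightarrow> measure M2 {\<omega>\<in>space M2. (SUP t. ereal \<bar>Z2 t \<omega>\<bar>) > ereal c'}
    \<and> (\<lambda>n. measure (sample_law (alt_law f0 h \<gamma> n) n)
              {X\<in>space (sample_law (alt_law f0 h \<gamma> n) n). CvM_stat (dens f0) n X > c''})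
        \<longlonglongrightarrow> measure M2 {\<omega>\<in>space M2. (\<integral>t. (Z2 t \<omega>)^2 \<partial>dens f0) > c''}"
proof -
  interpret L: local_alternatives f0 h \<gamma>
    by (rule local_alternatives.intro[OF f0_cont f0_pos[rule_format] F0_prob h_cont h_pos[rule_format] H_prob chi2 gamma_pos])
  obtain K p A R where "quantile_test f0 h \<gamma> r K p A R" using L.quantile_test_exists[OF dim r] by blast
  then interpret T: quantile_test f0 h \<gamma> r K p A R .
  \<comment> \<open>The level being below 1 excludes nonpositive critical values, at which the
    no-atom argument for the supremum would not apply.\<close>
  have "0 < c'" by (rule L.KS_critical_pos[OF Z20 Z20_cont]) (use c' alpha in simp)
  thus ?thesis
    by (intro conjI L.contiguous_Q_P T.V_power[OF Z1 Z1_cont] L.KS_power[OF Z2 Z2_cont] L.CvM_power[OF Z2 Z2_cont])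
qed

end
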